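(* Let $\omega$ be a free ultrafilter on $\mathbb{N}$, let $\Gamma$ be a discrete abelian group, and let $\alpha$ be an action of $\Gamma$ on a C*-algebra $\mathcal{A}$. Then $$\mathcal{A}^{\omega}\rtimes_{\alpha^{\omega}}\Gamma=(\mathcal{A}\rtimes_{\alpha}\Gamma)^{\omega}_{\hat{\alpha}},$$ that is, the canonical $*$-homomorphism $\mathcal{A}^{\omega}\rtimes_{\alpha^{\omega}}\Gamma\to(\mathcal{A}\rtimes_{\alpha}\Gamma)^{\omega}$ determined by $[(a_n)_n]_{\omega}\lambda_s\mapsto[(a_n\lambda_s)_n]_{\omega}$ (for $(a_n)_n\in\ell^{\infty}(\mathbb{N},\mathcal{A})$, $s\in\Gamma$) is injective with range exactly $(\mathcal{A}\rtimes_{\alpha}\Gamma)^{\omega}_{\hat{\alpha}}$.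
   Context: For a C*-algebra $\mathcal{B}$, $\ell^{\infty}(\mathbb{N},\mathcal{B})$ is the C*-algebra of bounded sequences in $\mathcal{B}$, $C^{\omega}(\mathcal{B})=\{x\in\ell^{\infty}(\mathbb{N},\mathcal{B}):\lim_{n\to\omega}\|x(n)\|=0\}$, and $\mathcal{B}^{\omega}=\ell^{\infty}(\mathbb{N},\mathcal{B})/C^{\omega}(\mathcal{B})$; the class of $(x_n)_n$ is written $[(x_n)_n]_{\omega}$. The action $\alpha^{\omega}$ on $\mathcal{A}^{\omega}$ is $\alpha^{\omega}_s([(x_n)_n]_{\omega})=[(\alpha_s(x_n))_n]_{\omega}$. $\mathcal{B}\rtimes_{\beta}\Gamma$ denotes the crossed product (full and reduced coincide since $\Gamma$ is abelian), with dense $*$-subalgebra of finite sums $\sum_s b_s\lambda_s$, $b_s\in\mathcal{B}$, where $\lambda_s$ are the canonical unitaries implementing $\beta$. The compact dual group $\hat{\Gamma}$ acts on $\mathcal{A}\rtimes_{\alpha}\Gamma$ by the dual action $\hat{\alpha}_{\gamma}(x)(s)=\overline{\langle s,\gamma\rangle}x(s)$ for $x\in C_c(\Gamma,\mathcal{A})$, i.e. $\hat{\alpha}_{\gamma}(a\lambda_s)=\overline{\langle s,\gamma\rangle}a\lambda_s$. The continuous part $(\mathcal{A}\rtimes_{\alpha}\Gamma)^{\omega}_{\hat{\alpha}}$ is the image in $(\mathcal{A}\rtimes_{\alpha}\Gamma)^{\omega}$ of the set of $(x_n)_n\in\ell^{\infty}(\mathbb{N},\mathcal{A}\rtimes_{\alpha}\Gamma)$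 such that $\gamma\mapsto(\hat{\alpha}_{\gamma}(x_n))_n$ is norm continuous from $\hat{\Gamma}$ to $\ell^{\infty}(\mathbb{N},\mathcal{A}\rtimes_{\alpha}\Gamma)$. *)

theory Defs
  imports "HOL-Analysis.Function_Topology" "HOL-Algebra.Module" "HOL-Algebra.QuotRing"
begin

section \<open>C*-algebras\<close>

text \<open>
  Algebras are complex and need not be unital. They are records over the module records of
  HOL-Algebra, and the field \<^const>\<open>one\<close> carries no assumption (as for modules there).
\<close>

definition complex_ring :: "complex ring" where
  "complex_ring = \<lparr>carrier = UNIV, monoid.mult = (*), one = 1, zero = 0, add = (+)\<rparr>"

record 'a cstar = "(complex, 'a) module" +
  star :: "'a \<Rightarrow> 'a"
  nrm :: "'a \<Rightarrow> real"

definition cauchy_in :: "'a cstar \<Rightarrow> (nat \<Rightarrow> 'a) \<Rightarrow> bool" where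
  "cauchy_in B x \<longleftrightarrow> (\<forall>n. x n \<in> carrier B) \<and>
     (\<forall>e>0. \<exists>N. \<forall>m\<ge>N. \<forall>n\<ge>N. nrm B (x m \<ominus>\<^bsub>B\<^esub> x n) < e)"

locale cstar_algebra = module complex_ring A for A :: "'a cstar" (structure) +
  assumes mult_closed: "\<lbrakk>x \<in> carrier A; y \<in> carrier A\<rbrakk> \<Longrightarrow> x \<otimes>\<^bsub>A\<^esub> y \<in> carrier A"
    and mult_assoc: "\<lbrakk>x \<in> carrier A; y \<in> carrier A; z \<in> carrier A\<rbrakk>
      \<Longrightarrow> (x \<otimes>\<^bsub>A\<^esub> y) \<otimes>\<^bsub>A\<^esub> z = x \<otimes>\<^bsub>A\<^esub> (y \<otimes>\<^bsub>A\<^esub> z)"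
    and distrib_right: "\<lbrakk>x \<in> carrier A; y \<in> carrier A; z \<in> carrier A\<rbrakk>
      \<Longrightarrow> (x \<oplus>\<^bsub>A\<^esub> y) \<otimes>\<^bsub>A\<^esub> z = x \<otimes>\<^bsub>A\<^esub> z \<oplus>\<^bsub>A\<^esub> y \<otimes>\<^bsub>A\<^esub> z"
    and distrib_left: "\<lbrakk>x \<in> carrier A; y \<in> carrier A; z \<in> carrier A\<rbrakk>
      \<Longrightarrow> z \<otimes>\<^bsub>A\<^esub> (x \<oplus>\<^bsub>A\<^esub> y) = z \<otimes>\<^bsub>A\<^esub> x \<oplus>\<^bsub>A\<^esub> z \<otimes>\<^bsub>A\<^esub> y"
    and smult_mult_left: "\<lbrakk>x \<in> carrier A; y \<in> carrier A\<rbrakk>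
      \<Longrightarrow> (c \<odot>\<^bsub>A\<^esub> x) \<otimes>\<^bsub>A\<^esub> y = c \<odot>\<^bsub>A\<^esub> (x \<otimes>\<^bsub>A\<^esub> y)"
    and smult_mult_right: "\<lbrakk>x \<in> carrier A; y \<in> carrier A\<rbrakk>
      \<Longrightarrow> x \<otimes>\<^bsub>A\<^esub> (c \<odot>\<^bsub>A\<^esub> y) = c \<odot>\<^bsub>A\<^esub> (x \<otimes>\<^bsub>A\<^esub> y)"
    and star_closed: "x \<in> carrier A \<Longrightarrow> star A x \<in> carrier A"
    and star_star: "x \<in> carrier A \<Longrightarrow> star A (star A x) = x"
    and star_add: "\<lbrakk>x \<in> carrier A; y \<in> carrier A\<rbrakk>
      \<Longrightarrow> star A (x \<oplus>\<^bsub>A\<^esub> y) = star A x \<oplus>\<^bsub>A\<^esub> star A y"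
    and star_smult: "x \<in> carrier A \<Longrightarrow> star A (c \<odot>\<^bsub>A\<^esub> x) = cnj c \<odot>\<^bsub>A\<^esub> star A x"
    and star_mult: "\<lbrakk>x \<in> carrier A; y \<in> carrier A\<rbrakk>
      \<Longrightarrow> star A (x \<otimes>\<^bsub>A\<^esub> y) = star A y \<otimes>\<^bsub>A\<^esub> star A x"
    and nrm_eq_0: "x \<in> carrier A \<Longrightarrow> nrm A x = 0 \<longleftrightarrow> x = \<zero>\<^bsub>A\<^esub>"
    and nrm_triangle: "\<lbrakk>x \<in> carrier A; y \<in> carrier A\<rbrakk>
      \<Longrightarrow> nrm A (x \<oplus>\<^bsub>A\<^esub> y) \<le> nrm A x + nrm A y"
    and nrm_smult: "x \<in> carrier A \<Longrightarrow> nrm A (c \<odot>\<^bsub>A\<^esub> x) = cmod c * nrm A x"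
    and nrm_mult: "\<lbrakk>x \<in> carrier A; y \<in> carrier A\<rbrakk>
      \<Longrightarrow> nrm A (x \<otimes>\<^bsub>A\<^esub> y) \<le> nrm A x * nrm A y"
    and cstar_identity: "x \<in> carrier A \<Longrightarrow> nrm A (star A x \<otimes>\<^bsub>A\<^esub> x) = (nrm A x)\<^sup>2"
    and complete: "cauchy_in A u \<Longrightarrow> \<exists>l\<in>carrier A. (\<lambda>n. nrm A (u n \<ominus>\<^bsub>A\<^esub> l)) \<longlonglongrightarrow> 0"

definition star_hom :: "'a cstar \<Rightarrow> 'b cstar \<Rightarrow> ('a \<Rightarrow> 'b) set" where
  "star_hom A B = {\<phi> \<in> carrier A \<rightarrow> carrier B.
     (\<forall>x\<in>carrier A. \<forall>y\<in>carrier A. \<phi> (x \<oplus>\<^bsub>A\<^esub> y) = \<phi> x \<oplus>\<^bsub>B\<^esub> \<phi> y \<and> \<phi> (x \<otimes>\<^bsub>A\<^esub> y) = \<phi> x \<otimes>\<^bsub>B\<^esub> \<phi> y) \<and>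
     (\<forall>x\<in>carrier A. (\<forall>c. \<phi> (c \<odot>\<^bsub>A\<^esub> x) = c \<odot>\<^bsub>B\<^esub> \<phi> x) \<and> \<phi> (star A x) = star B (\<phi> x))}"

section \<open>Sequence algebras, quotients and ultrapowers\<close>

definition linf :: "'a cstar \<Rightarrow> (nat \<Rightarrow> 'a) cstar" where
  "linf B = \<lparr>carrier = {x. (\<forall>n. x n \<in> carrier B) \<and> bdd_above (range (\<lambda>n. nrm B (x n)))},
     monoid.mult = (\<lambda>x y n. x n \<otimes>\<^bsub>B\<^esub> y n), one = (\<lambda>n. \<one>\<^bsub>B\<^esub>), zero = (\<lambda>n. \<zero>\<^bsub>B\<^esub>),
     add = (\<lambda>x y n. x n \<oplus>\<^bsub>B\<^esub> y n), smult = (\<lambda>c x n. c \<odot>\<^bsub>B\<^esub> x n),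
     star = (\<lambda>x n. star B (x n)), nrm = (\<lambda>x. SUP n. nrm B (x n))\<rparr>"

definition null_seqs :: "nat filter \<Rightarrow> 'a cstar \<Rightarrow> (nat \<Rightarrow> 'a) set" where
  "null_seqs F B = {x \<in> carrier (linf B). ((\<lambda>n. nrm B (x n)) \<longlongrightarrow> 0) F}"

text \<open>The map \<open>J + x \<mapsto> J + T x\<close> on cosets, for \<open>T\<close> compatible with congruence modulo \<open>J\<close>
  (same encoding as \<^const>\<open>rcoset_mult\<close>).\<close>

definition coset_map :: "'a cstar \<Rightarrow> 'a set \<Rightarrow> ('a \<Rightarrow> 'a) \<Rightarrow> 'a set \<Rightarrow> 'a set" where
  "coset_map B J T X = (\<Union>x\<in>X. J +>\<^bsub>B\<^esub> T x)"

definition quotient_alg :: "'a cstar \<Rightarrow> 'a set \<Rightarrow> 'a set cstar" where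
  "quotient_alg B J = \<lparr>carrier = a_rcosets\<^bsub>B\<^esub> J, monoid.mult = rcoset_mult B J,
     one = J +>\<^bsub>B\<^esub> \<one>\<^bsub>B\<^esub>, zero = J, add = set_add B,
     smult = (\<lambda>c. coset_map B J (smult B c)), star = coset_map B J (star B),
     nrm = (\<lambda>X. INF x\<in>X. nrm B x)\<rparr>"

definition free_ultrafilter :: "nat filter \<Rightarrow> bool" where
  "free_ultrafilter \<omega> \<longleftrightarrow> \<omega> \<noteq> bot \<and>
     (\<forall>P. eventually P \<omega> \<or> eventually (\<lambda>n. \<not> P n) \<omega>) \<and> (\<forall>k. eventually (\<lambda>n. n \<noteq> k) \<omega>)"

definition ultrapower :: "nat filter \<Rightarrow> 'a cstar \<Rightarrow> (nat \<Rightarrow> 'a) set cstar" where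
  "ultrapower \<omega> B = quotient_alg (linf B) (null_seqs \<omega> B)"

definition ultra_class :: "nat filter \<Rightarrow> 'a cstar \<Rightarrow> (nat \<Rightarrow> 'a) \<Rightarrow> (nat \<Rightarrow> 'a) set" where
  "ultra_class \<omega> B x = null_seqs \<omega> B +>\<^bsub>linf B\<^esub> x"

text \<open>The completion of a normed *-algebra: Cauchy sequences modulo null sequences. The quotient
  norm of the class of \<open>x\<close> is \<open>lim \<parallel>x n\<parallel>\<close>.\<close>

definition cauchy_alg :: "'a cstar \<Rightarrow> (nat \<Rightarrow> 'a) cstar" where
  "cauchy_alg B = (linf B)\<lparr>carrier := {x. cauchy_in B x}\<rparr>"

definition completion :: "'a cstar \<Rightarrow> (nat \<Rightarrow> 'a) set cstar" where
  "completion B = quotient_alg (cauchy_alg B) (null_seqs sequentially B)"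

definition completion_embed :: "'a cstar \<Rightarrow> 'a \<Rightarrow> (nat \<Rightarrow> 'a) set" where
  "completion_embed B x = null_seqs sequentially B +>\<^bsub>cauchy_alg B\<^esub> (\<lambda>n. x)"

section \<open>Actions of a discrete abelian group and crossed products\<close>

definition cstar_action :: "'a cstar \<Rightarrow> ('g::ab_group_add \<Rightarrow> 'a \<Rightarrow> 'a) \<Rightarrow> bool" where
  "cstar_action A \<alpha> \<longleftrightarrow> (\<forall>s. \<alpha> s \<in> star_hom A A) \<and> (\<forall>x\<in>carrier A. \<alpha> 0 x = x) \<and>
     (\<forall>s t. \<forall>x\<in>carrier A. \<alpha> (s + t) x = \<alpha> s (\<alpha> t x))"

definition ultra_action ::
    "nat filter \<Rightarrow> 'a cstar \<Rightarrow> ('g \<Rightarrow> 'a \<Rightarrow> 'a) \<Rightarrow> 'g \<Rightarrow> (nat \<Rightarrow> 'a) set \<Rightarrow> (nat \<Rightarrow> 'a) set" where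
  "ultra_action \<omega> A \<alpha> s = coset_map (linf A) (null_seqs \<omega> A) (\<lambda>x n. \<alpha> s (x n))"

definition supp :: "'a cstar \<Rightarrow> ('g \<Rightarrow> 'a) \<Rightarrow> 'g set" where
  "supp A f = {s. f s \<noteq> \<zero>\<^bsub>A\<^esub>}"

definition finsupp :: "'a cstar \<Rightarrow> ('g \<Rightarrow> 'a) set" where
  "finsupp A = {f. (\<forall>s. f s \<in> carrier A) \<and> finite (supp A f)}"

text \<open>
  The norm on finitely supported functions is that of the regular representation on the Hilbert
  \<open>A\<close>-module \<open>\<ell>\<^sup>2(\<Gamma>, A)\<close>, which has inner product \<open>\<langle>\<xi>, \<eta>\<rangle> = \<Sum>t. \<xi>(t)* \<eta>(t)\<close>. There
  \<open>a \<in> A\<close> acts by \<open>(a \<xi>)(t) = \<alpha>\<^sub>-\<^sub>t(a) \<xi>(t)\<close> and \<open>\<lambda>\<^sub>s\<close> by \<open>(\<lambda>\<^sub>s \<xi>)(t) = \<xi>(t - s)\<close>. These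
  operators preserve the dense submodule of finitely supported \<open>\<xi>\<close>, so the operator norm is a
  supremum over that submodule.
\<close>

definition l2_norm :: "'a cstar \<Rightarrow> ('g \<Rightarrow> 'a) \<Rightarrow> real" where
  "l2_norm A \<xi> = sqrt (nrm A (finsum A (\<lambda>t. star A (\<xi> t) \<otimes>\<^bsub>A\<^esub> \<xi> t) (supp A \<xi>)))"

definition regular_rep ::
    "'a cstar \<Rightarrow> ('g::ab_group_add \<Rightarrow> 'a \<Rightarrow> 'a) \<Rightarrow> ('g \<Rightarrow> 'a) \<Rightarrow> ('g \<Rightarrow> 'a) \<Rightarrow> 'g \<Rightarrow> 'a" where
  "regular_rep A \<alpha> f \<xi> t = finsum A (\<lambda>s. \<alpha> (- t) (f s) \<otimes>\<^bsub>A\<^esub> \<xi> (t - s)) (supp A f)"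

definition reduced_norm ::
    "'a cstar \<Rightarrow> ('g::ab_group_add \<Rightarrow> 'a \<Rightarrow> 'a) \<Rightarrow> ('g \<Rightarrow> 'a) \<Rightarrow> real" where
  "reduced_norm A \<alpha> f =
     (SUP \<xi>\<in>{\<xi> \<in> finsupp A. l2_norm A \<xi> \<le> 1}. l2_norm A (regular_rep A \<alpha> f \<xi>))"

text \<open>The *-algebra \<open>C\<^sub>c(\<Gamma>, A)\<close>, where \<open>f\<close> stands for the finite sum \<open>\<Sum>s. f(s) \<lambda>\<^sub>s\<close>; so
  \<open>a \<lambda>\<^sub>s b \<lambda>\<^sub>t = a \<alpha>\<^sub>s(b) \<lambda>\<^bsub>s+t\<^esub>\<close>.\<close>

definition Cc :: "'a cstar \<Rightarrow> ('g::ab_group_add \<Rightarrow> 'a \<Rightarrow> 'a) \<Rightarrow> ('g \<Rightarrow> 'a) cstar" where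
  "Cc A \<alpha> = \<lparr>carrier = finsupp A,
     monoid.mult = (\<lambda>f g t. finsum A (\<lambda>s. f s \<otimes>\<^bsub>A\<^esub> \<alpha> s (g (t - s))) (supp A f)),
     one = (\<lambda>s. if s = 0 then \<one>\<^bsub>A\<^esub> else \<zero>\<^bsub>A\<^esub>), zero = (\<lambda>s. \<zero>\<^bsub>A\<^esub>),
     add = (\<lambda>f g s. f s \<oplus>\<^bsub>A\<^esub> g s), smult = (\<lambda>c f s. c \<odot>\<^bsub>A\<^esub> f s),
     star = (\<lambda>f s. \<alpha> s (star A (f (- s)))), nrm = reduced_norm A \<alpha>\<rparr>"

definition crossed ::
    "'a cstar \<Rightarrow> ('g::ab_group_add \<Rightarrow> 'a \<Rightarrow> 'a) \<Rightarrow> (nat \<Rightarrow> 'g \<Rightarrow> 'a) set cstar" where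
  "crossed A \<alpha> = completion (Cc A \<alpha>)"

text \<open>The element \<open>a \<lambda>\<^sub>s\<close> of the crossed product.\<close>

definition crossed_elem ::
    "'a cstar \<Rightarrow> ('g::ab_group_add \<Rightarrow> 'a \<Rightarrow> 'a) \<Rightarrow> 'a \<Rightarrow> 'g \<Rightarrow> (nat \<Rightarrow> 'g \<Rightarrow> 'a) set" where
  "crossed_elem A \<alpha> a s = completion_embed (Cc A \<alpha>) (\<lambda>t. if t = s then a else \<zero>\<^bsub>A\<^esub>)"

section \<open>The dual action and its continuous part\<close>

text \<open>Below, the topology on the dual group is the one induced by the library's product topology
  on \<open>\<Gamma> \<Rightarrow> \<complex>\<close>, i.e. pointwise convergence.\<close>

definition dual_group :: "('g::ab_group_add \<Rightarrow> complex) set" where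
  "dual_group = {\<gamma>. (\<forall>s t. \<gamma> (s + t) = \<gamma> s * \<gamma> t) \<and> (\<forall>s. cmod (\<gamma> s) = 1)}"

text \<open>On \<open>C\<^sub>c(\<Gamma>, A)\<close> the dual action is multiplication by \<open>cnj (\<gamma> s)\<close>; it is extended to the
  completion termwise on Cauchy sequences.\<close>

definition dual_action ::
    "'a cstar \<Rightarrow> ('g::ab_group_add \<Rightarrow> 'a \<Rightarrow> 'a) \<Rightarrow> ('g \<Rightarrow> complex)
      \<Rightarrow> (nat \<Rightarrow> 'g \<Rightarrow> 'a) set \<Rightarrow> (nat \<Rightarrow> 'g \<Rightarrow> 'a) set" where
  "dual_action A \<alpha> \<gamma> =
     coset_map (cauchy_alg (Cc A \<alpha>)) (null_seqs sequentially (Cc A \<alpha>))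
       (\<lambda>x n s. cnj (\<gamma> s) \<odot>\<^bsub>A\<^esub> x n s)"

definition continuous_seqs ::
    "'a cstar \<Rightarrow> ('g::ab_group_add \<Rightarrow> 'a \<Rightarrow> 'a) \<Rightarrow> (nat \<Rightarrow> (nat \<Rightarrow> 'g \<Rightarrow> 'a) set) set" where
  "continuous_seqs A \<alpha> = {x \<in> carrier (linf (crossed A \<alpha>)).
     \<forall>\<gamma>\<^sub>0\<in>dual_group.
       ((\<lambda>\<gamma>. nrm (linf (crossed A \<alpha>))
          ((\<lambda>n. dual_action A \<alpha> \<gamma> (x n)) \<ominus>\<^bsub>linf (crossed A \<alpha>)\<^esub> (\<lambda>n. dual_action A \<alpha> \<gamma>\<^sub>0 (x n))))
        \<longlongrightarrow> 0) (at \<gamma>\<^sub>0 within dual_group)}"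

definition continuous_part ::
    "nat filter \<Rightarrow> 'a cstar \<Rightarrow> ('g::ab_group_add \<Rightarrow> 'a \<Rightarrow> 'a)
      \<Rightarrow> (nat \<Rightarrow> (nat \<Rightarrow> 'g \<Rightarrow> 'a) set) set set" where
  "continuous_part \<omega> A \<alpha> = ultra_class \<omega> (crossed A \<alpha>) ` continuous_seqs A \<alpha>"

section \<open>The canonical homomorphism\<close>

definition canonical_hom ::
    "nat filter \<Rightarrow> 'a cstar \<Rightarrow> ('g::ab_group_add \<Rightarrow> 'a \<Rightarrow> 'a)
      \<Rightarrow> ((nat \<Rightarrow> 'g \<Rightarrow> (nat \<Rightarrow> 'a) set) set \<Rightarrow> (nat \<Rightarrow> (nat \<Rightarrow> 'g \<Rightarrow> 'a) set) set) \<Rightarrow> bool" where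
  "canonical_hom \<omega> A \<alpha> \<phi> \<longleftrightarrow>
     \<phi> \<in> star_hom (crossed (ultrapower \<omega> A) (ultra_action \<omega> A \<alpha>)) (ultrapower \<omega> (crossed A \<alpha>)) \<and>
     (\<forall>a\<in>carrier (linf A). \<forall>s.
        \<phi> (crossed_elem (ultrapower \<omega> A) (ultra_action \<omega> A \<alpha>) (ultra_class \<omega> A a) s)
          = ultra_class \<omega> (crossed A \<alpha>) (\<lambda>n. crossed_elem A \<alpha> (a n) s))"

end

theory Submission
  imports Defs "HOL-Library.Poly_Mapping"
begin

text \<open>Representing the coefficients of a finitely supported \<open>f : \<Gamma> \<rightarrow> A\<^sup>\<omega>\<close> by bounded sequences gives a
  sequence of elements of \<open>C\<^sub>c(\<Gamma>, A)\<close> with a common finite support, and hence an element \<open>\<Phi> f\<close> of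
  the ultrapower of \<open>A \<rtimes> \<Gamma>\<close>. The map \<open>\<Phi>\<close> is a *-homomorphism with the prescribed values on
  \<open>[(a\<^sub>n)] \<lambda>\<^sub>s\<close>, and the theorem follows from four facts about it.

  \<^item> \<open>\<Phi>\<close> is isometric. Suppose that \<open>p\<close> and \<open>q\<close> satisfy the C*-identity on \<open>C\<^sub>c\<close>, that \<open>p\<close> is
    at most the sum of the norms of the coefficients, and that \<open>q\<close> is at least the norm of each
    coefficient. With \<open>f\<^sub>0 = f\<close> and \<open>f\<^sub>j\<^sub>+\<^sub>1 = f\<^sub>j* f\<^sub>j\<close> one has \<open>p(f\<^sub>j) = p(f)^(2^j)\<close>, and likewise for
    \<open>q\<close>. Since \<open>\<Gamma>\<close> is abelian, the size of the support of \<open>f\<^sub>j\<close> is polynomial in \<open>2^j\<close>. Taking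
    roots gives \<open>p \<le> q\<close> (\<open>cstar_norm_le\<close>). The reduced norm over \<open>A\<^sup>\<omega>\<close> and \<open>f \<mapsto> \<parallel>\<Phi> f\<parallel>\<close> both satisfy
    all of these conditions, so they agree. This is the form in which the amenability of \<open>\<Gamma>\<close> enters.

  \<^item> \<open>\<Phi>\<close> extends to the completion, with values in the continuous part. A fast Cauchy sequence in
    the ultrapower has a limit that is represented by a diagonal sequence
    (\<open>diagonal_sequence\<close>), and the diagonal sequence inherits the uniform continuity of the
    sequences that it is made of.

  \<^item> Every continuous sequence is reached. Multiplying the coefficients by those of a Fejer kernel
    changes a sequence little if the dual action moves it little near the trivial character, and it
    cuts all supports down to one fixed finite set (\<open>fejer_approximation\<close>). The existence of enough
    characters of \<open>\<Gamma>\<close> comes from Zorn's lemma. Averages over finite families of characters, adapted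
    to finitely many Fourier coefficients, take the place of Haar measure.

  \<^item> Uniqueness holds because a *-homomorphism from a complete algebra is automatically contractive
    (\<open>star_hom_contractive\<close>).

  That the reduced norm is a C*-norm rests on the Cauchy-Schwarz inequality for
  \<open>\<Sum> y\<^sub>i* x\<^sub>i\<close>, hence on the positivity of \<open>x* x\<close>. Both this and automatic contractivity are derived
  from one fact: a selfadjoint element of norm 1 has 1 or -1 as an approximate eigenvalue
  (\<open>approx_eigenvector_1\<close>).\<close>

section \<open>C*-seminorms and positivity\<close>

text \<open>The type \<open>'f\<close> carries the ring structure, so that identities are within reach of the simplifier;
  scalars enter through the central homomorphism \<open>sc\<close>.\<close>
locale cstar_seminorm =
  fixes sc :: "complex \<Rightarrow> 'f::ring_1" and st :: "'f \<Rightarrow> 'f" and q :: "'f \<Rightarrow> real"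
  assumes sc_add: "sc (a + b) = sc a + sc b"
    and sc_mult: "sc (a * b) = sc a * sc b"
    and sc_1: "sc 1 = 1"
    and sc_comm: "x * sc c = sc c * x"
    and st_add: "st (x + y) = st x + st y"
    and st_mult: "st (x * y) = st y * st x"
    and st_st: "st (st x) = x"
    and st_sc: "st (sc c) = sc (cnj c)"
    and q_add: "q (x + y) \<le> q x + q y"
    and q_mult: "q (x * y) \<le> q x * q y"
    and q_sc: "q (sc c * x) = cmod c * q x"
    and q_1: "q 1 \<le> 1"
    and q_cstar: "q (st x * x) = (q x)\<^sup>2"
begin

lemma sc_0: "sc 0 = 0" using sc_add[of 0 0] by simp
lemma sc_minus: "sc (- a) = - sc a" using sc_add[of a "-a"] sc_0 by (simp add: minus_unique)
lemma sc_diff: "sc (a - b) = sc a - sc b" using sc_add[of a "-b"] sc_minus by simp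
lemma st_0: "st 0 = 0" using st_add[of 0 0] by simp
lemma st_minus: "st (- a) = - st a" using st_add[of a "-a"] st_0 by (simp add: minus_unique)
lemma st_diff: "st (a - b) = st a - st b" using st_add[of a "-b"] st_minus by simp
lemma st_1: "st 1 = 1" using st_sc[of 1] by (simp add: sc_1)
lemma st_power: "st (a ^ n) = st a ^ n"
  by (induction n) (auto simp: st_1 st_mult power_commutes)
lemma st_sum: "st (\<Sum>i\<in>I. f i) = (\<Sum>i\<in>I. st (f i))"
  by (induction I rule: infinite_finite_induct) (auto simp: st_0 st_add)
lemma q_0: "q 0 = 0" using q_sc[of 0 0] by (simp add: sc_0)
lemma q_minus: "q (- x) = q x" using q_sc[of "-1" x] by (simp add: sc_minus sc_1)
lemma q_ge0: "0 \<le> q x" using q_add[of x "-x"] by (simp add: q_minus q_0)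
lemma q_diff: "q (x - y) \<le> q x + q y" using q_add[of x "-y"] by (simp add: q_minus)
lemma q_diff_ge: "q x - q y \<le> q (x - y)" using q_add[of "x - y" y] by simp
lemma q_add_ge: "q x - q y \<le> q (x + y)" using q_diff[of "x + y" y] by simp
lemma q_sc1: "q (sc c) \<le> cmod c"
  using q_sc[of c 1] q_1 by (simp add: mult_left_le)
lemma q_st: "q (st x) = q x"
proof -
  have *: "q x \<le> q (st x)" for x
  proof (cases "q x = 0")
    case False
    have "q x * q x \<le> q (st x) * q x"
      using q_cstar[of x] q_mult[of "st x" x] by (simp add: power2_eq_square)
    then show ?thesis using False q_ge0[of x] by simp
  qed (simp add: q_ge0)
  show ?thesis using *[of x] *[of "st x"] by (simp add: st_st)
qed
lemma q_cstar': "q (x * st x) = (q x)\<^sup>2" using q_cstar[of "st x"] by (simp add: st_st q_st)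

lemma sc_left_comm: "x * (sc c * y) = sc c * (x * y)"
  by (metis mult.assoc sc_comm)

lemma q_power_selfadjoint: assumes "st h = h" shows "q (h ^ (2 ^ j)) = q h ^ (2 ^ j)"
proof (induction j)
  case (Suc j)
  have "h ^ (2 ^ Suc j) = st (h ^ (2 ^ j)) * h ^ (2 ^ j)"
    by (simp add: st_power assms power_add[symmetric] mult_2)
  then show ?case using Suc by (simp add: q_cstar power_mult[symmetric] mult.commute)
qed simp

text \<open>The spectrum of \<open>h\<close> is real. If \<open>g\<close> is selfadjoint then \<open>\<parallel>g + iT\<parallel>\<^sup>2 \<le> \<parallel>g\<parallel>\<^sup>2 + T\<^sup>2\<close> by the
  C*-identity. Writing \<open>z - h\<close> as the scalar \<open>i(Im z + T)\<close> minus such an element and letting \<open>T\<close> tend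
  to infinity leaves \<open>Im z\<close>. (For negative \<open>Im z\<close> the sign of \<open>T\<close> is reversed.)\<close>
lemma Im_bound:
  assumes h: "st h = h"
  shows "\<bar>Im z\<bar> * q x \<le> q ((sc z - h) * x)"
proof (rule field_le_epsilon)
  fix e :: real assume e: "e > 0"
  define a b where "a = complex_of_real (Re z)" and "b = Im z"
  define s :: real where "s = (if b \<ge> 0 then 1 else -1)"
  define C where "C = q (h - sc a)"
  \<comment> \<open>This makes the error term \<open>C\<^sup>2 / (2 T) * q x\<close> at most \<open>e\<close>.\<close>
  define T where "T = C\<^sup>2 * q x / (2 * e) + 1"
  define w where "w = Complex 0 (s * T)"
  define g where "g = h - sc a + sc w"
  have T: "T > 0" unfolding T_def using e q_ge0[of x]
    by (simp add: add_nonneg_pos)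
  have ss: "s * s = 1" "s * \<bar>b\<bar> = b" "\<bar>s\<bar> = 1" by (auto simp: s_def)
  have ww: "w * w = - complex_of_real (T\<^sup>2)"
    using ss by (simp add: w_def complex_eq_iff power2_eq_square algebra_simps)
  have cw: "cnj w = - w" by (simp add: w_def complex_eq_iff)
  have wa: "sc w * sc a = sc a * sc w" by (rule sc_comm)
  have "st g * g = (h - sc a) * (h - sc a) - sc (w * w)"
    by (simp add: wa[unfolded a_def] g_def st_add st_diff h st_sc cw sc_minus sc_mult a_def algebra_simps sc_comm[of h])
  also have "q \<dots> \<le> C\<^sup>2 + T\<^sup>2"
    using q_diff[of "(h - sc a) * (h - sc a)" "sc (w * w)"] q_mult[of "h - sc a" "h - sc a"]
      q_sc1[of "w * w"] ww by (simp add: C_def power2_eq_square norm_mult)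
  finally have "(q g)\<^sup>2 \<le> C\<^sup>2 + T\<^sup>2" by (simp add: q_cstar)
  also have "\<dots> \<le> (T + C\<^sup>2 / (2 * T))\<^sup>2"
  proof -
    have "(T + C\<^sup>2 / (2 * T))\<^sup>2 = C\<^sup>2 + T\<^sup>2 + (C\<^sup>2 / (2 * T))\<^sup>2"
      using T by (simp add: power2_sum)
    then show ?thesis by simp
  qed
  finally have g: "q g \<le> T + C\<^sup>2 / (2 * T)"
    by (rule power2_le_imp_le) (use T in simp)
  define u where "u = Complex 0 (s * (\<bar>b\<bar> + T))"
  have z: "z = a + (u - w)" using ss
    by (simp add: a_def u_def w_def b_def complex_eq_iff algebra_simps)
  have "(sc z - h) * x = sc u * x - g * x"
    unfolding z by (simp add: g_def sc_add sc_diff algebra_simps)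
  then have "q ((sc z - h) * x) \<ge> cmod u * q x - q g * q x"
    using q_diff_ge[of "sc u * x" "g * x"] q_mult[of g x] by (simp add: q_sc)
  moreover have "cmod u = \<bar>b\<bar> + T" using T ss by (simp add: u_def cmod_def abs_mult)
  moreover have "q g * q x \<le> (T + C\<^sup>2 / (2 * T)) * q x" using g q_ge0 by (simp add: mult_right_mono)
  moreover have "C\<^sup>2 / (2 * T) * q x \<le> e"
  proof -
    have "C\<^sup>2 * q x \<le> e * (2 * T)" using e by (simp add: T_def field_simps)
    then show ?thesis using T by (simp add: field_simps)
  qed
  ultimately show "\<bar>Im z\<bar> * q x \<le> q ((sc z - h) * x) + e" by (simp add: b_def algebra_simps)
qed

text \<open>The bicommutant of \<open>h\<close> is commutative, and closed under \<open>st\<close> if \<open>h\<close> is selfadjoint. Eigenvectors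
  are sought in it so that they commute with \<open>h\<close> and are normal.\<close>
definition bicomm :: "'f \<Rightarrow> 'f set" where
  "bicomm h = {v. \<forall>y. y * h = h * y \<longrightarrow> v * y = y * v}"

lemma bicomm_1: "1 \<in> bicomm h" by (simp add: bicomm_def)
lemma bicomm_self: "h \<in> bicomm h" by (simp add: bicomm_def)
lemma bicomm_sc: "sc c \<in> bicomm h" by (simp add: bicomm_def sc_comm)
lemma bicomm_add: "v \<in> bicomm h \<Longrightarrow> w \<in> bicomm h \<Longrightarrow> v + w \<in> bicomm h"
  by (auto simp: bicomm_def algebra_simps)
lemma bicomm_diff: "v \<in> bicomm h \<Longrightarrow> w \<in> bicomm h \<Longrightarrow> v - w \<in> bicomm h"
  by (auto simp: bicomm_def algebra_simps)
lemma bicommD: "v \<in> bicomm h \<Longrightarrow> y * h = h * y \<Longrightarrow> v * y = y * v"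
  by (simp add: bicomm_def)
lemma bicomm_mult: assumes "v \<in> bicomm h" "w \<in> bicomm h" shows "v * w \<in> bicomm h"
  unfolding bicomm_def
proof (intro CollectI allI impI)
  fix y assume y: "y * h = h * y"
  have "v * w * y = v * y * w" using bicommD[OF assms(2) y] by (simp add: mult.assoc)
  also have "\<dots> = y * (v * w)" using bicommD[OF assms(1) y] by (simp add: mult.assoc)
  finally show "v * w * y = y * (v * w)" .
qed
lemma bicomm_power: "v \<in> bicomm h \<Longrightarrow> v ^ n \<in> bicomm h"
  by (induction n) (auto simp: bicomm_1 bicomm_mult)
lemma bicomm_st: assumes "st h = h" "v \<in> bicomm h" shows "st v \<in> bicomm h"
  unfolding bicomm_def
proof (intro CollectI allI impI)
  fix y assume "y * h = h * y"
  then have "st y * h = h * st y" by (metis assms(1) st_mult)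
  then have "v * st y = st y * v" using assms(2) by (auto simp: bicomm_def)
  then show "st v * y = y * st v" by (metis st_mult st_st)
qed
lemma bicomm_commute: assumes "v \<in> bicomm h" "w \<in> bicomm h" shows "v * w = w * v"
  by (rule bicommD[OF assms(1)]) (rule bicommD[OF assms(2)], rule refl)
lemma bicomm_cong: assumes "\<And>y. y * h = h * y \<longleftrightarrow> y * k = k * y" shows "bicomm h = bicomm k"
  unfolding bicomm_def using assms by auto

text \<open>Let \<open>s\<close> be the nearer of \<open>1\<close> and \<open>-1\<close>. If \<open>z\<close> is close to \<open>s\<close>, the assumption at \<open>s\<close> gives the
  bound by the triangle inequality; otherwise \<open>Im_bound\<close> does, since \<open>\<bar>z - s\<bar> \<le> 2 \<bar>Im z\<bar>\<close> on the unit
  circle.\<close>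
lemma circle_bound:
  assumes h: "st h = h" and e: "e > 0"
    and minus: "e * q v \<le> q (h * v - v)" and plus: "e * q v \<le> q (h * v + v)"
    and z: "cmod z = 1"
  shows "e / 4 * q v \<le> q ((sc z - h) * v)"
proof -
  define a b where "a = Re z" and "b = Im z"
  have ab: "a\<^sup>2 + b\<^sup>2 = 1" using z by (simp add: a_def b_def cmod_def)
  define s :: real where "s = (if a \<ge> 0 then 1 else -1)"
  have s: "s * s = 1" "s * a = \<bar>a\<bar>" by (auto simp: s_def)
  have "e * q v \<le> q (h * v - sc s * v)"
    using minus plus by (simp add: s_def sc_1 sc_minus)
  also have "\<dots> \<le> q ((sc z - h) * v) + cmod (z - s) * q v"
  proof -
    have "h * v - sc s * v = sc (z - s) * v - (sc z - h) * v"
      by (simp add: sc_diff algebra_simps)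
    then show ?thesis using q_diff[of "sc (z - s) * v" "(sc z - h) * v"] by (simp add: q_sc)
  qed
  finally have A: "(e - cmod (z - s)) * q v \<le> q ((sc z - h) * v)" by (simp add: algebra_simps)
  have B: "\<bar>b\<bar> * q v \<le> q ((sc z - h) * v)" using Im_bound[OF h] by (simp add: b_def)
  have "(cmod (z - s))\<^sup>2 = (a - s)\<^sup>2 + b\<^sup>2" by (simp add: cmod_power2 a_def b_def)
  also have "\<dots> = 2 - 2 * \<bar>a\<bar>" using ab s by (simp add: power2_eq_square algebra_simps)
  also have "\<dots> \<le> (2 * \<bar>b\<bar>)\<^sup>2"
  proof -
    have "\<bar>a\<bar> \<le> 1" using ab by (metis abs_square_le_1 le_add_same_cancel1 zero_le_power2)
    then have "\<bar>a\<bar> * \<bar>a\<bar> \<le> \<bar>a\<bar> * 1" by (intro mult_left_mono) auto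
    then have "a\<^sup>2 \<le> \<bar>a\<bar>" by (simp only: abs_mult_self_eq power2_eq_square mult_1_right)
    then show ?thesis using ab \<open>\<bar>a\<bar> \<le> 1\<close> by (simp add: power_mult_distrib)
  qed
  finally have cb: "cmod (z - s) \<le> 2 * \<bar>b\<bar>" by (rule power2_le_imp_le) simp
  show ?thesis
  proof (cases "cmod (z - s) \<le> e / 2")
    case True
    have "e / 4 * q v \<le> (e - cmod (z - s)) * q v"
      using True e q_ge0 by (intro mult_right_mono) auto
    then show ?thesis using A by simp
  next
    case False
    have "e / 4 * q v \<le> \<bar>b\<bar> * q v" using False cb q_ge0 by (intro mult_right_mono) auto
    then show ?thesis using B by simp
  qed
qed

text \<open>Passing from \<open>k\<close> to \<open>k\<^sup>2\<close> doubles the constant: if \<open>y\<^sup>2 = z\<close>, then \<open>4 y k\<^sup>2\<close> is the difference of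
  \<open>k (y + k)\<^sup>2\<close> and \<open>k (y - k)\<^sup>2\<close>, while \<open>(y + k)\<^sup>2 (y - k)\<^sup>2 = (z - k\<^sup>2)\<^sup>2\<close>.\<close>
lemma squaring_bound:
  assumes base: "\<And>z v. cmod z = 1 \<Longrightarrow> v \<in> bicomm h \<Longrightarrow> d * q v \<le> q ((sc z - h) * v)"
    and d: "d > 0" and h: "q h \<le> 1"
  shows "cmod z = 1 \<Longrightarrow> v \<in> bicomm h \<Longrightarrow>
    2 ^ j * d\<^sup>2 * q (h ^ (2 ^ j) * v) \<le> q ((sc z - h ^ (2 ^ j)) * ((sc z - h ^ (2 ^ j)) * v))"
proof (induction j arbitrary: z v)
  case 0
  have v': "(sc z - h) * v \<in> bicomm h"
    using 0 by (intro bicomm_mult bicomm_diff bicomm_sc bicomm_self)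
  have "d\<^sup>2 * q (h * v) \<le> d\<^sup>2 * q v"
    using q_mult[of h v] h q_ge0[of v] q_ge0[of h] by (intro mult_left_mono) (auto intro: order_trans mult_left_le_one_le)
  also have "\<dots> = d * (d * q v)" by (simp add: power2_eq_square)
  also have "\<dots> \<le> d * q ((sc z - h) * v)" using base[OF 0] d by (intro mult_left_mono) auto
  also have "\<dots> \<le> q ((sc z - h) * ((sc z - h) * v))" using base[OF 0(1) v'] .
  finally show ?case by simp
next
  case (Suc j)
  define k where "k = h ^ (2 ^ j)"
  have k2: "h ^ (2 ^ Suc j) = k * k" by (simp add: k_def power_add[symmetric] mult_2)
  define y where "y = csqrt z"
  have yy: "y * y = z" by (simp add: y_def power2_eq_square[symmetric])
  have y1: "cmod y = 1"
  proof -
    have "cmod y * cmod y = 1" using Suc.prems yy by (simp add: norm_mult[symmetric])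
    then show ?thesis by (metis abs_norm_cancel abs_square_eq_1 power2_eq_square)
  qed
  let ?p = "sc y + k" and ?m = "sc y - k"
  have k: "k \<in> bicomm h" unfolding k_def by (intro bicomm_power bicomm_self)
  have p: "?p * (?p * v) \<in> bicomm h" and m: "?m * (?m * v) \<in> bicomm h"
    using Suc.prems k by (auto intro!: bicomm_mult bicomm_add bicomm_diff bicomm_sc)
  have ky: "k * sc y = sc y * k" "\<And>u. k * (sc y * u) = sc y * (k * u)"
    by (rule sc_comm sc_left_comm)+
  have y4: "sc (4 * y) = sc y + sc y + sc y + sc y"
  proof -
    have "4 * y = y + y + y + y" by simp
    then show ?thesis by (simp only: sc_add)
  qed
  have "sc (4 * y) * (k * k * v) = k * (?p * (?p * v)) - k * (?m * (?m * v))"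
    unfolding y4 by (simp add: algebra_simps ky)
  then have "cmod (4 * y) * q (k * k * v) \<le> q (k * (?p * (?p * v))) + q (k * (?m * (?m * v)))"
    by (metis q_diff q_sc)
  then have A: "4 * q (k * k * v) \<le> q (k * (?p * (?p * v))) + q (k * (?m * (?m * v)))"
    using y1 by (simp add: norm_mult)
  have B: "2 ^ j * d\<^sup>2 * q (k * (?p * (?p * v))) \<le> q (?m * (?m * (?p * (?p * v))))"
    using Suc.IH[OF y1 p] by (simp add: k_def)
  have C: "2 ^ j * d\<^sup>2 * q (k * (?m * (?m * v))) \<le> q (?p * (?p * (?m * (?m * v))))"
  proof -
    have "(sc (-y) - k) * ((sc (-y) - k) * u) = ?p * (?p * u)" for u
      by (simp add: sc_minus algebra_simps)
    then show ?thesis using Suc.IH[of "-y", OF _ m] y1 by (simp add: k_def)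
  qed
  have mp: "?m * (?m * (?p * (?p * v))) = (sc z - k * k) * ((sc z - k * k) * v)"
    and pm: "?p * (?p * (?m * (?m * v))) = (sc z - k * k) * ((sc z - k * k) * v)"
    unfolding yy[symmetric] sc_mult by (simp_all add: algebra_simps ky)
  have "2 ^ j * d\<^sup>2 * (4 * q (k * k * v)) \<le> 2 ^ j * d\<^sup>2 * (q (k * (?p * (?p * v))) + q (k * (?m * (?m * v))))"
    using A by (intro mult_left_mono) auto
  also have "\<dots> \<le> 2 * q ((sc z - k * k) * ((sc z - k * k) * v))"
    using B C unfolding mp pm by (simp add: algebra_simps)
  finally show ?case unfolding k2 by (simp add: mult.assoc mult.left_commute)
qed

text \<open>Otherwise \<open>z - h\<close> is bounded below on the whole unit circle (\<open>circle_bound\<close>), and \<open>squaring_bound\<close>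
  at the vector \<open>1\<close> makes \<open>2 ^ j\<close> bounded, because all the powers \<open>h ^ (2 ^ j)\<close> have norm 1.\<close>
lemma approx_eigenvector_1:
  assumes h: "st h = h" and qh: "q h = 1" and e: "e > 0"
  shows "\<exists>v\<in>bicomm h. q v > 0 \<and> (q (h * v - v) \<le> e * q v \<or> q (h * v + v) \<le> e * q v)"
proof (rule ccontr)
  assume neg: "\<not> ?thesis"
  have *: "e * q v \<le> q (h * v - v) \<and> e * q v \<le> q (h * v + v)" if "v \<in> bicomm h" for v
  proof (cases "q v > 0")
    case True then show ?thesis using neg that by force
  next
    case False
    then have "q v = 0" using q_ge0[of v] by simp
    then show ?thesis by (simp add: q_ge0)
  qed
  define d where "d = e / 4"
  have d: "d > 0" using e by (simp add: d_def)
  have base: "d * q v \<le> q ((sc z - h) * v)" if "cmod z = 1" "v \<in> bicomm h" for z v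
    unfolding d_def using circle_bound[OF h e] * that by blast
  have bound: "2 ^ j * d\<^sup>2 \<le> 4" for j
  proof -
    let ?k = "h ^ (2 ^ j)"
    have qk: "q ?k = 1" by (simp add: q_power_selfadjoint h qh)
    have "2 ^ j * d\<^sup>2 * q (?k * 1) \<le> q ((sc 1 - ?k) * ((sc 1 - ?k) * 1))"
      by (rule squaring_bound[OF base d]) (auto simp: qh bicomm_1)
    also have "\<dots> \<le> (q (sc 1 - ?k))\<^sup>2" using q_mult[of "sc 1 - ?k" "sc 1 - ?k"] by (simp add: power2_eq_square)
    also have "\<dots> \<le> 2\<^sup>2"
      using q_diff[of "sc 1" ?k] q_sc1[of 1] qk q_ge0 by (intro power_mono) auto
    finally show ?thesis by (simp add: qk)
  qed
  obtain j where "4 / d\<^sup>2 < 2 ^ j" using real_arch_pow[of 2 "4 / d\<^sup>2"] by auto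
  then have "4 < 2 ^ j * d\<^sup>2" using d by (simp add: field_simps)
  then show False using bound[of j] by simp
qed

lemma approx_eigenvector:
  assumes h: "st h = h" and qh: "q h > 0" and e: "e > 0"
  shows "\<exists>v\<in>bicomm h. q v > 0 \<and> (q (h * v - sc (q h) * v) \<le> e * q v \<or> q (h * v + sc (q h) * v) \<le> e * q v)"
proof -
  define m where "m = q h"
  have m: "m > 0" using qh by (simp add: m_def)
  define k where "k = sc (1 / m) * h"
  have hk: "h = sc m * k" using m by (simp add: k_def mult.assoc[symmetric] sc_mult[symmetric] sc_1)
  have stk: "st k = k" by (simp add: k_def st_mult st_sc h sc_comm[of h])
  have qk: "q k = 1" using m by (simp add: k_def q_sc norm_divide flip: m_def)
  have "bicomm k = bicomm h"
  proof (rule bicomm_cong)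
    fix y
    show "y * k = k * y \<longleftrightarrow> y * h = h * y"
    proof
      assume "y * k = k * y"
      then show "y * h = h * y" by (metis hk mult.assoc sc_left_comm)
    next
      assume "y * h = h * y"
      then show "y * k = k * y" by (metis k_def mult.assoc sc_left_comm)
    qed
  qed
  moreover obtain v where "v \<in> bicomm k" "q v > 0"
    and v: "q (k * v - v) \<le> e / m * q v \<or> q (k * v + v) \<le> e / m * q v"
    using approx_eigenvector_1[OF stk qk, of "e / m"] e m by auto
  moreover have "q (h * v - sc m * v) = m * q (k * v - v)"
    using q_sc[of m "k * v - v"] m by (simp add: hk algebra_simps)
  moreover have "q (h * v + sc m * v) = m * q (k * v + v)"
    using q_sc[of m "k * v + v"] m by (simp add: hk algebra_simps)
  moreover have "m * r \<le> e * q v" if "r \<le> e / m * q v" for r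
    using that m by (simp add: field_simps)
  ultimately show ?thesis unfolding m_def[symmetric] by (metis (no_types))
qed

text \<open>An upper bound for the spectrum of a selfadjoint \<open>h\<close>: as \<open>t\<close> grows, \<open>\<parallel>t + h\<parallel> - t\<close> decreases to
  the supremum of the spectrum. In terms of norms, subadditivity is immediate.\<close>
definition spec_le :: "'f \<Rightarrow> real \<Rightarrow> bool" where
  "spec_le h c \<longleftrightarrow> (\<forall>e>0. \<exists>t0. \<forall>t\<ge>t0. q (sc (complex_of_real t) + h) \<le> t + c + e)"

lemma spec_leI:
  assumes "\<And>e. e > 0 \<Longrightarrow> \<exists>t. q (sc (complex_of_real t) + h) \<le> t + c + e"
  shows "spec_le h c"
  unfolding spec_le_def
proof (intro allI impI)
  fix e :: real assume "e > 0"
  then obtain t0 where t0: "q (sc (complex_of_real t0) + h) \<le> t0 + c + e" using assms by blast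
  have "q (sc t + h) \<le> t + c + e" if "t \<ge> t0" for t
  proof -
    have "sc (complex_of_real t) + h = sc (complex_of_real (t - t0)) + (sc t0 + h)" by (simp add: sc_diff)
    moreover have "q (sc (complex_of_real (t - t0))) \<le> t - t0" using q_sc1[of "complex_of_real (t - t0)"] that by (simp only: norm_of_real)
    moreover note q_add[of "sc (complex_of_real (t - t0))" "sc t0 + h"]
    ultimately have "q (sc t + h) \<le> (t - t0) + q (sc t0 + h)" by (metis add_right_mono order_trans)
    then show ?thesis using t0 by linarith
  qed
  then show "\<exists>t0. \<forall>t\<ge>t0. q (sc (complex_of_real t) + h) \<le> t + c + e" by blast
qed

lemma spec_le_add: assumes "spec_le h c" "spec_le k d" shows "spec_le (h + k) (c + d)"
proof (rule spec_leI)
  fix e :: real assume e: "e > 0"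
  obtain s where s: "\<forall>t\<ge>s. q (sc (complex_of_real t) + h) \<le> t + c + e/2"
    using assms(1) e unfolding spec_le_def by (meson half_gt_zero)
  obtain r where r: "\<forall>t\<ge>r. q (sc (complex_of_real t) + k) \<le> t + d + e/2"
    using assms(2) e unfolding spec_le_def by (meson half_gt_zero)
  define t where "t = max s r"
  have eq: "sc (complex_of_real (2 * t)) + (h + k) = (sc t + h) + (sc t + k)"
    by (simp only: mult_2 of_real_add sc_add) (simp add: algebra_simps)
  have "q (sc (complex_of_real (2 * t)) + (h + k)) \<le> q (sc t + h) + q (sc t + k)"
    unfolding eq by (rule q_add)
  also have "\<dots> \<le> 2 * t + (c + d) + e"
    using s[rule_format, of t] r[rule_format, of t] by (simp add: t_def)
  finally show "\<exists>t. q (sc (complex_of_real t) + (h + k)) \<le> t + (c + d) + e" by blast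
qed

lemma spec_le_norm: "spec_le h (q h)"
proof (rule spec_leI)
  fix e :: real assume "e > 0"
  then show "\<exists>t. q (sc (complex_of_real t) + h) \<le> t + q h + e"
    by (intro exI[of _ 0]) (simp add: sc_0)
qed

lemma spec_le_mono: "spec_le h c \<Longrightarrow> c \<le> d \<Longrightarrow> spec_le h d"
  unfolding spec_le_def by (meson add_left_mono add_right_mono order_trans)

lemma spec_le_closed: assumes "\<And>e. e > 0 \<Longrightarrow> spec_le h (c + e)" shows "spec_le h c"
proof (rule spec_leI)
  fix e :: real assume "e > 0"
  then have "spec_le h (c + e/2)" using assms by simp
  then obtain t where "q (sc (complex_of_real t) + h) \<le> t + (c + e/2) + e/2"
    unfolding spec_le_def using \<open>e > 0\<close> by (meson half_gt_zero order_refl)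
  then show "\<exists>t. q (sc (complex_of_real t) + h) \<le> t + c + e" by (auto intro!: exI[of _ t])
qed

lemma spec_le_scale: assumes "spec_le h c" "s > 0" shows "spec_le (sc (complex_of_real s) * h) (s * c)"
proof (rule spec_leI)
  fix e :: real assume "e > 0"
  then obtain t where t: "q (sc (complex_of_real t) + h) \<le> t + c + e / s"
    using assms unfolding spec_le_def by (meson divide_pos_pos order_refl)
  have "sc (complex_of_real (s * t)) + sc (complex_of_real s) * h = sc (complex_of_real s) * (sc t + h)"
    by (simp add: sc_mult algebra_simps)
  then have "q (sc (complex_of_real (s * t)) + sc (complex_of_real s) * h) = s * q (sc t + h)"
    using assms(2) by (simp add: q_sc)
  also have "\<dots> \<le> s * (t + c + e / s)" using t assms(2) by simp
  also have "\<dots> = s * t + s * c + e" using assms(2) by (simp add: field_simps)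
  finally show "\<exists>t. q (sc (complex_of_real t) + sc (complex_of_real s) * h) \<le> t + s * c + e" by blast
qed

lemma spec_le_sum: "finite I \<Longrightarrow> (\<And>i. i \<in> I \<Longrightarrow> spec_le (f i) 0) \<Longrightarrow> spec_le (\<Sum>i\<in>I. f i) 0"
proof (induction I rule: finite_induct)
  case empty show ?case using spec_le_norm[of 0] by (simp add: q_0)
next
  case (insert i I)
  then show ?case using spec_le_add[of "f i" 0 "\<Sum>i\<in>I. f i" 0] by simp
qed

text \<open>For large \<open>t\<close> an approximate eigenvalue of \<open>t + h\<close> of absolute value \<open>\<parallel>t + h\<parallel>\<close> must be positive,
  and then \<open>l = \<parallel>t + h\<parallel> - t\<close> is an approximate eigenvalue of \<open>h\<close>.\<close>
lemma not_spec_le_eigenvalue: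
  assumes h: "st h = h" and n: "\<not> spec_le h c"
  shows "\<exists>l>c. \<forall>e>0. \<exists>v\<in>bicomm h. q v > 0 \<and> q (h * v - sc (complex_of_real l) * v) \<le> e * q v"
proof -
  obtain e0 where e0: "e0 > 0" "\<And>t. q (sc (complex_of_real t) + h) > t + c + e0"
    using n spec_leI[of h c] by (meson not_le)
  \<comment> \<open>So large that \<open>- q k\<close> cannot be an approximate eigenvalue of \<open>k = t + h\<close>.\<close>
  define t where "t = q h + \<bar>c\<bar> + 1"
  define k where "k = sc (complex_of_real t) + h"
  define l where "l = q k - t"
  have l: "l > c" using e0(2)[of t] e0(1) by (simp add: l_def k_def)
  have stk: "st k = k" by (simp add: k_def st_add st_sc h)
  have qk: "q k > 0" using l q_ge0[of h] by (simp add: l_def t_def)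
  have D: "bicomm k = bicomm h"
  proof (rule bicomm_cong)
    fix y
    have "y * sc t = sc t * y" by (rule sc_comm)
    then show "y * k = k * y \<longleftrightarrow> y * h = h * y" by (simp add: k_def algebra_simps)
  qed
  have "\<exists>v\<in>bicomm h. q v > 0 \<and> q (h * v - sc (complex_of_real l) * v) \<le> e * q v" if e: "e > 0" for e
  proof -
    define e' where "e' = min e 1"
    have e': "e' > 0" "e' \<le> e" "e' \<le> 1" using e by (auto simp: e'_def)
    obtain v where v: "v \<in> bicomm h" "q v > 0"
      and or: "q (k * v - sc (q k) * v) \<le> e' * q v \<or> q (k * v + sc (q k) * v) \<le> e' * q v"
      using approx_eigenvector[OF stk qk e'(1)] D by auto
    have "\<not> q (k * v + sc (q k) * v) \<le> e' * q v"
    proof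
      assume a: "q (k * v + sc (q k) * v) \<le> e' * q v"
      have "k * v + sc (q k) * v = sc (complex_of_real (q k + t)) * v + h * v"
        by (simp add: k_def sc_add algebra_simps)
      then have "\<bar>q k + t\<bar> * q v - q (h * v) \<le> q (k * v + sc (q k) * v)"
        using q_add_ge[of "sc (complex_of_real (q k + t)) * v" "h * v"] by (simp only: q_sc norm_of_real)
      moreover have "\<bar>q k + t\<bar> = q k + t" using qk q_ge0[of h] by (simp add: t_def)
      moreover have "q (h * v) \<le> q h * q v" by (rule q_mult)
      moreover have "e' * q v \<le> 1 * q v" using e' v by (intro mult_right_mono) auto
      ultimately have "(q k + t - q h - 1) * q v \<le> 0" using a by (simp add: algebra_simps)
      moreover have "q k + t - q h - 1 > 0" using qk by (simp add: t_def)
      ultimately show False using v(2) by (simp add: mult_le_0_iff)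
    qed
    then have "q (k * v - sc (q k) * v) \<le> e' * q v" using or by blast
    moreover have "k * v - sc (q k) * v = h * v - sc (complex_of_real l) * v"
      by (simp add: k_def l_def sc_diff algebra_simps)
    moreover have "e' * q v \<le> e * q v" using e' v by (intro mult_right_mono) auto
    ultimately have "q (h * v - sc (complex_of_real l) * v) \<le> e * q v" by simp
    then show ?thesis using v by blast
  qed
  then show ?thesis using l by blast
qed

lemma eigenvalue_not_spec_le:
  assumes "c < l" and "\<And>e. e > 0 \<Longrightarrow> \<exists>v. q v > 0 \<and> q (h * v - sc (complex_of_real l) * v) \<le> e * q v"
  shows "\<not> spec_le h c"
proof
  assume "spec_le h c"
  define e where "e = (l - c) / 3"
  have e: "e > 0" using assms(1) by (simp add: e_def)
  obtain t0 where t0: "\<forall>t\<ge>t0. q (sc (complex_of_real t) + h) \<le> t + c + e"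
    using \<open>spec_le h c\<close> e unfolding spec_le_def by blast
  define t where "t = max t0 \<bar>l\<bar>"
  obtain v where v: "q v > 0" "q (h * v - sc (complex_of_real l) * v) \<le> e * q v"
    using assms(2)[OF e] by blast
  have "sc (complex_of_real (t + l)) * v = (sc t + h) * v - (h * v - sc (complex_of_real l) * v)"
    by (simp add: sc_add algebra_simps)
  then have "\<bar>t + l\<bar> * q v \<le> q ((sc t + h) * v) + q (h * v - sc (complex_of_real l) * v)"
    by (metis (no_types) norm_of_real q_diff q_sc)
  also have "\<dots> \<le> (t + c + e) * q v + e * q v"
  proof -
    have "q ((sc t + h) * v) \<le> q (sc t + h) * q v" by (rule q_mult)
    also have "\<dots> \<le> (t + c + e) * q v" using t0 v by (intro mult_right_mono) (auto simp: t_def)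
    finally show ?thesis using v by simp
  qed
  finally have "\<bar>t + l\<bar> * q v \<le> (t + c + 2 * e) * q v" by (simp add: algebra_simps)
  then have "\<bar>t + l\<bar> \<le> t + c + 2 * e" using v by simp
  moreover have "\<bar>t + l\<bar> = t + l" by (simp add: t_def)
  ultimately show False using e unfolding e_def by argo
qed

text \<open>One of \<open>\<plusminus>\<parallel>h\<parallel>\<close> is an approximate eigenvalue of \<open>h\<close>, and the bound on that side applies to it.\<close>
lemma norm_le_bounds:
  assumes h: "st h = h" and "spec_le h m" "spec_le (- h) m" "m \<ge> 0"
  shows "q h \<le> m"
proof (rule ccontr)
  assume "\<not> q h \<le> m"
  then have m: "q h > m" by simp
  define e where "e = (q h - m) / 3"
  have e: "e > 0" using m by (simp add: e_def)
  have qh: "q h > 0" using m assms(4) by simp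
  obtain v where v: "q v > 0" "q (h * v - sc (q h) * v) \<le> e * q v \<or> q (h * v + sc (q h) * v) \<le> e * q v"
    using approx_eigenvector[OF h qh e] by blast
  define k where "k = (if q (h * v - sc (q h) * v) \<le> e * q v then h else - h)"
  have "spec_le k m" using assms by (simp add: k_def)
  then obtain t0 where t0: "\<forall>t\<ge>t0. q (sc (complex_of_real t) + k) \<le> t + m + e" using e unfolding spec_le_def by blast
  define t where "t = max t0 0"
  have kv: "q (k * v - sc (q h) * v) \<le> e * q v"
  proof -
    have "- h * v - sc (q h) * v = - (h * v + sc (q h) * v)" by simp
    then have "q (- h * v - sc (q h) * v) = q (h * v + sc (q h) * v)" by (simp only: q_minus)
    then show ?thesis using v unfolding k_def by auto
  qed
  have "sc (complex_of_real (t + q h)) * v = (sc t + k) * v - (k * v - sc (q h) * v)"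
    by (simp add: sc_add algebra_simps)
  then have "\<bar>t + q h\<bar> * q v \<le> q ((sc t + k) * v) + q (k * v - sc (q h) * v)"
    by (metis (no_types) norm_of_real q_diff q_sc)
  also have "\<dots> \<le> (t + m + e) * q v + e * q v"
  proof -
    have "q ((sc t + k) * v) \<le> q (sc t + k) * q v" by (rule q_mult)
    also have "\<dots> \<le> (t + m + e) * q v" using t0 v by (intro mult_right_mono) (auto simp: t_def)
    finally show ?thesis using kv by simp
  qed
  finally have "\<bar>t + q h\<bar> * q v \<le> (t + m + 2 * e) * q v" by (simp add: algebra_simps)
  then have "\<bar>t + q h\<bar> \<le> t + m + 2 * e" using v by simp
  moreover have "\<bar>t + q h\<bar> = t + q h" using qh by (simp add: t_def)
  ultimately show False using e unfolding e_def by argo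
qed

text \<open>By \<open>Im_bound\<close>, both factors of \<open>p\<^sup>2 + l = (p - i\<surd>l) (p + i\<surd>l)\<close> are bounded below, so \<open>-p\<^sup>2\<close> has no
  approximate eigenvalue \<open>l > 0\<close>.\<close>
lemma square_pos: assumes p: "st p = p" shows "spec_le (- (p * p)) 0"
proof (rule ccontr)
  assume "\<not> spec_le (- (p * p)) 0"
  moreover have "st (- (p * p)) = - (p * p)" by (simp add: st_minus st_mult p)
  ultimately obtain l where l: "l > 0" and
    ev: "\<And>e. e > 0 \<Longrightarrow> \<exists>v. q v > 0 \<and> q (- (p * p) * v - sc (complex_of_real l) * v) \<le> e * q v"
    using not_spec_le_eigenvalue by blast
  obtain v where v: "q v > 0" "q (- (p * p) * v - sc (complex_of_real l) * v) \<le> l / 2 * q v"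
    using ev[of "l/2"] l by auto
  define z where "z = Complex 0 (sqrt l)"
  have zz: "z * z = - complex_of_real l" using l by (simp add: z_def complex_eq_iff)
  have "(sc z - p) * ((sc (- z) - p) * v) = p * p * v - sc (z * z) * v"
    by (simp add: sc_minus sc_mult algebra_simps sc_left_comm[of p] sc_comm[of p])
  also have "\<dots> = - (- (p * p) * v - sc (complex_of_real l) * v)" by (simp add: zz sc_minus)
  finally have eq: "q ((sc z - p) * ((sc (- z) - p) * v)) = q (- (p * p) * v - sc (complex_of_real l) * v)"
    by (simp only: q_minus)
  have "sqrt l * q v \<le> q ((sc (- z) - p) * v)"
    using Im_bound[OF p, of "- z" v] l by (simp add: z_def)
  then have "sqrt l * (sqrt l * q v) \<le> sqrt l * q ((sc (- z) - p) * v)"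
    using l by (intro mult_left_mono) auto
  also have "\<dots> \<le> q ((sc z - p) * ((sc (- z) - p) * v))"
    using Im_bound[OF p, of z] l by (simp add: z_def)
  finally have "sqrt l * (sqrt l * q v) \<le> l / 2 * q v" using v(2) eq by linarith
  moreover have "sqrt l * (sqrt l * q v) = l * q v" using l by (simp add: mult.assoc[symmetric])
  ultimately have "l * q v \<le> 0" by simp
  then show False using l v(1) by (simp add: mult_le_0_iff)
qed

text \<open>If \<open>v\<close> is an approximate eigenvector of \<open>y y*\<close> for \<open>l > 0\<close>, then \<open>y* v\<close> is one of \<open>y* y\<close>.\<close>
lemma spec_le_swap:
  assumes c: "c \<ge> 0" and "spec_le (st y * y) c"
  shows "spec_le (y * st y) c"
proof (rule ccontr)
  assume n: "\<not> spec_le (y * st y) c"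
  have "st (y * st y) = y * st y" by (simp add: st_mult st_st)
  then obtain l where l: "l > c" and
    ev: "\<And>e. e > 0 \<Longrightarrow> \<exists>v. q v > 0 \<and> q (y * st y * v - sc (complex_of_real l) * v) \<le> e * q v"
    using not_spec_le_eigenvalue n by blast
  have "\<not> spec_le (st y * y) c"
  proof (rule eigenvalue_not_spec_le[OF l])
    fix e :: real assume e: "e > 0"
    define C where "C = q y + 1"
    have C: "C > 0" "q y \<le> C" using q_ge0[of y] by (auto simp: C_def)
    \<comment> \<open>The first bound keeps \<open>w = y* v\<close> away from 0, the second makes its eigenvalue error at most \<open>e * q w\<close>.\<close>
    define e' where "e' = min (l / 2) (e * l / (2 * C * C))"
    have l0: "l > 0" using l c by simp
    have e': "e' > 0" "e' \<le> l / 2" "e' \<le> e * l / (2 * C * C)" using e l0 C by (auto simp: e'_def)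
    obtain v where v: "q v > 0" "q (y * st y * v - sc (complex_of_real l) * v) \<le> e' * q v"
      using ev[OF e'(1)] by blast
    define w where "w = st y * v"
    have yw: "y * st y * v = y * w" by (simp add: w_def mult.assoc)
    have "l * q v \<le> q (y * w) + e' * q v"
    proof -
      have "sc (complex_of_real l) * v = y * w - (y * w - sc (complex_of_real l) * v)" by simp
      then have "q (sc (complex_of_real l) * v) \<le> q (y * w) + q (y * w - sc (complex_of_real l) * v)" by (metis q_diff)
      then show ?thesis using v l0 yw by (simp add: q_sc)
    qed
    also have "\<dots> \<le> C * q w + l / 2 * q v"
      using q_mult[of y w] C(2) q_ge0[of w] e'(2) v(1)
      by (intro add_mono mult_right_mono) (auto intro: order_trans mult_right_mono)
    finally have w: "l / 2 * q v \<le> C * q w" by (simp add: algebra_simps)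
    have "q w > 0"
    proof -
      have "0 < l / 2 * q v" using l0 v by simp
      then have "0 < C * q w" using w by simp
      then show ?thesis using C by (simp add: zero_less_mult_iff)
    qed
    moreover have "q (st y * y * w - sc (complex_of_real l) * w) \<le> e * q w"
    proof -
      have "st y * y * w - sc (complex_of_real l) * w = st y * (y * st y * v - sc (complex_of_real l) * v)"
        by (simp add: w_def algebra_simps sc_left_comm)
      then have "q (st y * y * w - sc (complex_of_real l) * w) \<le> q (st y) * q (y * st y * v - sc (complex_of_real l) * v)"
        by (metis q_mult)
      also have "\<dots> \<le> C * (e' * q v)" using C v q_ge0 by (intro mult_mono) (auto simp: q_st)
      also have "\<dots> \<le> C * (e * l / (2 * C * C) * q v)"
        using C e' v by (intro mult_left_mono mult_right_mono) auto
      also have "\<dots> = e / C * (l / 2 * q v)" using C by (simp add: field_simps)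
      also have "\<dots> \<le> e / C * (C * q w)" using w e C by (intro mult_left_mono) auto
      also have "\<dots> = e * q w" using C by simp
      finally show ?thesis .
    qed
    ultimately show "\<exists>v. q v > 0 \<and> q (st y * y * v - sc (complex_of_real l) * v) \<le> e * q v" by blast
  qed
  then show False using assms(2) by blast
qed

text \<open>If \<open>p\<close> and \<open>r\<close> are the real and imaginary parts of \<open>y\<close>, then \<open>y y* + y* y = 2 (p\<^sup>2 + r\<^sup>2)\<close>.\<close>
lemma sym_square_pos: "spec_le (- (y * st y + st y * y)) 0"
proof -
  define p where "p = sc (1/2) * (y + st y)"
  define r where "r = sc (- \<i>/2) * (y - st y)"
  have p: "st p = p" by (simp add: p_def st_mult st_sc st_add st_st add.commute sc_comm[of "y + st y"])
  have r: "st r = r"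
  proof -
    have "st r = sc (\<i>/2) * (st y - y)"
      by (simp add: r_def st_mult st_sc st_diff st_st sc_comm[of "st y - y"])
    also have "\<dots> = r" by (simp add: r_def sc_minus algebra_simps)
    finally show ?thesis .
  qed
  have "p * p = sc (1/4) * ((y + st y) * (y + st y))"
  proof -
    have "p * p = sc (1/2) * sc (1/2) * ((y + st y) * (y + st y))"
      unfolding p_def by (metis (no_types) mult.assoc sc_left_comm)
    also have "sc (1/2) * sc (1/2) = sc (1/4)" by (simp add: sc_mult[symmetric])
    finally show ?thesis .
  qed
  moreover have "r * r = sc (- 1/4) * ((y - st y) * (y - st y))"
  proof -
    have "r * r = sc (- \<i>/2) * sc (- \<i>/2) * ((y - st y) * (y - st y))"
      unfolding r_def by (metis (no_types) mult.assoc sc_left_comm)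
    also have "sc (- \<i>/2) * sc (- \<i>/2) = sc (-1/4)" by (simp add: sc_mult[symmetric])
    finally show ?thesis .
  qed
  ultimately have pr: "p * p + r * r = sc (1/4) * (2 * (y * st y) + 2 * (st y * y))"
    by (simp add: sc_minus algebra_simps mult_2)
  have s2: "sc (1/4) * 2 = sc (1/2)"
  proof -
    have "sc (1/4) * 2 = sc (1/4) + sc (1/4)" by (simp only: mult_2_right)
    then show ?thesis by (simp only: sc_add[symmetric]) simp
  qed
  have pr': "p * p + r * r = sc (1/2) * (y * st y + st y * y)"
    unfolding pr by (simp add: distrib_left mult.assoc[symmetric] s2)
  have "spec_le (- (p * p) + - (r * r)) (0 + 0)" by (intro spec_le_add square_pos p r)
  from spec_le_scale[OF this, of 2] have "spec_le (sc 2 * (- (p * p + r * r))) 0" by simp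
  moreover have "sc 2 * sc (1/2) = 1" by (simp add: sc_mult[symmetric] sc_1)
  ultimately show ?thesis unfolding pr' by (simp add: mult.assoc[symmetric])
qed

text \<open>Suppose that \<open>x* x\<close> has an approximate eigenvalue \<open>-l < 0\<close> with eigenvector \<open>v\<close>, and put \<open>y = x v\<close>.
  Since \<open>v\<close> commutes with \<open>x* x\<close>, the product \<open>y* y\<close> is close to \<open>-l v* v\<close>, and \<open>v\<close> being normal, this
  is bounded above by almost 0. Hence \<open>y y*\<close> is bounded above by almost 0 (\<open>spec_le_swap\<close>), and so is
  \<open>-y y* = -(y y* + y* y) + y* y\<close>. Thus \<open>y\<close> is small, whereas \<open>\<parallel>y\<parallel>\<^sup>2\<close> is close to \<open>l \<parallel>v\<parallel>\<^sup>2\<close>.\<close>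
lemma star_square_pos: "spec_le (- (st x * x)) 0"
proof (rule ccontr)
  define h where "h = st x * x"
  assume "\<not> spec_le (- (st x * x)) 0"
  moreover have sth: "st h = h" "st (- h) = - h" by (auto simp: h_def st_mult st_st st_minus)
  moreover have "bicomm (- h) = bicomm h" by (rule bicomm_cong) simp
  ultimately obtain l where l: "l > 0" and
    ev: "\<And>e. e > 0 \<Longrightarrow> \<exists>v\<in>bicomm h. q v > 0 \<and> q (- h * v - sc (complex_of_real l) * v) \<le> e * q v"
    using not_spec_le_eigenvalue[of "- h" 0] by (auto simp: h_def)
  obtain v where vh: "v \<in> bicomm h" and v: "q v > 0" "q (- h * v - sc (complex_of_real l) * v) \<le> l / 3 * q v"
    using ev[of "l/3"] l by auto
  define c where "c = l / 3 * (q v)\<^sup>2"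
  have c: "c \<ge> 0" using l by (simp add: c_def)
  define w where "w = st v * v"
  have w: "v * st v = w" unfolding w_def
    by (rule bicomm_commute[OF vh bicomm_st[OF sth(1) vh]])
  define y where "y = x * v"
  define E where "E = st y * y + sc (complex_of_real l) * w"
  have "E = - (st v * (- h * v - sc (complex_of_real l) * v))"
    by (simp add: E_def y_def w_def h_def st_mult algebra_simps sc_left_comm)
  then have "q E \<le> q (st v) * q (- h * v - sc (complex_of_real l) * v)" by (metis q_minus q_mult)
  also have "\<dots> \<le> q v * (l / 3 * q v)" using v by (intro mult_mono) (auto simp: q_st q_ge0)
  finally have E: "q E \<le> c" by (simp add: c_def power2_eq_square mult.left_commute)
  have "spec_le (sc (complex_of_real (l / 2)) * (- (w + w))) (l / 2 * 0)"
    using sym_square_pos[of v] l by (intro spec_le_scale) (auto simp: w w_def)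
  moreover have "sc (complex_of_real (l / 2)) * (- (w + w)) = - (sc (complex_of_real l) * w)"
  proof -
    have "sc (complex_of_real (l / 2)) + sc (complex_of_real (l / 2)) = sc (complex_of_real l)"
      by (simp only: sc_add[symmetric] of_real_add[symmetric]) simp
    then show ?thesis by (metis distrib_left distrib_right mult_minus_right)
  qed
  ultimately have "spec_le (- (sc (complex_of_real l) * w)) 0" by simp
  then have "spec_le (- (sc (complex_of_real l) * w) + E) (0 + q E)" by (intro spec_le_add spec_le_norm)
  then have yy: "spec_le (st y * y) c" using E by (auto simp: E_def intro: spec_le_mono)
  then have "spec_le (- (y * st y + st y * y) + st y * y) (0 + c)" by (intro spec_le_add sym_square_pos)
  then have m: "spec_le (- (y * st y)) c" by simp
  have "q (y * st y) \<le> c"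
    by (rule norm_le_bounds[OF _ spec_le_swap[OF c yy] m c]) (simp add: st_mult st_st)
  then have "q (st y * y) \<le> c" by (simp add: q_cstar q_cstar')
  moreover have "l * (q v)\<^sup>2 = q (sc (complex_of_real l) * w)" using l by (simp add: q_sc w_def q_cstar)
  moreover have "q (sc (complex_of_real l) * w) \<le> q E + q (st y * y)"
    using q_diff[of E "st y * y"] by (simp add: E_def)
  ultimately have "l * (q v)\<^sup>2 \<le> 2 * c" using E by simp
  then have "l * (q v)\<^sup>2 \<le> 0" by (simp add: c_def)
  then show False using l v(1) by (simp add: mult_le_0_iff)
qed

text \<open>From \<open>(x - k x)* (x - k x) \<ge> 0\<close> one gets \<open>2 x* k x \<le> x* x + x* k\<^sup>2 x\<close>. By iteration, the excess of
  \<open>x* k x\<close> over \<open>x* x\<close> is at most \<open>2 ^ -n\<close> times the excess of \<open>x* k ^ (2 ^ n) x\<close>, which stays bounded.\<close>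
lemma conj_bound_1:
  assumes k: "st k = k" "q k \<le> 1"
  shows "spec_le (st x * (k * x) - st x * x) 0"
proof (rule spec_le_closed)
  fix e :: real assume e: "e > 0"
  define g where "g n = st x * (k ^ (2 ^ n) * x) - st x * x" for n :: nat
  have bound: "q (g n) \<le> 2 * (q x)\<^sup>2" for n
  proof -
    have "q (st x * (k ^ (2 ^ n) * x)) \<le> q (st x) * (q (k ^ (2 ^ n)) * q x)"
      by (intro order_trans[OF q_mult] mult_left_mono q_mult q_ge0)
    also have "\<dots> \<le> q x * (1 * q x)"
      using k q_ge0 by (intro mult_mono) (auto simp: q_st q_power_selfadjoint power_le_one)
    finally show ?thesis using q_diff[of "st x * (k ^ (2 ^ n) * x)" "st x * x"]
      by (simp add: g_def q_cstar power2_eq_square)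
  qed
  have step: "spec_le (g n) (c / 2)" if "spec_le (g (Suc n)) c" for n c
  proof -
    define p where "p = k ^ (2 ^ n)"
    have p: "st p = p" by (simp add: p_def st_power k)
    have p2: "k ^ (2 ^ Suc n) = p * p" by (simp add: p_def power_add[symmetric] mult_2)
    have "g (Suc n) + - (st (x - p * x) * (x - p * x)) = g n + g n"
      unfolding g_def p2 by (simp add: p_def[symmetric] st_diff st_mult p algebra_simps)
    moreover have "spec_le (g (Suc n) + - (st (x - p * x) * (x - p * x))) (c + 0)"
      by (intro spec_le_add that star_square_pos)
    ultimately have "spec_le (g n + g n) c" by simp
    from spec_le_scale[OF this, of "1/2"] have "spec_le (sc (complex_of_real (1/2)) * (g n + g n)) (c / 2)" by simp
    moreover have "sc (complex_of_real (1/2)) * (g n + g n) = g n"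
    proof -
      have "sc (complex_of_real (1/2)) + sc (complex_of_real (1/2)) = 1"
        by (simp only: sc_add[symmetric] of_real_add[symmetric]) (simp add: sc_1)
      then show ?thesis by (metis distrib_left distrib_right mult_1)
    qed
    ultimately show ?thesis by simp
  qed
  have "spec_le (g n) (2 * (q x)\<^sup>2) \<and> spec_le (g 0) (2 * (q x)\<^sup>2 / 2 ^ n)" for n
  proof -
    have "spec_le (g n) c \<Longrightarrow> spec_le (g 0) (c / 2 ^ n)" for c
    proof (induction n arbitrary: c)
      case (Suc n)
      from Suc.IH[OF step[OF Suc.prems]] show ?case by (simp add: field_simps)
    qed simp
    moreover have "spec_le (g n) (2 * (q x)\<^sup>2)" by (rule spec_le_mono[OF spec_le_norm bound])
    ultimately show ?thesis by blast
  qed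
  moreover obtain n where "2 * (q x)\<^sup>2 / e < 2 ^ n" using real_arch_pow[of 2 "2 * (q x)\<^sup>2 / e"] by auto
  then have "2 * (q x)\<^sup>2 / 2 ^ n \<le> e" using e by (simp add: field_simps)
  ultimately have "spec_le (g 0) e" using spec_le_mono by blast
  then show "spec_le (st x * (k * x) - st x * x) (0 + e)" by (simp add: g_def)
qed

lemma conj_bound:
  assumes k: "st k = k" "q k \<le> m" and m: "m > 0"
  shows "spec_le (st x * (k * x) - sc (complex_of_real m) * (st x * x)) 0"
proof -
  define k' where "k' = sc (complex_of_real (1 / m)) * k"
  have kk: "k = sc (complex_of_real m) * k'"
    using m by (simp add: k'_def mult.assoc[symmetric] sc_mult[symmetric] sc_1)
  have "st k' = k'" by (simp add: k'_def st_mult st_sc k sc_comm[of k])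
  moreover have "q k' \<le> 1" using m k by (simp add: k'_def q_sc norm_divide)
  ultimately have "spec_le (st x * (k' * x) - st x * x) 0" by (rule conj_bound_1)
  from spec_le_scale[OF this m] show ?thesis by (simp add: kk mult.assoc sc_left_comm right_diff_distrib)
qed

text \<open>Let \<open>S u = \<Sum> u\<^sub>i* u\<^sub>i\<close>, \<open>z = \<Sum> y\<^sub>i* x\<^sub>i\<close> and \<open>m\<close> slightly larger than \<open>\<parallel>S y\<parallel>\<close>. Expanding
  \<open>S (x - y z / m) \<ge> 0\<close> and using \<open>z* (S y) z \<le> m z* z\<close> (\<open>conj_bound\<close>) leaves \<open>z* z / m \<le> S x\<close>.\<close>
theorem cauchy_schwarz:
  assumes I: "finite I"
  shows "(q (\<Sum>i\<in>I. st (y i) * x i))\<^sup>2 \<le> q (\<Sum>i\<in>I. st (x i) * x i) * q (\<Sum>i\<in>I. st (y i) * y i)"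
proof -
  define S where "S u = (\<Sum>i\<in>I. st (u i) * u i)" for u
  define z where "z = (\<Sum>i\<in>I. st (y i) * x i)"
  have stz: "st z = (\<Sum>i\<in>I. st (x i) * y i)" by (simp add: z_def st_sum st_mult st_st)
  have stS: "st (S u) = S u" for u by (simp add: S_def st_sum st_mult st_st)
  have posS: "spec_le (- S u) 0" for u
    unfolding S_def using spec_le_sum[OF I, of "\<lambda>i. - (st (u i) * u i)"] star_square_pos by (simp add: sum_negf)
  have main: "(q z)\<^sup>2 \<le> m * q (S x)" if m: "m > 0" "q (S y) \<le> m" for m
  proof -
    define r where "r = sc (complex_of_real (1 / m))"
    have rm: "r * sc (complex_of_real m) = 1" "sc (complex_of_real m) * r = 1"
      using m by (auto simp: r_def sc_mult[symmetric] sc_1)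
    have rc: "u * r = r * u" "u * (r * v) = r * (u * v)" for u v by (auto simp: r_def sc_comm sc_left_comm)
    have str: "st r = r" by (simp add: r_def st_sc)
    have pos: "spec_le (r * u) 0" if "spec_le u 0" for u
      using spec_le_scale[OF that, of "1 / m"] m unfolding r_def by simp
    have "S (\<lambda>i. x i - r * (y i * z)) = S x - r * (st z * z) - r * (st z * z) + r * (r * (st z * (S y * z)))"
    proof -
      have "S (\<lambda>i. x i - r * (y i * z)) = (\<Sum>i\<in>I. st (x i) * x i - r * ((st (x i) * y i) * z)
          - r * (st z * (st (y i) * x i)) + r * (r * (st z * ((st (y i) * y i) * z))))"
        unfolding S_def
      proof (rule sum.cong[OF refl])
        fix i assume "i \<in> I"
        have st_eq: "st (x i - r * (y i * z)) = st (x i) - r * (st z * st (y i))"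
          by (simp add: st_diff st_mult str mult.assoc) (simp add: rc(1) mult.assoc rc(2)[of "st z"])
        show "st (x i - r * (y i * z)) * (x i - r * (y i * z)) = st (x i) * x i - r * ((st (x i) * y i) * z)
          - r * (st z * (st (y i) * x i)) + r * (r * (st z * ((st (y i) * y i) * z)))"
          unfolding st_eq by (simp add: algebra_simps rc(2)[of "st (x i)"] rc(2)[of "st (y i)"] rc(2)[of "st z"])
      qed
      also have "\<dots> = S x - r * (st z * z) - r * (st z * z) + r * (r * (st z * (S y * z)))"
      proof -
        have "(\<Sum>i\<in>I. r * ((st (x i) * y i) * z)) = r * (st z * z)"
          by (simp only: stz sum_distrib_left sum_distrib_right)
        moreover have "(\<Sum>i\<in>I. r * (st z * (st (y i) * x i))) = r * (st z * (\<Sum>i\<in>I. st (y i) * x i))"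
          by (simp only: sum_distrib_left)
        moreover have "(\<Sum>i\<in>I. r * (r * (st z * ((st (y i) * y i) * z)))) = r * (r * (st z * (S y * z)))"
          by (simp only: S_def sum_distrib_left sum_distrib_right)
        ultimately show ?thesis
          by (simp add: sum.distrib sum_subtractf S_def[symmetric] z_def[symmetric])
      qed
      finally show ?thesis .
    qed
    moreover have "r * (r * (sc (complex_of_real m) * u)) = r * u" for u
    proof -
      have "r * (r * (sc (complex_of_real m) * u)) = r * (r * sc (complex_of_real m) * u)" by (simp only: mult.assoc)
      then show ?thesis by (simp add: rm)
    qed
    ultimately have eq: "- S (\<lambda>i. x i - r * (y i * z)) + r * (r * (st z * (S y * z) - sc (complex_of_real m) * (st z * z))) + S x
        = r * (st z * z)"
      by (simp add: right_diff_distrib)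
    have "spec_le (st z * (S y * z) - sc (complex_of_real m) * (st z * z)) 0"
      by (rule conj_bound[OF stS m(2,1)])
    then have "spec_le (r * (r * (st z * (S y * z) - sc (complex_of_real m) * (st z * z)))) 0"
      by (intro pos)
    then have "spec_le (- S (\<lambda>i. x i - r * (y i * z)) + r * (r * (st z * (S y * z) - sc (complex_of_real m) * (st z * z))) + S x) (0 + 0 + q (S x))"
      by (intro spec_le_add posS spec_le_norm)
    then have "spec_le (r * (st z * z)) (q (S x))" unfolding eq by simp
    from spec_le_scale[OF this m(1)] have A: "spec_le (st z * z) (m * q (S x))"
      by (simp add: mult.assoc[symmetric] rm)
    have "spec_le (- (st z * z)) (m * q (S x))"
      by (rule spec_le_mono[OF star_square_pos]) (use m q_ge0 in auto)
    then have "q (st z * z) \<le> m * q (S x)"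
      using A m q_ge0 by (intro norm_le_bounds) (auto simp: st_mult st_st)
    then show ?thesis by (simp add: q_cstar)
  qed
  have "(q z)\<^sup>2 \<le> q (S y) * q (S x)"
  proof (rule field_le_epsilon)
    fix e :: real assume e: "e > 0"
    define d where "d = e / (q (S x) + 1)"
    have d: "d > 0" "d * q (S x) \<le> e" using e q_ge0[of "S x"] by (auto simp: d_def field_simps add_pos_nonneg)
    have "(q z)\<^sup>2 \<le> (q (S y) + d) * q (S x)" using d q_ge0[of "S y"] by (intro main) auto
    also have "\<dots> \<le> q (S y) * q (S x) + e" using d by (simp add: algebra_simps)
    finally show "(q z)\<^sup>2 \<le> q (S y) * q (S x) + e" .
  qed
  then show ?thesis by (simp add: z_def S_def mult.commute)
qed

end

section \<open>Algebras with a C*-norm\<close>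

lemma cring_complex_ring: "cring complex_ring"
proof -
  have "\<exists>y. x + y = 0 \<and> y + x = 0" for x :: complex by (intro exI[of _ "- x"]) simp
  then show ?thesis
  by (unfold_locales) (auto simp: complex_ring_def Units_def algebra_simps)
qed

lemma additive_finsum:
  assumes "abelian_group G" "abelian_group H" and h: "h \<in> carrier G \<rightarrow> carrier H"
    and add: "\<And>x y. x \<in> carrier G \<Longrightarrow> y \<in> carrier G \<Longrightarrow> h (x \<oplus>\<^bsub>G\<^esub> y) = h x \<oplus>\<^bsub>H\<^esub> h y"
    and f: "f \<in> I \<rightarrow> carrier G"
  shows "h (finsum G f I) = finsum H (\<lambda>i. h (f i)) I"
proof -
  interpret G: abelian_group G by fact
  interpret H: abelian_group H by fact
  have "h \<zero>\<^bsub>G\<^esub> \<oplus>\<^bsub>H\<^esub> h \<zero>\<^bsub>G\<^esub> = h \<zero>\<^bsub>G\<^esub> \<oplus>\<^bsub>H\<^esub> \<zero>\<^bsub>H\<^esub>"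
    using add[of "\<zero>\<^bsub>G\<^esub>" "\<zero>\<^bsub>G\<^esub>"] h by (simp add: Pi_iff)
  then have 0: "h \<zero>\<^bsub>G\<^esub> = \<zero>\<^bsub>H\<^esub>" using h by (auto simp: Pi_iff)
  show ?thesis
  proof (cases "finite I")
    case True
    then show ?thesis using f
    proof (induction I rule: finite_induct)
      case (insert i I)
      then have c: "f \<in> I \<rightarrow> carrier G" "f i \<in> carrier G" by auto
      then have "(\<lambda>i. h (f i)) \<in> I \<rightarrow> carrier H" "h (f i) \<in> carrier H" using h by auto
      with insert c show ?case by (simp add: add G.finsum_closed)
    qed (simp add: 0)
  qed (simp add: 0)
qed

text \<open>Completeness is left out, so that \<open>C\<^sub>c(\<Gamma>, A)\<close> with the reduced norm is an instance as well as its
  completion.\<close>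
locale pre_cstar = module complex_ring A for A :: "'a cstar" (structure) +
  assumes mult_closed: "\<lbrakk>x \<in> carrier A; y \<in> carrier A\<rbrakk> \<Longrightarrow> x \<otimes>\<^bsub>A\<^esub> y \<in> carrier A"
    and mult_assoc: "\<lbrakk>x \<in> carrier A; y \<in> carrier A; z \<in> carrier A\<rbrakk>
      \<Longrightarrow> (x \<otimes>\<^bsub>A\<^esub> y) \<otimes>\<^bsub>A\<^esub> z = x \<otimes>\<^bsub>A\<^esub> (y \<otimes>\<^bsub>A\<^esub> z)"
    and distrib_right: "\<lbrakk>x \<in> carrier A; y \<in> carrier A; z \<in> carrier A\<rbrakk>
      \<Longrightarrow> (x \<oplus>\<^bsub>A\<^esub> y) \<otimes>\<^bsub>A\<^esub> z = x \<otimes>\<^bsub>A\<^esub> z \<oplus>\<^bsub>A\<^esub> y \<otimes>\<^bsub>A\<^esub> z"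
    and distrib_left: "\<lbrakk>x \<in> carrier A; y \<in> carrier A; z \<in> carrier A\<rbrakk>
      \<Longrightarrow> z \<otimes>\<^bsub>A\<^esub> (x \<oplus>\<^bsub>A\<^esub> y) = z \<otimes>\<^bsub>A\<^esub> x \<oplus>\<^bsub>A\<^esub> z \<otimes>\<^bsub>A\<^esub> y"
    and smult_mult_left: "\<lbrakk>x \<in> carrier A; y \<in> carrier A\<rbrakk>
      \<Longrightarrow> (c \<odot>\<^bsub>A\<^esub> x) \<otimes>\<^bsub>A\<^esub> y = c \<odot>\<^bsub>A\<^esub> (x \<otimes>\<^bsub>A\<^esub> y)"
    and smult_mult_right: "\<lbrakk>x \<in> carrier A; y \<in> carrier A\<rbrakk>
      \<Longrightarrow> x \<otimes>\<^bsub>A\<^esub> (c \<odot>\<^bsub>A\<^esub> y) = c \<odot>\<^bsub>A\<^esub> (x \<otimes>\<^bsub>A\<^esub> y)"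
    and star_closed: "x \<in> carrier A \<Longrightarrow> star A x \<in> carrier A"
    and star_star: "x \<in> carrier A \<Longrightarrow> star A (star A x) = x"
    and star_add: "\<lbrakk>x \<in> carrier A; y \<in> carrier A\<rbrakk>
      \<Longrightarrow> star A (x \<oplus>\<^bsub>A\<^esub> y) = star A x \<oplus>\<^bsub>A\<^esub> star A y"
    and star_smult: "x \<in> carrier A \<Longrightarrow> star A (c \<odot>\<^bsub>A\<^esub> x) = cnj c \<odot>\<^bsub>A\<^esub> star A x"
    and star_mult: "\<lbrakk>x \<in> carrier A; y \<in> carrier A\<rbrakk>
      \<Longrightarrow> star A (x \<otimes>\<^bsub>A\<^esub> y) = star A y \<otimes>\<^bsub>A\<^esub> star A x"
    and nrm_eq_0: "x \<in> carrier A \<Longrightarrow> nrm A x = 0 \<longleftrightarrow> x = \<zero>\<^bsub>A\<^esub>"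
    and nrm_triangle: "\<lbrakk>x \<in> carrier A; y \<in> carrier A\<rbrakk>
      \<Longrightarrow> nrm A (x \<oplus>\<^bsub>A\<^esub> y) \<le> nrm A x + nrm A y"
    and nrm_smult: "x \<in> carrier A \<Longrightarrow> nrm A (c \<odot>\<^bsub>A\<^esub> x) = cmod c * nrm A x"
    and nrm_mult: "\<lbrakk>x \<in> carrier A; y \<in> carrier A\<rbrakk>
      \<Longrightarrow> nrm A (x \<otimes>\<^bsub>A\<^esub> y) \<le> nrm A x * nrm A y"
    and cstar_identity: "x \<in> carrier A \<Longrightarrow> nrm A (star A x \<otimes>\<^bsub>A\<^esub> x) = (nrm A x)\<^sup>2"

sublocale cstar_algebra \<subseteq> pre_cstar
  by unfold_locales (rule mult_closed mult_assoc distrib_right distrib_left smult_mult_left smult_mult_right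
      star_closed star_star star_add star_smult star_mult nrm_eq_0 nrm_triangle nrm_smult nrm_mult cstar_identity; assumption)+

context pre_cstar
begin

lemma abelian_group_A: "abelian_group A" by unfold_locales

lemma sm_closed: "x \<in> carrier A \<Longrightarrow> c \<odot> x \<in> carrier A"
  by (rule smult_closed) (auto simp: complex_ring_def)
lemma sm_add: "x \<in> carrier A \<Longrightarrow> (c + d) \<odot> x = c \<odot> x \<oplus> d \<odot> x"
  using smult_l_distr[of c d x] by (simp add: complex_ring_def)
lemma sm_radd: "x \<in> carrier A \<Longrightarrow> y \<in> carrier A \<Longrightarrow> c \<odot> (x \<oplus> y) = c \<odot> x \<oplus> c \<odot> y"
  using smult_r_distr[of c x y] by (simp add: complex_ring_def)
lemma sm_assoc: "x \<in> carrier A \<Longrightarrow> (c * d) \<odot> x = c \<odot> (d \<odot> x)"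
  using smult_assoc1[of c d x] by (simp add: complex_ring_def)
lemma sm_one: "x \<in> carrier A \<Longrightarrow> 1 \<odot> x = x"
  using smult_one[of x] by (simp add: complex_ring_def)
lemma sm_0: "x \<in> carrier A \<Longrightarrow> 0 \<odot> x = \<zero>"
  using sm_add[of x 0 0] sm_closed[of x 0] by (metis add_0 M.add.l_cancel_one' )
lemma sm_zero: "c \<odot> \<zero> = \<zero>"
  using sm_radd[of \<zero> \<zero> c] sm_closed[of \<zero> c] by (metis M.add.l_cancel_one' M.l_zero M.zero_closed)
lemma sm_minus1: "x \<in> carrier A \<Longrightarrow> (-1) \<odot> x = \<ominus> x"
  using sm_add[of x "-1" 1] sm_0[of x] sm_one[of x] sm_closed[of x "-1"]
  by (metis M.minus_equality add.commute add.right_inverse)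
lemma sm_minus: "x \<in> carrier A \<Longrightarrow> c \<odot> (\<ominus> x) = \<ominus> (c \<odot> x)"
  by (simp add: sm_minus1[symmetric] sm_closed sm_assoc[symmetric] mult.commute)
lemma mult_zero_left: "x \<in> carrier A \<Longrightarrow> \<zero> \<otimes> x = \<zero>"
  using smult_mult_left[of \<zero> x 0] mult_closed[of \<zero> x] by (simp add: sm_0)
lemma mult_zero_right: "x \<in> carrier A \<Longrightarrow> x \<otimes> \<zero> = \<zero>"
  using smult_mult_right[of x \<zero> 0] mult_closed[of x \<zero>] by (simp add: sm_0)
lemma mult_minus_left: "x \<in> carrier A \<Longrightarrow> y \<in> carrier A \<Longrightarrow> (\<ominus> x) \<otimes> y = \<ominus> (x \<otimes> y)"
  by (simp add: sm_minus1[symmetric] smult_mult_left mult_closed)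
lemma mult_minus_right: "x \<in> carrier A \<Longrightarrow> y \<in> carrier A \<Longrightarrow> x \<otimes> (\<ominus> y) = \<ominus> (x \<otimes> y)"
  by (simp add: sm_minus1[symmetric] smult_mult_right mult_closed)
lemma star_zero: "star A \<zero> = \<zero>"
  using star_smult[of \<zero> 0] star_closed[of \<zero>] by (simp add: sm_0)
lemma star_minus: "x \<in> carrier A \<Longrightarrow> star A (\<ominus> x) = \<ominus> star A x"
  by (simp add: sm_minus1[symmetric] star_smult star_closed)
lemma nrm_zero: "nrm A \<zero> = 0" by (simp add: nrm_eq_0)
lemma nrm_minus: "x \<in> carrier A \<Longrightarrow> nrm A (\<ominus> x) = nrm A x"
  by (simp add: sm_minus1[symmetric] nrm_smult)
lemma nrm_ge0: "x \<in> carrier A \<Longrightarrow> 0 \<le> nrm A x"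
  using nrm_triangle[of x "\<ominus> x"] by (simp add: M.r_neg nrm_zero nrm_minus)
lemma nrm_diff: "x \<in> carrier A \<Longrightarrow> y \<in> carrier A \<Longrightarrow> nrm A (x \<ominus> y) \<le> nrm A x + nrm A y"
  using nrm_triangle[of x "\<ominus> y"] by (simp add: a_minus_def nrm_minus)
lemma nrm_diff_commute: "x \<in> carrier A \<Longrightarrow> y \<in> carrier A \<Longrightarrow> nrm A (x \<ominus> y) = nrm A (y \<ominus> x)"
  using nrm_minus[of "x \<ominus> y"] by (simp add: a_minus_def M.minus_add M.a_comm)
lemma nrm_diff_ge: "x \<in> carrier A \<Longrightarrow> y \<in> carrier A \<Longrightarrow> \<bar>nrm A x - nrm A y\<bar> \<le> nrm A (x \<ominus> y)"
proof -
  have *: "nrm A x \<le> nrm A (x \<ominus> y) + nrm A y" if "x \<in> carrier A" "y \<in> carrier A" for x y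
  proof -
    have "x = (x \<ominus> y) \<oplus> y" using that by (simp add: a_minus_def M.a_assoc M.l_neg)
    then show ?thesis using nrm_triangle[of "x \<ominus> y" y] that by simp
  qed
  assume "x \<in> carrier A" "y \<in> carrier A"
  with *[of x y] *[of y x] show ?thesis by (simp add: nrm_diff_commute[of y x])
qed
lemma nrm_diff_triangle:
  "x \<in> carrier A \<Longrightarrow> y \<in> carrier A \<Longrightarrow> z \<in> carrier A \<Longrightarrow> nrm A (x \<ominus> z) \<le> nrm A (x \<ominus> y) + nrm A (y \<ominus> z)"
proof -
  assume c: "x \<in> carrier A" "y \<in> carrier A" "z \<in> carrier A"
  have "x \<ominus> z = (x \<ominus> y) \<oplus> (y \<ominus> z)"
    using c by (simp add: a_minus_def M.a_ac M.r_neg1 M.r_neg2 M.r_neg M.l_neg)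
  then show ?thesis using nrm_triangle[of "x \<ominus> y" "y \<ominus> z"] c by simp
qed
lemma nrm_star: "x \<in> carrier A \<Longrightarrow> nrm A (star A x) = nrm A x"
proof -
  have *: "nrm A x \<le> nrm A (star A x)" if x: "x \<in> carrier A" for x
  proof (cases "nrm A x = 0")
    case True then show ?thesis using x by (simp add: nrm_ge0 star_closed)
  next
    case False
    have "nrm A x * nrm A x \<le> nrm A (star A x) * nrm A x"
      using cstar_identity[OF x] nrm_mult[OF star_closed[OF x] x] by (simp add: power2_eq_square)
    then show ?thesis using False nrm_ge0[OF x] by simp
  qed
  assume "x \<in> carrier A"
  with *[of x] *[of "star A x"] show ?thesis by (simp add: star_star star_closed)
qed
lemma cstar_identity': "x \<in> carrier A \<Longrightarrow> nrm A (x \<otimes> star A x) = (nrm A x)\<^sup>2"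
  using cstar_identity[of "star A x"] by (simp add: star_closed star_star nrm_star)

lemma mult_finsum: "x \<in> carrier A \<Longrightarrow> f \<in> I \<rightarrow> carrier A \<Longrightarrow> x \<otimes> finsum A f I = finsum A (\<lambda>i. x \<otimes> f i) I"
  by (rule additive_finsum[OF abelian_group_A abelian_group_A]) (auto intro: mult_closed distrib_left)
lemma finsum_mult: "x \<in> carrier A \<Longrightarrow> f \<in> I \<rightarrow> carrier A \<Longrightarrow> finsum A f I \<otimes> x = finsum A (\<lambda>i. f i \<otimes> x) I"
  by (rule additive_finsum[OF abelian_group_A abelian_group_A, of "\<lambda>y. y \<otimes> x"]) (auto intro: mult_closed distrib_right)
lemma sm_finsum: "f \<in> I \<rightarrow> carrier A \<Longrightarrow> c \<odot> finsum A f I = finsum A (\<lambda>i. c \<odot> f i) I"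
  by (rule additive_finsum[OF abelian_group_A abelian_group_A]) (auto intro: sm_closed sm_radd)
lemma star_finsum: "f \<in> I \<rightarrow> carrier A \<Longrightarrow> star A (finsum A f I) = finsum A (\<lambda>i. star A (f i)) I"
  by (rule additive_finsum[OF abelian_group_A abelian_group_A]) (auto intro: star_closed star_add)
lemma nrm_finsum: "f \<in> I \<rightarrow> carrier A \<Longrightarrow> nrm A (finsum A f I) \<le> (\<Sum>i\<in>I. nrm A (f i))"
proof (induction I rule: infinite_finite_induct)
  case (insert i I)
  then have c: "f \<in> I \<rightarrow> carrier A" "f i \<in> carrier A" by auto
  with insert nrm_triangle[of "f i" "finsum A f I"] show ?case by (simp add: M.finsum_closed)
qed (auto simp: nrm_zero M.add.finprod_infinite)

end

section \<open>The action of the free *-algebra\<close>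

text \<open>Words in the elements of an algebra act on it by left multiplication. Through this action the
  operator norm pulls back to a C*-seminorm on the free unital *-algebra over the carrier, which is a
  type of class \<open>ring_1\<close>, and the results on \<open>cstar_seminorm\<close> descend to the algebra.\<close>
datatype 'a word = Word (letters: "'a list")

instantiation word :: (type) monoid_add
begin
definition "0 = Word []"
definition "v + w = Word (letters v @ letters w)"
instance by intro_classes (auto simp: zero_word_def plus_word_def)
end

lemma poly_mapping_single_induct [case_names zero single]:
  fixes f :: "'k \<Rightarrow>\<^sub>0 'b::ab_group_add"
  assumes "P 0" "\<And>f k c. P f \<Longrightarrow> P (f + Poly_Mapping.single k c)"
  shows "P f"
proof (induction f rule: update_induct)
  case const show ?case by (rule assms(1))
next
  case (update f a b)
  have "Poly_Mapping.update a b f = f + Poly_Mapping.single a b"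
    using update(1) by (intro poly_mapping_eqI)
      (auto simp: lookup_update lookup_add lookup_single when_def in_keys_iff)
  then show ?case using assms(2) update by simp
qed

context pre_cstar
begin

definition letter :: "'a \<Rightarrow> 'a" where "letter a = (if a \<in> carrier A then a else \<zero>)"
text \<open>Outside the carrier the involution is the identity, which makes \<open>word_star\<close> an involution of the
  whole type.\<close>
definition letter_star :: "'a \<Rightarrow> 'a" where "letter_star a = (if a \<in> carrier A then star A a else a)"

definition word_star :: "'a word \<Rightarrow> 'a word" where
  "word_star w = Word (rev (map letter_star (letters w)))"

definition word_act :: "'a word \<Rightarrow> 'a \<Rightarrow> 'a" where
  "word_act w v = foldr (\<lambda>a u. letter a \<otimes> u) (letters w) v"

definition free_star :: "('a word \<Rightarrow>\<^sub>0 complex) \<Rightarrow> ('a word \<Rightarrow>\<^sub>0 complex)" where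
  "free_star f = Poly_Mapping.map_key word_star (Poly_Mapping.map cnj f)"

definition act :: "('a word \<Rightarrow>\<^sub>0 complex) \<Rightarrow> 'a \<Rightarrow> 'a" where
  "act f v = finsum A (\<lambda>w. Poly_Mapping.lookup f w \<odot> word_act w v) (Poly_Mapping.keys f)"

definition free_norm :: "('a word \<Rightarrow>\<^sub>0 complex) \<Rightarrow> real" where
  "free_norm f = (SUP v\<in>{v \<in> carrier A. nrm A v \<le> 1}. nrm A (act f v))"

definition gen :: "'a \<Rightarrow> ('a word \<Rightarrow>\<^sub>0 complex)" where
  "gen a = Poly_Mapping.single (Word [a]) 1"

lemma letter_closed: "letter a \<in> carrier A" by (simp add: letter_def)
lemma letter_star_letter: "letter (letter_star a) = star A (letter a)"
  by (simp add: letter_def letter_star_def star_closed star_zero)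
lemma word_star_star: "word_star (word_star w) = w"
proof -
  have "letter_star (letter_star a) = a" for a by (simp add: letter_star_def star_star star_closed)
  then show ?thesis by (simp add: word_star_def rev_map o_def)
qed
lemma inj_word_star: "inj word_star" by (metis injI word_star_star)
lemma word_star_add: "word_star (v + w) = word_star w + word_star v"
  by (simp add: word_star_def plus_word_def)
lemma word_act_closed: "v \<in> carrier A \<Longrightarrow> word_act w v \<in> carrier A"
proof -
  assume v: "v \<in> carrier A"
  have "foldr (\<lambda>a u. letter a \<otimes> u) xs v \<in> carrier A" for xs
    by (induction xs) (auto intro: v mult_closed letter_closed)
  then show ?thesis by (simp add: word_act_def)
qed
lemma word_act_plus: "word_act (w + w') v = word_act w (word_act w' v)"
  by (simp add: word_act_def plus_word_def)
lemma word_act_0: "word_act 0 v = v" by (simp add: word_act_def zero_word_def)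
lemma word_act_add: "u \<in> carrier A \<Longrightarrow> v \<in> carrier A \<Longrightarrow> word_act w (u \<oplus> v) = word_act w u \<oplus> word_act w v"
proof -
  assume c: "u \<in> carrier A" "v \<in> carrier A"
  have cl: "foldr (\<lambda>a u. letter a \<otimes> u) xs v \<in> carrier A" if "v \<in> carrier A" for xs v
    by (induction xs) (auto intro: that mult_closed letter_closed)
  have "foldr (\<lambda>a u. letter a \<otimes> u) xs (u \<oplus> v) = foldr (\<lambda>a u. letter a \<otimes> u) xs u \<oplus> foldr (\<lambda>a u. letter a \<otimes> u) xs v" for xs
    by (induction xs) (auto simp: c cl distrib_left letter_closed)
  then show ?thesis by (simp add: word_act_def)
qed
lemma word_act_smult: "v \<in> carrier A \<Longrightarrow> word_act w (c \<odot> v) = c \<odot> word_act w v"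
proof -
  assume c: "v \<in> carrier A"
  have cl: "foldr (\<lambda>a u. letter a \<otimes> u) xs v \<in> carrier A" for xs
    by (induction xs) (auto intro: c mult_closed letter_closed)
  have "foldr (\<lambda>a u. letter a \<otimes> u) xs (c \<odot> v) = c \<odot> foldr (\<lambda>a u. letter a \<otimes> u) xs v" for xs
    by (induction xs) (auto simp: c cl smult_mult_right letter_closed)
  then show ?thesis by (simp add: word_act_def)
qed
lemma word_act_zero: "word_act w \<zero> = \<zero>"
  using word_act_smult[of \<zero> w 0] word_act_closed[of \<zero> w] by (simp add: sm_0)
lemma word_act_adjoint:
  assumes c: "u \<in> carrier A" "v \<in> carrier A"
  shows "star A (word_act w v) \<otimes> u = star A v \<otimes> word_act (word_star w) u"
proof -
  have cl: "foldr (\<lambda>a u. letter a \<otimes> u) xs v \<in> carrier A" if "v \<in> carrier A" for xs v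
    by (induction xs) (auto intro: that mult_closed letter_closed)
  have "star A (foldr (\<lambda>a u. letter a \<otimes> u) xs v) \<otimes> u
      = star A v \<otimes> foldr (\<lambda>a u. letter a \<otimes> u) (rev (map letter_star xs)) u" if "u \<in> carrier A" for xs u
    using that
  proof (induction xs arbitrary: u)
    case (Cons a xs)
    let ?F = "foldr (\<lambda>a u. letter a \<otimes> u) xs v"
    have "star A (letter a \<otimes> ?F) \<otimes> u = star A ?F \<otimes> (star A (letter a) \<otimes> u)"
      using Cons.prems c by (subst star_mult) (auto simp: cl letter_closed mult_assoc star_closed)
    also have "\<dots> = star A v \<otimes> foldr (\<lambda>a u. letter a \<otimes> u) (rev (map letter_star xs)) (letter (letter_star a) \<otimes> u)"
      unfolding letter_star_letter using Cons by (intro Cons.IH mult_closed star_closed letter_closed)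
    finally show ?case by simp
  qed simp
  then show ?thesis using c by (simp add: word_act_def word_star_def)
qed

lemma act_closed: "v \<in> carrier A \<Longrightarrow> act f v \<in> carrier A"
  unfolding act_def by (intro M.finsum_closed) (auto intro: sm_closed word_act_closed)

lemma act_superset:
  assumes "v \<in> carrier A" "finite S" "Poly_Mapping.keys f \<subseteq> S"
  shows "act f v = finsum A (\<lambda>w. Poly_Mapping.lookup f w \<odot> word_act w v) S"
  unfolding act_def
  by (rule M.add.finprod_mono_neutral_cong_left)
    (use assms in \<open>auto simp: in_keys_iff sm_0 word_act_closed sm_closed\<close>)

lemma act_single: "v \<in> carrier A \<Longrightarrow> act (Poly_Mapping.single w c) v = c \<odot> word_act w v"
  by (subst act_superset[of v "{w}"]) (auto simp: sm_closed word_act_closed)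

lemma act_plus: "v \<in> carrier A \<Longrightarrow> act (f + g) v = act f v \<oplus> act g v"
proof -
  assume v: "v \<in> carrier A"
  let ?S = "Poly_Mapping.keys f \<union> Poly_Mapping.keys g"
  have "act (f + g) v = finsum A (\<lambda>w. Poly_Mapping.lookup f w \<odot> word_act w v \<oplus> Poly_Mapping.lookup g w \<odot> word_act w v) ?S"
    by (subst act_superset[of v ?S])
      (use v keys_add[of f g] in \<open>auto simp: lookup_add sm_add word_act_closed sm_closed intro!: M.finsum_cong'\<close>)
  also have "\<dots> = act f v \<oplus> act g v"
    using v by (subst (1 2) act_superset[of v ?S]) (auto intro!: M.finsum_addf sm_closed word_act_closed)
  finally show ?thesis .
qed

lemma act_0: "act 0 v = \<zero>" by (simp add: act_def)
lemma act_1: "v \<in> carrier A \<Longrightarrow> act 1 v = v"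
  using act_single[of v 0 1] by (simp add: word_act_0 sm_one)

lemma act_smult: "v \<in> carrier A \<Longrightarrow> act f (c \<odot> v) = c \<odot> act f v"
proof (induction f rule: poly_mapping_single_induct)
  case (single f w d)
  have "d \<odot> (c \<odot> word_act w v) = c \<odot> (d \<odot> word_act w v)"
    using single(2) by (simp add: sm_assoc[symmetric] word_act_closed mult.commute)
  with single show ?case by (simp add: act_plus act_single word_act_smult sm_radd word_act_closed sm_closed act_closed)
qed (simp add: act_0 sm_zero)

lemma act_mult: "v \<in> carrier A \<Longrightarrow> act (f * g) v = act f (act g v)"
proof (induction f rule: poly_mapping_single_induct)
  case zero show ?case by (simp add: act_0)
next
  case (single f w c)
  have "act (Poly_Mapping.single w c * g) v = act (Poly_Mapping.single w c) (act g v)"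
    using single(2)
  proof (induction g rule: poly_mapping_single_induct)
    case zero then show ?case by (simp add: act_0 act_single word_act_zero sm_zero)
  next
    case (single g w' d)
    then show ?case
      by (simp add: algebra_simps act_plus mult_single act_single word_act_plus word_act_smult word_act_add act_closed
          sm_closed word_act_closed sm_radd sm_assoc)
  qed
  with single show ?case by (simp add: algebra_simps act_plus act_closed)
qed

lemma free_star_add: "free_star (f + g) = free_star f + free_star g"
proof -
  have "Poly_Mapping.map cnj (f + g) = Poly_Mapping.map cnj f + Poly_Mapping.map cnj g"
    by (rule poly_mapping_eqI)
      (auto simp: Poly_Mapping.map.rep_eq lookup_add when_def complex_cnj_add[symmetric] simp del: complex_cnj_add)
  then show ?thesis by (simp add: free_star_def map_key_plus[OF inj_word_star])
qed
lemma free_star_single: "free_star (Poly_Mapping.single w c) = Poly_Mapping.single (word_star w) (cnj c)"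
proof -
  have "Poly_Mapping.map cnj (Poly_Mapping.single w c) = Poly_Mapping.single (word_star (word_star w)) (cnj c)"
    by (rule poly_mapping_eqI) (auto simp: Poly_Mapping.map.rep_eq lookup_single when_def word_star_star)
  then show ?thesis by (simp add: free_star_def map_key_single[OF inj_word_star])
qed
lemma free_star_0: "free_star 0 = 0" using free_star_add[of 0 0] by simp
lemma free_star_mult: "free_star (f * g) = free_star g * free_star f"
proof (induction f rule: poly_mapping_single_induct)
  case zero show ?case by (simp add: free_star_0)
next
  case (single f w c)
  have "free_star (Poly_Mapping.single w c * g) = free_star g * free_star (Poly_Mapping.single w c)"
    by (induction g rule: poly_mapping_single_induct)
      (simp_all add: free_star_0 algebra_simps free_star_add free_star_single mult_single word_star_add)
  with single show ?case by (simp add: algebra_simps free_star_add)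
qed
lemma free_star_star: "free_star (free_star f) = f"
  by (induction f rule: poly_mapping_single_induct)
    (simp_all add: free_star_0 free_star_add free_star_single word_star_star)

lemma act_adjoint: "u \<in> carrier A \<Longrightarrow> v \<in> carrier A \<Longrightarrow> star A (act f v) \<otimes> u = star A v \<otimes> act (free_star f) u"
  by (induction f rule: poly_mapping_single_induct)
    (simp_all add: act_0 free_star_0 star_zero mult_zero_left mult_zero_right star_closed free_star_add act_plus
      free_star_single act_single star_add star_smult sm_closed word_act_closed act_closed distrib_left distrib_right
      smult_mult_left smult_mult_right word_act_adjoint)

lemma act_bounded: "\<exists>C\<ge>0. \<forall>v\<in>carrier A. nrm A (act f v) \<le> C * nrm A v"
proof (induction f rule: poly_mapping_single_induct)
  case zero show ?case by (intro exI[of _ 0]) (auto simp: act_0 nrm_zero)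
next
  case (single f w c)
  have "\<exists>C\<ge>0. \<forall>v\<in>carrier A. nrm A (foldr (\<lambda>a u. letter a \<otimes> u) xs v) \<le> C * nrm A v" for xs
  proof (induction xs)
    case Nil show ?case by (intro exI[of _ 1]) auto
  next
    case (Cons a xs)
    then obtain C where C: "C \<ge> 0" "\<And>v. v \<in> carrier A \<Longrightarrow> nrm A (foldr (\<lambda>a u. letter a \<otimes> u) xs v) \<le> C * nrm A v" by auto
    have "nrm A (letter a \<otimes> foldr (\<lambda>a u. letter a \<otimes> u) xs v) \<le> (nrm A (letter a) * C) * nrm A v" if v: "v \<in> carrier A" for v
    proof -
      have "foldr (\<lambda>a u. letter a \<otimes> u) xs v \<in> carrier A"
        by (induction xs) (auto intro: v mult_closed letter_closed)
      then have "nrm A (letter a \<otimes> foldr (\<lambda>a u. letter a \<otimes> u) xs v) \<le> nrm A (letter a) * nrm A (foldr (\<lambda>a u. letter a \<otimes> u) xs v)"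
        by (intro nrm_mult letter_closed)
      also have "\<dots> \<le> nrm A (letter a) * (C * nrm A v)" by (intro mult_left_mono C v nrm_ge0 letter_closed)
      finally show ?thesis by (simp add: mult.assoc)
    qed
    then show ?case using C nrm_ge0[OF letter_closed[of a]] by (intro exI[of _ "nrm A (letter a) * C"]) auto
  qed
  then obtain D where D: "D \<ge> 0" "\<And>v. v \<in> carrier A \<Longrightarrow> nrm A (word_act w v) \<le> D * nrm A v"
    unfolding word_act_def by blast
  obtain C where C: "C \<ge> 0" "\<And>v. v \<in> carrier A \<Longrightarrow> nrm A (act f v) \<le> C * nrm A v" using single by blast
  have "nrm A (act (f + Poly_Mapping.single w c) v) \<le> (C + cmod c * D) * nrm A v" if v: "v \<in> carrier A" for v
  proof -
    have "nrm A (act (f + Poly_Mapping.single w c) v) \<le> nrm A (act f v) + cmod c * nrm A (word_act w v)"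
      using nrm_triangle[of "act f v" "c \<odot> word_act w v"] v
      by (simp add: act_plus act_single act_closed sm_closed word_act_closed nrm_smult)
    also have "\<dots> \<le> C * nrm A v + cmod c * (D * nrm A v)" by (intro add_mono mult_left_mono C D v) auto
    finally show ?thesis by (simp add: algebra_simps)
  qed
  then show ?case using C D by (intro exI[of _ "C + cmod c * D"]) auto
qed

lemma act_bdd_above: "bdd_above ((\<lambda>v. nrm A (act f v)) ` {v \<in> carrier A. nrm A v \<le> 1})"
proof -
  obtain C where C: "C \<ge> 0" "\<And>v. v \<in> carrier A \<Longrightarrow> nrm A (act f v) \<le> C * nrm A v" using act_bounded by blast
  show ?thesis
  proof (rule bdd_aboveI2)
    fix v assume v: "v \<in> {v \<in> carrier A. nrm A v \<le> 1}"
    have "C * nrm A v \<le> C * 1" using v C by (intro mult_left_mono) auto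
    then show "nrm A (act f v) \<le> C" using C(2)[of v] v by simp
  qed
qed

lemma act_le_free_norm: "v \<in> carrier A \<Longrightarrow> nrm A (act f v) \<le> free_norm f * nrm A v"
proof -
  assume v: "v \<in> carrier A"
  obtain C where C: "C \<ge> 0" "\<And>v. v \<in> carrier A \<Longrightarrow> nrm A (act f v) \<le> C * nrm A v" using act_bounded by blast
  show ?thesis
  proof (cases "nrm A v = 0")
    case True
    then show ?thesis using C(2)[OF v] by simp
  next
    case False
    then have p: "nrm A v > 0" using nrm_ge0[OF v] by simp
    define u where "u = complex_of_real (1 / nrm A v) \<odot> v"
    have u: "u \<in> carrier A" "nrm A u \<le> 1" using v p by (auto simp: u_def sm_closed nrm_smult norm_divide)
    have "nrm A (act f u) \<le> free_norm f"
      unfolding free_norm_def using u by (intro cSUP_upper act_bdd_above) auto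
    moreover have "nrm A (act f u) = nrm A (act f v) / nrm A v"
      using v p by (simp add: u_def act_smult nrm_smult act_closed norm_divide)
    ultimately show ?thesis using p by (simp add: field_simps)
  qed
qed

lemma free_norm_le:
  assumes "C \<ge> 0" "\<And>v. v \<in> carrier A \<Longrightarrow> nrm A (act f v) \<le> C * nrm A v"
  shows "free_norm f \<le> C"
  unfolding free_norm_def
proof (rule cSUP_least)
  show "{v \<in> carrier A. nrm A v \<le> 1} \<noteq> {}" using nrm_zero by (auto intro!: exI[of _ \<zero>])
next
  fix v assume v: "v \<in> {v \<in> carrier A. nrm A v \<le> 1}"
  then have "C * nrm A v \<le> C * 1" using assms(1) by (intro mult_left_mono) auto
  then show "nrm A (act f v) \<le> C" using assms(2)[of v] v by auto
qed

lemma free_norm_ge0: "0 \<le> free_norm f"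
proof -
  have "nrm A (act f \<zero>) \<le> free_norm f"
    unfolding free_norm_def by (intro cSUP_upper act_bdd_above) (auto simp: nrm_zero)
  then show ?thesis using nrm_ge0[OF act_closed[OF M.zero_closed, of f]] by linarith
qed

text \<open>The norm of \<open>a\<close> is attained in the direction of the vector \<open>a*\<close>, because \<open>\<parallel>a a*\<parallel> = \<parallel>a\<parallel>\<^sup>2\<close>.\<close>
lemma free_norm_eqI:
  assumes a: "a \<in> carrier A" and eq: "\<And>v. v \<in> carrier A \<Longrightarrow> act f v = a \<otimes> v"
  shows "free_norm f = nrm A a"
proof (rule antisym)
  show "free_norm f \<le> nrm A a"
    by (rule free_norm_le) (auto simp: eq a intro: nrm_mult nrm_ge0)
  have "(nrm A a)\<^sup>2 \<le> free_norm f * nrm A a"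
    using act_le_free_norm[of "star A a" f] a by (simp add: star_closed eq cstar_identity' nrm_star)
  then show "nrm A a \<le> free_norm f"
    using nrm_ge0[OF a] free_norm_ge0[of f] by (cases "nrm A a = 0") (auto simp: power2_eq_square)
qed

text \<open>The C*-identity comes from \<open>(f v)* (f v) = v* ((f* f) v)\<close>, as for operators on a Hilbert space.\<close>
theorem free_cstar_seminorm: "cstar_seminorm (\<lambda>c. Poly_Mapping.single 0 c) free_star free_norm"
proof
  fix a b c :: complex and f g :: "'a word \<Rightarrow>\<^sub>0 complex"
  show "Poly_Mapping.single (0::'a word) (a + b) = Poly_Mapping.single 0 a + Poly_Mapping.single 0 b" by (rule single_add)
  show "Poly_Mapping.single (0::'a word) (a * b) = Poly_Mapping.single 0 a * Poly_Mapping.single 0 b" by (simp add: mult_single)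
  show "Poly_Mapping.single (0::'a word) (1::complex) = 1" by simp
  show "f * Poly_Mapping.single 0 c = Poly_Mapping.single 0 c * f"
    by (induction f rule: poly_mapping_single_induct) (auto simp: algebra_simps mult_single)
  show "free_star (f + g) = free_star f + free_star g" by (rule free_star_add)
  show "free_star (f * g) = free_star g * free_star f" by (rule free_star_mult)
  show "free_star (free_star f) = f" by (rule free_star_star)
  show "free_star (Poly_Mapping.single 0 c) = Poly_Mapping.single 0 (cnj c)"
    by (simp add: free_star_single word_star_def zero_word_def)
  show "free_norm (f + g) \<le> free_norm f + free_norm g"
  proof (rule free_norm_le)
    fix v assume v: "v \<in> carrier A"
    show "nrm A (act (f + g) v) \<le> (free_norm f + free_norm g) * nrm A v"
      using nrm_triangle[of "act f v" "act g v"] act_le_free_norm[OF v, of f] act_le_free_norm[OF v, of g] v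
      by (simp add: act_plus act_closed algebra_simps)
  qed (auto simp: free_norm_ge0)
  show mult: "free_norm (f * g) \<le> free_norm f * free_norm g" for f g
  proof (rule free_norm_le)
    fix v assume v: "v \<in> carrier A"
    have "nrm A (act f (act g v)) \<le> free_norm f * (free_norm g * nrm A v)"
      using v by (intro order_trans[OF act_le_free_norm] mult_left_mono act_le_free_norm free_norm_ge0 act_closed)
    then show "nrm A (act (f * g) v) \<le> free_norm f * free_norm g * nrm A v"
      using v by (simp add: act_mult mult.assoc)
  qed (auto simp: free_norm_ge0)
  have act_sc: "act (Poly_Mapping.single 0 c * f) v = c \<odot> act f v" if "v \<in> carrier A" for v c f
    using that by (simp add: act_mult act_single word_act_0 act_closed)
  have sc_le: "free_norm (Poly_Mapping.single 0 c * f) \<le> cmod c * free_norm f" for c f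
  proof (rule free_norm_le)
    fix v assume v: "v \<in> carrier A"
    then show "nrm A (act (Poly_Mapping.single 0 c * f) v) \<le> cmod c * free_norm f * nrm A v"
      using mult_left_mono[OF act_le_free_norm[OF v, of f], of "cmod c"] by (simp add: act_sc nrm_smult act_closed mult.assoc)
  qed (auto simp: free_norm_ge0)
  show "free_norm (Poly_Mapping.single 0 c * f) = cmod c * free_norm f"
  proof (cases "c = 0")
    case True
    have "free_norm 0 \<le> 0" by (rule free_norm_le) (auto simp: act_0 nrm_zero)
    then show ?thesis using True free_norm_ge0[of 0] by simp
  next
    case False
    have "Poly_Mapping.single 0 (1 / c) * (Poly_Mapping.single 0 c * f) = f"
      using False by (simp add: mult.assoc[symmetric] mult_single)
    then have "free_norm f \<le> cmod (1 / c) * free_norm (Poly_Mapping.single 0 c * f)" using sc_le by metis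
    then have "cmod c * free_norm f \<le> free_norm (Poly_Mapping.single 0 c * f)"
      using False by (simp add: norm_divide field_simps)
    then show ?thesis using sc_le by (simp add: antisym)
  qed
  show "free_norm 1 \<le> 1" by (rule free_norm_le) (auto simp: act_1)
  have *: "(free_norm f)\<^sup>2 \<le> free_norm (free_star f * f)" for f
  proof -
    have "free_norm f \<le> sqrt (free_norm (free_star f * f))"
    proof (rule free_norm_le)
      fix v assume v: "v \<in> carrier A"
      have "(nrm A (act f v))\<^sup>2 = nrm A (star A v \<otimes> act (free_star f) (act f v))"
        using v by (simp add: cstar_identity[symmetric] act_closed act_adjoint)
      also have "\<dots> \<le> nrm A v * nrm A (act (free_star f) (act f v))"
        using v nrm_mult[of "star A v" "act (free_star f) (act f v)"] by (simp add: star_closed act_closed nrm_star)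
      also have "\<dots> \<le> nrm A v * (free_norm (free_star f * f) * nrm A v)"
        using v act_le_free_norm[OF v, of "free_star f * f"] by (intro mult_left_mono nrm_ge0) (simp_all add: act_mult)
      also have "\<dots> = (sqrt (free_norm (free_star f * f)) * nrm A v)\<^sup>2"
        by (simp add: power_mult_distrib free_norm_ge0) (simp add: power2_eq_square)
      finally show "nrm A (act f v) \<le> sqrt (free_norm (free_star f * f)) * nrm A v"
        by (rule power2_le_imp_le) (auto simp: v nrm_ge0 free_norm_ge0)
    qed (auto simp: free_norm_ge0)
    then have "(free_norm f)\<^sup>2 \<le> (sqrt (free_norm (free_star f * f)))\<^sup>2" by (intro power_mono free_norm_ge0)
    then show ?thesis by (simp add: free_norm_ge0)
  qed
  have **: "free_norm f \<le> free_norm (free_star f)" for f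
  proof (cases "free_norm f = 0")
    case False
    then have p: "free_norm f > 0" using free_norm_ge0[of f] by simp
    have "free_norm f * free_norm f \<le> free_norm (free_star f) * free_norm f"
      using *[of f] mult[of "free_star f" f] by (simp add: power2_eq_square)
    then show ?thesis using p by simp
  qed (simp add: free_norm_ge0)
  have "free_norm (free_star f) = free_norm f"
    using **[of f] **[of "free_star f"] by (simp add: free_star_star)
  then show "free_norm (free_star f * f) = (free_norm f)\<^sup>2"
    using *[of f] mult[of "free_star f" f] by (simp add: power2_eq_square)
qed

interpretation F: cstar_seminorm "\<lambda>c. Poly_Mapping.single 0 c" free_star free_norm
  by (rule free_cstar_seminorm)

lemma act_gen: "a \<in> carrier A \<Longrightarrow> v \<in> carrier A \<Longrightarrow> act (gen a) v = a \<otimes> v"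
  by (simp add: gen_def act_single word_act_def letter_def sm_one mult_closed)
lemma free_star_gen: "a \<in> carrier A \<Longrightarrow> free_star (gen a) = gen (star A a)"
  by (simp add: gen_def free_star_single word_star_def letter_star_def)

theorem cauchy_schwarz:
  assumes I: "finite I" and x: "x \<in> I \<rightarrow> carrier A" and y: "y \<in> I \<rightarrow> carrier A"
  shows "(nrm A (finsum A (\<lambda>i. star A (y i) \<otimes> x i) I))\<^sup>2
    \<le> nrm A (finsum A (\<lambda>i. star A (x i) \<otimes> x i) I) * nrm A (finsum A (\<lambda>i. star A (y i) \<otimes> y i) I)"
proof -
  have act_sum: "act (\<Sum>i\<in>I. free_star (gen (u i)) * gen (w i)) v = finsum A (\<lambda>i. star A (u i) \<otimes> w i) I \<otimes> v"
    if "u \<in> I \<rightarrow> carrier A" "w \<in> I \<rightarrow> carrier A" "v \<in> carrier A" for u w v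
    using I that(1,2)
  proof (induction I rule: finite_induct)
    case empty show ?case using that by (simp add: act_0 mult_zero_left)
  next
    case (insert i I)
    then have "u i \<in> carrier A" "w i \<in> carrier A" "(\<lambda>i. star A (u i) \<otimes> w i) \<in> I \<rightarrow> carrier A"
      "u \<in> I \<rightarrow> carrier A" "w \<in> I \<rightarrow> carrier A"
      by (auto intro: mult_closed star_closed)
    then show ?case using insert that(3)
      by (simp add: act_plus act_mult free_star_gen act_gen mult_closed star_closed distrib_right mult_assoc M.finsum_closed)
  qed
  have n: "free_norm (\<Sum>i\<in>I. free_star (gen (u i)) * gen (w i)) = nrm A (finsum A (\<lambda>i. star A (u i) \<otimes> w i) I)"
    if "u \<in> I \<rightarrow> carrier A" "w \<in> I \<rightarrow> carrier A" for u w
  proof (rule free_norm_eqI)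
    show "finsum A (\<lambda>i. star A (u i) \<otimes> w i) I \<in> carrier A"
      using that by (intro M.finsum_closed) (auto intro: mult_closed star_closed)
  qed (rule act_sum[OF that])
  show ?thesis
    using F.cauchy_schwarz[OF I, of "\<lambda>i. gen (y i)" "\<lambda>i. gen (x i)"] by (simp add: n x y)
qed

text \<open>If \<open>V\<close> is an approximate eigenvector in the free algebra and \<open>u\<close> a unit vector at which the norm of
  \<open>V\<close> is nearly attained, then \<open>v = V u\<close> is one in the algebra.\<close>
theorem approx_eigenvector:
  assumes g: "g \<in> carrier A" "star A g = g" "nrm A g = 1" and e: "e > 0"
  shows "\<exists>v\<in>carrier A. nrm A v > 0 \<and> (nrm A (g \<otimes> v \<ominus> v) \<le> e * nrm A v \<or> nrm A (g \<otimes> v \<oplus> v) \<le> e * nrm A v)"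
proof -
  have n: "free_norm (gen g) = 1" using free_norm_eqI[OF g(1), of "gen g"] act_gen g by simp
  obtain V where V: "free_norm V > 0"
    "free_norm (gen g * V - V) \<le> e / 2 * free_norm V \<or> free_norm (gen g * V + V) \<le> e / 2 * free_norm V"
    using F.approx_eigenvector_1[of "gen g" "e / 2"] free_star_gen[OF g(1)] g n e by auto
  have "\<exists>u\<in>carrier A. nrm A u \<le> 1 \<and> nrm A (act V u) > free_norm V / 2"
  proof (rule ccontr)
    assume "\<not> ?thesis"
    then have "\<And>u. u \<in> {v \<in> carrier A. nrm A v \<le> 1} \<Longrightarrow> nrm A (act V u) \<le> free_norm V / 2" by force
    moreover have "{v \<in> carrier A. nrm A v \<le> 1} \<noteq> {}" using nrm_zero by (auto intro!: exI[of _ \<zero>])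
    ultimately have "free_norm V \<le> free_norm V / 2"
      by (subst free_norm_def) (rule cSUP_least)
    then show False using V by simp
  qed
  then obtain u where u: "u \<in> carrier A" "nrm A u \<le> 1" "nrm A (act V u) > free_norm V / 2" by blast
  define v where "v = act V u"
  have v: "v \<in> carrier A" using u by (simp add: v_def act_closed)
  have minus: "act (- f) u = \<ominus> act f u" for f
  proof (rule M.minus_equality[symmetric])
    show "act (- f) u \<oplus> act f u = \<zero>" using act_plus[of u "- f" f] u by (simp add: act_0)
  qed (use u in \<open>auto intro: act_closed\<close>)
  have "act (gen g * V - V) u = g \<otimes> v \<ominus> v"
    using act_plus[of u "gen g * V" "- V"] u v
    by (simp add: minus act_mult act_gen g v_def act_closed a_minus_def)
  moreover have "act (gen g * V + V) u = g \<otimes> v \<oplus> v"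
    using u v by (simp add: act_plus act_mult act_gen g v_def act_closed)
  moreover have "nrm A (act f u) \<le> e * nrm A v" if "free_norm f \<le> e / 2 * free_norm V" for f
  proof -
    have "nrm A (act f u) \<le> free_norm f * nrm A u" by (rule act_le_free_norm[OF u(1)])
    also have "\<dots> \<le> free_norm f * 1" using u by (intro mult_left_mono free_norm_ge0)
    also have "\<dots> \<le> e * (free_norm V / 2)" using that by simp
    also have "\<dots> \<le> e * nrm A v" using u e by (intro mult_left_mono) (auto simp: v_def)
    finally show ?thesis .
  qed
  ultimately have "nrm A (g \<otimes> v \<ominus> v) \<le> e * nrm A v \<or> nrm A (g \<otimes> v \<oplus> v) \<le> e * nrm A v"
    using V(2) by metis
  moreover have "nrm A v > 0" using u(3) V(1) by (simp add: v_def)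
  ultimately show ?thesis using v by blast
qed

end

section \<open>Automatic continuity\<close>

context pre_cstar
begin

lemma eq_if_nrm_le_0: "x \<in> carrier A \<Longrightarrow> y \<in> carrier A \<Longrightarrow> nrm A (x \<ominus> y) \<le> 0 \<Longrightarrow> x = y"
proof -
  assume c: "x \<in> carrier A" "y \<in> carrier A" "nrm A (x \<ominus> y) \<le> 0"
  then have "x \<ominus> y = \<zero>" using nrm_ge0[of "x \<ominus> y"] nrm_eq_0[of "x \<ominus> y"] by simp
  moreover have "x = (x \<ominus> y) \<oplus> y" using c by (simp add: a_minus_def M.a_assoc M.l_neg)
  ultimately show "x = y" using c by simp
qed

lemma eq_if_nrm_small:
  assumes "x \<in> carrier A" "y \<in> carrier A" "\<And>e. e > 0 \<Longrightarrow> nrm A (x \<ominus> y) \<le> e"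
  shows "x = y"
  by (rule eq_if_nrm_le_0) (use assms field_le_epsilon[of "nrm A (x \<ominus> y)" 0] in auto)

lemma add_diff_add: "a \<in> carrier A \<Longrightarrow> b \<in> carrier A \<Longrightarrow> c \<in> carrier A \<Longrightarrow> d \<in> carrier A \<Longrightarrow>
  (a \<oplus> b) \<ominus> (c \<oplus> d) = (a \<ominus> c) \<oplus> (b \<ominus> d)"
  by (simp add: a_minus_def M.minus_add M.a_ac)

lemma mult_diff_left: "a \<in> carrier A \<Longrightarrow> b \<in> carrier A \<Longrightarrow> c \<in> carrier A \<Longrightarrow> (a \<ominus> b) \<otimes> c = a \<otimes> c \<ominus> b \<otimes> c"
  by (simp add: a_minus_def distrib_right mult_minus_left)
lemma mult_diff_right: "a \<in> carrier A \<Longrightarrow> b \<in> carrier A \<Longrightarrow> c \<in> carrier A \<Longrightarrow> c \<otimes> (a \<ominus> b) = c \<otimes> a \<ominus> c \<otimes> b"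
  by (simp add: a_minus_def distrib_left mult_minus_right)

lemma geometric_cauchy:
  assumes u: "\<And>n. u n \<in> carrier A" and r: "0 \<le> r" "r < 1" and C: "C \<ge> 0"
    and step: "\<And>n. nrm A (u (Suc n) \<ominus> u n) \<le> C * r ^ n"
  shows "cauchy_in A u"
proof -
  have est: "nrm A (u (m + k) \<ominus> u m) \<le> C * r ^ m * (1 - r ^ k) / (1 - r)" for m k
  proof (induction k)
    case 0 show ?case using u by (simp add: a_minus_def M.r_neg nrm_zero)
  next
    case (Suc k)
    have "nrm A (u (m + Suc k) \<ominus> u m) \<le> nrm A (u (Suc (m + k)) \<ominus> u (m + k)) + nrm A (u (m + k) \<ominus> u m)"
      using nrm_diff_triangle[of "u (m + Suc k)" "u (m + k)" "u m"] u by simp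
    also have "\<dots> \<le> C * r ^ (m + k) + C * r ^ m * (1 - r ^ k) / (1 - r)" by (intro add_mono step Suc.IH)
    also have "\<dots> = C * r ^ m * (1 - r ^ Suc k) / (1 - r)" using r by (simp add: field_simps power_add)
    finally show ?case .
  qed
  have est': "nrm A (u n \<ominus> u m) \<le> C / (1 - r) * r ^ m" if "m \<le> n" for m n
  proof -
    define k where "k = n - m"
    have k: "n = m + k" using that by (simp add: k_def)
    have "C * r ^ m * (1 - r ^ k) \<le> C * r ^ m * 1" using C r by (intro mult_left_mono) auto
    then have "C * r ^ m * (1 - r ^ k) / (1 - r) \<le> C * r ^ m * 1 / (1 - r)" using r by (intro divide_right_mono) auto
    then show ?thesis using est[of m k] by (simp add: k)
  qed
  have "\<exists>N. \<forall>m\<ge>N. \<forall>n\<ge>N. nrm A (u m \<ominus> u n) < e" if e: "e > 0" for e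
  proof -
    have "(\<lambda>m. C / (1 - r) * r ^ m) \<longlonglongrightarrow> C / (1 - r) * 0" using r by (intro tendsto_mult tendsto_const LIMSEQ_power_zero) auto
    then have "eventually (\<lambda>m. C / (1 - r) * r ^ m < e) sequentially" using e by (intro order_tendstoD(2)) auto
    then obtain N where N: "\<And>m. m \<ge> N \<Longrightarrow> C / (1 - r) * r ^ m < e" by (auto simp: eventually_sequentially)
    have "nrm A (u m \<ominus> u n) < e" if "m \<ge> N" "n \<ge> N" for m n
    proof (cases "m \<le> n")
      case True
      have "nrm A (u m \<ominus> u n) = nrm A (u n \<ominus> u m)" using u by (simp add: nrm_diff_commute[of "u m"])
      then show ?thesis using est'[OF True] N[OF that(1)] by linarith
    next
      case False
      then have "nrm A (u m \<ominus> u n) \<le> C / (1 - r) * r ^ n" using est'[of n m] by simp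
      then show ?thesis using N[OF that(2)] by linarith
    qed
    then show ?thesis by blast
  qed
  then show ?thesis using u by (simp add: cauchy_in_def)
qed

text \<open>The solution is \<open>a + a\<^sup>2 + a\<^sup>3 + \<dots>\<close>, so that \<open>1 + k\<close> is a left inverse of \<open>1 - a\<close>. Its partial
  sums are the iterates of \<open>w \<mapsto> a + w a\<close>.\<close>
lemma neumann:
  assumes complete: "\<And>u. cauchy_in A u \<Longrightarrow> \<exists>l\<in>carrier A. (\<lambda>n. nrm A (u n \<ominus> l)) \<longlonglongrightarrow> 0"
    and a: "a \<in> carrier A" "nrm A a < 1"
  shows "\<exists>k\<in>carrier A. k = a \<oplus> k \<otimes> a"
proof -
  define u where "u n = rec_nat a (\<lambda>_ w. a \<oplus> w \<otimes> a) n" for n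
  have u0: "u 0 = a" and uS: "\<And>n. u (Suc n) = a \<oplus> u n \<otimes> a" by (simp_all add: u_def)
  have c: "u n \<in> carrier A" for n by (induction n) (simp_all add: u0 uS a mult_closed)
  have "nrm A (u (Suc n) \<ominus> u n) \<le> 1 * nrm A a ^ n" for n
  proof (induction n)
    case 0
    have "u (Suc 0) \<ominus> u 0 = a \<otimes> a" using a by (simp add: u0 uS a_minus_def M.a_ac M.r_neg1 mult_closed M.r_neg2)
    then have "nrm A (u (Suc 0) \<ominus> u 0) \<le> nrm A a * nrm A a" using a nrm_mult by simp
    also have "\<dots> \<le> 1 * 1" using a nrm_ge0[OF a(1)] by (intro mult_mono) auto
    finally show ?case by simp
  next
    case (Suc n)
    have "u (Suc (Suc n)) \<ominus> u (Suc n) = (u (Suc n) \<ominus> u n) \<otimes> a"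
      using a c by (subst (1 2) uS) (simp add: add_diff_add mult_closed mult_diff_left, simp add: a_minus_def M.r_neg mult_closed)
    then have "nrm A (u (Suc (Suc n)) \<ominus> u (Suc n)) \<le> nrm A (u (Suc n) \<ominus> u n) * nrm A a"
      using a c nrm_mult[of "u (Suc n) \<ominus> u n" a] by simp
    also have "\<dots> \<le> (1 * nrm A a ^ n) * nrm A a" using Suc a by (intro mult_right_mono nrm_ge0) auto
    finally show ?case by (simp add: mult.commute)
  qed
  then have "cauchy_in A u" using c a nrm_ge0 by (intro geometric_cauchy[of u "nrm A a" 1]) auto
  then obtain k where k: "k \<in> carrier A" and lim: "(\<lambda>n. nrm A (u n \<ominus> k)) \<longlonglongrightarrow> 0" using complete by blast
  have "k = a \<oplus> k \<otimes> a"
  proof (rule eq_if_nrm_small)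
    show "a \<oplus> k \<otimes> a \<in> carrier A" using a k by (simp add: mult_closed)
    fix e :: real assume e: "e > 0"
    have "eventually (\<lambda>n. nrm A (u n \<ominus> k) < e / 2) sequentially" using lim e by (intro order_tendstoD(2)) auto
    then obtain N where N: "\<And>n. n \<ge> N \<Longrightarrow> nrm A (u n \<ominus> k) < e / 2" by (auto simp: eventually_sequentially)
    have "u (Suc N) \<ominus> (a \<oplus> k \<otimes> a) = (u N \<ominus> k) \<otimes> a"
      using a c k by (simp add: uS add_diff_add mult_closed mult_diff_left) (simp add: a_minus_def M.r_neg mult_closed)
    then have "nrm A (u (Suc N) \<ominus> (a \<oplus> k \<otimes> a)) \<le> nrm A (u N \<ominus> k) * nrm A a"
      using a c k nrm_mult[of "u N \<ominus> k" a] by simp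
    also have "\<dots> \<le> nrm A (u N \<ominus> k) * 1" using a c k by (intro mult_left_mono nrm_ge0) auto
    also have "\<dots> \<le> e / 2" using N[of N] by simp
    finally have 1: "nrm A (u (Suc N) \<ominus> (a \<oplus> k \<otimes> a)) \<le> e / 2" .
    have "nrm A (k \<ominus> (a \<oplus> k \<otimes> a)) \<le> nrm A (k \<ominus> u (Suc N)) + nrm A (u (Suc N) \<ominus> (a \<oplus> k \<otimes> a))"
      using a k c by (intro nrm_diff_triangle) (auto intro: mult_closed)
    moreover have "nrm A (k \<ominus> u (Suc N)) < e / 2" using N[of "Suc N"] k c by (simp add: nrm_diff_commute[of k])
    ultimately show "nrm A (k \<ominus> (a \<oplus> k \<otimes> a)) \<le> e" using 1 by simp
  qed (rule k)
  then show ?thesis using k by blast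
qed

lemma resolvent_bound:
  assumes c: "g \<in> carrier A" "k \<in> carrier A" "v \<in> carrier A" and k: "k = g \<oplus> k \<otimes> g"
  shows "nrm A v \<le> (1 + nrm A k) * nrm A (g \<otimes> v \<ominus> v)"
proof -
  define w where "w = v \<ominus> g \<otimes> v"
  have w: "w \<in> carrier A" using c by (simp add: w_def mult_closed)
  have "k \<otimes> v = g \<otimes> v \<oplus> k \<otimes> (g \<otimes> v)"
    using c by (subst k) (simp add: distrib_right mult_closed mult_assoc)
  then have "k \<otimes> w = g \<otimes> v"
    using c by (simp add: w_def mult_diff_right mult_closed) (simp add: a_minus_def M.a_assoc M.r_neg mult_closed)
  then have "v = w \<oplus> k \<otimes> w"
    using c by (simp add: w_def mult_closed) (simp add: a_minus_def M.a_assoc M.l_neg mult_closed)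
  then have "nrm A v \<le> nrm A w + nrm A k * nrm A w"
    using nrm_triangle[of w "k \<otimes> w"] nrm_mult[of k w] c w by (simp add: mult_closed)
  moreover have "nrm A w = nrm A (g \<otimes> v \<ominus> v)" using c by (simp add: w_def nrm_diff_commute[of v] mult_closed)
  ultimately show ?thesis by (simp add: algebra_simps)
qed

end

lemma star_homD:
  assumes "\<psi> \<in> star_hom A B"
  shows "x \<in> carrier A \<Longrightarrow> \<psi> x \<in> carrier B"
    and "x \<in> carrier A \<Longrightarrow> y \<in> carrier A \<Longrightarrow> \<psi> (x \<oplus>\<^bsub>A\<^esub> y) = \<psi> x \<oplus>\<^bsub>B\<^esub> \<psi> y"
    and "x \<in> carrier A \<Longrightarrow> y \<in> carrier A \<Longrightarrow> \<psi> (x \<otimes>\<^bsub>A\<^esub> y) = \<psi> x \<otimes>\<^bsub>B\<^esub> \<psi> y"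
    and "x \<in> carrier A \<Longrightarrow> \<psi> (c \<odot>\<^bsub>A\<^esub> x) = c \<odot>\<^bsub>B\<^esub> \<psi> x"
    and "x \<in> carrier A \<Longrightarrow> \<psi> (star A x) = star B (\<psi> x)"
  using assms by (auto simp: star_hom_def)

text \<open>If \<open>\<psi>\<close> increased the norm of \<open>x\<close>, a multiple \<open>h\<close> of \<open>x* x\<close> would have norm less than 1 and an image
  \<open>g\<close> of norm 1. The Neumann series for \<open>h\<close> and \<open>-h\<close> are mapped to left inverses of \<open>1 - g\<close> and \<open>1 + g\<close>,
  although \<open>1\<close> or \<open>-1\<close> is an approximate eigenvalue of \<open>g\<close>.\<close>
theorem star_hom_contractive:
  assumes B: "pre_cstar B" and C: "pre_cstar C"
    and complete: "\<And>u. cauchy_in B u \<Longrightarrow> \<exists>l\<in>carrier B. (\<lambda>n. nrm B (u n \<ominus>\<^bsub>B\<^esub> l)) \<longlonglongrightarrow> 0"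
    and psi: "\<psi> \<in> star_hom B C" and x: "x \<in> carrier B"
  shows "nrm C (\<psi> x) \<le> nrm B x"
proof (rule ccontr)
  interpret B: pre_cstar B by fact
  interpret C: pre_cstar C by fact
  note psi = star_homD[OF psi]
  assume "\<not> nrm C (\<psi> x) \<le> nrm B x"
  define c where "c = nrm C (\<psi> x)"
  have c: "nrm B x < c" "c > 0" using \<open>\<not> _\<close> B.nrm_ge0[OF x] by (auto simp: c_def)
  define h where "h = complex_of_real (1 / c\<^sup>2) \<odot>\<^bsub>B\<^esub> (star B x \<otimes>\<^bsub>B\<^esub> x)"
  define g where "g = \<psi> h"
  have h: "h \<in> carrier B" using x by (simp add: h_def B.sm_closed B.mult_closed B.star_closed)
  have g: "g \<in> carrier C" using h psi by (simp add: g_def)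
  have nh: "nrm B h < 1"
  proof -
    have "nrm B h = (nrm B x)\<^sup>2 / c\<^sup>2"
      using x by (simp add: h_def B.nrm_smult B.mult_closed B.star_closed B.cstar_identity norm_divide norm_power)
    moreover have "(nrm B x)\<^sup>2 < c\<^sup>2" using c B.nrm_ge0[OF x] by (intro power_strict_mono) auto
    ultimately show ?thesis using c by simp
  qed
  have g_eq: "g = complex_of_real (1 / c\<^sup>2) \<odot>\<^bsub>C\<^esub> (star C (\<psi> x) \<otimes>\<^bsub>C\<^esub> \<psi> x)"
    using x by (simp add: g_def h_def psi B.mult_closed B.star_closed)
  have gs: "star C g = g"
    using psi(1)[OF x] by (simp add: g_eq C.star_smult C.star_mult C.star_star C.mult_closed C.star_closed)
  have gn: "nrm C g = 1"
    using psi(1)[OF x] c by (simp add: g_eq C.nrm_smult C.mult_closed C.star_closed C.cstar_identity norm_divide norm_power flip: c_def)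
  obtain k1 where k1: "k1 \<in> carrier B" "k1 = h \<oplus>\<^bsub>B\<^esub> k1 \<otimes>\<^bsub>B\<^esub> h"
    using B.neumann[OF complete h nh] by blast
  obtain k2 where k2: "k2 \<in> carrier B" "k2 = \<ominus>\<^bsub>B\<^esub> h \<oplus>\<^bsub>B\<^esub> k2 \<otimes>\<^bsub>B\<^esub> \<ominus>\<^bsub>B\<^esub> h"
    using B.neumann[OF complete, of "\<ominus>\<^bsub>B\<^esub> h"] h nh by (auto simp: B.nrm_minus)
  have neg: "\<psi> (\<ominus>\<^bsub>B\<^esub> h) = \<ominus>\<^bsub>C\<^esub> g"
    using h g psi(4)[OF h, of "-1"] by (simp add: B.sm_minus1 C.sm_minus1 g_def)
  have p1: "\<psi> k1 = g \<oplus>\<^bsub>C\<^esub> \<psi> k1 \<otimes>\<^bsub>C\<^esub> g"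
    using arg_cong[OF k1(2), of \<psi>] k1(1) h by (simp add: psi B.mult_closed g_def)
  have p2: "\<psi> k2 = \<ominus>\<^bsub>C\<^esub> g \<oplus>\<^bsub>C\<^esub> \<psi> k2 \<otimes>\<^bsub>C\<^esub> \<ominus>\<^bsub>C\<^esub> g"
    using arg_cong[OF k2(2), of \<psi>] k2(1) h by (simp add: psi B.mult_closed neg)
  define m where "m = 1 + max (nrm C (\<psi> k1)) (nrm C (\<psi> k2))"
  have pk: "\<psi> k1 \<in> carrier C" "\<psi> k2 \<in> carrier C" using psi k1 k2 by auto
  have m: "m \<ge> 1" "1 + nrm C (\<psi> k1) \<le> m" "1 + nrm C (\<psi> k2) \<le> m"
    using C.nrm_ge0[OF pk(1)] by (auto simp: m_def)
  obtain v where v: "v \<in> carrier C" "nrm C v > 0"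
    "nrm C (g \<otimes>\<^bsub>C\<^esub> v \<ominus>\<^bsub>C\<^esub> v) \<le> 1 / (2 * m) * nrm C v \<or> nrm C (g \<otimes>\<^bsub>C\<^esub> v \<oplus>\<^bsub>C\<^esub> v) \<le> 1 / (2 * m) * nrm C v"
    using C.approx_eigenvector[OF g gs gn, of "1 / (2 * m)"] m by auto
  have A1: "nrm C v \<le> m * nrm C (g \<otimes>\<^bsub>C\<^esub> v \<ominus>\<^bsub>C\<^esub> v)"
  proof -
    have "nrm C v \<le> (1 + nrm C (\<psi> k1)) * nrm C (g \<otimes>\<^bsub>C\<^esub> v \<ominus>\<^bsub>C\<^esub> v)"
      by (rule C.resolvent_bound[OF g pk(1) v(1) p1])
    also have "\<dots> \<le> m * nrm C (g \<otimes>\<^bsub>C\<^esub> v \<ominus>\<^bsub>C\<^esub> v)"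
      using m g v by (intro mult_right_mono C.nrm_ge0) (auto intro: C.mult_closed)
    finally show ?thesis .
  qed
  have A2: "nrm C v \<le> m * nrm C (g \<otimes>\<^bsub>C\<^esub> v \<oplus>\<^bsub>C\<^esub> v)"
  proof -
    have "nrm C v \<le> (1 + nrm C (\<psi> k2)) * nrm C ((\<ominus>\<^bsub>C\<^esub> g) \<otimes>\<^bsub>C\<^esub> v \<ominus>\<^bsub>C\<^esub> v)"
      using g by (intro C.resolvent_bound[OF _ pk(2) v(1) p2]) auto
    also have "(\<ominus>\<^bsub>C\<^esub> g) \<otimes>\<^bsub>C\<^esub> v \<ominus>\<^bsub>C\<^esub> v = \<ominus>\<^bsub>C\<^esub> (g \<otimes>\<^bsub>C\<^esub> v \<oplus>\<^bsub>C\<^esub> v)"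
      using g v by (simp add: a_minus_def C.mult_minus_left C.minus_add C.mult_closed)
    also have "nrm C \<dots> = nrm C (g \<otimes>\<^bsub>C\<^esub> v \<oplus>\<^bsub>C\<^esub> v)" using g v by (simp add: C.nrm_minus C.mult_closed)
    also have "(1 + nrm C (\<psi> k2)) * \<dots> \<le> m * \<dots>"
      using m g v by (intro mult_right_mono C.nrm_ge0) (auto intro: C.mult_closed)
    finally show ?thesis .
  qed
  have "nrm C v \<le> m * (1 / (2 * m) * nrm C v)"
    using v(3)
  proof
    assume "nrm C (g \<otimes>\<^bsub>C\<^esub> v \<ominus>\<^bsub>C\<^esub> v) \<le> 1 / (2 * m) * nrm C v"
    then have "m * nrm C (g \<otimes>\<^bsub>C\<^esub> v \<ominus>\<^bsub>C\<^esub> v) \<le> m * (1 / (2 * m) * nrm C v)" using m by (intro mult_left_mono) auto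
    then show ?thesis using A1 by linarith
  next
    assume "nrm C (g \<otimes>\<^bsub>C\<^esub> v \<oplus>\<^bsub>C\<^esub> v) \<le> 1 / (2 * m) * nrm C v"
    then have "m * nrm C (g \<otimes>\<^bsub>C\<^esub> v \<oplus>\<^bsub>C\<^esub> v) \<le> m * (1 / (2 * m) * nrm C v)" using m by (intro mult_left_mono) auto
    then show ?thesis using A2 by linarith
  qed
  then show False using v m by simp
qed

section \<open>Quotients of algebras of bounded sequences\<close>

text \<open>Ultrapowers (bounded sequences, limits along an ultrafilter) and completions (Cauchy sequences,
  limits at infinity) are instances of one construction: an algebra \<open>S\<close> of bounded sequences whose
  norms converge along a filter, modulo the sequences whose norms tend to 0. Condition \<open>S_cut\<close> allows
  a sequence to be replaced by 0 off a set of the filter, so that the quotient norm becomes the limit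
  of the norms.\<close>
locale seq_quot = pre_cstar B for B :: "'a cstar" (structure) +
  fixes F :: "nat filter" and S :: "(nat \<Rightarrow> 'a) set"
  assumes F: "F \<noteq> bot"
    and S_sub: "S \<subseteq> carrier (linf B)"
    and null_sub: "null_seqs F B \<subseteq> S"
    and S_add: "x \<in> S \<Longrightarrow> y \<in> S \<Longrightarrow> (\<lambda>n. x n \<oplus> y n) \<in> S"
    and S_mult: "x \<in> S \<Longrightarrow> y \<in> S \<Longrightarrow> (\<lambda>n. x n \<otimes> y n) \<in> S"
    and S_smult: "x \<in> S \<Longrightarrow> (\<lambda>n. c \<odot> x n) \<in> S"
    and S_star: "x \<in> S \<Longrightarrow> (\<lambda>n. star B (x n)) \<in> S"
    and S_cut: "x \<in> S \<Longrightarrow> eventually P F \<Longrightarrow> (\<lambda>n. if P n then x n else \<zero>) \<in> S"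
    and S_lim: "x \<in> S \<Longrightarrow> \<exists>L. ((\<lambda>n. nrm B (x n)) \<longlongrightarrow> L) F"
begin

definition R where "R = (linf B)\<lparr>carrier := S\<rparr>"
definition J where "J = null_seqs F B"
definition Q where "Q = quotient_alg R J"
definition cl where "cl x = J +>\<^bsub>R\<^esub> x"
definition eqv where "eqv x y \<longleftrightarrow> ((\<lambda>n. nrm B (x n \<ominus> y n)) \<longlongrightarrow> 0) F"

lemma diff_zero: "x \<in> carrier B \<Longrightarrow> x \<ominus> \<zero> = x"
  by (simp add: a_minus_def sm_minus1[symmetric] sm_zero)
lemma S_closed: "x \<in> S \<Longrightarrow> x n \<in> carrier B"
  using S_sub by (auto simp: linf_def)
lemma S_bounded: "x \<in> S \<Longrightarrow> \<exists>K>0. \<forall>n. nrm B (x n) \<le> K"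
proof -
  assume "x \<in> S"
  then have "bdd_above (range (\<lambda>n. nrm B (x n)))" using S_sub by (auto simp: linf_def)
  then obtain K where "\<And>n. nrm B (x n) \<le> K" by (auto simp: bdd_above_def)
  then show ?thesis by (intro exI[of _ "max K 1"]) (auto simp: le_max_iff_disj)
qed
lemma linfI: "(\<And>n. x n \<in> carrier B) \<Longrightarrow> (\<And>n. nrm B (x n) \<le> K) \<Longrightarrow> x \<in> carrier (linf B)"
  by (auto simp: linf_def bdd_above_def)
lemma JI: "(\<And>n. x n \<in> carrier B) \<Longrightarrow> (\<And>n. nrm B (x n) \<le> K) \<Longrightarrow> ((\<lambda>n. nrm B (x n)) \<longlongrightarrow> 0) F \<Longrightarrow> x \<in> J"
  unfolding J_def null_seqs_def using linfI by blast
lemma J_S: "J \<subseteq> S" using null_sub by (simp add: J_def)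
lemma J_lim: "x \<in> J \<Longrightarrow> ((\<lambda>n. nrm B (x n)) \<longlongrightarrow> 0) F" by (simp add: J_def null_seqs_def)
lemma zero_J: "(\<lambda>n. \<zero>) \<in> J" by (rule JI[of _ 0]) (auto simp: nrm_zero)
lemma zero_S: "(\<lambda>n. \<zero>) \<in> S" using zero_J J_S by blast
lemma S_neg: "x \<in> S \<Longrightarrow> (\<lambda>n. \<ominus> x n) \<in> S"
proof -
  assume x: "x \<in> S"
  have "(\<lambda>n. \<ominus> x n) = (\<lambda>n. (-1) \<odot> x n)" using S_closed[OF x] by (simp add: sm_minus1)
  then show ?thesis using S_smult[OF x] by simp
qed
lemma S_diff: "x \<in> S \<Longrightarrow> y \<in> S \<Longrightarrow> (\<lambda>n. x n \<ominus> y n) \<in> S"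
  unfolding a_minus_def by (intro S_add S_neg)

lemma eqv_refl: "x \<in> S \<Longrightarrow> eqv x x"
  by (simp add: eqv_def S_closed a_minus_def M.r_neg nrm_zero)
lemma eqv_squeeze:
  assumes "(g \<longlongrightarrow> 0) F" "\<And>n. x n \<in> carrier B" "\<And>n. y n \<in> carrier B" "\<And>n. nrm B (x n \<ominus> y n) \<le> g n"
  shows "eqv x y"
  unfolding eqv_def
  by (rule tendsto_sandwich[of "\<lambda>n. 0", OF _ _ tendsto_const assms(1)]) (use assms nrm_ge0 in auto)
lemma eqv_sym: "x \<in> S \<Longrightarrow> y \<in> S \<Longrightarrow> eqv x y \<Longrightarrow> eqv y x"
  unfolding eqv_def using nrm_diff_commute S_closed by simp
lemma eqv_trans: "x \<in> S \<Longrightarrow> y \<in> S \<Longrightarrow> z \<in> S \<Longrightarrow> eqv x y \<Longrightarrow> eqv y z \<Longrightarrow> eqv x z"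
  using tendsto_add[of "\<lambda>n. nrm B (x n \<ominus> y n)" 0 F "\<lambda>n. nrm B (y n \<ominus> z n)" 0]
  by (intro eqv_squeeze[of "\<lambda>n. nrm B (x n \<ominus> y n) + nrm B (y n \<ominus> z n)"])
    (auto simp: eqv_def S_closed nrm_diff_triangle)

lemma cl_eq: assumes x: "x \<in> S" shows "cl x = {y \<in> S. eqv y x}"
proof -
  have "cl x = {y. \<exists>j\<in>J. y = (\<lambda>n. j n \<oplus> x n)}"
    by (auto simp: cl_def a_r_coset_def r_coset_def R_def linf_def)
  also have "\<dots> = {y \<in> S. eqv y x}"
  proof (intro subset_antisym subsetI)
    fix y assume "y \<in> {y. \<exists>j\<in>J. y = (\<lambda>n. j n \<oplus> x n)}"
    then obtain j where j: "j \<in> J" "y = (\<lambda>n. j n \<oplus> x n)" by auto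
    have "j n \<oplus> x n \<ominus> x n = j n" for n
      using S_closed[OF x, of n] S_closed[of j n] j J_S by (auto simp: a_minus_def M.a_assoc M.r_neg)
    then show "y \<in> {y \<in> S. eqv y x}" using j J_S x J_lim[OF j(1)] by (auto simp: eqv_def intro: S_add)
  next
    fix y assume y: "y \<in> {y \<in> S. eqv y x}"
    have "(\<lambda>n. y n \<ominus> x n) \<in> S" using y x by (auto intro: S_diff)
    then have "(\<lambda>n. y n \<ominus> x n) \<in> J" using y S_sub by (auto simp: J_def null_seqs_def eqv_def)
    moreover have "y n = (y n \<ominus> x n) \<oplus> x n" for n
      using y S_closed[OF x, of n] S_closed[of y n] by (auto simp: a_minus_def M.a_assoc M.l_neg)
    ultimately show "y \<in> {y. \<exists>j\<in>J. y = (\<lambda>n. j n \<oplus> x n)}" by (auto intro!: bexI[of _ "\<lambda>n. y n \<ominus> x n"])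
  qed
  finally show ?thesis .
qed

lemma cl_self: "x \<in> S \<Longrightarrow> x \<in> cl x" by (simp add: cl_eq eqv_refl)
lemma cl_eqI: "x \<in> S \<Longrightarrow> y \<in> S \<Longrightarrow> eqv x y \<Longrightarrow> cl x = cl y"
  by (auto simp: cl_eq intro: eqv_trans eqv_sym)
lemma cl_eqD: "x \<in> S \<Longrightarrow> y \<in> S \<Longrightarrow> cl x = cl y \<Longrightarrow> eqv x y"
  using cl_self[of x] by (auto simp: cl_eq)

lemma carrier_Q: "carrier Q = cl ` S"
  by (auto simp: Q_def quotient_alg_def A_RCOSETS_def RCOSETS_def cl_def a_r_coset_def R_def)
lemma cl_closed: "x \<in> S \<Longrightarrow> cl x \<in> carrier Q" by (simp add: carrier_Q)

lemma eqv_add: "x \<in> S \<Longrightarrow> y \<in> S \<Longrightarrow> x' \<in> S \<Longrightarrow> y' \<in> S \<Longrightarrow> eqv x x' \<Longrightarrow> eqv y y' \<Longrightarrow>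
  eqv (\<lambda>n. x n \<oplus> y n) (\<lambda>n. x' n \<oplus> y' n)"
  using tendsto_add[of "\<lambda>n. nrm B (x n \<ominus> x' n)" 0 F "\<lambda>n. nrm B (y n \<ominus> y' n)" 0]
  by (intro eqv_squeeze[of "\<lambda>n. nrm B (x n \<ominus> x' n) + nrm B (y n \<ominus> y' n)"])
    (auto simp: eqv_def S_closed add_diff_add intro: nrm_triangle)

lemma eqv_mult:
  assumes S: "x \<in> S" "y \<in> S" "x' \<in> S" "y' \<in> S" and e: "eqv x x'" "eqv y y'"
  shows "eqv (\<lambda>n. x n \<otimes> y n) (\<lambda>n. x' n \<otimes> y' n)"
proof -
  obtain K where K: "K > 0" "\<And>n. nrm B (y n) \<le> K" using S_bounded[OF S(2)] by blast
  obtain L where L: "L > 0" "\<And>n. nrm B (x' n) \<le> L" using S_bounded[OF S(3)] by blast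
  show ?thesis
  proof (rule eqv_squeeze)
    have "((\<lambda>n. nrm B (x n \<ominus> x' n) * K + L * nrm B (y n \<ominus> y' n)) \<longlongrightarrow> 0 * K + L * 0) F"
      using e unfolding eqv_def by (intro tendsto_intros)
    then show "((\<lambda>n. nrm B (x n \<ominus> x' n) * K + L * nrm B (y n \<ominus> y' n)) \<longlongrightarrow> 0) F" by simp
    fix n
    note c = S_closed[OF S(1), of n] S_closed[OF S(2), of n] S_closed[OF S(3), of n] S_closed[OF S(4), of n]
    have "x n \<otimes> y n \<ominus> x' n \<otimes> y' n = (x n \<ominus> x' n) \<otimes> y n \<oplus> x' n \<otimes> (y n \<ominus> y' n)"
      using c by (simp add: mult_diff_left mult_diff_right mult_closed)
        (simp add: a_minus_def M.a_assoc mult_closed M.r_neg1)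
    then have "nrm B (x n \<otimes> y n \<ominus> x' n \<otimes> y' n) \<le> nrm B (x n \<ominus> x' n) * nrm B (y n) + nrm B (x' n) * nrm B (y n \<ominus> y' n)"
      using c nrm_triangle[of "(x n \<ominus> x' n) \<otimes> y n" "x' n \<otimes> (y n \<ominus> y' n)"]
        nrm_mult[of "x n \<ominus> x' n" "y n"] nrm_mult[of "x' n" "y n \<ominus> y' n"] by (simp add: mult_closed)
    also have "\<dots> \<le> nrm B (x n \<ominus> x' n) * K + L * nrm B (y n \<ominus> y' n)"
      using c K L by (intro add_mono mult_left_mono mult_right_mono nrm_ge0) auto
    finally show "nrm B (x n \<otimes> y n \<ominus> x' n \<otimes> y' n) \<le> nrm B (x n \<ominus> x' n) * K + L * nrm B (y n \<ominus> y' n)" .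
  qed (use S in \<open>auto intro: S_closed mult_closed\<close>)
qed

lemma coset_map_cl:
  assumes T: "\<And>y. y \<in> S \<Longrightarrow> T y \<in> S" and e: "\<And>y. y \<in> S \<Longrightarrow> eqv y x \<Longrightarrow> eqv (T y) (T x)" and x: "x \<in> S"
  shows "coset_map R J T (cl x) = cl (T x)"
proof -
  have "J +>\<^bsub>R\<^esub> T y = cl (T x)" if "y \<in> cl x" for y
  proof -
    have "y \<in> S" "eqv y x" using that by (simp_all add: cl_eq[OF x])
    then have "cl (T y) = cl (T x)" using x T e by (intro cl_eqI) auto
    then show ?thesis by (simp add: cl_def)
  qed
  then show ?thesis using cl_self[OF x] by (auto simp: coset_map_def)
qed

lemma Q_simps:
  "add Q = set_add R" "monoid.mult Q = rcoset_mult R J" "smult Q = (\<lambda>c. coset_map R J (smult R c))"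
  "star Q = coset_map R J (star R)" "zero Q = J" "nrm Q X = (INF x\<in>X. nrm R x)"
  "add R = (\<lambda>x y n. x n \<oplus> y n)" "monoid.mult R = (\<lambda>x y n. x n \<otimes> y n)" "smult R = (\<lambda>c x n. c \<odot> x n)"
  "star R = (\<lambda>x n. star B (x n))" "nrm R = (\<lambda>x. SUP n. nrm B (x n))"
  by (auto simp: Q_def quotient_alg_def R_def linf_def)

lemma cl_add: assumes S: "x \<in> S" "y \<in> S" shows "cl x \<oplus>\<^bsub>Q\<^esub> cl y = cl (\<lambda>n. x n \<oplus> y n)"
proof -
  have "set_add R (cl x) (cl y) = {z. \<exists>a\<in>cl x. \<exists>b\<in>cl y. z = (\<lambda>n. a n \<oplus> b n)}"
    by (auto simp: set_add_def set_mult_def Q_simps)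
  also have "\<dots> = cl (\<lambda>n. x n \<oplus> y n)"
  proof (intro subset_antisym subsetI)
    fix z assume "z \<in> {z. \<exists>a\<in>cl x. \<exists>b\<in>cl y. z = (\<lambda>n. a n \<oplus> b n)}"
    then show "z \<in> cl (\<lambda>n. x n \<oplus> y n)"
      using S by (auto simp: cl_eq S_add intro!: eqv_add)
  next
    fix z assume "z \<in> cl (\<lambda>n. x n \<oplus> y n)"
    then have z: "z \<in> S" "eqv z (\<lambda>n. x n \<oplus> y n)" using S by (auto simp: cl_eq S_add)
    have "z n = x n \<oplus> (z n \<ominus> x n)" for n
      using S_closed[OF z(1), of n] S_closed[OF S(1), of n] M.a_lcomm[of "x n" "z n" "\<ominus> x n"]
      by (simp add: a_minus_def M.r_neg)
    moreover have "(z n \<ominus> x n) \<ominus> y n = z n \<ominus> (x n \<oplus> y n)" for n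
      using S_closed[OF z(1), of n] S_closed[OF S(1), of n] S_closed[OF S(2), of n]
      by (simp add: a_minus_def M.minus_add M.a_ac)
    ultimately have eq: "\<And>n. z n = x n \<oplus> (z n \<ominus> x n)" "\<And>n. (z n \<ominus> x n) \<ominus> y n = z n \<ominus> (x n \<oplus> y n)" by blast+
    have "(\<lambda>n. z n \<ominus> x n) \<in> cl y" using S z by (auto simp: cl_eq S_diff eqv_def eq(2))
    then show "z \<in> {z. \<exists>a\<in>cl x. \<exists>b\<in>cl y. z = (\<lambda>n. a n \<oplus> b n)}"
    proof -
      have "z = (\<lambda>n. x n \<oplus> (z n \<ominus> x n))" by (rule ext) (rule eq(1))
      then show ?thesis using \<open>(\<lambda>n. z n \<ominus> x n) \<in> cl y\<close> cl_self[OF S(1)]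
        by (intro CollectI bexI[of _ x] bexI[of _ "\<lambda>n. z n \<ominus> x n"])
    qed
  qed
  finally show ?thesis by (simp add: Q_simps)
qed

lemma cl_mult: assumes S: "x \<in> S" "y \<in> S" shows "cl x \<otimes>\<^bsub>Q\<^esub> cl y = cl (\<lambda>n. x n \<otimes> y n)"
proof -
  have "J +>\<^bsub>R\<^esub> (\<lambda>n. a n \<otimes> b n) = cl (\<lambda>n. x n \<otimes> y n)" if "a \<in> cl x" "b \<in> cl y" for a b
    using that S unfolding cl_def[symmetric] by (intro cl_eqI eqv_mult S_mult) (auto simp: cl_eq)
  then show ?thesis using cl_self[OF S(1)] cl_self[OF S(2)]
    by (auto simp: Q_simps rcoset_mult_def)
qed

lemma cl_smult: assumes S: "x \<in> S" shows "c \<odot>\<^bsub>Q\<^esub> cl x = cl (\<lambda>n. c \<odot> x n)"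
  unfolding Q_simps
proof (rule coset_map_cl[where T = "\<lambda>x n. c \<odot> x n"])
  fix y assume y: "y \<in> S" "eqv y x"
  have "c \<odot> y n \<ominus> c \<odot> x n = c \<odot> (y n \<ominus> x n)" for n
    using S_closed[OF y(1), of n] S_closed[OF S, of n] by (simp add: a_minus_def sm_radd sm_minus)
  then have "nrm B (c \<odot> y n \<ominus> c \<odot> x n) = cmod c * nrm B (y n \<ominus> x n)" for n
    using S_closed[OF y(1), of n] S_closed[OF S, of n] by (simp add: nrm_smult)
  then show "eqv (\<lambda>n. c \<odot> y n) (\<lambda>n. c \<odot> x n)"
    using y tendsto_mult_right_zero[of "\<lambda>n. nrm B (y n \<ominus> x n)" F "cmod c"] by (simp add: eqv_def)
qed (use S in \<open>auto intro: S_smult\<close>)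

lemma cl_star: assumes S: "x \<in> S" shows "star Q (cl x) = cl (\<lambda>n. star B (x n))"
  unfolding Q_simps
proof (rule coset_map_cl[where T = "\<lambda>x n. star B (x n)"])
  fix y assume y: "y \<in> S" "eqv y x"
  have "nrm B (star B (y n) \<ominus> star B (x n)) = nrm B (y n \<ominus> x n)" for n
    using S_closed[OF y(1), of n] S_closed[OF S, of n] nrm_star[of "y n \<ominus> x n"]
    by (simp add: a_minus_def star_add star_minus)
  then show "eqv (\<lambda>n. star B (y n)) (\<lambda>n. star B (x n))" using y by (simp add: eqv_def)
qed (use S in \<open>auto intro: S_star\<close>)

lemma cl_zero: "\<zero>\<^bsub>Q\<^esub> = cl (\<lambda>n. \<zero>)"
proof -
  have "J \<subseteq> S" by (rule J_S)
  have "y \<in> S \<Longrightarrow> eqv y (\<lambda>n. \<zero>) \<longleftrightarrow> y \<in> J" for y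
    using S_sub S_closed[of y] by (auto simp: eqv_def diff_zero J_def null_seqs_def)
  then show ?thesis using J_S by (auto simp: Q_simps cl_eq zero_S)
qed

lemma tendsto_nrm_eqv:
  assumes S: "x \<in> S" "y \<in> S" and e: "eqv x y" and l: "((\<lambda>n. nrm B (x n)) \<longlongrightarrow> L) F"
  shows "((\<lambda>n. nrm B (y n)) \<longlongrightarrow> L) F"
proof -
  have "((\<lambda>n. nrm B (y n) - nrm B (x n)) \<longlongrightarrow> 0) F"
  proof (rule tendsto_0_le[where K = 1])
    show "((\<lambda>n. nrm B (x n \<ominus> y n)) \<longlongrightarrow> 0) F" using e by (simp add: eqv_def)
    show "\<forall>\<^sub>F n in F. norm (nrm B (y n) - nrm B (x n)) \<le> norm (nrm B (x n \<ominus> y n)) * 1"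
      using nrm_diff_ge S_closed S nrm_ge0 by (intro always_eventually) (simp add: abs_minus_commute)
  qed
  then have "((\<lambda>n. (nrm B (y n) - nrm B (x n)) + nrm B (x n)) \<longlongrightarrow> 0 + L) F" by (intro tendsto_add l)
  then show ?thesis by simp
qed

text \<open>The norms of all representatives have the same limit \<open>L\<close>, which is at most their supremum.
  Conversely, replacing \<open>x n\<close> by 0 wherever its norm exceeds \<open>L + e\<close> does not change the class.\<close>
lemma nrm_cl: assumes S: "x \<in> S" shows "((\<lambda>n. nrm B (x n)) \<longlongrightarrow> nrm Q (cl x)) F"
proof -
  obtain L where L: "((\<lambda>n. nrm B (x n)) \<longlongrightarrow> L) F" using S_lim[OF S] by blast
  have bdd: "bdd_above (range (\<lambda>n. nrm B (y n)))" if "y \<in> S" for y using that S_sub by (auto simp: linf_def)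
  have lower: "L \<le> nrm R y" if "y \<in> cl x" for y
  proof -
    have y: "y \<in> S" "eqv x y" using that S by (auto simp: cl_eq intro: eqv_sym)
    show ?thesis
      unfolding Q_simps
      by (rule tendsto_upperbound[OF tendsto_nrm_eqv[OF S y L] _ F])
        (use bdd[OF y(1)] in \<open>auto intro!: always_eventually cSUP_upper\<close>)
  qed
  have L0: "L \<ge> 0"
    by (rule tendsto_lowerbound[OF L _ F]) (use S in \<open>auto intro!: always_eventually nrm_ge0 S_closed\<close>)
  have "nrm Q (cl x) = L"
  proof (rule antisym)
    show "L \<le> nrm Q (cl x)" unfolding Q_simps(6)
      using cl_self[OF S] lower by (intro cINF_greatest) auto
    show "nrm Q (cl x) \<le> L"
    proof (rule field_le_epsilon)
      fix e :: real assume e: "e > 0"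
      define P where "P n \<longleftrightarrow> nrm B (x n) < L + e" for n
      have P: "eventually P F" unfolding P_def using L e by (intro order_tendstoD(2)) auto
      define y where "y n = (if P n then x n else \<zero>)" for n
      have y: "y \<in> S" unfolding y_def using S_cut[OF S P] by (simp add: fun_eq_iff)
      have "eqv y x"
        unfolding eqv_def
      proof (rule tendsto_eventually)
        show "\<forall>\<^sub>F n in F. nrm B (y n \<ominus> x n) = 0"
          using P S_closed[OF S] by (auto elim!: eventually_mono simp: y_def a_minus_def M.r_neg nrm_zero)
      qed
      then have yc: "y \<in> cl x" using y S by (simp add: cl_eq)
      have "bdd_below (nrm R ` cl x)" using lower by (auto simp: bdd_below_def)
      then have "nrm Q (cl x) \<le> nrm R y" unfolding Q_simps(6) using yc by (intro cINF_lower)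
      also have "\<dots> \<le> L + e" unfolding Q_simps
        by (rule cSUP_least) (use e L0 in \<open>auto simp: y_def P_def nrm_zero\<close>)
      finally show "nrm Q (cl x) \<le> L + e" .
    qed
  qed
  then show ?thesis using L by simp
qed

lemma nrm_cl_eqI: "x \<in> S \<Longrightarrow> ((\<lambda>n. nrm B (x n)) \<longlongrightarrow> L) F \<Longrightarrow> nrm Q (cl x) = L"
  using tendsto_unique[OF F nrm_cl] by blast

lemma nrm_cl_le: "x \<in> S \<Longrightarrow> eventually (\<lambda>n. nrm B (x n) \<le> K) F \<Longrightarrow> nrm Q (cl x) \<le> K"
  by (rule tendsto_upperbound[OF nrm_cl _ F])

lemma cl_cases: "X \<in> carrier Q \<Longrightarrow> (\<And>x. x \<in> S \<Longrightarrow> X = cl x \<Longrightarrow> P) \<Longrightarrow> P"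
  by (auto simp: carrier_Q)

lemma abelian_group_Q: "abelian_group Q"
proof (rule abelian_groupI)
  fix x assume "x \<in> carrier Q"
  then obtain u where u: "u \<in> S" "x = cl u" by (rule cl_cases)
  have "cl (\<lambda>n. \<ominus> u n) \<oplus>\<^bsub>Q\<^esub> x = \<zero>\<^bsub>Q\<^esub>"
    using u S_closed[OF u(1)] by (simp add: cl_add S_neg cl_zero M.l_neg)
  then show "\<exists>y\<in>carrier Q. y \<oplus>\<^bsub>Q\<^esub> x = \<zero>\<^bsub>Q\<^esub>" using u by (auto intro!: bexI cl_closed S_neg)
next
  fix x y assume "x \<in> carrier Q" "y \<in> carrier Q"
  then obtain u v where u: "u \<in> S" "x = cl u" and v: "v \<in> S" "y = cl v" by (auto elim!: cl_cases)
  have "(\<lambda>n. u n \<oplus> v n) = (\<lambda>n. v n \<oplus> u n)" using u v by (simp add: S_closed M.a_comm)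
  then show "x \<oplus>\<^bsub>Q\<^esub> y = y \<oplus>\<^bsub>Q\<^esub> x" using u v by (simp add: cl_add)
qed (auto elim!: cl_cases simp: cl_add cl_zero zero_S S_add S_closed M.a_assoc intro!: cl_closed S_add zero_S)

lemma pre_cstar_Q: "pre_cstar Q"
proof (intro pre_cstar.intro pre_cstar_axioms.intro moduleI)
  fix x y assume "x \<in> carrier Q" "y \<in> carrier Q"
  then obtain u v where u: "u \<in> S" "x = cl u" and v: "v \<in> S" "y = cl v" by (auto elim!: cl_cases)
  show "nrm Q (x \<oplus>\<^bsub>Q\<^esub> y) \<le> nrm Q x + nrm Q y"
    using u v S_closed[OF u(1)] S_closed[OF v(1)]
    by (auto simp: cl_add intro!: tendsto_le[OF F tendsto_add[OF nrm_cl nrm_cl] nrm_cl] S_add always_eventually nrm_triangle)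
  show "nrm Q (x \<otimes>\<^bsub>Q\<^esub> y) \<le> nrm Q x * nrm Q y"
    using u v S_closed[OF u(1)] S_closed[OF v(1)]
    by (auto simp: cl_mult intro!: tendsto_le[OF F tendsto_mult[OF nrm_cl nrm_cl] nrm_cl] S_mult always_eventually nrm_mult)
next
  fix x assume "x \<in> carrier Q"
  then obtain u where u: "u \<in> S" "x = cl u" by (auto elim!: cl_cases)
  note uc = S_closed[OF u(1)]
  show "nrm Q (star Q x \<otimes>\<^bsub>Q\<^esub> x) = (nrm Q x)\<^sup>2"
    using u uc tendsto_power[OF nrm_cl[OF u(1)], of 2]
    by (auto simp: cl_mult cl_star S_star S_mult cstar_identity intro!: nrm_cl_eqI)
  show "(nrm Q x = 0) = (x = \<zero>\<^bsub>Q\<^esub>)"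
  proof
    assume "x = \<zero>\<^bsub>Q\<^esub>"
    then show "nrm Q x = 0" by (auto simp: cl_zero nrm_zero intro!: nrm_cl_eqI zero_S)
  next
    assume "nrm Q x = 0"
    then have "eqv u (\<lambda>n. \<zero>)" using u uc nrm_cl[OF u(1)] by (simp add: eqv_def diff_zero)
    then show "x = \<zero>\<^bsub>Q\<^esub>" unfolding u(2) cl_zero by (intro cl_eqI u zero_S)
  qed
  show "nrm Q (c \<odot>\<^bsub>Q\<^esub> x) = cmod c * nrm Q x" for c
    using u uc tendsto_mult_left[OF nrm_cl[OF u(1)], of "cmod c"]
    by (auto simp: cl_smult nrm_smult S_smult intro!: nrm_cl_eqI)
qed (auto elim!: cl_cases simp: cl_add cl_mult cl_smult cl_star S_add S_mult S_smult S_star S_closed mult_closed sm_closed star_closed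
    mult_assoc distrib_left distrib_right smult_mult_left smult_mult_right star_star star_add star_smult star_mult
    sm_radd complex_ring_def sm_add sm_assoc sm_one
    intro!: cl_closed abelian_group_Q cring_complex_ring[unfolded complex_ring_def])

sublocale Q: pre_cstar Q by (rule pre_cstar_Q)

lemma cl_neg: "x \<in> S \<Longrightarrow> \<ominus>\<^bsub>Q\<^esub> cl x = cl (\<lambda>n. \<ominus> x n)"
  using Q.sm_minus1[OF cl_closed, of x] by (simp add: cl_smult sm_minus1 S_closed)
lemma cl_diff: "x \<in> S \<Longrightarrow> y \<in> S \<Longrightarrow> cl x \<ominus>\<^bsub>Q\<^esub> cl y = cl (\<lambda>n. x n \<ominus> y n)"
  by (simp add: a_minus_def cl_neg cl_add S_neg)

lemma finsum_S: "finite I \<Longrightarrow> (\<And>i. i \<in> I \<Longrightarrow> f i \<in> S) \<Longrightarrow> (\<lambda>n. finsum B (\<lambda>i. f i n) I) \<in> S"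
  by (induction I rule: finite_induct) (auto simp: zero_S S_closed Pi_iff intro!: S_add)

lemma cl_finsum:
  "finite I \<Longrightarrow> (\<And>i. i \<in> I \<Longrightarrow> f i \<in> S) \<Longrightarrow> finsum Q (\<lambda>i. cl (f i)) I = cl (\<lambda>n. finsum B (\<lambda>i. f i n) I)"
proof (induction I rule: finite_induct)
  case empty show ?case by (simp add: cl_zero)
next
  case (insert i I)
  then show ?case by (simp add: cl_closed Pi_iff cl_add finsum_S S_closed)
qed

end

section \<open>Ultrapowers\<close>

text \<open>Compactness provides a cluster point along the filter, and an ultrafilter converges to its cluster
  points.\<close>
lemma ultrafilter_lim:
  fixes f :: "nat \<Rightarrow> real"
  assumes bot: "\<omega> \<noteq> bot" and ultra: "\<And>P. eventually P \<omega> \<or> eventually (\<lambda>n. \<not> P n) \<omega>"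
    and bd: "\<And>n. \<bar>f n\<bar> \<le> K"
  shows "\<exists>L. (f \<longlongrightarrow> L) \<omega>"
proof -
  have "compact {-K..K}" by simp
  moreover have "filtermap f \<omega> \<noteq> bot" using bot by (simp add: filtermap_bot_iff)
  moreover have "eventually (\<lambda>x. x \<in> {-K..K}) (filtermap f \<omega>)"
    using bd by (auto simp: eventually_filtermap abs_le_iff minus_le_iff intro!: always_eventually)
  ultimately obtain L where L: "inf (nhds L) (filtermap f \<omega>) \<noteq> bot" unfolding compact_filter by blast
  have "(f \<longlongrightarrow> L) \<omega>"
  proof (rule topological_tendstoI)
    fix T assume T: "open T" "L \<in> T"
    show "eventually (\<lambda>n. f n \<in> T) \<omega>"
    proof (rule ccontr)
      assume "\<not> ?thesis"
      then have "eventually (\<lambda>n. f n \<notin> T) \<omega>" using ultra[of "\<lambda>n. f n \<in> T"] by blast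
      then have "eventually (\<lambda>x. x \<notin> T) (filtermap f \<omega>)" by (simp add: eventually_filtermap)
      moreover have "eventually (\<lambda>x. x \<in> T) (nhds L)" using T by (rule eventually_nhds_in_open)
      ultimately have "eventually (\<lambda>x. False) (inf (nhds L) (filtermap f \<omega>))"
        unfolding eventually_inf by (intro exI[of _ "\<lambda>x. x \<in> T"] exI[of _ "\<lambda>x. x \<notin> T"]) auto
      then show False using L by (simp add: trivial_limit_def)
    qed
  qed
  then show ?thesis by blast
qed

lemma (in pre_cstar) seq_quot_ultra:
  assumes "free_ultrafilter \<omega>"
  shows "seq_quot A \<omega> (carrier (linf A))"
proof -
  have bdI: "x \<in> carrier (linf A)" if "\<And>n. x n \<in> carrier A" "\<And>n. nrm A (x n) \<le> K" for x K
    using that by (auto simp: linf_def bdd_above_def)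
  have bdE: "(\<forall>n. x n \<in> carrier A) \<and> (\<exists>K. \<forall>n. nrm A (x n) \<le> K)" if "x \<in> carrier (linf A)" for x
    using that by (auto simp: linf_def bdd_above_def)
  have u: "\<omega> \<noteq> bot" "\<And>P. eventually P \<omega> \<or> eventually (\<lambda>n. \<not> P n) \<omega>"
    using assms by (auto simp: free_ultrafilter_def)
  show ?thesis
  proof
    show "\<omega> \<noteq> bot" by (rule u)
    show "null_seqs \<omega> A \<subseteq> carrier (linf A)" by (auto simp: null_seqs_def)
    fix x y assume x: "x \<in> carrier (linf A)" and y: "y \<in> carrier (linf A)"
    obtain K where K: "\<And>n. x n \<in> carrier A" "\<And>n. nrm A (x n) \<le> K" using bdE[OF x] by blast
    obtain L where L: "\<And>n. y n \<in> carrier A" "\<And>n. nrm A (y n) \<le> L" using bdE[OF y] by blast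
    show "(\<lambda>n. x n \<oplus> y n) \<in> carrier (linf A)"
      by (rule bdI[of _ "K + L"]) (use K L in simp, rule order_trans[OF nrm_triangle add_mono], use K L in auto)
    have K0: "0 \<le> K" using K nrm_ge0 order_trans by blast
    show "(\<lambda>n. x n \<otimes> y n) \<in> carrier (linf A)"
      by (rule bdI[of _ "K * L"]) (use K L K0 in \<open>auto intro!: order_trans[OF nrm_mult] mult_mono mult_closed nrm_ge0\<close>)
  next
    fix x assume x: "x \<in> carrier (linf A)"
    obtain K where K: "\<And>n. x n \<in> carrier A" "\<And>n. nrm A (x n) \<le> K" using bdE[OF x] by blast
    have K0: "0 \<le> K" using K nrm_ge0 order_trans by blast
    show "(\<lambda>n. c \<odot> x n) \<in> carrier (linf A)" for c
      by (rule bdI[of _ "cmod c * K"]) (use K in \<open>auto simp: nrm_smult sm_closed intro: mult_left_mono\<close>)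
    show "(\<lambda>n. star A (x n)) \<in> carrier (linf A)"
      by (rule bdI[of _ K]) (use K in \<open>auto simp: nrm_star star_closed\<close>)
    show "(\<lambda>n. if P n then x n else \<zero>) \<in> carrier (linf A)" for P
      by (rule bdI[of _ K]) (use K K0 in \<open>auto simp: nrm_zero\<close>)
    show "\<exists>L. ((\<lambda>n. nrm A (x n)) \<longlongrightarrow> L) \<omega>"
      by (rule ultrafilter_lim[OF u, of _ K]) (use K nrm_ge0 in auto)
  qed simp
qed

section \<open>Completions\<close>

lemma (in pre_cstar) cauchy_bounded:
  assumes "cauchy_in A x" shows "\<exists>K>0. \<forall>n. nrm A (x n) \<le> K"
proof -
  have c: "\<And>n. x n \<in> carrier A" using assms by (simp add: cauchy_in_def)
  have "\<exists>N. \<forall>m\<ge>N. \<forall>n\<ge>N. nrm A (x m \<ominus> x n) < 1"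
    using assms unfolding cauchy_in_def by (meson zero_less_one)
  then obtain N where N: "\<forall>m\<ge>N. \<forall>n\<ge>N. nrm A (x m \<ominus> x n) < 1" by blast
  define K where "K = Max (nrm A ` x ` {..N}) + 1"
  have K: "nrm A (x n) \<le> K - 1" if "n \<le> N" for n
    using that unfolding K_def by (simp add: Max_ge)
  have "nrm A (x n) \<le> K" for n
  proof (cases "n \<le> N")
    case True then show ?thesis using K by fastforce
  next
    case False
    then have "nrm A (x n \<ominus> x N) < 1" using N by simp
    moreover have "nrm A (x n) - nrm A (x N) \<le> nrm A (x n \<ominus> x N)" using nrm_diff_ge[of "x n" "x N"] c by simp
    ultimately show ?thesis using K[of N] by simp
  qed
  moreover have "K > 0" using K[of N] nrm_ge0[OF c[of N]] by simp
  ultimately show ?thesis by blast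
qed

lemma (in pre_cstar) cauchyI:
  assumes c: "\<And>n. y n \<in> carrier A" and x: "cauchy_in A x" and K: "K > 0"
    and b: "\<And>m n. N0 \<le> m \<Longrightarrow> N0 \<le> n \<Longrightarrow> nrm A (y m \<ominus> y n) \<le> K * nrm A (x m \<ominus> x n)"
  shows "cauchy_in A y"
  unfolding cauchy_in_def
proof (intro conjI allI impI)
  fix e :: real assume e: "e > 0"
  then have "e / K > 0" using K by simp
  then obtain N where N: "\<forall>m\<ge>N. \<forall>n\<ge>N. nrm A (x m \<ominus> x n) < e / K"
    using x unfolding cauchy_in_def by blast
  show "\<exists>N. \<forall>m\<ge>N. \<forall>n\<ge>N. nrm A (y m \<ominus> y n) < e"
  proof (intro exI[of _ "max N N0"] allI impI)
    fix m n assume mn: "max N N0 \<le> m" "max N N0 \<le> n"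
    then have "nrm A (y m \<ominus> y n) \<le> K * nrm A (x m \<ominus> x n)" by (intro b) auto
    also have "\<dots> < K * (e / K)" using N mn K by (intro mult_strict_left_mono) auto
    finally show "nrm A (y m \<ominus> y n) < e" using K by simp
  qed
qed (rule c)

lemma (in pre_cstar) seq_quot_completion:
  "seq_quot A sequentially {x. cauchy_in A x}"
proof
  show "{x. cauchy_in A x} \<subseteq> carrier (linf A)"
  proof
    fix x assume "x \<in> {x. cauchy_in A x}"
    then have "cauchy_in A x" by simp
    from cauchy_bounded[OF this] this show "x \<in> carrier (linf A)"
      by (auto simp: linf_def bdd_above_def cauchy_in_def)
  qed
  show "null_seqs sequentially A \<subseteq> {x. cauchy_in A x}"
  proof
    fix x assume "x \<in> null_seqs sequentially A"
    then have c: "\<And>n. x n \<in> carrier A" and l: "(\<lambda>n. nrm A (x n)) \<longlonglongrightarrow> 0" by (auto simp: null_seqs_def linf_def)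
    have "\<exists>N. \<forall>m\<ge>N. \<forall>n\<ge>N. nrm A (x m \<ominus> x n) < e" if e: "e > 0" for e
    proof -
      have "eventually (\<lambda>n. nrm A (x n) < e / 2) sequentially" using l e by (intro order_tendstoD(2)) auto
      then obtain N where N: "\<And>n. n \<ge> N \<Longrightarrow> nrm A (x n) < e / 2" by (auto simp: eventually_sequentially)
      have "nrm A (x m \<ominus> x n) < e" if "m \<ge> N" "n \<ge> N" for m n
        using nrm_diff[OF c[of m] c[of n]] N[OF that(1)] N[OF that(2)] by simp
      then show ?thesis by blast
    qed
    then show "x \<in> {x. cauchy_in A x}" using c by (simp add: cauchy_in_def)
  qed
  fix x y assume x: "x \<in> {x. cauchy_in A x}" and y: "y \<in> {x. cauchy_in A x}"
  have c: "x n \<in> carrier A" "y n \<in> carrier A" for n using x y by (auto simp: cauchy_in_def)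
  have comb: "cauchy_in A z" if z: "\<And>n. z n \<in> carrier A" and K: "K > 0" "L > 0"
    and b: "\<And>m n. nrm A (z m \<ominus> z n) \<le> K * nrm A (x m \<ominus> x n) + L * nrm A (y m \<ominus> y n)" for z K L
    unfolding cauchy_in_def
  proof (intro conjI allI impI)
    fix e :: real assume e: "e > 0"
    have "e / (2 * K) > 0" "e / (2 * L) > 0" using e K by auto
    obtain N where N: "\<forall>m\<ge>N. \<forall>n\<ge>N. nrm A (x m \<ominus> x n) < e / (2 * K)"
      using x \<open>e / (2 * K) > 0\<close> unfolding cauchy_in_def by blast
    obtain M where M: "\<forall>m\<ge>M. \<forall>n\<ge>M. nrm A (y m \<ominus> y n) < e / (2 * L)"
      using y \<open>e / (2 * L) > 0\<close> unfolding cauchy_in_def by blast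
    show "\<exists>N. \<forall>m\<ge>N. \<forall>n\<ge>N. nrm A (z m \<ominus> z n) < e"
    proof (intro exI[of _ "max N M"] allI impI)
      fix m n assume mn: "max N M \<le> m" "max N M \<le> n"
      have "K * nrm A (x m \<ominus> x n) < K * (e / (2 * K))" using N mn K by (intro mult_strict_left_mono) auto
      moreover have "L * nrm A (y m \<ominus> y n) < L * (e / (2 * L))" using M mn K by (intro mult_strict_left_mono) auto
      ultimately show "nrm A (z m \<ominus> z n) < e" using b[of m n] K by simp
    qed
  qed (rule z)
  show "(\<lambda>n. x n \<oplus> y n) \<in> {x. cauchy_in A x}"
    using c by (auto simp: add_diff_add intro!: comb[of _ 1 1] nrm_triangle)
  obtain K where K: "K > 0" "\<And>n. nrm A (y n) \<le> K" using cauchy_bounded y by blast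
  obtain L where L: "L > 0" "\<And>n. nrm A (x n) \<le> L" using cauchy_bounded x by blast
  have "cauchy_in A (\<lambda>n. x n \<otimes> y n)"
  proof (rule comb[of _ K L])
    fix m n
    have "x m \<otimes> y m \<ominus> x n \<otimes> y n = (x m \<ominus> x n) \<otimes> y m \<oplus> x n \<otimes> (y m \<ominus> y n)"
      using c by (simp add: mult_diff_left mult_diff_right mult_closed)
        (simp add: a_minus_def M.a_assoc mult_closed M.r_neg1)
    then have "nrm A (x m \<otimes> y m \<ominus> x n \<otimes> y n) \<le> nrm A (x m \<ominus> x n) * nrm A (y m) + nrm A (x n) * nrm A (y m \<ominus> y n)"
      using c nrm_triangle[of "(x m \<ominus> x n) \<otimes> y m" "x n \<otimes> (y m \<ominus> y n)"]
        nrm_mult[of "x m \<ominus> x n" "y m"] nrm_mult[of "x n" "y m \<ominus> y n"] by (simp add: mult_closed)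
    also have "\<dots> \<le> nrm A (x m \<ominus> x n) * K + L * nrm A (y m \<ominus> y n)"
      using c K L by (intro add_mono mult_left_mono mult_right_mono nrm_ge0) auto
    finally show "nrm A (x m \<otimes> y m \<ominus> x n \<otimes> y n) \<le> K * nrm A (x m \<ominus> x n) + L * nrm A (y m \<ominus> y n)"
      by (simp add: mult.commute)
  qed (use c K L in \<open>auto intro: mult_closed\<close>)
  then show "(\<lambda>n. x n \<otimes> y n) \<in> {x. cauchy_in A x}" by simp
next
  fix x assume x: "x \<in> {x. cauchy_in A x}"
  then have c: "x n \<in> carrier A" and xc: "cauchy_in A x" for n by (auto simp: cauchy_in_def)
  have "nrm A (cc \<odot> x m \<ominus> cc \<odot> x n) \<le> (cmod cc + 1) * nrm A (x m \<ominus> x n)" for cc m n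
  proof -
    have "cc \<odot> x m \<ominus> cc \<odot> x n = cc \<odot> (x m \<ominus> x n)" using c by (simp add: a_minus_def sm_radd sm_minus)
    then show ?thesis using c nrm_ge0[of "x m \<ominus> x n"] by (simp add: nrm_smult algebra_simps)
  qed
  then show "(\<lambda>n. cc \<odot> x n) \<in> {x. cauchy_in A x}" for cc
    using c xc by (auto intro!: cauchyI[of _ x "cmod cc + 1" 0] sm_closed add_nonneg_pos)
  have "nrm A (star A (x m) \<ominus> star A (x n)) = nrm A (x m \<ominus> x n)" for m n
    using c nrm_star[of "x m \<ominus> x n"] by (simp add: a_minus_def star_add star_minus)
  then show "(\<lambda>n. star A (x n)) \<in> {x. cauchy_in A x}"
    using c xc by (auto intro!: cauchyI[of _ x 1 0] star_closed)
  show "(\<lambda>n. if P n then x n else \<zero>) \<in> {x. cauchy_in A x}" if ev: "eventually P sequentially" for P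
  proof -
    obtain N where "\<And>n. n \<ge> N \<Longrightarrow> P n" using ev by (auto simp: eventually_sequentially)
    then show ?thesis using c xc by (auto intro!: cauchyI[of _ x 1 N])
  qed
  have "Cauchy (\<lambda>n. nrm A (x n))"
  proof (rule metric_CauchyI)
    fix e :: real assume "e > 0"
    then obtain N where N: "\<forall>m\<ge>N. \<forall>n\<ge>N. nrm A (x m \<ominus> x n) < e" using xc unfolding cauchy_in_def by blast
    show "\<exists>M. \<forall>m\<ge>M. \<forall>n\<ge>M. dist (nrm A (x m)) (nrm A (x n)) < e"
      using N nrm_diff_ge c unfolding dist_real_def by (meson order_le_less_trans)
  qed
  then show "\<exists>L. (\<lambda>n. nrm A (x n)) \<longlonglongrightarrow> L"
    by (simp add: Cauchy_convergent_iff convergent_def)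
qed simp

context pre_cstar
begin

interpretation C: seq_quot A sequentially "{x. cauchy_in A x}" by (rule seq_quot_completion)

lemma completion_Q: "seq_quot.Q A sequentially {x. cauchy_in A x} = completion A"
  by (simp add: C.Q_def C.R_def C.J_def completion_def cauchy_alg_def)

lemma pre_cstar_completion: "pre_cstar (completion A)"
  using C.pre_cstar_Q by (simp add: completion_Q)

interpretation Q: pre_cstar "completion A" by (rule pre_cstar_completion)

abbreviation emb where "emb \<equiv> completion_embed A"

lemma const_cauchy: "x \<in> carrier A \<Longrightarrow> cauchy_in A (\<lambda>n. x)"
  by (simp add: cauchy_in_def a_minus_def M.r_neg nrm_zero)

lemma emb_cl: "emb x = C.cl (\<lambda>n. x)"
  by (simp add: completion_embed_def C.cl_def C.R_def C.J_def cauchy_alg_def)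

lemma completion_cases:
  assumes "X \<in> carrier (completion A)"
  obtains x where "cauchy_in A x" "X = C.cl x"
  using assms by (auto simp: completion_Q[symmetric] C.carrier_Q)

lemma emb_closed: "x \<in> carrier A \<Longrightarrow> emb x \<in> carrier (completion A)"
  using C.cl_closed[of "\<lambda>n. x"] by (simp add: emb_cl completion_Q const_cauchy)
lemma emb_star_hom: "emb \<in> star_hom A (completion A)"
  using C.cl_add[unfolded completion_Q] C.cl_mult[unfolded completion_Q] C.cl_smult[unfolded completion_Q]
    C.cl_star[unfolded completion_Q]
  by (auto simp: star_hom_def emb_closed[unfolded emb_cl] emb_cl const_cauchy)
lemmas emb_hom = star_homD[OF emb_star_hom]
lemma nrm_emb: "x \<in> carrier A \<Longrightarrow> nrm (completion A) (emb x) = nrm A x"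
  unfolding emb_cl completion_Q[symmetric] by (rule C.nrm_cl_eqI) (auto intro: const_cauchy)
lemma emb_diff: "x \<in> carrier A \<Longrightarrow> y \<in> carrier A \<Longrightarrow> emb (x \<ominus> y) = emb x \<ominus>\<^bsub>completion A\<^esub> emb y"
  using C.cl_diff[unfolded completion_Q] by (simp add: emb_cl const_cauchy)

lemma emb_tendsto:
  assumes y: "cauchy_in A y"
  shows "(\<lambda>n. nrm (completion A) (emb (y n) \<ominus>\<^bsub>completion A\<^esub> C.cl y)) \<longlonglongrightarrow> 0"
proof (rule LIMSEQ_I)
  fix e :: real assume e: "e > 0"
  have c: "y n \<in> carrier A" for n using y by (simp add: cauchy_in_def)
  have "e / 2 > 0" using e by simp
  then obtain N where N: "\<forall>m\<ge>N. \<forall>n\<ge>N. nrm A (y m \<ominus> y n) < e / 2" using y unfolding cauchy_in_def by blast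
  have "norm (nrm (completion A) (emb (y n) \<ominus>\<^bsub>completion A\<^esub> C.cl y) - 0) < e" if n: "n \<ge> N" for n
  proof -
    have eq: "emb (y n) \<ominus>\<^bsub>completion A\<^esub> C.cl y = C.cl (\<lambda>k. y n \<ominus> y k)"
      using C.cl_diff[unfolded completion_Q, of "\<lambda>k. y n" y] y c by (simp add: emb_cl const_cauchy)
    have S: "(\<lambda>k. y n \<ominus> y k) \<in> {x. cauchy_in A x}" using y c by (intro C.S_diff) (auto intro: const_cauchy)
    have "nrm (completion A) (C.cl (\<lambda>k. y n \<ominus> y k)) \<le> e / 2"
      unfolding completion_Q[symmetric] using N n
      by (intro C.nrm_cl_le[OF S]) (auto simp: eventually_sequentially intro!: exI[of _ N] less_imp_le)
    moreover have "0 \<le> nrm (completion A) (C.cl (\<lambda>k. y n \<ominus> y k))"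
      using C.cl_closed[OF S] by (intro Q.nrm_ge0) (simp add: completion_Q)
    ultimately show ?thesis using e unfolding eq by simp
  qed
  then show "\<exists>N. \<forall>n\<ge>N. norm (nrm (completion A) (emb (y n) \<ominus>\<^bsub>completion A\<^esub> C.cl y) - 0) < e" by blast
qed

lemma emb_dense:
  assumes "X \<in> carrier (completion A)" "e > 0"
  shows "\<exists>x\<in>carrier A. nrm (completion A) (X \<ominus>\<^bsub>completion A\<^esub> emb x) < e"
proof -
  obtain y where y: "cauchy_in A y" "X = C.cl y" using completion_cases[OF assms(1)] by blast
  have c: "y n \<in> carrier A" for n using y by (simp add: cauchy_in_def)
  have "eventually (\<lambda>n. nrm (completion A) (emb (y n) \<ominus>\<^bsub>completion A\<^esub> X) < e) sequentially"
    using emb_tendsto[OF y(1)] assms(2) unfolding y(2) by (intro order_tendstoD(2)) auto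
  then obtain n where "nrm (completion A) (emb (y n) \<ominus>\<^bsub>completion A\<^esub> X) < e"
    by (auto simp: eventually_sequentially)
  then have "nrm (completion A) (X \<ominus>\<^bsub>completion A\<^esub> emb (y n)) < e"
    using Q.nrm_diff_commute[of X "emb (y n)"] assms(1) emb_closed[OF c] by simp
  then show ?thesis using c by blast
qed

lemma cauchy_approx:
  assumes u: "cauchy_in A u" and y: "\<And>n. y n \<in> carrier A" and l: "(\<lambda>n. nrm A (u n \<ominus> y n)) \<longlonglongrightarrow> 0"
  shows "cauchy_in A y"
  unfolding cauchy_in_def
proof (intro conjI allI impI)
  fix e :: real assume e: "e > 0"
  have c: "u n \<in> carrier A" for n using u by (simp add: cauchy_in_def)
  have "e / 3 > 0" using e by simp
  then obtain N where N: "\<forall>m\<ge>N. \<forall>n\<ge>N. nrm A (u m \<ominus> u n) < e / 3" using u unfolding cauchy_in_def by blast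
  have "eventually (\<lambda>n. nrm A (u n \<ominus> y n) < e / 3) sequentially"
    using l \<open>e / 3 > 0\<close> by (intro order_tendstoD(2)) auto
  then obtain M where M: "\<And>n. n \<ge> M \<Longrightarrow> nrm A (u n \<ominus> y n) < e / 3" by (auto simp: eventually_sequentially)
  show "\<exists>N. \<forall>m\<ge>N. \<forall>n\<ge>N. nrm A (y m \<ominus> y n) < e"
  proof (intro exI[of _ "max N M"] allI impI)
    fix m n assume mn: "max N M \<le> m" "max N M \<le> n"
    have "nrm A (y m \<ominus> y n) \<le> nrm A (y m \<ominus> u m) + nrm A (u m \<ominus> y n)" using c y by (intro nrm_diff_triangle)
    also have "nrm A (u m \<ominus> y n) \<le> nrm A (u m \<ominus> u n) + nrm A (u n \<ominus> y n)" using c y by (intro nrm_diff_triangle)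
    also have "nrm A (y m \<ominus> u m) = nrm A (u m \<ominus> y m)" using c y by (intro nrm_diff_commute)
    finally show "nrm A (y m \<ominus> y n) < e"
      using N[rule_format, of m n] M[of m] M[of n] mn by simp
  qed
qed (rule y)

text \<open>Approximating each member of a Cauchy sequence by the class of a constant sequence yields a Cauchy
  sequence of the original algebra. Its class is the limit.\<close>
lemma completion_complete:
  assumes u: "cauchy_in (completion A) u"
  shows "\<exists>l\<in>carrier (completion A). (\<lambda>n. nrm (completion A) (u n \<ominus>\<^bsub>completion A\<^esub> l)) \<longlonglongrightarrow> 0"
proof -
  have c: "u n \<in> carrier (completion A)" for n using u by (simp add: cauchy_in_def)
  have "\<exists>x\<in>carrier A. nrm (completion A) (u n \<ominus>\<^bsub>completion A\<^esub> emb x) < 1 / Suc n" for n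
    by (rule emb_dense[OF c]) simp
  then obtain y where y: "\<And>n. y n \<in> carrier A"
    "\<And>n. nrm (completion A) (u n \<ominus>\<^bsub>completion A\<^esub> emb (y n)) < 1 / Suc n" by metis
  have l: "(\<lambda>n. nrm (completion A) (u n \<ominus>\<^bsub>completion A\<^esub> emb (y n))) \<longlonglongrightarrow> 0"
    by (rule tendsto_sandwich[of "\<lambda>_. 0", OF _ _ tendsto_const LIMSEQ_inverse_real_of_nat])
      (use y c Q.nrm_ge0 emb_closed in \<open>auto intro!: always_eventually less_imp_le simp: inverse_eq_divide\<close>)
  have "cauchy_in (completion A) (\<lambda>n. emb (y n))"
    by (rule pre_cstar.cauchy_approx[OF pre_cstar_completion u emb_closed[OF y(1)] l])
  then have ycau: "cauchy_in A y"
    using y(1) by (simp add: cauchy_in_def emb_diff[symmetric] nrm_emb)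
  define L where "L = C.cl y"
  have L: "L \<in> carrier (completion A)" using C.cl_closed[of y] ycau by (simp add: L_def completion_Q)
  have "(\<lambda>n. nrm (completion A) (u n \<ominus>\<^bsub>completion A\<^esub> L)) \<longlonglongrightarrow> 0"
  proof (rule tendsto_sandwich[of "\<lambda>_. 0", OF _ _ tendsto_const])
    show "(\<lambda>n. nrm (completion A) (u n \<ominus>\<^bsub>completion A\<^esub> emb (y n)) + nrm (completion A) (emb (y n) \<ominus>\<^bsub>completion A\<^esub> L)) \<longlonglongrightarrow> 0"
      using tendsto_add[OF l emb_tendsto[OF ycau]] by (simp add: L_def)
    show "\<forall>\<^sub>F n in sequentially. nrm (completion A) (u n \<ominus>\<^bsub>completion A\<^esub> L)
      \<le> nrm (completion A) (u n \<ominus>\<^bsub>completion A\<^esub> emb (y n)) + nrm (completion A) (emb (y n) \<ominus>\<^bsub>completion A\<^esub> L)"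
      using c L y emb_closed by (intro always_eventually allI Q.nrm_diff_triangle) auto
    show "\<forall>\<^sub>F n in sequentially. 0 \<le> nrm (completion A) (u n \<ominus>\<^bsub>completion A\<^esub> L)"
      using c L by (intro always_eventually allI Q.nrm_ge0) auto
  qed
  then show ?thesis using L by blast
qed

end

section \<open>The Hilbert module of square-summable functions\<close>

text \<open>Log-convexity makes the ratios \<open>p (n + 1) / p n\<close> increase, so a first ratio above \<open>r\<close> would make
  \<open>p\<close> grow faster than \<open>r ^ n\<close>.\<close>
lemma log_convex_bound:
  fixes p :: "nat \<Rightarrow> real"
  assumes p: "\<And>n. p n \<ge> 0" and conv: "\<And>n. (p (Suc n))\<^sup>2 \<le> p n * p (Suc (Suc n))"
    and growth: "\<And>n. p n \<le> C * r ^ n" and r: "r \<ge> 0"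
  shows "p 1 \<le> r * p 0"
proof (rule ccontr)
  assume "\<not> p 1 \<le> r * p 0"
  then have a: "p 1 > r * p 0" by simp
  have p0: "p 0 > 0"
  proof (rule ccontr)
    assume "\<not> p 0 > 0"
    then have "p 0 = 0" using p[of 0] by simp
    then show False using conv[of 0] a by simp
  qed
  define q where "q = p 1 / p 0"
  have q: "q > r" "q > 0" using a p0 r by (auto simp: q_def field_simps intro: le_less_trans[of 0 "r * p 0"])
  have step: "p n > 0 \<and> p (Suc n) \<ge> q * p n" for n
  proof (induction n)
    case 0 then show ?case using p0 by (simp add: q_def)
  next
    case (Suc n)
    then have pos: "p (Suc n) > 0" using q by (auto intro: less_le_trans[of 0 "q * p n"])
    have "q * p n * p (Suc n) \<le> p (Suc n) * p (Suc n)" using Suc pos by (intro mult_right_mono) auto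
    also have "\<dots> \<le> p n * p (Suc (Suc n))" using conv[of n] by (simp add: power2_eq_square)
    finally have "p n * (q * p (Suc n)) \<le> p n * p (Suc (Suc n))" by (simp add: mult_ac)
    then show ?case using Suc pos by simp
  qed
  have pow: "p n \<ge> q ^ n * p 0" for n
  proof (induction n)
    case (Suc n)
    have "q ^ Suc n * p 0 \<le> q * p n" using Suc q by (simp add: mult.assoc)
    then show ?case using step[of n] by linarith
  qed simp
  have C: "C > 0" using growth[of 0] p0 by simp
  have r0: "r > 0"
  proof (rule ccontr)
    assume "\<not> r > 0"
    then have "r = 0" using r by simp
    then show False using growth[of 1] step[of 1] by simp
  qed
  obtain n where n: "C / p 0 < (q / r) ^ n" using real_arch_pow[of "q / r" "C / p 0"] q r0 by auto
  have "q ^ n * p 0 \<le> C * r ^ n" using pow[of n] growth[of n] by linarith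
  then have "(q / r) ^ n \<le> C / p 0" using r0 p0 by (simp add: power_divide field_simps)
  then show False using n by simp
qed

context pre_cstar
begin

lemma finsum_swap:
  "finite I \<Longrightarrow> finite J \<Longrightarrow> (\<And>i j. i \<in> I \<Longrightarrow> j \<in> J \<Longrightarrow> g i j \<in> carrier A) \<Longrightarrow>
  finsum A (\<lambda>i. finsum A (\<lambda>j. g i j) J) I = finsum A (\<lambda>j. finsum A (\<lambda>i. g i j) I) J"
proof (induction I rule: finite_induct)
  case empty then show ?case by simp
next
  case (insert i I)
  then have "finsum A (\<lambda>j. finsum A (\<lambda>i. g i j) (insert i I)) J
    = finsum A (\<lambda>j. g i j \<oplus> finsum A (\<lambda>i. g i j) I) J"
    by (intro M.finsum_cong') (auto intro!: M.finsum_insert M.finsum_closed)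
  also have "\<dots> = finsum A (\<lambda>j. g i j) J \<oplus> finsum A (\<lambda>j. finsum A (\<lambda>i. g i j) I) J"
    using insert by (intro M.finsum_addf) (auto intro!: M.finsum_closed)
  finally show ?case using insert by (simp add: M.finsum_closed Pi_iff)
qed

lemma fsI: "(\<And>s. f s \<in> carrier A) \<Longrightarrow> finite T \<Longrightarrow> (\<And>s. s \<notin> T \<Longrightarrow> f s = \<zero>) \<Longrightarrow> f \<in> finsupp A"
  by (auto simp: finsupp_def supp_def intro: finite_subset[of _ T])
lemma fs_closed: "f \<in> finsupp A \<Longrightarrow> f s \<in> carrier A" by (simp add: finsupp_def)
lemma fs_finite: "f \<in> finsupp A \<Longrightarrow> finite (supp A f)" by (simp add: finsupp_def)
lemma not_supp: "s \<notin> supp A f \<Longrightarrow> f s = \<zero>" by (simp add: supp_def)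

lemma finsum_supp_eq:
  assumes "finite T" "S \<subseteq> T" "\<And>t. g t \<in> carrier A" "\<And>t. t \<in> T \<Longrightarrow> t \<notin> S \<Longrightarrow> g t = \<zero>"
  shows "finsum A g S = finsum A g T"
  by (rule M.add.finprod_mono_neutral_cong_left) (use assms in auto)

lemma fs_add: "f \<in> finsupp A \<Longrightarrow> g \<in> finsupp A \<Longrightarrow> (\<lambda>s. f s \<oplus> g s) \<in> finsupp A"
  by (rule fsI[of _ "supp A f \<union> supp A g"]) (auto simp: fs_closed fs_finite not_supp)
lemma fs_smult: "f \<in> finsupp A \<Longrightarrow> (\<lambda>s. c \<odot> f s) \<in> finsupp A"
  by (rule fsI[of _ "supp A f"]) (auto simp: fs_closed fs_finite not_supp sm_closed sm_zero)
lemma fs_zero: "(\<lambda>s. \<zero>) \<in> finsupp A"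
  by (rule fsI[of _ "{}"]) auto
lemma fs_mult: "\<xi> \<in> finsupp A \<Longrightarrow> (\<And>t. a t \<in> carrier A) \<Longrightarrow> (\<lambda>t. a t \<otimes> \<xi> t) \<in> finsupp A"
  by (rule fsI[of _ "supp A \<xi>"]) (auto simp: fs_closed fs_finite not_supp mult_closed mult_zero_right)
lemma fs_delta: "a \<in> carrier A \<Longrightarrow> (\<lambda>t. if t = s then a else \<zero>) \<in> finsupp A"
  by (rule fsI[of _ "{s}"]) auto
lemma fs_shift:
  fixes s :: "'g::ab_group_add"
  assumes "f \<in> finsupp A" shows "(\<lambda>t. f (t - s)) \<in> finsupp A"
proof (rule fsI[of _ "(\<lambda>t. t + s) ` supp A f"])
  fix t assume "t \<notin> (\<lambda>t. t + s) ` supp A f"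
  then have "t - s \<notin> supp A f" by (metis diff_add_cancel imageI)
  then show "f (t - s) = \<zero>" by (rule not_supp)
qed (use assms in \<open>auto simp: fs_closed fs_finite\<close>)

lemma l2_sq:
  assumes "\<xi> \<in> finsupp A" "finite T" "supp A \<xi> \<subseteq> T"
  shows "(l2_norm A \<xi>)\<^sup>2 = nrm A (finsum A (\<lambda>t. star A (\<xi> t) \<otimes> \<xi> t) T)"
proof -
  have "finsum A (\<lambda>t. star A (\<xi> t) \<otimes> \<xi> t) (supp A \<xi>) = finsum A (\<lambda>t. star A (\<xi> t) \<otimes> \<xi> t) T"
    by (rule finsum_supp_eq) (use assms in \<open>auto simp: fs_closed mult_closed star_closed not_supp mult_zero_right star_zero\<close>)
  moreover have "finsum A (\<lambda>t. star A (\<xi> t) \<otimes> \<xi> t) T \<in> carrier A"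
    using assms by (intro M.finsum_closed) (auto simp: fs_closed mult_closed star_closed)
  ultimately show ?thesis by (simp add: l2_norm_def nrm_ge0)
qed

lemma l2_ge0: "\<xi> \<in> finsupp A \<Longrightarrow> 0 \<le> l2_norm A \<xi>"
  unfolding l2_norm_def
  by (intro real_sqrt_ge_zero nrm_ge0 M.finsum_closed) (auto simp: fs_closed mult_closed star_closed)

lemma l2_CS:
  assumes "\<xi> \<in> finsupp A" "\<eta> \<in> finsupp A" "finite T" "supp A \<xi> \<subseteq> T \<or> supp A \<eta> \<subseteq> T"
  shows "nrm A (finsum A (\<lambda>t. star A (\<xi> t) \<otimes> \<eta> t) T) \<le> l2_norm A \<xi> * l2_norm A \<eta>"
proof -
  define U where "U = T \<union> supp A \<xi> \<union> supp A \<eta>"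
  have U: "finite U" "supp A \<xi> \<subseteq> U" "supp A \<eta> \<subseteq> U" using assms by (auto simp: U_def fs_finite)
  have eq: "finsum A (\<lambda>t. star A (\<xi> t) \<otimes> \<eta> t) T = finsum A (\<lambda>t. star A (\<xi> t) \<otimes> \<eta> t) U"
  proof (rule finsum_supp_eq[OF U(1)])
    fix t assume "t \<notin> T"
    then have "t \<notin> supp A \<xi> \<or> t \<notin> supp A \<eta>" using assms(4) by blast
    then have "\<xi> t = \<zero> \<or> \<eta> t = \<zero>" using not_supp[of t \<xi>] not_supp[of t \<eta>] by argo
    then show "star A (\<xi> t) \<otimes> \<eta> t = \<zero>"
      using assms by (auto simp: fs_closed star_closed star_zero mult_zero_left mult_zero_right)
  qed (use assms in \<open>auto simp: U_def fs_closed mult_closed star_closed\<close>)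
  have "(nrm A (finsum A (\<lambda>t. star A (\<xi> t) \<otimes> \<eta> t) U))\<^sup>2 \<le> (l2_norm A \<eta>)\<^sup>2 * (l2_norm A \<xi>)\<^sup>2"
    unfolding l2_sq[OF assms(1) U(1,2)] l2_sq[OF assms(2) U(1,3)]
    using assms by (intro cauchy_schwarz U) (auto simp: fs_closed)
  then have "(nrm A (finsum A (\<lambda>t. star A (\<xi> t) \<otimes> \<eta> t) U))\<^sup>2 \<le> (l2_norm A \<xi> * l2_norm A \<eta>)\<^sup>2"
    by (simp add: power_mult_distrib mult.commute)
  then show ?thesis unfolding eq by (rule power2_le_imp_le) (use assms in \<open>auto intro!: mult_nonneg_nonneg l2_ge0\<close>)
qed

lemma l2_triangle:
  assumes "\<xi> \<in> finsupp A" "\<eta> \<in> finsupp A"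
  shows "l2_norm A (\<lambda>t. \<xi> t \<oplus> \<eta> t) \<le> l2_norm A \<xi> + l2_norm A \<eta>"
proof -
  define U where "U = supp A \<xi> \<union> supp A \<eta>"
  note c = fs_closed[OF assms(1)] fs_closed[OF assms(2)]
  have U: "finite U" "supp A \<xi> \<subseteq> U" "supp A \<eta> \<subseteq> U" "supp A (\<lambda>t. \<xi> t \<oplus> \<eta> t) \<subseteq> U"
    using fs_finite[OF assms(1)] fs_finite[OF assms(2)] by (auto simp: U_def supp_def)
  have cl: "finsum A (\<lambda>t. star A (u t) \<otimes> v t) U \<in> carrier A" if "\<And>t. u t \<in> carrier A" "\<And>t. v t \<in> carrier A" for u v
    using that by (intro M.finsum_closed) (auto simp: mult_closed star_closed)
  have "finsum A (\<lambda>t. star A (\<xi> t \<oplus> \<eta> t) \<otimes> (\<xi> t \<oplus> \<eta> t)) U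
    = finsum A (\<lambda>t. (star A (\<xi> t) \<otimes> \<xi> t \<oplus> star A (\<xi> t) \<otimes> \<eta> t) \<oplus> (star A (\<eta> t) \<otimes> \<xi> t \<oplus> star A (\<eta> t) \<otimes> \<eta> t)) U"
    using c by (intro M.finsum_cong') (auto simp: star_add star_closed mult_closed distrib_left distrib_right M.a_ac)
  also have "\<dots> = (finsum A (\<lambda>t. star A (\<xi> t) \<otimes> \<xi> t) U \<oplus> finsum A (\<lambda>t. star A (\<xi> t) \<otimes> \<eta> t) U) \<oplus>
      (finsum A (\<lambda>t. star A (\<eta> t) \<otimes> \<xi> t) U \<oplus> finsum A (\<lambda>t. star A (\<eta> t) \<otimes> \<eta> t) U)"
    using c by (simp add: M.finsum_addf Pi_iff mult_closed star_closed)
  finally have "(l2_norm A (\<lambda>t. \<xi> t \<oplus> \<eta> t))\<^sup>2 \<le> nrm A (finsum A (\<lambda>t. star A (\<xi> t) \<otimes> \<xi> t) U) + nrm A (finsum A (\<lambda>t. star A (\<xi> t) \<otimes> \<eta> t) U)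
     + (nrm A (finsum A (\<lambda>t. star A (\<eta> t) \<otimes> \<xi> t) U) + nrm A (finsum A (\<lambda>t. star A (\<eta> t) \<otimes> \<eta> t) U))"
    unfolding l2_sq[OF fs_add[OF assms] U(1,4)]
    using c by (simp, intro order_trans[OF nrm_triangle] add_mono nrm_triangle M.add.m_closed cl) auto
  also have "\<dots> \<le> (l2_norm A \<xi>)\<^sup>2 + l2_norm A \<xi> * l2_norm A \<eta> + (l2_norm A \<eta> * l2_norm A \<xi> + (l2_norm A \<eta>)\<^sup>2)"
    using assms U by (intro add_mono l2_CS) (auto simp: l2_sq[OF _ U(1)])
  also have "\<dots> = (l2_norm A \<xi> + l2_norm A \<eta>)\<^sup>2" by (simp add: power2_eq_square algebra_simps)
  finally show ?thesis by (rule power2_le_imp_le) (use assms in \<open>auto intro!: add_nonneg_nonneg l2_ge0\<close>)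
qed

lemma l2_delta: "a \<in> carrier A \<Longrightarrow> l2_norm A (\<lambda>t. if t = s then a else \<zero>) = nrm A a"
proof -
  assume a: "a \<in> carrier A"
  have "(l2_norm A (\<lambda>t. if t = s then a else \<zero>))\<^sup>2 = (nrm A a)\<^sup>2"
    using a by (subst l2_sq[of _ "{s}"]) (auto simp: fs_delta supp_def mult_closed star_closed cstar_identity)
  then show ?thesis using l2_ge0[OF fs_delta[OF a, of s]] nrm_ge0[OF a] by (simp add: power2_eq_iff_nonneg)
qed

text \<open>Cauchy-Schwarz against the function that agrees with \<open>\<xi>\<close> at \<open>t\<close> and vanishes elsewhere.\<close>
lemma l2_coord: assumes "\<xi> \<in> finsupp A" shows "nrm A (\<xi> t) \<le> l2_norm A \<xi>"
proof -
  let ?d = "\<lambda>u. if u = t then \<xi> t else \<zero>"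
  have c: "\<xi> t \<in> carrier A" using assms by (rule fs_closed)
  have "nrm A (finsum A (\<lambda>u. star A (?d u) \<otimes> \<xi> u) {t}) \<le> l2_norm A ?d * l2_norm A \<xi>"
    using assms c by (intro l2_CS fs_delta) (auto simp: supp_def)
  then have "nrm A (\<xi> t) * nrm A (\<xi> t) \<le> nrm A (\<xi> t) * l2_norm A \<xi>"
    using c by (simp add: mult_closed star_closed cstar_identity l2_delta power2_eq_square)
  then show ?thesis using nrm_ge0[OF c] l2_ge0[OF assms] by (cases "nrm A (\<xi> t) = 0") auto
qed

lemma l2_le_sum: assumes "\<xi> \<in> finsupp A" "finite T" "supp A \<xi> \<subseteq> T"
  shows "l2_norm A \<xi> \<le> (\<Sum>t\<in>T. nrm A (\<xi> t))"
proof (rule power2_le_imp_le)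
  have "(l2_norm A \<xi>)\<^sup>2 \<le> (\<Sum>t\<in>T. nrm A (star A (\<xi> t) \<otimes> \<xi> t))"
    unfolding l2_sq[OF assms] using assms by (intro nrm_finsum) (auto simp: fs_closed mult_closed star_closed)
  also have "\<dots> = (\<Sum>t\<in>T. nrm A (\<xi> t) * nrm A (\<xi> t))"
    using assms by (simp add: cstar_identity fs_closed power2_eq_square)
  also have "\<dots> \<le> (\<Sum>t\<in>T. nrm A (\<xi> t) * (\<Sum>t\<in>T. nrm A (\<xi> t)))"
    using assms by (intro sum_mono mult_left_mono member_le_sum[where f = "\<lambda>t. nrm A (\<xi> t)"])
      (auto intro: nrm_ge0 fs_closed)
  also have "\<dots> = (\<Sum>t\<in>T. nrm A (\<xi> t))\<^sup>2" by (simp add: power2_eq_square sum_distrib_right)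
  finally show "(l2_norm A \<xi>)\<^sup>2 \<le> (\<Sum>t\<in>T. nrm A (\<xi> t))\<^sup>2" .
qed (use assms in \<open>auto simp: fs_closed intro!: sum_nonneg nrm_ge0\<close>)

text \<open>Let \<open>h = a* a\<close> and \<open>p n = \<parallel>h ^ n \<xi>\<parallel>\<close>. Cauchy-Schwarz makes \<open>p\<close> log-convex, and \<open>p n\<close> is at most a
  multiple of \<open>(K\<^sup>2) ^ n\<close>; so \<open>p 1 \<le> K\<^sup>2 p 0\<close>, and \<open>\<parallel>a \<xi>\<parallel>\<^sup>2 \<le> p 0 p 1\<close>.\<close>
lemma l2_mult_bound:
  assumes x: "\<xi> \<in> finsupp A" and a: "\<And>t. a t \<in> carrier A" and K: "\<And>t. nrm A (a t) \<le> K"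
  shows "l2_norm A (\<lambda>t. a t \<otimes> \<xi> t) \<le> K * l2_norm A \<xi>"
proof -
  have K0: "K \<ge> 0" using K nrm_ge0[OF a] order_trans by blast
  define h where "h t = star A (a t) \<otimes> a t" for t
  have h: "h t \<in> carrier A" "star A (h t) = h t" "nrm A (h t) \<le> K\<^sup>2" for t
    using a K nrm_ge0[OF a] by (auto simp: h_def mult_closed star_closed star_mult star_star cstar_identity power_mono)
  define v where "v n = ((\<lambda>w t. h t \<otimes> w t) ^^ n) \<xi>" for n
  have v0: "v 0 = \<xi>" and vS: "v (Suc n) t = h t \<otimes> v n t" for n t by (auto simp: v_def)
  have vf: "v n \<in> finsupp A" for n
  proof (induction n)
    case (Suc n) then show ?case using fs_mult[OF Suc, of h] h by (simp add: vS[abs_def])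
  qed (simp add: v0 x)
  define T where "T = supp A \<xi>"
  have T: "finite T" using x by (simp add: T_def fs_finite)
  have vT: "supp A (v n) \<subseteq> T" for n
  proof (induction n)
    case (Suc n)
    have "v (Suc n) t = \<zero>" if "t \<notin> T" for t
    proof -
      have "v n t = \<zero>" using that Suc not_supp[of t "v n"] by blast
      then show ?thesis using h by (simp add: vS mult_zero_right)
    qed
    then show ?case by (auto simp: supp_def)
  qed (simp add: v0 T_def)
  have vn: "nrm A (v n t) \<le> (K\<^sup>2) ^ n * nrm A (\<xi> t)" for n t
  proof (induction n)
    case (Suc n)
    have "nrm A (v (Suc n) t) \<le> nrm A (h t) * nrm A (v n t)" by (simp add: vS nrm_mult h fs_closed[OF vf])
    also have "\<dots> \<le> K\<^sup>2 * ((K\<^sup>2) ^ n * nrm A (\<xi> t))"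
      by (intro mult_mono h Suc nrm_ge0 fs_closed[OF vf]) auto
    finally show ?case by (simp add: mult.assoc)
  qed (simp add: v0)
  define p where "p n = l2_norm A (v n)" for n
  have p: "p n \<ge> 0" for n by (simp add: p_def l2_ge0 vf)
  have "p 1 \<le> K\<^sup>2 * p 0"
  proof (rule log_convex_bound[OF p, where C = "\<Sum>t\<in>T. nrm A (\<xi> t)"])
    fix n
    have "star A (v (Suc n) t) \<otimes> v (Suc n) t = star A (v n t) \<otimes> v (Suc (Suc n)) t" for t
      using h fs_closed[OF vf[of n]] by (simp add: vS star_mult mult_assoc star_closed mult_closed)
    then have "(p (Suc n))\<^sup>2 = nrm A (finsum A (\<lambda>t. star A (v n t) \<otimes> v (Suc (Suc n)) t) T)"
      unfolding p_def l2_sq[OF vf T vT] by simp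
    also have "\<dots> \<le> p n * p (Suc (Suc n))" unfolding p_def by (intro l2_CS vf T) (auto simp: vT)
    finally show "(p (Suc n))\<^sup>2 \<le> p n * p (Suc (Suc n))" .
    have "p n \<le> (\<Sum>t\<in>T. nrm A (v n t))" unfolding p_def by (rule l2_le_sum[OF vf T vT])
    also have "\<dots> \<le> (\<Sum>t\<in>T. (K\<^sup>2) ^ n * nrm A (\<xi> t))" by (intro sum_mono vn)
    finally show "p n \<le> (\<Sum>t\<in>T. nrm A (\<xi> t)) * (K\<^sup>2) ^ n" by (simp add: sum_distrib_right mult.commute)
  qed simp
  have af: "(\<lambda>t. a t \<otimes> \<xi> t) \<in> finsupp A" by (rule fs_mult[OF x a])
  have aT: "supp A (\<lambda>t. a t \<otimes> \<xi> t) \<subseteq> T" using a by (auto simp: supp_def T_def mult_zero_right)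
  have "star A (a t \<otimes> \<xi> t) \<otimes> (a t \<otimes> \<xi> t) = star A (v 0 t) \<otimes> v 1 t" for t
    using a fs_closed[OF x] by (simp add: v0 vS h_def star_mult mult_assoc star_closed mult_closed)
  then have "(l2_norm A (\<lambda>t. a t \<otimes> \<xi> t))\<^sup>2 = nrm A (finsum A (\<lambda>t. star A (v 0 t) \<otimes> v 1 t) T)"
    unfolding l2_sq[OF af T aT] by simp
  also have "\<dots> \<le> p 0 * p 1" unfolding p_def by (intro l2_CS vf T) (auto simp: vT)
  also have "\<dots> \<le> p 0 * (K\<^sup>2 * p 0)" using \<open>p 1 \<le> _\<close> p by (intro mult_left_mono)
  also have "\<dots> = (K * l2_norm A \<xi>)\<^sup>2" by (simp add: p_def v0 power2_eq_square)
  finally show ?thesis by (rule power2_le_imp_le) (use K0 l2_ge0[OF x] in auto)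
qed

lemma l2_shift:
  fixes s :: "'g::ab_group_add"
  assumes "\<xi> \<in> finsupp A" shows "l2_norm A (\<lambda>t. \<xi> (t - s)) = l2_norm A \<xi>"
proof -
  have T: "supp A (\<lambda>t. \<xi> (t - s)) = (\<lambda>t. t + s) ` supp A \<xi>"
    by (auto simp: supp_def image_iff) (metis diff_add_cancel)
  have "finsum A (\<lambda>t. star A (\<xi> (t - s)) \<otimes> \<xi> (t - s)) ((\<lambda>t. t + s) ` supp A \<xi>)
    = finsum A (\<lambda>t. star A (\<xi> t) \<otimes> \<xi> t) (supp A \<xi>)"
    using assms by (subst M.finsum_reindex) (auto simp: inj_on_def fs_closed mult_closed star_closed)
  then show ?thesis by (simp add: l2_norm_def T)
qed

lemma l2_smult: assumes "\<xi> \<in> finsupp A" shows "l2_norm A (\<lambda>t. c \<odot> \<xi> t) = cmod c * l2_norm A \<xi>"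
proof -
  have T: "finite (supp A \<xi>)" "supp A (\<lambda>t. c \<odot> \<xi> t) \<subseteq> supp A \<xi>"
    using fs_finite[OF assms] by (auto simp: supp_def sm_zero)
  have "star A (c \<odot> \<xi> t) \<otimes> (c \<odot> \<xi> t) = (cnj c * c) \<odot> (star A (\<xi> t) \<otimes> \<xi> t)" for t
    using fs_closed[OF assms] by (simp add: star_smult smult_mult_left smult_mult_right sm_closed star_closed mult_closed sm_assoc[symmetric] mult.commute)
  then have "finsum A (\<lambda>t. star A (c \<odot> \<xi> t) \<otimes> (c \<odot> \<xi> t)) (supp A \<xi>) = (cnj c * c) \<odot> finsum A (\<lambda>t. star A (\<xi> t) \<otimes> \<xi> t) (supp A \<xi>)"
    using assms by (simp add: sm_finsum fs_closed mult_closed star_closed)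
  moreover have "finsum A (\<lambda>t. star A (\<xi> t) \<otimes> \<xi> t) (supp A \<xi>) \<in> carrier A"
    using assms by (intro M.finsum_closed) (auto simp: fs_closed mult_closed star_closed)
  ultimately have "(l2_norm A (\<lambda>t. c \<odot> \<xi> t))\<^sup>2 = (cmod c * l2_norm A \<xi>)\<^sup>2"
    unfolding l2_sq[OF fs_smult[OF assms] T] power_mult_distrib l2_sq[OF assms T(1) subset_refl]
    by (simp add: nrm_smult norm_mult power2_eq_square)
  then show ?thesis using l2_ge0[OF assms] l2_ge0[OF fs_smult[OF assms]] by (simp add: power2_eq_iff_nonneg)
qed

end

section \<open>The regular representation\<close>

text \<open>For complete \<open>A\<close>, contractivity of the action is an instance of \<open>star_hom_contractive\<close>; for the
  ultrapower it follows coordinatewise from contractivity over \<open>A\<close>.\<close>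
locale cstar_dyn = pre_cstar A for A :: "'a cstar" (structure) +
  fixes \<alpha> :: "'g::ab_group_add \<Rightarrow> 'a \<Rightarrow> 'a"
  assumes action: "cstar_action A \<alpha>"
    and contractive: "x \<in> carrier A \<Longrightarrow> nrm A (\<alpha> s x) \<le> nrm A x"
begin

lemma act_hom: "\<alpha> s \<in> star_hom A A" using action by (simp add: cstar_action_def)
lemmas a_hom = star_homD[OF act_hom]
lemma a_0: "x \<in> carrier A \<Longrightarrow> \<alpha> 0 x = x" using action by (simp add: cstar_action_def)
lemma a_plus: "x \<in> carrier A \<Longrightarrow> \<alpha> s (\<alpha> t x) = \<alpha> (s + t) x" using action by (simp add: cstar_action_def)
lemma a_nrm: "x \<in> carrier A \<Longrightarrow> nrm A (\<alpha> s x) = nrm A x"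
  using contractive[of x s] contractive[of "\<alpha> s x" "- s"] by (simp add: a_hom a_plus a_0)
lemma a_zero: "\<alpha> s \<zero> = \<zero>"
  using a_nrm[of \<zero> s] a_hom(1)[of \<zero> s] by (simp add: nrm_zero nrm_eq_0)
lemma a_minus: "x \<in> carrier A \<Longrightarrow> \<alpha> s (\<ominus> x) = \<ominus> \<alpha> s x"
  using a_hom(4)[of x s "-1"] by (simp add: sm_minus1 a_hom)
lemma a_finsum: "f \<in> I \<rightarrow> carrier A \<Longrightarrow> \<alpha> s (finsum A f I) = finsum A (\<lambda>i. \<alpha> s (f i)) I"
  by (rule additive_finsum[OF abelian_group_A abelian_group_A]) (auto simp: a_hom)

abbreviation C where "C \<equiv> Cc A \<alpha>"
abbreviation reg where "reg \<equiv> regular_rep A \<alpha>"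

lemma C_simps:
  "carrier C = finsupp A" "\<zero>\<^bsub>C\<^esub> = (\<lambda>s. \<zero>)" "x \<oplus>\<^bsub>C\<^esub> y = (\<lambda>s. x s \<oplus> y s)" "c \<odot>\<^bsub>C\<^esub> x = (\<lambda>s. c \<odot> x s)"
  "star C x = (\<lambda>s. \<alpha> s (star A (x (- s))))" "nrm C x = reduced_norm A \<alpha> x"
  by (auto simp: Cc_def)

lemma mul_eq:
  assumes "f \<in> finsupp A" "g \<in> finsupp A" "finite T" "supp A f \<subseteq> T"
  shows "(f \<otimes>\<^bsub>C\<^esub> g) t = finsum A (\<lambda>s. f s \<otimes> \<alpha> s (g (t - s))) T"
proof -
  have "(f \<otimes>\<^bsub>C\<^esub> g) t = finsum A (\<lambda>s. f s \<otimes> \<alpha> s (g (t - s))) (supp A f)" by (simp add: Cc_def)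
  also have "\<dots> = finsum A (\<lambda>s. f s \<otimes> \<alpha> s (g (t - s))) T"
    by (rule finsum_supp_eq) (use assms in \<open>auto simp: fs_closed a_hom mult_closed not_supp mult_zero_left\<close>)
  finally show ?thesis .
qed

lemma reg_eq:
  assumes "f \<in> finsupp A" "\<xi> \<in> finsupp A" "finite T" "supp A f \<subseteq> T"
  shows "reg f \<xi> t = finsum A (\<lambda>s. \<alpha> (- t) (f s) \<otimes> \<xi> (t - s)) T"
  unfolding regular_rep_def
  by (rule finsum_supp_eq) (use assms in \<open>auto simp: fs_closed a_hom mult_closed not_supp mult_zero_left a_zero\<close>)

lemma sumset_zero:
  fixes f g :: "'g \<Rightarrow> 'a"
  assumes "f \<in> finsupp A" "g \<in> finsupp A" "t \<notin> (\<lambda>(s, u). s + u) ` (supp A f \<times> supp A g)" "s \<in> supp A f"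
  shows "g (t - s) = \<zero>"
proof (rule not_supp[of "t - s" g], rule notI)
  assume "t - s \<in> supp A g"
  then have "t \<in> (\<lambda>(s, u). s + u) ` (supp A f \<times> supp A g)"
    using assms(4) by (intro image_eqI[of _ _ "(s, t - s)"]) (auto simp: algebra_simps)
  then show False using assms(3) by simp
qed

lemma fs_reg: assumes "f \<in> finsupp A" "\<xi> \<in> finsupp A" shows "reg f \<xi> \<in> finsupp A"
proof (rule fsI)
  show "finite ((\<lambda>(s, u). s + u) ` (supp A f \<times> supp A \<xi>))" using assms by (simp add: fs_finite)
  show "reg f \<xi> t \<in> carrier A" for t
    unfolding regular_rep_def using assms by (intro M.finsum_closed) (auto simp: mult_closed a_hom fs_closed)
  fix t assume "t \<notin> (\<lambda>(s, u). s + u) ` (supp A f \<times> supp A \<xi>)"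
  then have z: "\<xi> (t - s) = \<zero>" if "s \<in> supp A f" for s using sumset_zero[OF assms] that by blast
  have "reg f \<xi> t = finsum A (\<lambda>s. \<zero>) (supp A f)"
    unfolding regular_rep_def using assms z by (intro M.finsum_cong') (auto simp: a_hom fs_closed mult_zero_right)
  then show "reg f \<xi> t = \<zero>" by (simp add: M.finsum_zero)
qed

lemma supp_mul: assumes "f \<in> finsupp A" "g \<in> finsupp A"
  shows "supp A (f \<otimes>\<^bsub>C\<^esub> g) \<subseteq> (\<lambda>(s, u). s + u) ` (supp A f \<times> supp A g)"
proof (rule ccontr)
  assume "\<not> ?thesis"
  then obtain t where t: "t \<in> supp A (f \<otimes>\<^bsub>C\<^esub> g)" "t \<notin> (\<lambda>(s, u). s + u) ` (supp A f \<times> supp A g)" by blast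
  then have z: "g (t - s) = \<zero>" if "s \<in> supp A f" for s using sumset_zero[OF assms] that by blast
  have "(f \<otimes>\<^bsub>C\<^esub> g) t = finsum A (\<lambda>s. \<zero>) (supp A f)"
    unfolding mul_eq[OF assms fs_finite[OF assms(1)] subset_refl] using assms z
    by (intro M.finsum_cong') (auto simp: a_hom fs_closed mult_zero_right a_zero)
  then show False using t(1) by (simp add: M.finsum_zero supp_def)
qed

lemma fs_mul: assumes "f \<in> finsupp A" "g \<in> finsupp A" shows "f \<otimes>\<^bsub>C\<^esub> g \<in> finsupp A"
proof (rule fsI)
  show "finite ((\<lambda>(s, u). s + u) ` (supp A f \<times> supp A g))" using assms by (simp add: fs_finite)
  show "(f \<otimes>\<^bsub>C\<^esub> g) t \<in> carrier A" for t
    unfolding mul_eq[OF assms fs_finite[OF assms(1)] subset_refl] using assms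
    by (intro M.finsum_closed) (auto simp: mult_closed a_hom fs_closed)
  show "(f \<otimes>\<^bsub>C\<^esub> g) t = \<zero>" if "t \<notin> (\<lambda>(s, u). s + u) ` (supp A f \<times> supp A g)" for t
    by (rule not_supp[of t]) (use supp_mul[OF assms] that in blast)
qed

lemma fs_star: assumes "f \<in> finsupp A" shows "star C f \<in> finsupp A"
proof (rule fsI[of _ "uminus ` supp A f"])
  fix s assume "s \<notin> uminus ` supp A f"
  then have "- s \<notin> supp A f" using image_eqI[of s uminus "- s" "supp A f"] by auto
  then have "f (- s) = \<zero>" by (rule not_supp[of "- s" f])
  then show "star C f s = \<zero>" by (simp add: C_simps star_zero a_zero)
qed (use assms in \<open>auto simp: C_simps fs_closed fs_finite star_closed a_hom\<close>)

lemma star_star_C: "f \<in> finsupp A \<Longrightarrow> star C (star C f) = f"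
  by (rule ext) (simp add: C_simps a_hom(5)[symmetric] star_star a_plus a_0 fs_closed star_closed a_hom(1))

lemma reg_mult:
  assumes f: "f \<in> finsupp A" and g: "g \<in> finsupp A" and x: "\<xi> \<in> finsupp A"
  shows "reg (f \<otimes>\<^bsub>C\<^esub> g) \<xi> = reg f (reg g \<xi>)"
proof
  fix t
  define S T U where "S = supp A f" and "T = supp A g" and "U = (\<lambda>(s, u). s + u) ` (S \<times> T)"
  have fin: "finite S" "finite T" "finite U" using f g by (auto simp: S_def T_def U_def fs_finite)
  note c = fs_closed[OF f] fs_closed[OF g] fs_closed[OF x] a_hom(1) mult_closed
  define m where "m s u = \<alpha> (- t) (f s) \<otimes> (\<alpha> (s - t) (g (u - s)) \<otimes> \<xi> (t - u))" for s u
  have m: "m s u \<in> carrier A" for s u by (auto simp: m_def intro!: c)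
  have "reg (f \<otimes>\<^bsub>C\<^esub> g) \<xi> t = finsum A (\<lambda>u. \<alpha> (- t) ((f \<otimes>\<^bsub>C\<^esub> g) u) \<otimes> \<xi> (t - u)) U"
    using supp_mul[OF f g] by (intro reg_eq fs_mul f g x fin) (simp add: U_def S_def T_def)
  also have "\<dots> = finsum A (\<lambda>u. finsum A (\<lambda>s. m s u) S) U"
  proof (rule M.finsum_cong')
    fix u
    have "\<alpha> (- t) ((f \<otimes>\<^bsub>C\<^esub> g) u) = finsum A (\<lambda>s. \<alpha> (- t) (f s \<otimes> \<alpha> s (g (u - s)))) S"
      by (subst mul_eq[OF f g fin(1)]) (auto simp: S_def intro!: a_finsum c)
    also have "\<dots> = finsum A (\<lambda>s. \<alpha> (- t) (f s) \<otimes> \<alpha> (s - t) (g (u - s))) S"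
      by (intro M.finsum_cong') (auto simp: a_hom a_plus c intro!: c)
    also have "\<dots> \<otimes> \<xi> (t - u) = finsum A (\<lambda>s. m s u) S"
      by (subst finsum_mult) (auto simp: m_def mult_assoc c intro!: c M.finsum_cong')
    finally show "\<alpha> (- t) ((f \<otimes>\<^bsub>C\<^esub> g) u) \<otimes> \<xi> (t - u) = finsum A (\<lambda>s. m s u) S" .
  qed (auto intro!: M.finsum_closed m)
  also have "\<dots> = finsum A (\<lambda>s. finsum A (\<lambda>u. m s u) U) S"
    by (intro finsum_swap fin m)
  also have "\<dots> = finsum A (\<lambda>s. \<alpha> (- t) (f s) \<otimes> reg g \<xi> (t - s)) S"
  proof (rule M.finsum_cong')
    fix s assume s: "s \<in> S"
    have "finsum A (m s) U = finsum A (m s) ((\<lambda>r. s + r) ` T)"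
    proof (rule finsum_supp_eq[symmetric])
      show "(\<lambda>r. s + r) ` T \<subseteq> U" using s by (auto simp: U_def)
      fix u assume "u \<notin> (\<lambda>r. s + r) ` T"
      then have "u - s \<notin> supp A g" unfolding T_def by (metis add.commute diff_add_cancel imageI)
      then have "g (u - s) = \<zero>" by (rule not_supp[of "u - s" g])
      then show "m s u = \<zero>" by (simp add: m_def a_zero mult_zero_left mult_zero_right c)
    qed (auto intro: fin m)
    also have "\<dots> = finsum A (\<lambda>r. m s (s + r)) T"
      by (rule M.finsum_reindex) (auto intro: m)
    also have "\<dots> = finsum A (\<lambda>r. \<alpha> (- t) (f s) \<otimes> (\<alpha> (- (t - s)) (g r) \<otimes> \<xi> (t - s - r))) T"
      by (intro M.finsum_cong') (auto simp: m_def algebra_simps intro!: c)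
    also have "\<dots> = \<alpha> (- t) (f s) \<otimes> reg g \<xi> (t - s)"
      unfolding reg_eq[OF g x fin(2), of "t - s", unfolded T_def, OF subset_refl, folded T_def]
      by (rule mult_finsum[symmetric]) (auto intro!: c)
    finally show "finsum A (m s) U = \<alpha> (- t) (f s) \<otimes> reg g \<xi> (t - s)" .
  qed (auto simp: fs_closed[OF fs_reg[OF g x]] intro!: c)
  also have "\<dots> = reg f (reg g \<xi>) t"
    by (rule reg_eq[symmetric]) (auto intro: f g x fs_reg simp: S_def fs_finite[OF f])
  finally show "reg (f \<otimes>\<^bsub>C\<^esub> g) \<xi> t = reg f (reg g \<xi>) t" .
qed

lemma inner_shift:
  fixes s :: 'g
  assumes k: "\<And>t. k t \<in> carrier A" and U: "finite U" "\<And>t. t \<notin> U \<Longrightarrow> k t = \<zero>"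
    and V: "finite V" "\<And>t. t \<notin> V \<Longrightarrow> k (t + s) = \<zero>"
  shows "finsum A k U = finsum A (\<lambda>t. k (t + s)) V"
proof -
  define W where "W = U \<union> (\<lambda>t. t + s) ` V"
  have W: "finite W" using U V by (simp add: W_def)
  have "finsum A k U = finsum A k W"
    by (rule finsum_supp_eq[OF W]) (use k U in \<open>auto simp: W_def\<close>)
  also have "\<dots> = finsum A k ((\<lambda>t. t + s) ` V)"
  proof (rule finsum_supp_eq[OF W, symmetric])
    fix t assume "t \<notin> (\<lambda>t. t + s) ` V"
    then have "t - s \<notin> V" by (metis diff_add_cancel imageI)
    then show "k t = \<zero>" using V(2)[of "t - s"] by simp
  qed (use k in \<open>auto simp: W_def\<close>)
  also have "\<dots> = finsum A (\<lambda>t. k (t + s)) V"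
    by (rule M.finsum_reindex) (use k in auto)
  finally show ?thesis .
qed

text \<open>After exchanging the sums over the group and over the support of \<open>f\<close>, the inner sum is translated
  by \<open>s\<close>, and \<open>\<alpha>\<^bsub>-(t+s)\<^esub> (f s)* = \<alpha>\<^bsub>-t\<^esub> (f* (-s))\<close>.\<close>
lemma reg_adjoint:
  assumes f: "f \<in> finsupp A" and x: "\<xi> \<in> finsupp A" and y: "\<eta> \<in> finsupp A"
  shows "finsum A (\<lambda>t. star A (reg f \<xi> t) \<otimes> \<eta> t) (supp A \<eta>)
    = finsum A (\<lambda>t. star A (\<xi> t) \<otimes> reg (star C f) \<eta> t) (supp A \<xi>)"
proof -
  define S U V where "S = supp A f" and "U = supp A \<eta>" and "V = supp A \<xi>"
  have fin: "finite S" "finite U" "finite V" using f x y by (auto simp: S_def U_def V_def fs_finite)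
  note c = fs_closed[OF f] fs_closed[OF x] fs_closed[OF y] a_hom(1) mult_closed star_closed
  define k where "k s t = star A (\<alpha> (- t) (f s) \<otimes> \<xi> (t - s)) \<otimes> \<eta> t" for s t
  have k: "k s t \<in> carrier A" for s t by (auto simp: k_def intro!: c)
  have "finsum A (\<lambda>t. star A (reg f \<xi> t) \<otimes> \<eta> t) U = finsum A (\<lambda>t. finsum A (\<lambda>s. k s t) S) U"
  proof (rule M.finsum_cong')
    fix t
    have "star A (reg f \<xi> t) = finsum A (\<lambda>s. star A (\<alpha> (- t) (f s) \<otimes> \<xi> (t - s))) S"
      unfolding regular_rep_def S_def by (rule star_finsum) (auto intro!: c)
    also have "\<dots> \<otimes> \<eta> t = finsum A (\<lambda>s. k s t) S"
      unfolding k_def by (rule finsum_mult) (auto intro!: c)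
    finally show "star A (reg f \<xi> t) \<otimes> \<eta> t = finsum A (\<lambda>s. k s t) S" .
  qed (auto intro!: M.finsum_closed k)
  also have "\<dots> = finsum A (\<lambda>s. finsum A (\<lambda>t. k s t) U) S" by (intro finsum_swap fin k)
  also have "\<dots> = finsum A (\<lambda>s. finsum A (\<lambda>t. k s (t + s)) V) S"
  proof (rule M.finsum_cong')
    fix s
    show "finsum A (k s) U = finsum A (\<lambda>t. k s (t + s)) V"
    proof (rule inner_shift)
      show "k s t = \<zero>" if "t \<notin> U" for t
        using that not_supp[of t \<eta>] by (simp add: k_def U_def mult_zero_right c)
      show "k s (t + s) = \<zero>" if "t \<notin> V" for t
        using that not_supp[of t \<xi>] by (simp add: k_def V_def mult_zero_right mult_zero_left star_zero c)
    qed (auto intro: k fin)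
  qed (auto intro!: M.finsum_closed k)
  also have "\<dots> = finsum A (\<lambda>t. finsum A (\<lambda>s. k s (t + s)) S) V" by (intro finsum_swap fin k)
  also have "\<dots> = finsum A (\<lambda>t. star A (\<xi> t) \<otimes> reg (star C f) \<eta> t) V"
  proof (rule M.finsum_cong')
    fix t
    have sf: "star C f \<in> finsupp A" by (rule fs_star[OF f])
    have sub: "supp A (star C f) \<subseteq> uminus ` S"
    proof
      fix u assume "u \<in> supp A (star C f)"
      then have "f (- u) \<noteq> \<zero>" by (auto simp: supp_def C_simps star_zero a_zero)
      then have "- u \<in> S" by (simp add: S_def supp_def)
      then show "u \<in> uminus ` S" by (intro image_eqI[of _ _ "- u"]) auto
    qed
    have "reg (star C f) \<eta> t = finsum A (\<lambda>u. \<alpha> (- t) (star C f u) \<otimes> \<eta> (t - u)) (uminus ` S)"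
      by (rule reg_eq[OF sf y _ sub]) (simp add: fin)
    also have "\<dots> = finsum A (\<lambda>s. \<alpha> (- t) (star C f (- s)) \<otimes> \<eta> (t - (- s))) S"
      by (rule M.finsum_reindex) (auto simp: fs_closed[OF sf] intro!: c)
    also have "star A (\<xi> t) \<otimes> \<dots> = finsum A (\<lambda>s. star A (\<xi> t) \<otimes> (\<alpha> (- t) (star C f (- s)) \<otimes> \<eta> (t - (- s)))) S"
      by (rule mult_finsum) (auto simp: fs_closed[OF sf] intro!: c)
    also have "\<dots> = finsum A (\<lambda>s. k s (t + s)) S"
    proof (rule M.finsum_cong')
      fix s
      have "k s (t + s) = (star A (\<xi> t) \<otimes> \<alpha> (- (t + s)) (star A (f s))) \<otimes> \<eta> (t + s)"
        by (simp add: k_def star_mult c a_hom(5)[symmetric])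
      also have "\<alpha> (- (t + s)) (star A (f s)) = \<alpha> (- t) (star C f (- s))"
        by (simp add: C_simps a_plus c)
      finally show "star A (\<xi> t) \<otimes> (\<alpha> (- t) (star C f (- s)) \<otimes> \<eta> (t - (- s))) = k s (t + s)"
        using fs_closed[OF sf] by (simp add: mult_assoc c)
    qed (auto intro: k)
    finally show "finsum A (\<lambda>s. k s (t + s)) S = star A (\<xi> t) \<otimes> reg (star C f) \<eta> t" by simp
  qed (auto simp: fs_closed[OF fs_reg[OF fs_star[OF f] y]] intro!: c)
  finally show ?thesis by (simp add: U_def V_def)
qed

lemma reg_bound_l1:
  assumes f: "f \<in> finsupp A" and x: "\<xi> \<in> finsupp A"
  shows "l2_norm A (reg f \<xi>) \<le> (\<Sum>s\<in>supp A f. nrm A (f s)) * l2_norm A \<xi>"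
proof -
  note c = fs_closed[OF f] fs_closed[OF x] a_hom(1) mult_closed
  have "(\<lambda>t. finsum A (\<lambda>s. \<alpha> (- t) (f s) \<otimes> \<xi> (t - s)) T) \<in> finsupp A \<and>
    l2_norm A (\<lambda>t. finsum A (\<lambda>s. \<alpha> (- t) (f s) \<otimes> \<xi> (t - s)) T) \<le> (\<Sum>s\<in>T. nrm A (f s)) * l2_norm A \<xi>"
    if "finite T" for T
    using that
  proof (induction T rule: finite_induct)
    case empty
    have "l2_norm A (\<lambda>t::'g. \<zero>) = 0" using l2_delta[of \<zero> 0] by (simp add: nrm_zero)
    then show ?case by (simp add: fs_zero)
  next
    case (insert s T)
    have s: "(\<lambda>t. \<alpha> (- t) (f s) \<otimes> \<xi> (t - s)) \<in> finsupp A"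
      by (rule fs_mult[OF fs_shift[OF x]]) (auto intro: c)
    have "l2_norm A (\<lambda>t. \<alpha> (- t) (f s) \<otimes> \<xi> (t - s)) \<le> nrm A (f s) * l2_norm A (\<lambda>t. \<xi> (t - s))"
      by (rule l2_mult_bound[OF fs_shift[OF x]]) (auto simp: a_nrm[OF c(1)] intro: c)
    then have b: "l2_norm A (\<lambda>t. \<alpha> (- t) (f s) \<otimes> \<xi> (t - s)) \<le> nrm A (f s) * l2_norm A \<xi>"
      by (simp add: l2_shift[OF x])
    have eq: "finsum A (\<lambda>s. \<alpha> (- t) (f s) \<otimes> \<xi> (t - s)) (insert s T)
      = \<alpha> (- t) (f s) \<otimes> \<xi> (t - s) \<oplus> finsum A (\<lambda>s. \<alpha> (- t) (f s) \<otimes> \<xi> (t - s)) T" for t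
      using insert by (intro M.finsum_insert) (auto intro: c)
    show ?case unfolding eq using insert
      l2_triangle[OF s conjunct1[OF insert.IH]] b fs_add[OF s conjunct1[OF insert.IH]]
      by (simp add: algebra_simps)
  qed
  from this[OF fs_finite[OF f]] show ?thesis unfolding regular_rep_def[abs_def] by simp
qed

lemma reduced_norm_bdd: "f \<in> finsupp A \<Longrightarrow>
  bdd_above ((\<lambda>\<xi>. l2_norm A (reg f \<xi>)) ` {\<xi> \<in> finsupp A. l2_norm A \<xi> \<le> 1})"
proof (rule bdd_aboveI2)
  fix \<xi> :: "'g \<Rightarrow> 'a" assume f: "f \<in> finsupp A" and x: "\<xi> \<in> {\<xi> \<in> finsupp A. l2_norm A \<xi> \<le> 1}"
  then have "(\<Sum>s\<in>supp A f. nrm A (f s)) * l2_norm A \<xi> \<le> (\<Sum>s\<in>supp A f. nrm A (f s)) * 1"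
    by (intro mult_left_mono sum_nonneg nrm_ge0 fs_closed) auto
  then show "l2_norm A (reg f \<xi>) \<le> (\<Sum>s\<in>supp A f. nrm A (f s))" using reg_bound_l1[OF f, of \<xi>] x by simp
qed

lemma reg_bound:
  assumes f: "f \<in> finsupp A" and x: "\<xi> \<in> finsupp A"
  shows "l2_norm A (reg f \<xi>) \<le> reduced_norm A \<alpha> f * l2_norm A \<xi>"
proof (cases "l2_norm A \<xi> = 0")
  case True
  then show ?thesis using reg_bound_l1[OF f x] by simp
next
  case False
  then have p: "l2_norm A \<xi> > 0" using l2_ge0[OF x] by simp
  define c where "c = complex_of_real (1 / l2_norm A \<xi>)"
  have cn: "cmod c = 1 / l2_norm A \<xi>" using p by (simp add: c_def norm_divide)
  have u: "(\<lambda>t. c \<odot> \<xi> t) \<in> {\<xi> \<in> finsupp A. l2_norm A \<xi> \<le> 1}"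
    using x p cn by (auto simp: fs_smult l2_smult)
  have "reg f (\<lambda>t. c \<odot> \<xi> t) = (\<lambda>t. c \<odot> reg f \<xi> t)"
    unfolding regular_rep_def using f x
    by (intro ext) (subst sm_finsum, auto simp: fs_closed a_hom mult_closed sm_closed smult_mult_right)
  then have "l2_norm A (reg f (\<lambda>t. c \<odot> \<xi> t)) = cmod c * l2_norm A (reg f \<xi>)"
    using l2_smult[OF fs_reg[OF f x]] by simp
  moreover have "l2_norm A (reg f (\<lambda>t. c \<odot> \<xi> t)) \<le> reduced_norm A \<alpha> f"
    unfolding reduced_norm_def by (rule cSUP_upper[OF u reduced_norm_bdd[OF f]])
  moreover have "l2_norm A \<xi> * (cmod c * l2_norm A (reg f \<xi>)) = l2_norm A (reg f \<xi>)" using p cn by simp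
  ultimately show ?thesis using mult_left_mono[of _ "reduced_norm A \<alpha> f" "l2_norm A \<xi>"] p
    by (metis less_imp_le mult.commute)
qed

lemma reduced_norm_le:
  assumes "K \<ge> 0" "\<And>\<xi>. \<xi> \<in> finsupp A \<Longrightarrow> l2_norm A (reg f \<xi>) \<le> K * l2_norm A \<xi>"
  shows "reduced_norm A \<alpha> f \<le> K"
  unfolding reduced_norm_def
proof (rule cSUP_least)
  have "l2_norm A (\<lambda>t::'g. \<zero>) = 0" using l2_delta[of \<zero> 0] by (simp add: nrm_zero)
  then show "{\<xi> \<in> finsupp A. l2_norm A (\<xi> :: 'g \<Rightarrow> 'a) \<le> 1} \<noteq> {}" using fs_zero by force
  fix \<xi> assume x: "\<xi> \<in> {\<xi> \<in> finsupp A. l2_norm A (\<xi> :: 'g \<Rightarrow> 'a) \<le> 1}"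
  then have "K * l2_norm A \<xi> \<le> K * 1" using assms(1) by (intro mult_left_mono) auto
  then show "l2_norm A (reg f \<xi>) \<le> K" using assms(2)[of \<xi>] x by simp
qed

lemma reg_delta:
  assumes f: "f \<in> finsupp A" and a: "a \<in> carrier A"
  shows "reg f (\<lambda>t. if t = 0 then a else \<zero>) s = \<alpha> (- s) (f s) \<otimes> a"
proof -
  let ?d = "\<lambda>t::'g. if t = 0 then a else \<zero>"
  have d: "?d \<in> finsupp A" using a by (rule fs_delta)
  have "reg f ?d s = finsum A (\<lambda>u. \<alpha> (- s) (f u) \<otimes> ?d (s - u)) (insert s (supp A f))"
    by (rule reg_eq[OF f d]) (auto simp: fs_finite f)
  also have "\<dots> = finsum A (\<lambda>u. \<alpha> (- s) (f u) \<otimes> ?d (s - u)) {s}"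
    by (rule finsum_supp_eq[symmetric]) (auto simp: f a fs_finite fs_closed a_hom mult_closed mult_zero_right)
  also have "\<dots> = \<alpha> (- s) (f s) \<otimes> a" using f a by (simp add: fs_closed a_hom mult_closed)
  finally show ?thesis .
qed

lemma reduced_norm_ge0: assumes "f \<in> finsupp A" shows "0 \<le> reduced_norm A \<alpha> f"
proof -
  have z: "l2_norm A (\<lambda>t::'g. \<zero>) = 0" using l2_delta[of \<zero> 0] by (simp add: nrm_zero)
  have "l2_norm A (reg f (\<lambda>t. \<zero>)) \<le> reduced_norm A \<alpha> f"
    unfolding reduced_norm_def by (rule cSUP_upper[OF _ reduced_norm_bdd[OF assms]]) (simp add: z fs_zero)
  then show ?thesis using l2_ge0[OF fs_reg[OF assms fs_zero]] by linarith
qed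

text \<open>The coefficient is read off at \<open>s\<close> from the image of the vector supported at 0 with value \<open>b*\<close>, where
  \<open>b = \<alpha>\<^bsub>-s\<^esub> (f s)\<close>.\<close>
lemma coeff_le_reduced_norm: assumes f: "f \<in> finsupp A" shows "nrm A (f s) \<le> reduced_norm A \<alpha> f"
proof -
  define b where "b = \<alpha> (- s) (f s)"
  have b: "b \<in> carrier A" "nrm A b = nrm A (f s)" using f by (auto simp: b_def a_hom a_nrm fs_closed)
  let ?d = "\<lambda>t::'g. if t = 0 then star A b else \<zero>"
  have d: "?d \<in> finsupp A" using b by (intro fs_delta star_closed)
  have "nrm A b * nrm A b = nrm A (reg f ?d s)"
    using b by (simp add: reg_delta[OF f] star_closed b_def[symmetric] cstar_identity' power2_eq_square)
  also have "\<dots> \<le> l2_norm A (reg f ?d)" by (rule l2_coord[OF fs_reg[OF f d]])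
  also have "\<dots> \<le> reduced_norm A \<alpha> f * l2_norm A ?d" by (rule reg_bound[OF f d])
  also have "\<dots> = reduced_norm A \<alpha> f * nrm A b" using b by (simp add: l2_delta star_closed nrm_star)
  finally show ?thesis using b nrm_ge0[OF b(1)] reduced_norm_ge0[OF f] by (cases "nrm A b = 0") auto
qed

lemma reduced_norm_le_sum: assumes f: "f \<in> finsupp A" shows "reduced_norm A \<alpha> f \<le> (\<Sum>s\<in>supp A f. nrm A (f s))"
  by (rule reduced_norm_le) (auto intro!: sum_nonneg nrm_ge0 fs_closed[OF f] reg_bound_l1[OF f])

text \<open>Vectors supported at 0 recover the coefficients. Through this lemma the ring axioms of \<open>C\<^sub>c\<close> become
  identities between operators.\<close>
lemma reg_faithful:
  assumes f: "f \<in> finsupp A" and g: "g \<in> finsupp A" and eq: "\<And>\<xi>. \<xi> \<in> finsupp A \<Longrightarrow> reg f \<xi> = reg g \<xi>"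
  shows "f = g"
proof
  fix s
  define d where "d = \<alpha> (- s) (f s) \<ominus> \<alpha> (- s) (g s)"
  have d: "d \<in> carrier A" using f g by (simp add: d_def a_hom fs_closed)
  have "\<alpha> (- s) (f s) \<otimes> star A d = \<alpha> (- s) (g s) \<otimes> star A d"
    using eq[OF fs_delta[OF star_closed[OF d]], of 0] reg_delta[OF f star_closed[OF d], of s] reg_delta[OF g star_closed[OF d], of s]
    by simp
  then have "d \<otimes> star A d = \<zero>"
    using mult_diff_left[of "\<alpha> (- s) (f s)" "\<alpha> (- s) (g s)" "star A d", folded d_def] f g d
    by (simp add: a_hom fs_closed star_closed mult_closed a_minus_def M.r_neg)
  then have "nrm A d = 0" using cstar_identity'[OF d] by (simp add: nrm_zero)
  then have "\<alpha> (- s) (f s) = \<alpha> (- s) (g s)"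
    using f g by (intro eq_if_nrm_le_0) (auto simp: d_def a_hom fs_closed)
  then have "\<alpha> s (\<alpha> (- s) (f s)) = \<alpha> s (\<alpha> (- s) (g s))" by simp
  then show "f s = g s" using f g by (simp add: a_plus a_0 fs_closed)
qed

lemma reg_l2_sq:
  assumes f: "f \<in> finsupp A" and x: "\<xi> \<in> finsupp A"
  shows "(l2_norm A (reg f \<xi>))\<^sup>2 = nrm A (finsum A (\<lambda>t. star A (\<xi> t) \<otimes> reg (star C f) (reg f \<xi>) t) (supp A \<xi>))"
  unfolding l2_sq[OF fs_reg[OF f x] fs_finite[OF fs_reg[OF f x]] subset_refl]
  by (simp add: reg_adjoint[OF f x fs_reg[OF f x]])

lemma reduced_norm_star_le: assumes f: "f \<in> finsupp A" shows "reduced_norm A \<alpha> f \<le> reduced_norm A \<alpha> (star C f)"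
proof (rule reduced_norm_le)
  fix \<xi> assume x: "\<xi> \<in> (finsupp A :: ('g \<Rightarrow> 'a) set)"
  let ?r = "reg f \<xi>"
  have r: "?r \<in> finsupp A" by (rule fs_reg[OF f x])
  have "(l2_norm A ?r)\<^sup>2 \<le> l2_norm A \<xi> * l2_norm A (reg (star C f) ?r)"
    unfolding reg_l2_sq[OF f x] by (intro l2_CS x fs_reg fs_star f r fs_finite) simp
  also have "\<dots> \<le> l2_norm A \<xi> * (reduced_norm A \<alpha> (star C f) * l2_norm A ?r)"
    by (intro mult_left_mono reg_bound fs_star f r l2_ge0 x)
  finally have "l2_norm A ?r * l2_norm A ?r \<le> (reduced_norm A \<alpha> (star C f) * l2_norm A \<xi>) * l2_norm A ?r"
    by (simp add: power2_eq_square mult_ac)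
  then show "l2_norm A ?r \<le> reduced_norm A \<alpha> (star C f) * l2_norm A \<xi>"
    using l2_ge0[OF r] l2_ge0[OF x] reduced_norm_ge0[OF fs_star[OF f]] by (cases "l2_norm A ?r = 0") auto
qed (rule reduced_norm_ge0[OF fs_star[OF f]])

lemma reduced_norm_star: "f \<in> finsupp A \<Longrightarrow> reduced_norm A \<alpha> (star C f) = reduced_norm A \<alpha> f"
  using reduced_norm_star_le[of f] reduced_norm_star_le[of "star C f"] by (simp add: fs_star star_star_C)

lemma reduced_norm_mult: assumes f: "f \<in> finsupp A" and g: "g \<in> finsupp A"
  shows "reduced_norm A \<alpha> (f \<otimes>\<^bsub>C\<^esub> g) \<le> reduced_norm A \<alpha> f * reduced_norm A \<alpha> g"
proof (rule reduced_norm_le)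
  fix \<xi> assume x: "\<xi> \<in> (finsupp A :: ('g \<Rightarrow> 'a) set)"
  have "l2_norm A (reg f (reg g \<xi>)) \<le> reduced_norm A \<alpha> f * (reduced_norm A \<alpha> g * l2_norm A \<xi>)"
    by (intro order_trans[OF reg_bound] mult_left_mono reg_bound f g x fs_reg reduced_norm_ge0)
  then show "l2_norm A (reg (f \<otimes>\<^bsub>C\<^esub> g) \<xi>) \<le> reduced_norm A \<alpha> f * reduced_norm A \<alpha> g * l2_norm A \<xi>"
    by (simp add: reg_mult[OF f g x] mult.assoc)
qed (intro mult_nonneg_nonneg reduced_norm_ge0 f g)

lemma reduced_norm_cstar: assumes f: "f \<in> finsupp A"
  shows "reduced_norm A \<alpha> (star C f \<otimes>\<^bsub>C\<^esub> f) = (reduced_norm A \<alpha> f)\<^sup>2"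
proof (rule antisym)
  show "reduced_norm A \<alpha> (star C f \<otimes>\<^bsub>C\<^esub> f) \<le> (reduced_norm A \<alpha> f)\<^sup>2"
    using reduced_norm_mult[OF fs_star[OF f] f] by (simp add: reduced_norm_star f power2_eq_square)
  let ?N = "reduced_norm A \<alpha> (star C f \<otimes>\<^bsub>C\<^esub> f)"
  have N0: "?N \<ge> 0" by (intro reduced_norm_ge0 fs_mul fs_star f)
  have "reduced_norm A \<alpha> f \<le> sqrt ?N"
  proof (rule reduced_norm_le)
    fix \<xi> assume x: "\<xi> \<in> (finsupp A :: ('g \<Rightarrow> 'a) set)"
    have "(l2_norm A (reg f \<xi>))\<^sup>2 \<le> l2_norm A \<xi> * l2_norm A (reg (star C f) (reg f \<xi>))"
      unfolding reg_l2_sq[OF f x] by (intro l2_CS x fs_reg fs_star f fs_finite) simp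
    also have "\<dots> \<le> l2_norm A \<xi> * (?N * l2_norm A \<xi>)"
      unfolding reg_mult[OF fs_star[OF f] f x, symmetric] by (intro mult_left_mono reg_bound fs_mul fs_star f l2_ge0 x)
    also have "\<dots> = (sqrt ?N * l2_norm A \<xi>)\<^sup>2" using N0 by (simp add: power_mult_distrib) (simp add: power2_eq_square)
    finally show "l2_norm A (reg f \<xi>) \<le> sqrt ?N * l2_norm A \<xi>"
      by (rule power2_le_imp_le) (auto simp: N0 l2_ge0[OF x])
  qed (simp add: N0)
  then have "(reduced_norm A \<alpha> f)\<^sup>2 \<le> (sqrt ?N)\<^sup>2" by (intro power_mono reduced_norm_ge0 f)
  then show "(reduced_norm A \<alpha> f)\<^sup>2 \<le> ?N" by (simp add: N0)
qed

lemma reg_add: assumes f: "f \<in> finsupp A" and g: "g \<in> finsupp A" and x: "\<xi> \<in> finsupp A"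
  shows "reg (\<lambda>s. f s \<oplus> g s) \<xi> = (\<lambda>t. reg f \<xi> t \<oplus> reg g \<xi> t)"
proof
  fix t
  define T where "T = supp A f \<union> supp A g"
  have T: "finite T" "supp A f \<subseteq> T" "supp A g \<subseteq> T" "supp A (\<lambda>s. f s \<oplus> g s) \<subseteq> T"
    using fs_finite[OF f] fs_finite[OF g] by (auto simp: T_def supp_def)
  note c = fs_closed[OF f] fs_closed[OF g] fs_closed[OF x] a_hom mult_closed
  show "reg (\<lambda>s. f s \<oplus> g s) \<xi> t = reg f \<xi> t \<oplus> reg g \<xi> t"
    unfolding reg_eq[OF fs_add[OF f g] x T(1,4)] reg_eq[OF f x T(1,2)] reg_eq[OF g x T(1,3)]
    by (subst M.finsum_addf[symmetric]) (auto simp: c distrib_right)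
qed

lemma reg_smult: assumes f: "f \<in> finsupp A" and x: "\<xi> \<in> finsupp A"
  shows "reg (\<lambda>s. c \<odot> f s) \<xi> = (\<lambda>t. c \<odot> reg f \<xi> t)"
proof
  fix t
  have T: "finite (supp A f)" "supp A f \<subseteq> supp A f" "supp A (\<lambda>s. c \<odot> f s) \<subseteq> supp A f"
    using fs_finite[OF f] by (auto simp: supp_def sm_zero)
  show "reg (\<lambda>s. c \<odot> f s) \<xi> t = c \<odot> reg f \<xi> t"
    unfolding reg_eq[OF fs_smult[OF f] x T(1,3)] reg_eq[OF f x T(1,2)]
    by (subst sm_finsum) (auto simp: fs_closed[OF f] fs_closed[OF x] a_hom mult_closed smult_mult_left)
qed

end

context cstar_dyn
begin

lemma reg_add_right: assumes h: "h \<in> finsupp A" and x: "\<xi> \<in> finsupp A" and y: "\<eta> \<in> finsupp A"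
  shows "reg h (\<lambda>t. \<xi> t \<oplus> \<eta> t) = (\<lambda>t. reg h \<xi> t \<oplus> reg h \<eta> t)"
  unfolding regular_rep_def
  by (intro ext, subst M.finsum_addf[symmetric])
    (auto simp: fs_closed[OF h] fs_closed[OF x] fs_closed[OF y] a_hom mult_closed distrib_left)

lemma reg_smult_right: assumes h: "h \<in> finsupp A" and x: "\<xi> \<in> finsupp A"
  shows "reg h (\<lambda>t. c \<odot> \<xi> t) = (\<lambda>t. c \<odot> reg h \<xi> t)"
  unfolding regular_rep_def
  by (intro ext, subst sm_finsum)
    (auto simp: fs_closed[OF h] fs_closed[OF x] a_hom mult_closed smult_mult_right)

lemma star_mult_C: assumes f: "f \<in> finsupp A" and g: "g \<in> finsupp A"
  shows "star C (f \<otimes>\<^bsub>C\<^esub> g) = star C g \<otimes>\<^bsub>C\<^esub> star C f"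
proof
  fix t
  note c = fs_closed[OF f] fs_closed[OF g] a_hom(1) mult_closed star_closed
  define k where "k u = star C g u \<otimes> \<alpha> u (star C f (t - u))" for u
  have sg: "star C g \<in> finsupp A" and sf: "star C f \<in> finsupp A" using f g by (auto intro: fs_star)
  have "star C (f \<otimes>\<^bsub>C\<^esub> g) t = \<alpha> t (star A (finsum A (\<lambda>s. f s \<otimes> \<alpha> s (g (- t - s))) (supp A f)))"
    unfolding C_simps by (subst mul_eq[OF f g fs_finite[OF f] subset_refl]) simp
  also have "\<dots> = finsum A (\<lambda>s. \<alpha> t (star A (f s \<otimes> \<alpha> s (g (- t - s))))) (supp A f)"
    by (subst star_finsum) (auto intro!: a_finsum c)
  also have "\<dots> = finsum A (\<lambda>s. k (s + t)) (supp A f)"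
  proof (rule M.finsum_cong')
    fix s
    have "\<alpha> t (star A (f s \<otimes> \<alpha> s (g (- t - s)))) = \<alpha> (t + s) (star A (g (- t - s))) \<otimes> \<alpha> t (star A (f s))"
      by (simp add: star_mult c a_hom a_hom(5)[symmetric] a_plus del: a_hom(5))
    also have "\<dots> = k (s + t)"
    proof -
      have e: "- (s + t) = - t - s" "t - (s + t) = - s" "- (- s) = s" "t + s = s + t" by (simp_all add: add.commute)
      have "k (s + t) = \<alpha> (s + t) (star A (g (- t - s))) \<otimes> \<alpha> (s + t) (\<alpha> (- s) (star A (f s)))"
        by (simp only: k_def C_simps e)
      then show ?thesis by (simp add: a_plus c add.commute[of t s])
    qed
    finally show "\<alpha> t (star A (f s \<otimes> \<alpha> s (g (- t - s)))) = k (s + t)" .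
  qed (auto simp: k_def intro!: c fs_closed[OF sg] fs_closed[OF sf])
  also have "\<dots> = finsum A k (supp A (star C g))"
  proof (rule inner_shift[symmetric])
    show "k u \<in> carrier A" for u by (auto simp: k_def intro!: c fs_closed[OF sg] fs_closed[OF sf])
    show "k u = \<zero>" if "u \<notin> supp A (star C g)" for u
      using not_supp[OF that] by (simp add: k_def mult_zero_left c fs_closed[OF sf])
    show "k (v + t) = \<zero>" if "v \<notin> supp A f" for v
    proof -
      have "star C f (t - (v + t)) = \<zero>" using not_supp[OF that] by (simp add: C_simps star_zero a_zero)
      then show ?thesis by (simp add: k_def a_zero mult_zero_right fs_closed[OF sg])
    qed
  qed (auto simp: fs_finite[OF f] fs_finite[OF sg])
  also have "\<dots> = (star C g \<otimes>\<^bsub>C\<^esub> star C f) t"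
    unfolding k_def by (rule mul_eq[OF sg sf fs_finite[OF sg] subset_refl, symmetric])
  finally show "star C (f \<otimes>\<^bsub>C\<^esub> g) t = (star C g \<otimes>\<^bsub>C\<^esub> star C f) t" .
qed

lemma reduced_norm_triangle: assumes f: "f \<in> finsupp A" and g: "g \<in> finsupp A"
  shows "reduced_norm A \<alpha> (\<lambda>s. f s \<oplus> g s) \<le> reduced_norm A \<alpha> f + reduced_norm A \<alpha> g"
proof (rule reduced_norm_le)
  fix \<xi> :: "'g \<Rightarrow> 'a" assume x: "\<xi> \<in> finsupp A"
  show "l2_norm A (reg (\<lambda>s. f s \<oplus> g s) \<xi>) \<le> (reduced_norm A \<alpha> f + reduced_norm A \<alpha> g) * l2_norm A \<xi>"
    unfolding reg_add[OF f g x]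
    using l2_triangle[OF fs_reg[OF f x] fs_reg[OF g x]] reg_bound[OF f x] reg_bound[OF g x]
    by (simp add: algebra_simps)
qed (intro add_nonneg_nonneg reduced_norm_ge0 f g)

lemma reduced_norm_smult: assumes f: "f \<in> finsupp A"
  shows "reduced_norm A \<alpha> (\<lambda>s. c \<odot> f s) = cmod c * reduced_norm A \<alpha> f"
proof -
  have le: "reduced_norm A \<alpha> (\<lambda>s. c \<odot> f s) \<le> cmod c * reduced_norm A \<alpha> f" if f: "f \<in> finsupp A" for f c
  proof (rule reduced_norm_le)
    fix \<xi> :: "'g \<Rightarrow> 'a" assume x: "\<xi> \<in> finsupp A"
    show "l2_norm A (reg (\<lambda>s. c \<odot> f s) \<xi>) \<le> cmod c * reduced_norm A \<alpha> f * l2_norm A \<xi>"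
      unfolding reg_smult[OF f x] l2_smult[OF fs_reg[OF f x]] mult.assoc
      by (intro mult_left_mono reg_bound f x) simp
  qed (intro mult_nonneg_nonneg reduced_norm_ge0 f norm_ge_zero)
  show ?thesis
  proof (cases "c = 0")
    case True
    then show ?thesis using le[OF f, of 0] reduced_norm_ge0[OF fs_smult[OF f, of 0]] by simp
  next
    case False
    have "reduced_norm A \<alpha> f \<le> cmod (1 / c) * reduced_norm A \<alpha> (\<lambda>s. c \<odot> f s)"
      using le[OF fs_smult[OF f, of c], of "1 / c"] False by (simp add: sm_assoc[symmetric] sm_one fs_closed[OF f])
    then have "cmod c * reduced_norm A \<alpha> f \<le> reduced_norm A \<alpha> (\<lambda>s. c \<odot> f s)"
      using False by (simp add: norm_divide field_simps)
    then show ?thesis using le[OF f] by (simp add: antisym)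
  qed
qed

lemma pre_cstar_C: "pre_cstar C"
proof (intro pre_cstar.intro pre_cstar_axioms.intro moduleI cring_complex_ring)
  show "abelian_group C"
  proof (rule abelian_groupI)
    fix f assume "f \<in> carrier C"
    then have f: "f \<in> finsupp A" by (simp add: C_simps)
    have "(\<lambda>s. (-1) \<odot> f s) \<oplus>\<^bsub>C\<^esub> f = \<zero>\<^bsub>C\<^esub>" by (simp add: C_simps sm_minus1 fs_closed[OF f] M.l_neg)
    then show "\<exists>y\<in>carrier C. y \<oplus>\<^bsub>C\<^esub> f = \<zero>\<^bsub>C\<^esub>" using fs_smult[OF f] by (auto simp: C_simps)
  qed (auto simp: C_simps fs_add fs_zero fs_closed M.a_ac)
next
  fix f g h assume "f \<in> carrier C" "g \<in> carrier C" "h \<in> carrier C"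
  then have f: "f \<in> finsupp A" and g: "g \<in> finsupp A" and h: "h \<in> finsupp A" by (auto simp: C_simps)
  note i = fs_mul fs_add fs_smult fs_star fs_reg f g h
  show "f \<otimes>\<^bsub>C\<^esub> g \<otimes>\<^bsub>C\<^esub> h = f \<otimes>\<^bsub>C\<^esub> (g \<otimes>\<^bsub>C\<^esub> h)"
    by (rule reg_faithful) (simp_all add: reg_mult i)
  show "(f \<oplus>\<^bsub>C\<^esub> g) \<otimes>\<^bsub>C\<^esub> h = f \<otimes>\<^bsub>C\<^esub> h \<oplus>\<^bsub>C\<^esub> g \<otimes>\<^bsub>C\<^esub> h"
    unfolding C_simps by (rule reg_faithful) (simp_all add: reg_mult reg_add i)
  show "h \<otimes>\<^bsub>C\<^esub> (f \<oplus>\<^bsub>C\<^esub> g) = h \<otimes>\<^bsub>C\<^esub> f \<oplus>\<^bsub>C\<^esub> h \<otimes>\<^bsub>C\<^esub> g"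
    unfolding C_simps by (rule reg_faithful) (simp_all add: reg_mult reg_add reg_add_right i)
next
  fix f g assume "f \<in> carrier C" "g \<in> carrier C"
  then have f: "f \<in> finsupp A" and g: "g \<in> finsupp A" by (auto simp: C_simps)
  note i = fs_mul fs_add fs_smult fs_star fs_reg f g
  show "f \<otimes>\<^bsub>C\<^esub> g \<in> carrier C" by (simp add: C_simps(1) i)
  show "c \<odot>\<^bsub>C\<^esub> f \<otimes>\<^bsub>C\<^esub> g = c \<odot>\<^bsub>C\<^esub> (f \<otimes>\<^bsub>C\<^esub> g)" for c
    unfolding C_simps by (rule reg_faithful) (simp_all add: reg_mult reg_smult i)
  show "f \<otimes>\<^bsub>C\<^esub> (c \<odot>\<^bsub>C\<^esub> g) = c \<odot>\<^bsub>C\<^esub> (f \<otimes>\<^bsub>C\<^esub> g)" for c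
    unfolding C_simps by (rule reg_faithful) (simp_all add: reg_mult reg_smult reg_smult_right i)
  show "star C (f \<otimes>\<^bsub>C\<^esub> g) = star C g \<otimes>\<^bsub>C\<^esub> star C f" by (rule star_mult_C[OF f g])
  show "nrm C (f \<oplus>\<^bsub>C\<^esub> g) \<le> nrm C f + nrm C g" unfolding C_simps by (rule reduced_norm_triangle[OF f g])
  show "nrm C (f \<otimes>\<^bsub>C\<^esub> g) \<le> nrm C f * nrm C g" unfolding C_simps by (rule reduced_norm_mult[OF f g])
next
  fix f assume "f \<in> carrier C"
  then have f: "f \<in> finsupp A" by (auto simp: C_simps)
  show "star C f \<in> carrier C" by (simp add: C_simps(1) fs_star f)
  show "star C (star C f) = f" by (rule star_star_C[OF f])
  show "nrm C (star C f \<otimes>\<^bsub>C\<^esub> f) = (nrm C f)\<^sup>2" unfolding C_simps(6) by (rule reduced_norm_cstar[OF f])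
  show "nrm C (c \<odot>\<^bsub>C\<^esub> f) = cmod c * nrm C f" for c unfolding C_simps by (rule reduced_norm_smult[OF f])
  show "(nrm C f = 0) = (f = \<zero>\<^bsub>C\<^esub>)"
  proof
    assume "nrm C f = 0"
    then have "nrm A (f s) = 0" for s
      using coeff_le_reduced_norm[OF f, of s] nrm_ge0[OF fs_closed[OF f, of s]] by (simp add: C_simps)
    then show "f = \<zero>\<^bsub>C\<^esub>" by (intro ext) (simp add: C_simps nrm_eq_0 fs_closed[OF f])
  next
    assume "f = \<zero>\<^bsub>C\<^esub>"
    then have "supp A f = {}" by (simp add: C_simps supp_def)
    then show "nrm C f = 0" using reduced_norm_le_sum[OF f] reduced_norm_ge0[OF f] by (simp add: C_simps)
  qed
qed (auto simp: C_simps fs_closed complex_ring_def sm_add sm_radd sm_assoc sm_one fs_smult star_add star_smult a_hom sm_closed star_closed)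

end

section \<open>Polynomial growth of abelian groups\<close>

text \<open>Only multiples by natural numbers are used; integer combinations are covered by generating sets
  that are closed under negation.\<close>
definition nmul :: "nat \<Rightarrow> 'g::ab_group_add \<Rightarrow> 'g" where "nmul n s = (\<Sum>i<n. s)"

text \<open>The combinations of \<open>S\<close> with coefficients at most \<open>m\<close>. Because the group is commutative, products of
  length \<open>m\<close> lie in such a set, whose cardinality is polynomial in \<open>m\<close>.\<close>
definition box :: "'g::ab_group_add set \<Rightarrow> nat \<Rightarrow> 'g set" where
  "box S m = (\<lambda>n. \<Sum>s\<in>S. nmul (n s) s) ` (S \<rightarrow>\<^sub>E {..m})"

lemma nmul_0: "nmul 0 s = 0" and nmul_Suc: "nmul (Suc n) s = nmul n s + s"
  by (simp_all add: nmul_def)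
lemma nmul_add: "nmul (m + n) s = nmul m s + nmul n s"
  by (induction n) (simp_all add: nmul_0 nmul_Suc add.assoc)
lemma nmul_minus: "nmul n (- s) = - nmul n s"
  by (induction n) (simp_all add: nmul_0 nmul_Suc)

lemma boxI: "(\<And>s. s \<in> S \<Longrightarrow> n s \<le> m) \<Longrightarrow> x = (\<Sum>s\<in>S. nmul (n s) s) \<Longrightarrow> x \<in> box S m"
  unfolding box_def by (rule image_eqI[of _ _ "restrict n S"]) auto
lemma boxE:
  assumes "x \<in> box S m"
  obtains n where "\<forall>s\<in>S. n s \<le> m" "x = (\<Sum>s\<in>S. nmul (n s) s)"
  using assms unfolding box_def by (auto simp: PiE_def Pi_def)
lemma finite_box: "finite S \<Longrightarrow> finite (box S m)" by (simp add: box_def finite_PiE)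
lemma card_box: "finite S \<Longrightarrow> card (box S m) \<le> Suc m ^ card S"
  using card_image_le[of "S \<rightarrow>\<^sub>E {..m}" "\<lambda>n. \<Sum>s\<in>S. nmul (n s) s"]
  by (simp add: box_def finite_PiE card_PiE)
lemma box_add: assumes "x \<in> box S m" "y \<in> box S k" shows "x + y \<in> box S (m + k)"
proof -
  obtain n where n: "\<forall>s\<in>S. n s \<le> m" "x = (\<Sum>s\<in>S. nmul (n s) s)" using assms(1) by (rule boxE)
  obtain n' where n': "\<forall>s\<in>S. n' s \<le> k" "y = (\<Sum>s\<in>S. nmul (n' s) s)" using assms(2) by (rule boxE)
  show ?thesis
    by (rule boxI[of _ "\<lambda>s. n s + n' s"]) (auto simp: n n' add_mono nmul_add sum.distrib)
qed
lemma box_zero: "0 \<in> box S m" by (rule boxI[of _ "\<lambda>_. 0"]) (auto simp: nmul_0)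
lemma box_gen: "finite S \<Longrightarrow> s \<in> S \<Longrightarrow> s \<in> box S 1"
proof (rule boxI[of _ "\<lambda>t. if t = s then 1 else 0"])
  assume "finite S" "s \<in> S"
  then have "(\<Sum>t\<in>S. nmul (if t = s then 1 else 0) t) = (\<Sum>t\<in>S. if t = s then s else 0)"
    by (intro sum.cong) (auto simp: nmul_0 nmul_Suc)
  then show "s = (\<Sum>t\<in>S. nmul (if t = s then 1 else 0) t)" using \<open>finite S\<close> \<open>s \<in> S\<close> by simp
qed auto
lemma box_uminus: assumes S: "\<And>s. s \<in> S \<Longrightarrow> - s \<in> S" and x: "x \<in> box S m" shows "- x \<in> box S m"
proof -
  obtain n where n: "\<forall>s\<in>S. n s \<le> m" "x = (\<Sum>s\<in>S. nmul (n s) s)" using x by (rule boxE)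
  have "- x = (\<Sum>s\<in>S. nmul (n s) (- s))" by (simp add: n(2) nmul_minus sum_negf)
  also have "\<dots> = (\<Sum>s\<in>S. nmul (n (- s)) s)"
    by (rule sum.reindex_bij_witness[of _ uminus uminus]) (auto simp: S)
  finally show ?thesis using n(1) S by (intro boxI[of _ "\<lambda>s. n (- s)"]) auto
qed

lemma poly_less_exp:
  fixes r :: real assumes r: "r > 1"
  shows "\<exists>N0. \<forall>N\<ge>N0. (real N + 1) ^ k < r ^ N"
proof (cases "k = 0")
  case True
  have "1 < r ^ N" if "N \<ge> 1" for N using that r by (simp add: one_less_power)
  then show ?thesis using True by (intro exI[of _ 1]) auto
next
  case False
  define s where "s = root k r"
  have s: "s > 1" "s ^ k = r" using False r by (auto simp: s_def real_root_gt_1_iff)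
  have "(\<lambda>n. real n * (1 / s) ^ n + (1 / s) ^ n) \<longlonglongrightarrow> 0 + 0"
    using s by (intro tendsto_add powser_times_n_limit_0 LIMSEQ_power_zero) auto
  then have "eventually (\<lambda>n. real n * (1 / s) ^ n + (1 / s) ^ n < 1) sequentially"
    by (intro order_tendstoD(2)) auto
  then obtain N0 where N0: "\<And>n. n \<ge> N0 \<Longrightarrow> real n * (1 / s) ^ n + (1 / s) ^ n < 1"
    by (auto simp: eventually_sequentially)
  have "(real N + 1) ^ k < r ^ N" if "N \<ge> N0" for N
  proof -
    have "real N + 1 < s ^ N" using N0[OF that] s by (simp add: power_one_over field_simps)
    then have "(real N + 1) ^ k < (s ^ N) ^ k" using False by (intro power_strict_mono) auto
    also have "\<dots> = r ^ N" by (simp add: s(2)[symmetric] power_mult[symmetric] mult.commute)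
    finally show ?thesis .
  qed
  then show ?thesis by blast
qed

lemma le_of_subexponential:
  fixes a b :: real
  assumes a: "a \<ge> 0" "b \<ge> 0" and le: "\<And>j. a ^ (2 ^ j) \<le> (real (2 ^ j) + 1) ^ k * b ^ (2 ^ j)"
  shows "a \<le> b"
proof (rule ccontr)
  assume "\<not> a \<le> b"
  then have ab: "b < a" by simp
  show False
  proof (cases "b = 0")
    case True
    then show False using le[of 0] ab by simp
  next
    case False
    then have b: "b > 0" using a by simp
    obtain N0 where N0: "\<forall>N\<ge>N0. (real N + 1) ^ k < (a / b) ^ N"
      using poly_less_exp[of "a / b" k] ab b by auto
    have "N0 < 2 ^ N0" by (rule less_exp)
    then have "(real (2 ^ N0) + 1) ^ k < (a / b) ^ (2 ^ N0)" using N0 by (meson less_imp_le)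
    then have "(real (2 ^ N0) + 1) ^ k * b ^ (2 ^ N0) < a ^ (2 ^ N0)"
      using b by (simp add: power_divide field_simps)
    then show False using le[of N0] by simp
  qed
qed

text \<open>Otherwise the cardinality of the boxes would grow exponentially.\<close>
lemma box_folner:
  fixes S :: "'g::ab_group_add set"
  assumes S: "finite S" and e: "e > 0"
  shows "\<exists>m. real (card (box S (Suc m))) \<le> (1 + e) * real (card (box S m))"
proof (rule ccontr)
  assume "\<not> ?thesis"
  then have *: "(1 + e) * real (card (box S m)) < real (card (box S (Suc m)))" for m by (simp add: not_le)
  have "(1 + e) ^ m \<le> real (card (box S m))" for m
  proof (induction m)
    case 0
    have "card (box S 0) > 0" using box_zero[of S 0] finite_box[OF S] by (auto simp: card_gt_0_iff)
    then show ?case by simp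
  next
    case (Suc m)
    have "(1 + e) ^ Suc m \<le> (1 + e) * real (card (box S m))" using Suc e by simp
    then show ?case using *[of m] by linarith
  qed
  moreover have "real (card (box S m)) \<le> (real m + 1) ^ card S" for m
  proof -
    have "real (card (box S m)) \<le> real (Suc m ^ card S)" using card_box[OF S, of m] by (simp only: of_nat_le_iff)
    then show ?thesis by (simp add: add.commute)
  qed
  ultimately have "(1 + e) ^ m \<le> (real m + 1) ^ card S" for m by (meson order_trans)
  moreover obtain N0 where "\<forall>N\<ge>N0. (real N + 1) ^ card S < (1 + e) ^ N" using poly_less_exp[of "1 + e" "card S"] e by auto
  ultimately show False by (meson not_le order_refl)
qed

context cstar_dyn
begin

text \<open>Iterating \<open>f \<mapsto> f* f\<close> raises both \<open>p1\<close> and \<open>p2\<close> to the power \<open>2 ^ j\<close>, while the number of coefficients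
  stays polynomial in \<open>2 ^ j\<close>. So the loss in passing from a sum of coefficients to the largest one
  disappears on taking roots. In particular the full and the reduced norm coincide.\<close>
theorem cstar_norm_le:
  fixes p1 p2 :: "('g \<Rightarrow> 'a) \<Rightarrow> real"
  assumes p1: "\<And>f. f \<in> finsupp A \<Longrightarrow> p1 (star C f \<otimes>\<^bsub>C\<^esub> f) = (p1 f)\<^sup>2" "\<And>f. f \<in> finsupp A \<Longrightarrow> 0 \<le> p1 f"
      "\<And>f. f \<in> finsupp A \<Longrightarrow> p1 f \<le> (\<Sum>s\<in>supp A f. nrm A (f s))"
    and p2: "\<And>f. f \<in> finsupp A \<Longrightarrow> p2 (star C f \<otimes>\<^bsub>C\<^esub> f) = (p2 f)\<^sup>2" "\<And>f. f \<in> finsupp A \<Longrightarrow> 0 \<le> p2 f"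
      "\<And>f s. f \<in> finsupp A \<Longrightarrow> nrm A (f s) \<le> p2 f"
    and f: "f \<in> finsupp A"
  shows "p1 f \<le> p2 f"
proof -
  define F where "F j = ((\<lambda>f. star C f \<otimes>\<^bsub>C\<^esub> f) ^^ j) f" for j
  have F0: "F 0 = f" and FS: "F (Suc j) = star C (F j) \<otimes>\<^bsub>C\<^esub> F j" for j by (auto simp: F_def)
  have Ff: "F j \<in> finsupp A" for j by (induction j) (simp_all add: F0 FS f fs_mul fs_star)
  define S where "S = supp A f \<union> uminus ` supp A f"
  have S: "finite S" "\<And>s. s \<in> S \<Longrightarrow> - s \<in> S" using fs_finite[OF f] by (auto simp: S_def)
  have supp: "supp A (F j) \<subseteq> box S (2 ^ j)" for j
  proof (induction j)
    case 0 then show ?case using box_gen[OF S(1)] by (auto simp: F0 S_def)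
  next
    case (Suc j)
    have "supp A (star C (F j)) \<subseteq> box S (2 ^ j)"
    proof
      fix u assume "u \<in> supp A (star C (F j))"
      then have "- u \<in> supp A (F j)" by (auto simp: supp_def C_simps star_zero a_zero)
      then have "- u \<in> box S (2 ^ j)" using Suc by blast
      from box_uminus[OF S(2) this] have "- (- u) \<in> box S (2 ^ j)" by simp
      then show "u \<in> box S (2 ^ j)" by simp
    qed
    then show ?case using supp_mul[OF fs_star[OF Ff] Ff, of j j] Suc box_add[of _ S "2 ^ j" _ "2 ^ j"]
      unfolding FS by (fastforce simp: mult_2)
  qed
  have pow: "p (F j) = (p f) ^ (2 ^ j)" if "\<And>f. f \<in> finsupp A \<Longrightarrow> p (star C f \<otimes>\<^bsub>C\<^esub> f) = (p f)\<^sup>2" for p :: "_ \<Rightarrow> real" and j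
    by (induction j) (simp_all add: F0 FS that[OF Ff] power_mult[symmetric] mult.commute)
  show ?thesis
  proof (rule le_of_subexponential)
    fix j
    have "p1 f ^ (2 ^ j) = p1 (F j)" by (simp add: pow p1)
    also have "\<dots> \<le> (\<Sum>s\<in>supp A (F j). nrm A (F j s))" by (rule p1(3)[OF Ff])
    also have "\<dots> \<le> (\<Sum>s\<in>supp A (F j). p2 (F j))" by (intro sum_mono p2(3)[OF Ff])
    also have "\<dots> = real (card (supp A (F j))) * p2 f ^ (2 ^ j)" by (simp add: pow p2)
    also have "\<dots> \<le> (real (2 ^ j) + 1) ^ card S * p2 f ^ (2 ^ j)"
    proof (rule mult_right_mono)
      have "card (supp A (F j)) \<le> Suc (2 ^ j) ^ card S"
        using card_mono[OF finite_box[OF S(1)] supp] card_box[OF S(1)] order_trans by blast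
      then have "real (card (supp A (F j))) \<le> real (Suc (2 ^ j) ^ card S)" by (simp only: of_nat_le_iff)
      then show "real (card (supp A (F j))) \<le> (real (2 ^ j) + 1) ^ card S" by (simp add: add.commute)
    qed (simp add: p2 f)
    finally show "p1 f ^ (2 ^ j) \<le> (real (2 ^ j) + 1) ^ card S * p2 f ^ (2 ^ j)" .
  qed (simp_all add: p1 p2 f)
qed

end

section \<open>Characters of abelian groups\<close>

text \<open>Characters of subgroups, represented by their graphs so that Zorn's lemma applies to inclusion.\<close>
definition char_graph :: "('g::ab_group_add \<times> complex) set \<Rightarrow> bool" where
  "char_graph G \<longleftrightarrow> (0, 1) \<in> G \<and> (\<forall>a x b y. (a, x) \<in> G \<longrightarrow> (b, y) \<in> G \<longrightarrow> (a + b, x * y) \<in> G) \<and>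
     (\<forall>a x. (a, x) \<in> G \<longrightarrow> (- a, cnj x) \<in> G) \<and> (\<forall>a x. (a, x) \<in> G \<longrightarrow> cmod x = 1) \<and>
     (\<forall>x. (0, x) \<in> G \<longrightarrow> x = 1)"

lemma cnj_mult_unit: "cmod x = 1 \<Longrightarrow> x * cnj x = 1" "cmod x = 1 \<Longrightarrow> cnj x * x = 1"
  by (simp_all add: complex_norm_square[symmetric] mult.commute)

lemma char_graph_unique: assumes G: "char_graph G" and "(a, x) \<in> G" "(a, y) \<in> G" shows "x = y"
proof -
  have "(a + - a, x * cnj y) \<in> G" "cmod y = 1" using assms unfolding char_graph_def by blast+
  then have "x * cnj y = 1" using G unfolding char_graph_def by simp
  then have "x * (cnj y * y) = y" by (metis mult.assoc mult_1)
  then show ?thesis using cnj_mult_unit(2)[OF \<open>cmod y = 1\<close>] by simp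
qed

lemma char_graph_nmul: "char_graph G \<Longrightarrow> (a, x) \<in> G \<Longrightarrow> (nmul n a, x ^ n) \<in> G"
proof (induction n)
  case 0 then show ?case by (simp add: nmul_0 char_graph_def)
next
  case (Suc n)
  then have "(nmul n a + a, x ^ n * x) \<in> G" unfolding char_graph_def by blast
  then show ?case by (simp add: nmul_Suc mult.commute)
qed

text \<open>The domain is enlarged by \<open>a\<close>, which gets the value \<open>z\<close>; the natural numbers \<open>k\<close> and \<open>l\<close> stand for the
  integer \<open>k - l\<close>.\<close>
definition graph_ext :: "('g::ab_group_add \<times> complex) set \<Rightarrow> 'g \<Rightarrow> complex \<Rightarrow> ('g \<times> complex) set" where
  "graph_ext G a z = {(h + nmul k a - nmul l a, x * z ^ k * cnj z ^ l) | h x k l. (h, x) \<in> G}"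

lemma graph_ext_super: "G \<subseteq> graph_ext G a z"
proof
  fix p assume p: "p \<in> G"
  obtain h x where hx: "p = (h, x)" by fastforce
  have "(h, x) = (h + nmul 0 a - nmul 0 a, x * z ^ 0 * cnj z ^ 0)" by (simp add: nmul_0)
  then show "p \<in> graph_ext G a z" using p unfolding hx graph_ext_def by blast
qed

lemma graph_ext_new: assumes "char_graph G" shows "(a, z) \<in> graph_ext G a z"
proof -
  have "(a, z) = (0 + nmul 1 a - nmul 0 a, 1 * z ^ 1 * cnj z ^ 0)" by (simp add: nmul_0 nmul_Suc)
  moreover have "(0, 1) \<in> G" using assms by (simp add: char_graph_def)
  ultimately show ?thesis unfolding graph_ext_def by blast
qed

lemma char_graph_ext:
  assumes G: "char_graph G" and z: "cmod z = 1" and comp: "\<And>n w. n > 0 \<Longrightarrow> (nmul n a, w) \<in> G \<Longrightarrow> z ^ n = w"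
  shows "char_graph (graph_ext G a z)"
  unfolding char_graph_def
proof (intro conjI allI impI)
  show "(0, 1) \<in> graph_ext G a z" using G graph_ext_super[of G a z] unfolding char_graph_def by blast
next
  fix b x c y assume "(b, x) \<in> graph_ext G a z" "(c, y) \<in> graph_ext G a z"
  then obtain h u k l h' u' k' l' where 1: "b = h + nmul k a - nmul l a" "x = u * z ^ k * cnj z ^ l" "(h, u) \<in> G"
    and 2: "c = h' + nmul k' a - nmul l' a" "y = u' * z ^ k' * cnj z ^ l'" "(h', u') \<in> G"
    unfolding graph_ext_def by blast
  have "(h + h', u * u') \<in> G" using 1 2 G unfolding char_graph_def by blast
  moreover have "b + c = (h + h') + nmul (k + k') a - nmul (l + l') a" by (simp add: 1 2 nmul_add algebra_simps)
  moreover have "x * y = (u * u') * z ^ (k + k') * cnj z ^ (l + l')" by (simp add: 1 2 power_add)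
  ultimately show "(b + c, x * y) \<in> graph_ext G a z" unfolding graph_ext_def by blast
next
  fix b x assume "(b, x) \<in> graph_ext G a z"
  then obtain h u k l where 1: "b = h + nmul k a - nmul l a" "x = u * z ^ k * cnj z ^ l" "(h, u) \<in> G"
    unfolding graph_ext_def by blast
  have "(- h, cnj u) \<in> G" using 1 G unfolding char_graph_def by blast
  moreover have "- b = - h + nmul l a - nmul k a" by (simp add: 1)
  moreover have "cnj x = cnj u * z ^ l * cnj z ^ k" by (simp add: 1)
  ultimately show "(- b, cnj x) \<in> graph_ext G a z" unfolding graph_ext_def by blast
next
  fix b x assume "(b, x) \<in> graph_ext G a z"
  then obtain h u k l where 1: "x = u * z ^ k * cnj z ^ l" "(h, u) \<in> G"
    unfolding graph_ext_def by blast
  then show "cmod x = 1" using G z unfolding char_graph_def by (auto simp: norm_mult norm_power)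
next
  fix x assume "(0, x) \<in> graph_ext G a z"
  then obtain h u k l where 1: "0 = h + nmul k a - nmul l a" "x = u * z ^ k * cnj z ^ l" "(h, u) \<in> G"
    unfolding graph_ext_def by blast
  show "x = 1"
  proof (cases k l rule: linorder_cases)
    case equal
    then have "(0, u) \<in> G" using 1 by simp
    then have "u = 1" using G unfolding char_graph_def by blast
    then show ?thesis using 1 equal z by (simp add: power_mult_distrib[symmetric] cnj_mult_unit)
  next
    case less
    then obtain n where n: "l = k + n" "n > 0" using less_imp_add_positive by blast
    have "nmul n a = h" using 1(1) by (simp add: n nmul_add algebra_simps)
    then have "z ^ n = u" using comp n 1 by blast
    then have "x = (z * cnj z) ^ (k + n)" by (simp add: 1 n power_add power_mult_distrib)
    then show ?thesis using z by (simp add: cnj_mult_unit)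
  next
    case greater
    then obtain n where n: "k = l + n" "n > 0" using less_imp_add_positive by blast
    have "nmul n a = - h" using 1(1) by (simp add: n nmul_add algebra_simps) (metis add_eq_0_iff)
    moreover have "(- h, cnj u) \<in> G" using 1 G unfolding char_graph_def by blast
    ultimately have zn: "z ^ n = cnj u" using comp n by metis
    have "cmod u = 1" using 1 G unfolding char_graph_def by blast
    have "x = u * cnj u * (z * cnj z) ^ l" by (simp add: 1 n power_add power_mult_distrib zn[symmetric])
    then show ?thesis using z \<open>cmod u = 1\<close> by (simp add: cnj_mult_unit)
  qed
qed

text \<open>The integers \<open>m\<close> with \<open>m a\<close> in the domain are the multiples of \<open>n\<close>.\<close>
lemma char_graph_divide:
  assumes G: "char_graph G" and n: "n > 0" "(nmul n a, w) \<in> G" "\<And>m. 0 < m \<Longrightarrow> m < n \<Longrightarrow> nmul m a \<notin> fst ` G"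
    and z: "z ^ n = w" and m: "(nmul m a, v) \<in> G"
  shows "z ^ m = v"
proof -
  define q r where "q = m div n" and "r = m mod n"
  have m_eq: "m = q * n + r" by (simp add: q_def r_def)
  have "nmul (q * n) a = nmul q (nmul n a)" for q
    by (induction q) (simp_all add: nmul_0 nmul_Suc nmul_add add.commute)
  then have q: "(nmul (q * n) a, w ^ q) \<in> G" using char_graph_nmul[OF G n(2), of q] by simp
  have "(nmul m a + - nmul (q * n) a, v * cnj (w ^ q)) \<in> G" using m q G unfolding char_graph_def by blast
  moreover have "nmul m a + - nmul (q * n) a = nmul r a" by (simp add: m_eq nmul_add)
  ultimately have "nmul r a \<in> fst ` G" by force
  then have "r = 0" using n(1) n(3)[of r] by (auto simp: r_def)
  then have "(nmul m a, w ^ q) \<in> G" using q m_eq by simp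
  then have "v = w ^ q" using char_graph_unique[OF G m] by blast
  then show ?thesis using \<open>r = 0\<close> by (simp add: m_eq z[symmetric] power_mult[symmetric] mult.commute)
qed

lemma unit_root: assumes "cmod w = 1" "n > 0" shows "\<exists>z. cmod z = 1 \<and> z ^ n = w"
proof -
  define z where "z = cis (Arg w / n)"
  have "z ^ n = cis (Arg w)" using assms by (simp add: z_def DeMoivre)
  also have "w \<noteq> 0" using assms(1) by auto
  then have "cis (Arg w) = w" using cis_Arg[of w] assms by (simp add: sgn_eq)
  finally show ?thesis by (intro exI[of _ z]) (simp add: z_def)
qed

text \<open>If some positive multiple of \<open>a\<close> lies in the domain, a root of the value at the least one serves as
  the value at \<open>a\<close>; otherwise any value does.\<close>
lemma char_graph_extend: assumes G: "char_graph G" shows "\<exists>G'. char_graph G' \<and> G \<subseteq> G' \<and> a \<in> fst ` G'"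
proof -
  have "\<exists>z. cmod z = 1 \<and> (\<forall>n w. n > 0 \<longrightarrow> (nmul n a, w) \<in> G \<longrightarrow> z ^ n = w)"
  proof (cases "\<exists>n>0. nmul n a \<in> fst ` G")
    case False
    then have "(nmul n a, w) \<notin> G" if "n > 0" for n w
      using that image_eqI[of "nmul n a" fst "(nmul n a, w)" G] by (metis fst_conv)
    then show ?thesis by (intro exI[of _ 1]) auto
  next
    case True
    define n where "n = (LEAST n. n > 0 \<and> nmul n a \<in> fst ` G)"
    have n: "n > 0 \<and> nmul n a \<in> fst ` G" unfolding n_def by (rule LeastI_ex) (use True in blast)
    then obtain p where p: "p \<in> G" "nmul n a = fst p" by blast
    define w where "w = snd p"
    have w: "(nmul n a, w) \<in> G" using p by (simp add: w_def)
    have min: "nmul m a \<notin> fst ` G" if "0 < m" "m < n" for m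
      using not_less_Least[of m "\<lambda>n. n > 0 \<and> nmul n a \<in> fst ` G"] that unfolding n_def by blast
    have "cmod w = 1" using w G unfolding char_graph_def by blast
    then obtain z where z: "cmod z = 1" "z ^ n = w" using unit_root n by blast
    have "z ^ m = v" if "(nmul m a, v) \<in> G" for m v
      by (rule char_graph_divide[OF G _ w min z(2) that]) (use n in auto)
    then show ?thesis using z(1) by (intro exI[of _ z]) auto
  qed
  then obtain z where z: "cmod z = 1" "\<And>n w. n > 0 \<Longrightarrow> (nmul n a, w) \<in> G \<Longrightarrow> z ^ n = w" by blast
  have "char_graph (graph_ext G a z)" by (rule char_graph_ext[OF G z])
  moreover have "a \<in> fst ` graph_ext G a z"
    by (rule image_eqI[OF _ graph_ext_new[OF G, of a z]]) simp
  ultimately show ?thesis using graph_ext_super[of G a z] by blast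
qed

lemma character_of_graph:
  assumes G0: "char_graph G0"
  shows "\<exists>\<gamma>\<in>dual_group. \<forall>a x. (a, x) \<in> G0 \<longrightarrow> \<gamma> a = x"
proof -
  define \<C> where "\<C> = {G. char_graph G \<and> G0 \<subseteq> G}"
  have "\<exists>M\<in>\<C>. \<forall>X\<in>\<C>. M \<subseteq> X \<longrightarrow> X = M"
  proof (rule subset_Zorn_nonempty)
    show "\<C> \<noteq> {}" using G0 by (auto simp: \<C>_def)
    fix c assume c: "c \<noteq> {}" "subset.chain \<C> c"
    then have cc: "\<And>G. G \<in> c \<Longrightarrow> char_graph G \<and> G0 \<subseteq> G" by (auto simp: subset.chain_def \<C>_def)
    have tot: "\<And>G H. G \<in> c \<Longrightarrow> H \<in> c \<Longrightarrow> G \<subseteq> H \<or> H \<subseteq> G" using c(2) by (auto simp: subset_chain_def)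
    have "char_graph (\<Union>c)"
      unfolding char_graph_def
    proof (intro conjI allI impI)
      show "(0, 1) \<in> \<Union>c" using c(1) cc unfolding char_graph_def by blast
    next
      fix a x b y assume "(a, x) \<in> \<Union>c" "(b, y) \<in> \<Union>c"
      then obtain G H where GH: "G \<in> c" "H \<in> c" "(a, x) \<in> G" "(b, y) \<in> H" by blast
      then obtain K where K: "K \<in> c" "(a, x) \<in> K" "(b, y) \<in> K" using tot[of G H] by blast
      then have "char_graph K" using cc by blast
      then show "(a + b, x * y) \<in> \<Union>c" using K unfolding char_graph_def by blast
    next
      fix a x assume "(a, x) \<in> \<Union>c"
      then obtain G where G: "G \<in> c" "(a, x) \<in> G" by blast
      then have "char_graph G" using cc by blast
      then show "(- a, cnj x) \<in> \<Union>c" "cmod x = 1" using G unfolding char_graph_def by blast+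
    next
      fix x assume "(0, x) \<in> \<Union>c"
      then obtain G where G: "G \<in> c" "(0, x) \<in> G" by blast
      then have "char_graph G" using cc by blast
      then show "x = 1" using G unfolding char_graph_def by blast
    qed
    then show "\<Union>c \<in> \<C>" using c cc by (auto simp: \<C>_def)
  qed
  then obtain M where M: "char_graph M" "G0 \<subseteq> M" and max: "\<And>X. char_graph X \<Longrightarrow> M \<subseteq> X \<Longrightarrow> X = M"
    by (auto simp: \<C>_def)
  have dom: "a \<in> fst ` M" for a
  proof -
    obtain G' where "char_graph G'" "M \<subseteq> G'" "a \<in> fst ` G'" using char_graph_extend[OF M(1)] by blast
    then show ?thesis using max by blast
  qed
  define \<gamma> where "\<gamma> a = (THE x. (a, x) \<in> M)" for a
  have g: "\<gamma> a = x" if "(a, x) \<in> M" for a x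
    unfolding \<gamma>_def by (rule the_equality) (use that char_graph_unique[OF M(1)] in blast)+
  have gM: "(a, \<gamma> a) \<in> M" for a using dom[of a] g by force
  have "\<gamma> \<in> dual_group"
    unfolding dual_group_def
  proof (intro CollectI conjI allI)
    fix s t
    have "(s + t, \<gamma> s * \<gamma> t) \<in> M" using gM[of s] gM[of t] M(1) unfolding char_graph_def by blast
    then show "\<gamma> (s + t) = \<gamma> s * \<gamma> t" by (rule g)
    show "cmod (\<gamma> s) = 1" using gM[of s] M(1) unfolding char_graph_def by blast
  qed
  then show ?thesis using g M(2) by blast
qed

lemma dual_groupD:
  assumes "\<gamma> \<in> dual_group"
  shows "\<gamma> (s + t) = \<gamma> s * \<gamma> t" "cmod (\<gamma> s) = 1" "\<gamma> 0 = 1" "\<gamma> (- s) = cnj (\<gamma> s)" "\<gamma> (s - t) = \<gamma> s * cnj (\<gamma> t)"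
proof -
  show a: "\<gamma> (s + t) = \<gamma> s * \<gamma> t" for s t using assms by (simp add: dual_group_def)
  show n: "cmod (\<gamma> s) = 1" for s using assms by (simp add: dual_group_def)
  have "\<gamma> 0 = \<gamma> 0 * \<gamma> 0" using a[of 0 0] by simp
  then show 0: "\<gamma> 0 = 1" using n[of 0] by (metis mult_cancel_left1 norm_zero zero_neq_one)
  show m: "\<gamma> (- s) = cnj (\<gamma> s)" for s
  proof -
    have "\<gamma> s * \<gamma> (- s) = \<gamma> s * cnj (\<gamma> s)" using a[of s "- s"] 0 cnj_mult_unit[OF n] by simp
    then show ?thesis using n[of s] by (metis mult_cancel_left norm_zero zero_neq_one)
  qed
  show "\<gamma> (s - t) = \<gamma> s * cnj (\<gamma> t)" using a[of s "- t"] m[of t] by simp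
qed

text \<open>The value at \<open>s\<close> is prescribed to be a root of unity other than 1, namely \<open>-1\<close> if \<open>s\<close> has infinite
  order and \<open>exp (2 \<pi> i / n)\<close> if it has order \<open>n\<close>. The sum over its powers then vanishes.\<close>
lemma separating_character:
  fixes s :: "'g::ab_group_add"
  assumes s: "s \<noteq> 0"
  shows "\<exists>\<gamma>\<in>dual_group. \<exists>d>0. (\<Sum>j<d. \<gamma> s ^ j) = 0"
proof -
  define G :: "('g \<times> complex) set" where "G = {(0, 1)}"
  have G: "char_graph G" by (auto simp: G_def char_graph_def)
  have "\<exists>z d. cmod z = 1 \<and> (\<forall>n w. n > 0 \<longrightarrow> (nmul n s, w) \<in> G \<longrightarrow> z ^ n = w) \<and> d > (0::nat) \<and> z \<noteq> 1 \<and> z ^ d = 1"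
  proof (cases "\<exists>n>0. nmul n s = 0")
    case False
    then have "nmul n s \<noteq> 0" if "n > 0" for n using that by blast
    then show ?thesis by (intro exI[of _ "-1"] exI[of _ 2]) (auto simp: G_def)
  next
    case True
    define n where "n = (LEAST n. n > 0 \<and> nmul n s = 0)"
    have n: "n > 0 \<and> nmul n s = 0" unfolding n_def by (rule LeastI_ex) (use True in blast)
    have min: "nmul m s \<notin> fst ` G" if "0 < m" "m < n" for m
      using not_less_Least[of m "\<lambda>n. n > 0 \<and> nmul n s = 0"] that unfolding n_def G_def by simp
    have "n \<noteq> 1" using n s by (auto simp: nmul_Suc nmul_0)
    define z where "z = cis (2 * pi / n)"
    have zn: "z ^ n = 1" using n by (simp add: z_def DeMoivre)
    have "z \<noteq> 1"
    proof
      assume "z = 1"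
      then have "cos (2 * pi / n) = 1" by (simp add: z_def complex_eq_iff)
      then obtain k :: int where k: "2 * pi / n = of_int k * 2 * pi" unfolding cos_one_2pi_int by blast
      have "of_int k * (2 * pi) * n = 2 * pi" using k n by (simp add: field_simps)
      then have "of_int k * real n = 1" by (simp add: field_simps)
      then have "k * int n = 1" by (metis of_int_1 of_int_eq_iff of_int_mult of_int_of_nat_eq)
      then show False using \<open>n \<noteq> 1\<close> by (simp add: zmult_eq_1_iff)
    qed
    moreover have "z ^ m = v" if "(nmul m s, v) \<in> G" for m v
      by (rule char_graph_divide[OF G _ _ min zn that]) (use n in \<open>auto simp: G_def\<close>)
    moreover have "cmod z = 1" by (simp add: z_def)
    ultimately show ?thesis using zn n by blast
  qed
  then obtain z and d :: nat where z: "cmod z = 1" "\<And>n w. n > 0 \<Longrightarrow> (nmul n s, w) \<in> G \<Longrightarrow> z ^ n = w"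
    and d: "d > 0" "z \<noteq> 1" "z ^ d = 1" by blast
  obtain \<gamma> where \<gamma>: "\<gamma> \<in> dual_group" "\<forall>a x. (a, x) \<in> graph_ext G s z \<longrightarrow> \<gamma> a = x"
    using character_of_graph[OF char_graph_ext[OF G z]] by blast
  then have "\<gamma> s = z" using graph_ext_new[OF G] by blast
  moreover have "(\<Sum>j<d. z ^ j) = 0" using d geometric_sum[of z d] by simp
  ultimately show ?thesis using \<gamma> d by blast
qed

lemma dual_group_mult_power: "\<gamma> \<in> dual_group \<Longrightarrow> \<chi> \<in> dual_group \<Longrightarrow> (\<lambda>s. \<gamma> s * \<chi> s ^ j) \<in> dual_group"
  by (auto simp: dual_group_def norm_mult norm_power power_mult_distrib)

text \<open>Multiplying all members of a family by the powers \<open>\<chi> ^ j\<close> of a character multiplies the sum at \<open>w\<close> by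
  \<open>\<Sum> \<chi> w ^ j\<close>. So zeros of the sum are kept while a new one is created at \<open>s\<close>.\<close>
lemma averaging_characters:
  fixes W :: "'g::ab_group_add set"
  assumes "finite W" "0 \<notin> W"
  shows "\<exists>gs. gs \<noteq> [] \<and> set gs \<subseteq> dual_group \<and> (\<forall>w\<in>W. (\<Sum>g\<leftarrow>gs. g w) = 0)"
  using assms
proof (induction W rule: finite_induct)
  case empty
  have "(\<lambda>_. 1) \<in> dual_group" by (simp add: dual_group_def)
  then show ?case by (intro exI[of _ "[\<lambda>_. 1]"]) auto
next
  case (insert s W)
  obtain gs where gs: "gs \<noteq> []" "set gs \<subseteq> dual_group" "\<And>w. w \<in> W \<Longrightarrow> (\<Sum>g\<leftarrow>gs. g w) = 0" using insert by auto
  obtain \<chi> and d :: nat where \<chi>: "\<chi> \<in> dual_group" "d > 0" "(\<Sum>j<d. \<chi> s ^ j) = 0"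
    using separating_character[of s] insert by auto
  define hs where "hs = concat (map (\<lambda>g. map (\<lambda>j s. g s * \<chi> s ^ j) [0..<d]) gs)"
  have sum: "(\<Sum>h\<leftarrow>hs. h w) = (\<Sum>g\<leftarrow>gs. g w) * (\<Sum>j<d. \<chi> w ^ j)" for w
  proof -
    have "(\<Sum>h\<leftarrow>hs. h w) = (\<Sum>g\<leftarrow>gs. \<Sum>j\<leftarrow>[0..<d]. g w * \<chi> w ^ j)"
      unfolding hs_def by (induction gs) (simp_all add: o_def)
    also have "\<dots> = (\<Sum>g\<leftarrow>gs. g w * (\<Sum>j<d. \<chi> w ^ j))"
      by (simp add: interv_sum_list_conv_sum_set_nat sum_distrib_left atLeast0LessThan)
    also have "\<dots> = (\<Sum>g\<leftarrow>gs. g w) * (\<Sum>j<d. \<chi> w ^ j)" by (simp add: sum_list_mult_const)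
    finally show ?thesis .
  qed
  have "hs \<noteq> []" using gs(1) \<chi>(2) by (cases gs) (auto simp: hs_def)
  moreover have "set hs \<subseteq> dual_group" using gs(2) \<chi>(1) by (auto simp: hs_def intro!: dual_group_mult_power)
  moreover have "(\<Sum>h\<leftarrow>hs. h w) = 0" if "w \<in> insert s W" for w using that gs(3) \<chi>(3) by (auto simp: sum)
  ultimately show ?case by blast
qed

lemma averaging_characters':
  fixes W :: "'g::ab_group_add set"
  assumes "finite W"
  shows "\<exists>N>0. \<exists>\<gamma>. (\<forall>i<N. \<gamma> i \<in> dual_group) \<and> (\<forall>w\<in>W. (\<Sum>i<N. \<gamma> i w) = (if w = 0 then of_nat N else 0))"
proof -
  obtain gs where gs: "gs \<noteq> []" "set gs \<subseteq> dual_group" "\<And>w. w \<in> W - {0} \<Longrightarrow> (\<Sum>g\<leftarrow>gs. g w) = 0"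
    using averaging_characters[of "W - {0}"] assms by auto
  have mem: "gs ! i \<in> dual_group" if "i < length gs" for i using gs(2) that by auto
  have "(\<Sum>i<length gs. (gs ! i) w) = (if w = 0 then of_nat (length gs) else 0)" if "w \<in> W" for w
  proof (cases "w = 0")
    case True
    have "(\<Sum>i<length gs. (gs ! i) w) = (\<Sum>i<length gs. 1)"
      using True dual_groupD(3)[OF mem] by (intro sum.cong) auto
    then show ?thesis using True by simp
  next
    case False
    then show ?thesis using gs(3)[of w] that
      by (simp add: sum_list_sum_nth atLeast0LessThan)
  qed
  then show ?thesis using mem gs(1) by (intro exI[of _ "length gs"] conjI exI[of _ "\<lambda>i. gs ! i"]) auto
qed

section \<open>Fejer kernels\<close>

text \<open>The Fejer kernel of a Folner set \<open>F\<close> is \<open>K(\<gamma>) = \<bar>\<Sum>\<^sub>a\<^sub>\<in>\<^sub>F \<gamma>(a)\<bar>\<^sup>2 / \<bar>F\<bar>\<close>; its Fourier coefficient \<open>k(s)\<close> is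
  the number of pairs in \<open>F\<close> with difference \<open>s\<close>, divided by \<open>\<bar>F\<bar>\<close>, and is close to 1 for \<open>s \<in> S\<close>. By
  Chebyshev's inequality for \<open>\<bar>\<gamma>(s) - 1\<bar>\<^sup>2\<close>, little mass lies away from the trivial character. For the
  coefficients in a finite set \<open>T\<close>, the integral against \<open>K\<close> may be replaced by a finite average, with
  weights \<open>c i = K(\<gamma>\<^sub>i) / N\<close>.\<close>
lemma fejer_kernel:
  fixes S :: "'g::ab_group_add set"
  assumes S: "finite S" and eta: "\<eta> > 0" and e: "e > 0"
  shows "\<exists>k :: 'g \<Rightarrow> real. finite {s. k s \<noteq> 0} \<and> (\<forall>T. finite T \<longrightarrow> (\<exists>N c \<gamma>.
    (\<forall>i<N. \<gamma> i \<in> dual_group \<and> 0 \<le> c i) \<and> (\<Sum>i<N. c i) = 1 \<and>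
    (\<forall>s\<in>T. (\<Sum>i<(N::nat). complex_of_real (c i) * cnj (\<gamma> i s)) = complex_of_real (k s)) \<and>
    (\<Sum>i | i < N \<and> \<not> (\<forall>s\<in>S. cmod (\<gamma> i s - 1) < \<eta>). c i) \<le> e))"
proof -
  \<comment> \<open>Chebyshev's inequality will bound the mass far from 1 by \<open>2 d \<bar>S\<bar> / \<eta>\<^sup>2\<close>, which is then at most \<open>e\<close>.\<close>
  define d where "d = e * \<eta>\<^sup>2 / (2 * (real (card S) + 1))"
  have d: "d > 0" using e eta by (simp add: d_def)
  obtain m where m: "real (card (box S (Suc m))) \<le> (1 + d) * real (card (box S m))" using box_folner[OF S d] by blast
  define F where "F = box S m"
  have F: "finite F" "card F > 0" using finite_box[OF S] box_zero[of S m] by (auto simp: F_def card_gt_0_iff)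
  define k where "k s = real (card {(a, b) \<in> F \<times> F. a - b = s}) / real (card F)" for s
  have "{s. k s \<noteq> 0} \<subseteq> (\<lambda>(a, b). a - b) ` (F \<times> F)"
  proof
    fix s assume "s \<in> {s. k s \<noteq> 0}"
    then have "card {(a, b) \<in> F \<times> F. a - b = s} \<noteq> 0" by (simp add: k_def)
    then have "{(a, b) \<in> F \<times> F. a - b = s} \<noteq> {}" by (metis card.empty)
    then show "s \<in> (\<lambda>(a, b). a - b) ` (F \<times> F)" by force
  qed
  then have fin: "finite {s. k s \<noteq> 0}" by (rule finite_subset) (simp add: F)
  have k0: "k 0 = 1"
  proof -
    have "{(a, b) \<in> F \<times> F. a - b = 0} = (\<lambda>a. (a, a)) ` F" by auto
    then show ?thesis using F by (simp add: k_def card_image inj_on_def card_gt_0_iff)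
  qed
  have kS: "k s \<ge> 1 - d" if s: "s \<in> S" for s
  proof -
    define F' where "F' = (\<lambda>b. b + s) ` F"
    have F': "finite F'" "card F' = card F" using F by (simp_all add: F'_def card_image)
    have "{(a, b) \<in> F \<times> F. a - b = s} = (\<lambda>a. (a, a - s)) ` (F \<inter> F')"
      by (auto simp: F'_def algebra_simps image_iff)
    then have c: "card {(a, b) \<in> F \<times> F. a - b = s} = card (F \<inter> F')" by (simp add: card_image inj_on_def)
    have "F \<union> F' \<subseteq> box S (Suc m)"
    proof -
      have "F \<subseteq> box S (Suc m)" using box_add[OF _ box_zero[of S 1], of _ m] by (auto simp: F_def)
      moreover have "F' \<subseteq> box S (Suc m)" using box_add[OF _ box_gen[OF S s], of _ m] by (auto simp: F_def F'_def)
      ultimately show ?thesis by blast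
    qed
    then have "card (F \<union> F') \<le> card (box S (Suc m))" by (intro card_mono finite_box S)
    moreover have "card F + card F' = card (F \<union> F') + card (F \<inter> F')" by (rule card_Un_Int[OF F(1) F'(1)])
    ultimately have "2 * real (card F) \<le> real (card (box S (Suc m))) + real (card (F \<inter> F'))" using F'(2) by linarith
    then have "(1 - d) * real (card F) \<le> real (card (F \<inter> F'))" using m by (simp add: F_def algebra_simps)
    then show ?thesis unfolding k_def c using F by (simp add: pos_le_divide_eq)
  qed
  have main: "\<exists>N c \<gamma>.
    (\<forall>i<N. \<gamma> i \<in> dual_group \<and> 0 \<le> c i) \<and> (\<Sum>i<N. c i) = 1 \<and>
    (\<forall>s\<in>T. (\<Sum>i<(N::nat). complex_of_real (c i) * cnj (\<gamma> i s)) = complex_of_real (k s)) \<and>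
    (\<Sum>i | i < N \<and> \<not> (\<forall>s\<in>S. cmod (\<gamma> i s - 1) < \<eta>). c i) \<le> e" if T: "finite T" for T
  proof -
    \<comment> \<open>The coefficient at 0 gives the total mass, those in \<open>S\<close> the second moments.\<close>
    define T' where "T' = T \<union> S \<union> {0}"
    have T': "finite T'" using T S by (simp add: T'_def)
    define W where "W = (\<lambda>((a, b), s). a - b - s) ` ((F \<times> F) \<times> T')"
    have W: "finite W" using F T' by (simp add: W_def)
    obtain N \<gamma> where N: "N > (0::nat)" and g: "\<And>i. i < N \<Longrightarrow> \<gamma> i \<in> dual_group"
      and av: "\<And>w. w \<in> W \<Longrightarrow> (\<Sum>i<N. \<gamma> i w) = (if w = 0 then of_nat N else 0)"
      using averaging_characters'[OF W] by blast
    define K where "K i = (cmod (\<Sum>a\<in>F. \<gamma> i a))\<^sup>2 / real (card F)" for i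
    define c where "c i = K i / real N" for i
    have c0: "c i \<ge> 0" for i by (simp add: c_def K_def)
    have Kc: "complex_of_real (K i) * cnj (\<gamma> i s) = (\<Sum>(a, b)\<in>F \<times> F. \<gamma> i (a - b - s)) / of_nat (card F)" if i: "i < N" for i s
    proof -
      have "complex_of_real ((cmod (\<Sum>a\<in>F. \<gamma> i a))\<^sup>2) = (\<Sum>a\<in>F. \<gamma> i a) * (\<Sum>b\<in>F. cnj (\<gamma> i b))"
        by (simp only: complex_norm_square cnj_sum)
      also have "\<dots> = (\<Sum>(a, b)\<in>F \<times> F. \<gamma> i a * cnj (\<gamma> i b))" by (simp add: sum_product sum.cartesian_product)
      finally have "complex_of_real ((cmod (\<Sum>a\<in>F. \<gamma> i a))\<^sup>2) * cnj (\<gamma> i s)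
        = (\<Sum>(a, b)\<in>F \<times> F. \<gamma> i a * cnj (\<gamma> i b) * cnj (\<gamma> i s))"
        by (simp add: sum_distrib_right case_prod_unfold)
      also have "\<dots> = (\<Sum>(a, b)\<in>F \<times> F. \<gamma> i (a - b - s))"
        by (simp add: dual_groupD(5)[OF g[OF i]])
      finally show ?thesis by (simp add: K_def)
    qed
    have avk: "(\<Sum>i<N. complex_of_real (c i) * cnj (\<gamma> i s)) = complex_of_real (k s)" if s: "s \<in> T'" for s
    proof -
      have "(\<Sum>i<N. complex_of_real (K i) * cnj (\<gamma> i s)) = (\<Sum>i<N. (\<Sum>(a, b)\<in>F \<times> F. \<gamma> i (a - b - s)) / of_nat (card F))"
        using Kc by (intro sum.cong) auto
      also have "\<dots> = (\<Sum>i<N. \<Sum>p\<in>F \<times> F. \<gamma> i (fst p - snd p - s)) / of_nat (card F)"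
        by (simp add: sum_divide_distrib case_prod_unfold)
      also have "(\<Sum>i<N. \<Sum>p\<in>F \<times> F. \<gamma> i (fst p - snd p - s)) = (\<Sum>p\<in>F \<times> F. \<Sum>i<N. \<gamma> i (fst p - snd p - s))"
        by (rule sum.swap)
      also have "\<dots> = (\<Sum>p\<in>F \<times> F. if fst p - snd p = s then of_nat N else 0)"
      proof (rule sum.cong[OF refl])
        fix p assume p: "p \<in> F \<times> F"
        have "fst p - snd p - s \<in> W" unfolding W_def using p s by (intro image_eqI[of _ _ "(p, s)"]) (auto simp: case_prod_unfold)
        then show "(\<Sum>i<N. \<gamma> i (fst p - snd p - s)) = (if fst p - snd p = s then of_nat N else 0)" by (simp add: av)
      qed
      also have "\<dots> = of_nat (card {p \<in> F \<times> F. fst p - snd p = s}) * of_nat N"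
        using F by (simp add: sum.inter_filter[symmetric])
      also have "{p \<in> F \<times> F. fst p - snd p = s} = {(a, b) \<in> F \<times> F. a - b = s}" by auto
      finally have "(\<Sum>i<N. complex_of_real (K i) * cnj (\<gamma> i s)) = of_nat N * complex_of_real (k s)"
        by (simp add: k_def)
      moreover have "(\<Sum>i<N. complex_of_real (c i) * cnj (\<gamma> i s)) = (\<Sum>i<N. complex_of_real (K i) * cnj (\<gamma> i s)) / of_nat N"
        by (simp add: c_def sum_divide_distrib)
      ultimately show ?thesis using N by simp
    qed
    have c1: "(\<Sum>i<N. c i) = 1"
    proof -
      have "complex_of_real (\<Sum>i<N. c i) = (\<Sum>i<N. complex_of_real (c i) * cnj (\<gamma> i 0))"
        unfolding of_real_sum using dual_groupD(3)[OF g] by (intro sum.cong) auto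
      also have "\<dots> = 1" using avk[of 0] k0 by (simp add: T'_def)
      finally show ?thesis by (metis of_real_1 of_real_eq_iff)
    qed
    have dev: "(\<Sum>i<N. c i * (cmod (\<gamma> i s - 1))\<^sup>2) \<le> 2 * d" if s: "s \<in> S" for s
    proof -
      have sq: "(cmod (\<gamma> i s - 1))\<^sup>2 = 2 - 2 * Re (cnj (\<gamma> i s))" if i: "i < N" for i
      proof -
        have "(Re (\<gamma> i s))\<^sup>2 + (Im (\<gamma> i s))\<^sup>2 = 1" using dual_groupD(2)[OF g[OF i], of s] by (simp add: cmod_def)
        moreover have "(cmod (\<gamma> i s - 1))\<^sup>2 = (Re (\<gamma> i s) - 1)\<^sup>2 + (Im (\<gamma> i s))\<^sup>2" by (simp add: cmod_power2)
        ultimately show ?thesis by (simp add: power2_eq_square algebra_simps)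
      qed
      have "(\<Sum>i<N. c i * (cmod (\<gamma> i s - 1))\<^sup>2) = (\<Sum>i<N. 2 * c i - 2 * Re (complex_of_real (c i) * cnj (\<gamma> i s)))"
        by (rule sum.cong[OF refl], subst sq) (auto simp: right_diff_distrib)
      also have "\<dots> = 2 * (\<Sum>i<N. c i) - 2 * Re (\<Sum>i<N. complex_of_real (c i) * cnj (\<gamma> i s))"
        by (simp add: sum_subtractf sum_distrib_left)
      also have "\<dots> = 2 - 2 * k s" using c1 avk[of s] s by (simp add: T'_def)
      finally show ?thesis using kS[OF s] by simp
    qed
    define Bad where "Bad = {i. i < N \<and> \<not> (\<forall>s\<in>S. cmod (\<gamma> i s - 1) < \<eta>)}"
    have "(\<Sum>i\<in>Bad. c i) \<le> (\<Sum>i<N. \<Sum>s\<in>S. c i * (cmod (\<gamma> i s - 1))\<^sup>2 / \<eta>\<^sup>2)"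
    proof -
      have "c i \<le> (\<Sum>s\<in>S. c i * (cmod (\<gamma> i s - 1))\<^sup>2 / \<eta>\<^sup>2)" if iB: "i \<in> Bad" for i
      proof -
        obtain s where s: "s \<in> S" "cmod (\<gamma> i s - 1) \<ge> \<eta>" using iB by (auto simp: Bad_def not_less)
        have "\<eta>\<^sup>2 \<le> (cmod (\<gamma> i s - 1))\<^sup>2" using s eta by (intro power_mono) auto
        then have "c i * \<eta>\<^sup>2 \<le> c i * (cmod (\<gamma> i s - 1))\<^sup>2" using c0 by (intro mult_left_mono)
        then have "c i \<le> c i * (cmod (\<gamma> i s - 1))\<^sup>2 / \<eta>\<^sup>2" using eta by (simp add: pos_le_divide_eq)
        also have "\<dots> \<le> (\<Sum>s\<in>S. c i * (cmod (\<gamma> i s - 1))\<^sup>2 / \<eta>\<^sup>2)"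
          using s S c0 by (intro member_le_sum[where f = "\<lambda>s. c i * (cmod (\<gamma> i s - 1))\<^sup>2 / \<eta>\<^sup>2"]) auto
        finally show ?thesis .
      qed
      then have "(\<Sum>i\<in>Bad. c i) \<le> (\<Sum>i\<in>Bad. \<Sum>s\<in>S. c i * (cmod (\<gamma> i s - 1))\<^sup>2 / \<eta>\<^sup>2)" by (rule sum_mono)
      also have "\<dots> \<le> (\<Sum>i<N. \<Sum>s\<in>S. c i * (cmod (\<gamma> i s - 1))\<^sup>2 / \<eta>\<^sup>2)"
        by (rule sum_mono2) (auto simp: Bad_def c0 intro!: sum_nonneg)
      finally show ?thesis .
    qed
    also have "\<dots> = (\<Sum>s\<in>S. (\<Sum>i<N. c i * (cmod (\<gamma> i s - 1))\<^sup>2) / \<eta>\<^sup>2)"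
      by (subst sum.swap) (simp add: sum_divide_distrib)
    also have "\<dots> \<le> (\<Sum>s\<in>S. 2 * d / \<eta>\<^sup>2)" using dev eta by (intro sum_mono divide_right_mono) auto
    also have "2 * d / \<eta>\<^sup>2 = e / (real (card S) + 1)"
    proof -
      have "2 * (real (card S) + 1) * d = e * \<eta>\<^sup>2" by (simp add: d_def)
      then show ?thesis using eta by (simp add: field_simps)
    qed
    also have "(\<Sum>s\<in>S. e / (real (card S) + 1)) = real (card S) / (real (card S) + 1) * e" by simp
    also have "\<dots> \<le> 1 * e" using e by (intro mult_right_mono) auto
    finally have "(\<Sum>i\<in>Bad. c i) \<le> e" by simp
    then show ?thesis
      by (intro exI[of _ N] exI[of _ c] exI[of _ \<gamma>]) (use g c0 c1 avk in \<open>auto simp: Bad_def T'_def\<close>)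
  qed
  show ?thesis by (intro exI[of _ k] conjI fin allI impI main)
qed

context pre_cstar
begin

lemma sm_sum: "x \<in> carrier A \<Longrightarrow> finsum A (\<lambda>i. c i \<odot> x) I = (\<Sum>i\<in>I. c i) \<odot> x"
  by (induction I rule: infinite_finite_induct) (auto simp: sm_0 sm_add sm_closed)

lemma sm_diff: "x \<in> carrier A \<Longrightarrow> (c - d) \<odot> x = c \<odot> x \<ominus> d \<odot> x"
proof -
  assume x: "x \<in> carrier A"
  have "(c - d) \<odot> x = (c + (-1) * d) \<odot> x" by simp
  also have "\<dots> = c \<odot> x \<oplus> (-1) \<odot> (d \<odot> x)" using x by (simp only: sm_add sm_assoc)
  finally show ?thesis using x by (simp add: a_minus_def sm_minus1 sm_closed)
qed

end

section \<open>The dual action and Fejer approximation\<close>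

context cstar_dyn
begin

definition dual :: "('g \<Rightarrow> complex) \<Rightarrow> ('g \<Rightarrow> 'a) \<Rightarrow> 'g \<Rightarrow> 'a" where
  "dual \<gamma> f = (\<lambda>s. cnj (\<gamma> s) \<odot> f s)"

lemma fs_scale: "f \<in> finsupp A \<Longrightarrow> (\<lambda>s. c s \<odot> f s) \<in> finsupp A"
  by (rule fsI[of _ "supp A f"]) (auto simp: fs_closed fs_finite not_supp sm_closed sm_zero)

lemma fs_dual: "f \<in> finsupp A \<Longrightarrow> dual \<gamma> f \<in> finsupp A"
  unfolding dual_def by (rule fs_scale)

lemma dual_star: assumes "\<gamma> \<in> dual_group" "f \<in> finsupp A" shows "dual \<gamma> (star C f) = star C (dual \<gamma> f)"
  using assms by (intro ext) (simp add: dual_def C_simps star_smult fs_closed a_hom star_closed dual_groupD)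

lemma dual_mult: assumes g: "\<gamma> \<in> dual_group" and f: "f \<in> finsupp A" and h: "h \<in> finsupp A"
  shows "dual \<gamma> (f \<otimes>\<^bsub>C\<^esub> h) = dual \<gamma> f \<otimes>\<^bsub>C\<^esub> dual \<gamma> h"
proof
  fix t
  have sub: "supp A (dual \<gamma> f) \<subseteq> supp A f" by (auto simp: supp_def dual_def sm_zero)
  have "dual \<gamma> (f \<otimes>\<^bsub>C\<^esub> h) t = finsum A (\<lambda>s. cnj (\<gamma> t) \<odot> (f s \<otimes> \<alpha> s (h (t - s)))) (supp A f)"
    unfolding dual_def mul_eq[OF f h fs_finite[OF f] subset_refl]
    by (rule sm_finsum) (auto simp: fs_closed[OF f] fs_closed[OF h] a_hom mult_closed)
  also have "\<dots> = finsum A (\<lambda>s. dual \<gamma> f s \<otimes> \<alpha> s (dual \<gamma> h (t - s))) (supp A f)"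
  proof (rule M.finsum_cong')
    fix s
    have c: "f s \<in> carrier A" "\<alpha> s (h (t - s)) \<in> carrier A" using f h by (auto simp: fs_closed a_hom)
    have "dual \<gamma> f s \<otimes> \<alpha> s (dual \<gamma> h (t - s)) = (cnj (\<gamma> s) * cnj (\<gamma> (t - s))) \<odot> (f s \<otimes> \<alpha> s (h (t - s)))"
      using c by (simp add: dual_def a_hom fs_closed[OF h] smult_mult_left smult_mult_right sm_closed mult_closed sm_assoc[symmetric] mult.commute)
    also have "cnj (\<gamma> s) * cnj (\<gamma> (t - s)) = cnj (\<gamma> t)"
      using dual_groupD(1)[OF g, of s "t - s"] by (simp add: complex_cnj_mult[symmetric] del: complex_cnj_mult)
    finally show "cnj (\<gamma> t) \<odot> (f s \<otimes> \<alpha> s (h (t - s))) = dual \<gamma> f s \<otimes> \<alpha> s (dual \<gamma> h (t - s))" by simp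
  qed (auto simp: dual_def fs_closed[OF f] fs_closed[OF h] a_hom mult_closed sm_closed)
  also have "\<dots> = (dual \<gamma> f \<otimes>\<^bsub>C\<^esub> dual \<gamma> h) t"
    by (rule mul_eq[OF fs_dual[OF f] fs_dual[OF h] fs_finite[OF f] sub, symmetric])
  finally show "dual \<gamma> (f \<otimes>\<^bsub>C\<^esub> h) t = (dual \<gamma> f \<otimes>\<^bsub>C\<^esub> dual \<gamma> h) t" .
qed

text \<open>The dual action commutes with product and involution and preserves the norms of the coefficients,
  so \<open>cstar_norm_le\<close> applies to \<open>f \<mapsto> \<parallel>dual \<gamma> f\<parallel>\<close>.\<close>
lemma reduced_norm_dual_le:
  assumes g: "\<gamma> \<in> dual_group" and f: "f \<in> finsupp A"
  shows "reduced_norm A \<alpha> (dual \<gamma> f) \<le> reduced_norm A \<alpha> f"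
proof (rule cstar_norm_le[OF _ _ _ _ _ _ f, of "\<lambda>f. reduced_norm A \<alpha> (dual \<gamma> f)" "reduced_norm A \<alpha>"])
  fix f :: "'g \<Rightarrow> 'a" assume f: "f \<in> finsupp A"
  show "reduced_norm A \<alpha> (dual \<gamma> (star C f \<otimes>\<^bsub>C\<^esub> f)) = (reduced_norm A \<alpha> (dual \<gamma> f))\<^sup>2"
    using f by (simp add: dual_mult[OF g] dual_star[OF g] fs_star reduced_norm_cstar fs_dual)
  show "0 \<le> reduced_norm A \<alpha> (dual \<gamma> f)" by (intro reduced_norm_ge0 fs_dual f)
  have "reduced_norm A \<alpha> (dual \<gamma> f) \<le> (\<Sum>s\<in>supp A (dual \<gamma> f). nrm A (dual \<gamma> f s))"
    by (intro reduced_norm_le_sum fs_dual f)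
  also have "\<dots> \<le> (\<Sum>s\<in>supp A f. nrm A (dual \<gamma> f s))"
    using fs_finite[OF f] fs_closed[OF f]
    by (intro sum_mono2) (auto simp: supp_def dual_def sm_zero sm_closed intro!: nrm_ge0)
  also have "\<dots> = (\<Sum>s\<in>supp A f. nrm A (f s))"
    using dual_groupD(2)[OF g] by (simp add: dual_def nrm_smult fs_closed[OF f])
  finally show "reduced_norm A \<alpha> (dual \<gamma> f) \<le> (\<Sum>s\<in>supp A f. nrm A (f s))" .
  show "reduced_norm A \<alpha> (star C f \<otimes>\<^bsub>C\<^esub> f) = (reduced_norm A \<alpha> f)\<^sup>2" by (rule reduced_norm_cstar[OF f])
  show "0 \<le> reduced_norm A \<alpha> f" by (rule reduced_norm_ge0[OF f])
  show "nrm A (f s) \<le> reduced_norm A \<alpha> f" for s by (rule coeff_le_reduced_norm[OF f])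
qed

lemma reduced_norm_combination:
  assumes f: "\<And>i. i < (N::nat) \<Longrightarrow> f i \<in> finsupp A"
  shows "(\<lambda>s. finsum A (\<lambda>i. c i \<odot> f i s) {..<N}) \<in> finsupp A \<and>
    reduced_norm A \<alpha> (\<lambda>s. finsum A (\<lambda>i. c i \<odot> f i s) {..<N}) \<le> (\<Sum>i<N. cmod (c i) * reduced_norm A \<alpha> (f i))"
  using f
proof (induction N)
  case 0
  have "reduced_norm A \<alpha> (\<lambda>s. \<zero>) \<le> (\<Sum>s\<in>supp A (\<lambda>s::'g. \<zero>). nrm A \<zero>)" by (rule reduced_norm_le_sum[OF fs_zero])
  then show ?case by (simp add: fs_zero supp_def)
next
  case (Suc N)
  let ?s = "\<lambda>s. finsum A (\<lambda>i. c i \<odot> f i s) {..<N}"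
  have IH: "?s \<in> finsupp A" "reduced_norm A \<alpha> ?s \<le> (\<Sum>i<N. cmod (c i) * reduced_norm A \<alpha> (f i))" using Suc by auto
  have fN: "f N \<in> finsupp A" using Suc by simp
  have eq: "finsum A (\<lambda>i. c i \<odot> f i s) {..<Suc N} = c N \<odot> f N s \<oplus> ?s s" for s
    unfolding lessThan_Suc by (rule M.finsum_insert) (auto simp: sm_closed fs_closed Suc.prems)
  have t: "reduced_norm A \<alpha> (\<lambda>s. c N \<odot> f N s \<oplus> ?s s) \<le> reduced_norm A \<alpha> (\<lambda>s. c N \<odot> f N s) + reduced_norm A \<alpha> ?s"
    by (rule reduced_norm_triangle[OF fs_smult[OF fN] IH(1)])
  show ?case unfolding eq using fs_add[OF fs_smult[OF fN] IH(1)] t IH(2) by (simp add: reduced_norm_smult[OF fN])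
qed

lemma fs_diff: assumes f: "f \<in> finsupp A" and g: "g \<in> finsupp A" shows "(\<lambda>s. f s \<ominus> g s) \<in> finsupp A"
proof -
  have "(\<lambda>s. f s \<ominus> g s) = (\<lambda>s. f s \<oplus> (-1) \<odot> g s)" by (simp add: a_minus_def sm_minus1 fs_closed[OF g])
  then show ?thesis using fs_add[OF f fs_smult[OF g, of "-1"]] by simp
qed
lemma C_diff: assumes f: "f \<in> finsupp A" and g: "g \<in> finsupp A" shows "f \<ominus>\<^bsub>C\<^esub> g = (\<lambda>s. f s \<ominus> g s)"
proof -
  have "\<ominus>\<^bsub>C\<^esub> g = (\<lambda>s. \<ominus> g s)"
    using pre_cstar.sm_minus1[OF pre_cstar_C, of g, symmetric] g by (simp add: C_simps sm_minus1 fs_closed)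
  then show ?thesis by (simp add: a_minus_def C_simps)
qed
lemma reduced_norm_diff: "f \<in> finsupp A \<Longrightarrow> g \<in> finsupp A \<Longrightarrow>
  reduced_norm A \<alpha> (\<lambda>s. f s \<ominus> g s) \<le> reduced_norm A \<alpha> f + reduced_norm A \<alpha> g"
  using pre_cstar.nrm_diff[OF pre_cstar_C, of f g] by (simp add: C_diff C_simps)

text \<open>Let \<open>z = k y\<close> with the coefficients \<open>k\<close> of a Fejer kernel. On the support of \<open>y\<close> this is an average of
  \<open>dual \<gamma>\<^sub>i y\<close>. The difference \<open>dual \<gamma>\<^sub>i y - y\<close> has norm at most \<open>d\<close> if \<open>\<gamma>\<^sub>i\<close> is near the trivial
  character; the other \<open>\<gamma>\<^sub>i\<close> have total weight at most \<open>e\<close>, and there it has norm at most \<open>2 M\<close>.\<close>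
theorem fejer_approximation:
  assumes S: "finite S" and eta: "\<eta> > 0" and e: "e > 0"
  shows "\<exists>K. finite K \<and> (\<forall>y M d. y \<in> finsupp A \<longrightarrow> reduced_norm A \<alpha> y \<le> M \<longrightarrow> 0 \<le> d \<longrightarrow>
    (\<forall>\<gamma>\<in>dual_group. (\<forall>s\<in>S. cmod (\<gamma> s - 1) < \<eta>) \<longrightarrow> reduced_norm A \<alpha> (\<lambda>s. dual \<gamma> y s \<ominus> y s) \<le> d) \<longrightarrow>
    (\<exists>z\<in>finsupp A. supp A z \<subseteq> K \<and> reduced_norm A \<alpha> (\<lambda>s. z s \<ominus> y s) \<le> d + 2 * M * e))"
proof -
  obtain k :: "'g \<Rightarrow> real" where fin: "finite {s. k s \<noteq> 0}"
    and k: "\<And>T. finite T \<Longrightarrow> \<exists>N c \<gamma>. (\<forall>i<N. \<gamma> i \<in> dual_group \<and> 0 \<le> c i) \<and> (\<Sum>i<N. c i) = 1 \<and>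
    (\<forall>s\<in>T. (\<Sum>i<(N::nat). complex_of_real (c i) * cnj (\<gamma> i s)) = complex_of_real (k s)) \<and>
    (\<Sum>i | i < N \<and> \<not> (\<forall>s\<in>S. cmod (\<gamma> i s - 1) < \<eta>). c i) \<le> e"
    using fejer_kernel[OF S eta e] by blast
  have "\<exists>z\<in>finsupp A. supp A z \<subseteq> {s. k s \<noteq> 0} \<and> reduced_norm A \<alpha> (\<lambda>s. z s \<ominus> y s) \<le> d + 2 * M * e"
    if y: "y \<in> finsupp A" "reduced_norm A \<alpha> y \<le> M" and d: "0 \<le> d"
      and osc: "\<And>\<gamma>. \<gamma> \<in> dual_group \<Longrightarrow> \<forall>s\<in>S. cmod (\<gamma> s - 1) < \<eta> \<Longrightarrow> reduced_norm A \<alpha> (\<lambda>s. dual \<gamma> y s \<ominus> y s) \<le> d"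
    for y M d
  proof -
    obtain N c \<gamma> where g: "\<And>i. i < (N::nat) \<Longrightarrow> \<gamma> i \<in> dual_group" and c0: "\<And>i. i < N \<Longrightarrow> 0 \<le> c i"
      and c1: "(\<Sum>i<N. c i) = 1"
      and ck: "\<And>s. s \<in> supp A y \<Longrightarrow> (\<Sum>i<N. complex_of_real (c i) * cnj (\<gamma> i s)) = complex_of_real (k s)"
      and bad: "(\<Sum>i | i < N \<and> \<not> (\<forall>s\<in>S. cmod (\<gamma> i s - 1) < \<eta>). c i) \<le> e"
      using k[OF fs_finite[OF y(1)]] by blast
    define Bad where "Bad = {i. i < N \<and> \<not> (\<forall>s\<in>S. cmod (\<gamma> i s - 1) < \<eta>)}"
    define z where "z s = complex_of_real (k s) \<odot> y s" for s
    have z: "z \<in> finsupp A" unfolding z_def[abs_def] by (rule fs_scale[OF y(1)])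
    have M0: "M \<ge> 0" using y reduced_norm_ge0 order_trans by blast
    define f where "f i = (\<lambda>s. dual (\<gamma> i) y s \<ominus> y s)" for i
    have f: "f i \<in> finsupp A" for i unfolding f_def by (intro fs_diff fs_dual y)
    have "z s \<ominus> y s = finsum A (\<lambda>i. complex_of_real (c i) \<odot> f i s) {..<N}" for s
    proof -
      have ys: "y s \<in> carrier A" using y by (simp add: fs_closed)
      have "finsum A (\<lambda>i. complex_of_real (c i) \<odot> f i s) {..<N}
        = finsum A (\<lambda>i. (complex_of_real (c i) * (cnj (\<gamma> i s) - 1)) \<odot> y s) {..<N}"
        using ys by (intro M.finsum_cong') (auto simp: f_def dual_def sm_assoc sm_diff sm_one sm_closed)
      also have "\<dots> = ((\<Sum>i<N. complex_of_real (c i) * cnj (\<gamma> i s)) - complex_of_real (\<Sum>i<N. c i)) \<odot> y s"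
        by (subst sm_sum[OF ys]) (simp add: algebra_simps sum_subtractf)
      also have "\<dots> = z s \<ominus> y s"
      proof (cases "s \<in> supp A y")
        case True
        then show ?thesis using ys by (simp add: ck c1 z_def sm_diff sm_one)
      next
        case False
        then have "y s = \<zero>" by (rule not_supp)
        then show ?thesis by (simp add: z_def sm_zero a_minus_def M.r_neg)
      qed
      finally show ?thesis by simp
    qed
    then have "reduced_norm A \<alpha> (\<lambda>s. z s \<ominus> y s) \<le> (\<Sum>i<N. cmod (complex_of_real (c i)) * reduced_norm A \<alpha> (f i))"
      using reduced_norm_combination[of N f "\<lambda>i. complex_of_real (c i)"] f by simp
    also have "\<dots> \<le> (\<Sum>i<N. c i * d + (if i \<in> Bad then c i * (2 * M) else 0))"
    proof (rule sum_mono)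
      fix i assume i: "i \<in> {..<N}"
      have "reduced_norm A \<alpha> (f i) \<le> d + (if i \<in> Bad then 2 * M else 0)"
      proof (cases "i \<in> Bad")
        case False
        then show ?thesis using i osc[OF g[of i]] by (auto simp: Bad_def f_def)
      next
        case True
        have "reduced_norm A \<alpha> (f i) \<le> reduced_norm A \<alpha> (dual (\<gamma> i) y) + reduced_norm A \<alpha> y"
          unfolding f_def by (intro reduced_norm_diff fs_dual y)
        also have "\<dots> \<le> M + M" using reduced_norm_dual_le[OF g[of i] y(1)] i y by simp
        finally show ?thesis using True d by simp
      qed
      then have "c i * reduced_norm A \<alpha> (f i) \<le> c i * (d + (if i \<in> Bad then 2 * M else 0))"
        using c0[of i] i by (intro mult_left_mono) auto
      then show "cmod (complex_of_real (c i)) * reduced_norm A \<alpha> (f i) \<le> c i * d + (if i \<in> Bad then c i * (2 * M) else 0)"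
        using c0[of i] i by (simp add: algebra_simps split: if_splits)
    qed
    also have "\<dots> = d + (\<Sum>i\<in>Bad. c i) * (2 * M)"
    proof -
      have "{..<N} \<inter> Bad = Bad" by (auto simp: Bad_def)
      then show ?thesis
        by (simp add: sum.distrib sum_distrib_right[symmetric] c1 sum.inter_restrict[symmetric])
    qed
    also have "\<dots> \<le> d + e * (2 * M)" using bad M0 by (intro add_left_mono mult_right_mono) (auto simp: Bad_def)
    finally have "reduced_norm A \<alpha> (\<lambda>s. z s \<ominus> y s) \<le> d + 2 * M * e" by (simp add: mult_ac)
    moreover have "supp A z \<subseteq> {s. k s \<noteq> 0}" by (auto simp: supp_def z_def sm_0 fs_closed y)
    ultimately show ?thesis using z by blast
  qed
  then show ?thesis using fin by (intro exI[of _ "{s. k s \<noteq> 0}"]) blast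
qed

end

section \<open>Diagonal sequences in ultrapowers\<close>

text \<open>Let \<open>U k\<close> be the set of indices \<open>n \<ge> k\<close> at which the sequences \<open>w 0, \<dots>, w k\<close> satisfy the estimates
  that their classes satisfy. It belongs to the filter and decreases with \<open>k\<close>. For each \<open>n\<close> take the
  largest \<open>k \<le> n\<close> with \<open>n \<in> U k\<close> and put \<open>v n = w k n\<close>; then \<open>v n\<close> is close to \<open>w i n\<close> for every \<open>n \<in> U i\<close>.\<close>
lemma (in seq_quot) diagonal_sequence:
  assumes free: "\<And>k. eventually (\<lambda>n. n \<noteq> k) F"
    and w: "\<And>j. w j \<in> S"
    and cau: "\<And>i j. i \<le> j \<Longrightarrow> nrm Q (cl (w i) \<ominus>\<^bsub>Q\<^esub> cl (w j)) < (1/2) ^ i"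
    and S: "S = carrier (linf B)"
  shows "\<exists>v\<in>S. (\<forall>i. nrm Q (cl (w i) \<ominus>\<^bsub>Q\<^esub> cl v) \<le> (1/2) ^ i) \<and>
    (\<forall>n. \<exists>k. v n = w k n \<and> (\<forall>i\<le>k. nrm B (w i n \<ominus> v n) \<le> (1/2) ^ i))"
proof -
  note c = S_closed[OF w]
  have large: "eventually (\<lambda>n. k \<le> n) F" for k
  proof -
    have "eventually (\<lambda>n. \<forall>j\<in>{..<k}. n \<noteq> j) F" by (rule eventually_ball_finite) (auto intro: free)
    then show ?thesis by (rule eventually_mono) (metis lessThan_iff not_le)
  qed
  define U where "U k = {n. k \<le> n \<and> (\<forall>j\<le>k. \<forall>i\<le>j. nrm B (w i n \<ominus> w j n) \<le> (1/2) ^ i)}" for k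
  have U: "eventually (\<lambda>n. n \<in> U k) F" for k
  proof -
    have "eventually (\<lambda>n. nrm B (w i n \<ominus> w j n) \<le> (1/2) ^ i) F" if "i \<le> j" for i j
    proof -
      have "((\<lambda>n. nrm B (w i n \<ominus> w j n)) \<longlongrightarrow> nrm Q (cl (w i) \<ominus>\<^bsub>Q\<^esub> cl (w j))) F"
        unfolding cl_diff[OF w w] by (rule nrm_cl[OF S_diff[OF w w]])
      then have "eventually (\<lambda>n. nrm B (w i n \<ominus> w j n) < (1/2) ^ i) F"
        using cau[OF that] by (rule order_tendstoD)
      then show ?thesis by (rule eventually_mono) simp
    qed
    then have "eventually (\<lambda>n. \<forall>j\<in>{..k}. \<forall>i\<in>{..j}. nrm B (w i n \<ominus> w j n) \<le> (1/2) ^ i) F"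
      by (intro eventually_ball_finite ballI) auto
    then show ?thesis using large[of k] by eventually_elim (auto simp: U_def)
  qed
  have U0: "n \<in> U 0" for n using c by (simp add: U_def a_minus_def M.r_neg nrm_zero)
  define k where "k n = Max {k. k \<le> n \<and> n \<in> U k}" for n
  have fin: "finite {k. k \<le> n \<and> n \<in> U k}" for n by simp
  have kU: "n \<in> U (k n)" for n
  proof -
    have "k n \<in> {k. k \<le> n \<and> n \<in> U k}" unfolding k_def by (rule Max_in[OF fin]) (use U0 in auto)
    then show ?thesis by simp
  qed
  have k_ge: "i \<le> k n" if "n \<in> U i" for i n
    unfolding k_def using that by (intro Max_ge fin) (simp add: U_def)
  define v where "v n = w (k n) n" for n
  have near: "nrm B (w i n \<ominus> v n) \<le> (1/2) ^ i" if "i \<le> k n" for i n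
    using kU[of n] that by (auto simp: U_def v_def)
  have vc: "v n \<in> carrier B" for n by (simp add: v_def c)
  obtain L where L: "\<And>n. nrm B (w 0 n) \<le> L" using S_bounded[OF w] by blast
  have "nrm B (v n) \<le> L + 1" for n
  proof -
    have "\<bar>nrm B (w 0 n) - nrm B (v n)\<bar> \<le> 1" using nrm_diff_ge[OF c[of 0 n] vc[of n]] near[of 0 n] by simp
    then show ?thesis using L[of n] by linarith
  qed
  then have v: "v \<in> S" unfolding S using vc by (intro linfI) auto
  have "nrm Q (cl (w i) \<ominus>\<^bsub>Q\<^esub> cl v) \<le> (1/2) ^ i" for i
    unfolding cl_diff[OF w v]
    by (rule nrm_cl_le[OF S_diff[OF w v]]) (rule eventually_mono[OF U[of i]], rule near, rule k_ge)
  then show ?thesis using v near v_def by blast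
qed

lemma (in pre_cstar) convergent_cauchy:
  assumes u: "\<And>n. u n \<in> carrier A" and l: "l \<in> carrier A" and lim: "(\<lambda>n. nrm A (u n \<ominus> l)) \<longlonglongrightarrow> 0"
  shows "cauchy_in A u"
  using cauchy_approx[OF const_cauchy[OF l] u] lim nrm_diff_commute[OF l u] by simp

section \<open>The homomorphism on finitely supported functions\<close>

text \<open>Below, \<open>D\<close> and \<open>E\<close> refer to the actions on \<open>A\<close> and on its ultrapower, \<open>X0\<close> and \<open>X\<close> are the
  corresponding crossed products with embeddings \<open>\<iota>\<close> and \<open>\<iota>'\<close> of the finitely supported functions, and
  \<open>Y\<close> is the ultrapower of \<open>X0\<close>. The classes modulo null sequences are \<open>U.cl\<close> for \<open>A\<close> and \<open>V.cl\<close> for \<open>X0\<close>.\<close>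
locale crossed_ultra =
  fixes \<omega> :: "nat filter" and A :: "'a cstar" and \<alpha> :: "'g::ab_group_add \<Rightarrow> 'a \<Rightarrow> 'a"
  assumes om: "free_ultrafilter \<omega>" and cst: "cstar_algebra A" and act: "cstar_action A \<alpha>"
begin

sublocale A: cstar_algebra A by (rule cst)

lemma alpha_contractive: "x \<in> carrier A \<Longrightarrow> nrm A (\<alpha> s x) \<le> nrm A x"
  by (rule star_hom_contractive[OF A.pre_cstar_axioms A.pre_cstar_axioms A.complete])
    (use act in \<open>auto simp: cstar_action_def\<close>)

sublocale D: cstar_dyn A \<alpha>
  by unfold_locales (use act alpha_contractive in auto)

sublocale U: seq_quot A \<omega> "carrier (linf A)"
  by (rule A.seq_quot_ultra[OF om])

abbreviation A\<omega> where "A\<omega> \<equiv> ultrapower \<omega> A"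
abbreviation \<alpha>\<omega> where "\<alpha>\<omega> \<equiv> ultra_action \<omega> A \<alpha>"

lemma UQ: "seq_quot.Q A \<omega> (carrier (linf A)) = A\<omega>"
  by (simp add: U.Q_def U.R_def U.J_def ultrapower_def)
lemma Ucl: "ultra_class \<omega> A x = U.cl x"
  by (simp add: ultra_class_def U.cl_def U.R_def U.J_def)

lemma alpha_linf: "x \<in> carrier (linf A) \<Longrightarrow> (\<lambda>n. \<alpha> s (x n)) \<in> carrier (linf A)"
proof -
  assume x: "x \<in> carrier (linf A)"
  obtain K where "\<And>n. nrm A (x n) \<le> K" using U.S_bounded[OF x] by blast
  then show ?thesis using U.S_closed[OF x] by (intro U.linfI[of _ K]) (auto simp: D.a_nrm D.a_hom)
qed

lemma ultra_action_cl: assumes x: "x \<in> carrier (linf A)" shows "\<alpha>\<omega> s (U.cl x) = U.cl (\<lambda>n. \<alpha> s (x n))"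
proof -
  have "coset_map U.R U.J (\<lambda>x n. \<alpha> s (x n)) (U.cl x) = U.cl (\<lambda>n. \<alpha> s (x n))"
  proof (rule U.coset_map_cl[where T = "\<lambda>x n. \<alpha> s (x n)", OF alpha_linf _ x])
    fix y assume y: "y \<in> carrier (linf A)" "U.eqv y x"
    have "nrm A (\<alpha> s (y n) \<ominus>\<^bsub>A\<^esub> \<alpha> s (x n)) = nrm A (y n \<ominus>\<^bsub>A\<^esub> x n)" for n
      using U.S_closed[OF y(1), of n] U.S_closed[OF x, of n] D.a_nrm[of "y n \<ominus>\<^bsub>A\<^esub> x n" s]
      by (simp add: a_minus_def D.a_hom D.a_minus)
    then show "U.eqv (\<lambda>n. \<alpha> s (y n)) (\<lambda>n. \<alpha> s (x n))" using y(2) by (simp add: U.eqv_def)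
  qed
  then show ?thesis by (simp add: ultra_action_def U.R_def U.J_def)
qed

lemma cases_A\<omega>: "X \<in> carrier A\<omega> \<Longrightarrow> (\<And>x. x \<in> carrier (linf A) \<Longrightarrow> X = U.cl x \<Longrightarrow> P) \<Longrightarrow> P"
  using U.cl_cases[unfolded UQ] by blast

lemma ultra_cstar_action: "cstar_action A\<omega> \<alpha>\<omega>"
  unfolding cstar_action_def
proof (intro conjI allI ballI)
  fix s
  note cl = U.cl_add[unfolded UQ] U.cl_mult[unfolded UQ] U.cl_smult[unfolded UQ] U.cl_star[unfolded UQ] U.cl_closed[unfolded UQ]
  show "\<alpha>\<omega> s \<in> star_hom A\<omega> A\<omega>"
    by (auto simp: star_hom_def cl ultra_action_cl alpha_linf U.S_add U.S_mult U.S_smult U.S_star D.a_hom U.S_closed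
        elim!: cases_A\<omega>)
next
  fix X assume "X \<in> carrier A\<omega>"
  then show "\<alpha>\<omega> 0 X = X" by (auto simp: ultra_action_cl D.a_0 U.S_closed elim!: cases_A\<omega>)
next
  fix s t X assume "X \<in> carrier A\<omega>"
  then show "\<alpha>\<omega> (s + t) X = \<alpha>\<omega> s (\<alpha>\<omega> t X)"
    by (auto simp: ultra_action_cl D.a_plus U.S_closed alpha_linf elim!: cases_A\<omega>)
qed

lemma pre_cstar_A\<omega>: "pre_cstar A\<omega>" using U.pre_cstar_Q by (simp add: UQ)

sublocale E: cstar_dyn A\<omega> \<alpha>\<omega>
proof (intro cstar_dyn.intro cstar_dyn_axioms.intro pre_cstar_A\<omega> ultra_cstar_action)
  fix X s assume "X \<in> carrier A\<omega>"
  then obtain x where x: "x \<in> carrier (linf A)" "X = U.cl x" by (rule cases_A\<omega>)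
  have "((\<lambda>n. nrm A (\<alpha> s (x n))) \<longlongrightarrow> nrm A\<omega> X) \<omega>"
    using U.nrm_cl[OF x(1)] U.S_closed[OF x(1)] by (simp add: D.a_nrm x(2) UQ)
  then show "nrm A\<omega> (\<alpha>\<omega> s X) \<le> nrm A\<omega> X"
    using U.nrm_cl_eqI[OF alpha_linf[OF x(1)]] by (simp add: x(2) ultra_action_cl[OF x(1)] UQ)
qed

sublocale DC: pre_cstar "Cc A \<alpha>" by (rule D.pre_cstar_C)
sublocale EC: pre_cstar "Cc A\<omega> \<alpha>\<omega>" by (rule E.pre_cstar_C)

abbreviation X0 where "X0 \<equiv> crossed A \<alpha>"
abbreviation X where "X \<equiv> crossed A\<omega> \<alpha>\<omega>"
abbreviation Y where "Y \<equiv> ultrapower \<omega> X0"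
abbreviation \<iota> where "\<iota> \<equiv> completion_embed (Cc A \<alpha>)"
abbreviation \<iota>' where "\<iota>' \<equiv> completion_embed (Cc A\<omega> \<alpha>\<omega>)"

sublocale X0: pre_cstar X0 unfolding crossed_def by (rule DC.pre_cstar_completion)
sublocale X: pre_cstar X unfolding crossed_def by (rule EC.pre_cstar_completion)
sublocale V: seq_quot X0 \<omega> "carrier (linf X0)" by (rule X0.seq_quot_ultra[OF om])

lemma VQ: "seq_quot.Q X0 \<omega> (carrier (linf X0)) = Y"
  by (simp add: V.Q_def V.R_def V.J_def ultrapower_def)
lemma Vcl: "ultra_class \<omega> X0 x = V.cl x"
  by (simp add: ultra_class_def V.cl_def V.R_def V.J_def)
sublocale Y: pre_cstar Y using V.pre_cstar_Q by (simp add: VQ)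

lemma nontriv: "\<omega> \<noteq> bot" using om by (simp add: free_ultrafilter_def)

definition lifts :: "(nat \<Rightarrow> 'g \<Rightarrow> 'a) \<Rightarrow> ('g \<Rightarrow> (nat \<Rightarrow> 'a) set) \<Rightarrow> bool" where
  "lifts g f \<longleftrightarrow> (\<exists>T. finite T \<and> (\<forall>n s. s \<notin> T \<longrightarrow> g n s = \<zero>\<^bsub>A\<^esub>)) \<and>
     (\<forall>s. (\<lambda>n. g n s) \<in> carrier (linf A)) \<and> (\<forall>s. f s = U.cl (\<lambda>n. g n s))"

lemma lifts_linf: "lifts g f \<Longrightarrow> (\<lambda>n. g n s) \<in> carrier (linf A)" by (simp add: lifts_def)
lemma lifts_cl: "lifts g f \<Longrightarrow> f s = U.cl (\<lambda>n. g n s)" by (simp add: lifts_def)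
lemma lifts_closed: "lifts g f \<Longrightarrow> g n s \<in> carrier A" using U.S_closed[OF lifts_linf] .
lemma lifts_fs: assumes "lifts g f" shows "g n \<in> finsupp A"
proof -
  obtain T where "finite T" "\<And>n s. s \<notin> T \<Longrightarrow> g n s = \<zero>\<^bsub>A\<^esub>" using assms unfolding lifts_def by blast
  then show ?thesis using lifts_closed[OF assms] by (intro A.fsI[of _ T]) auto
qed
lemma lifts_fs': assumes "lifts g f" shows "f \<in> finsupp A\<omega>"
proof -
  obtain T where T: "finite T" "\<And>n s. s \<notin> T \<Longrightarrow> g n s = \<zero>\<^bsub>A\<^esub>" using assms unfolding lifts_def by blast
  show ?thesis
    by (rule E.fsI[of _ T]) (use T in \<open>auto simp: lifts_cl[OF assms] U.cl_closed[OF lifts_linf[OF assms], unfolded UQ] U.cl_zero[unfolded UQ]\<close>)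
qed

lemma lift_exists: assumes f: "f \<in> finsupp A\<omega>" shows "\<exists>g. lifts g f \<and> (\<forall>n. supp A (g n) \<subseteq> supp A\<omega> f)"
proof -
  have "\<exists>x. x \<in> carrier (linf A) \<and> f s = U.cl x \<and> (f s = \<zero>\<^bsub>A\<omega>\<^esub> \<longrightarrow> x = (\<lambda>n. \<zero>\<^bsub>A\<^esub>))" for s
  proof (cases "f s = \<zero>\<^bsub>A\<omega>\<^esub>")
    case True
    then show ?thesis using U.zero_S U.cl_zero[unfolded UQ] by auto
  next
    case False
    obtain x where "x \<in> carrier (linf A)" "f s = U.cl x" using E.fs_closed[OF f, of s] by (rule cases_A\<omega>)
    then show ?thesis using False by blast
  qed
  then obtain r where r: "\<And>s. r s \<in> carrier (linf A) \<and> f s = U.cl (r s) \<and> (f s = \<zero>\<^bsub>A\<omega>\<^esub> \<longrightarrow> r s = (\<lambda>n. \<zero>\<^bsub>A\<^esub>))" by metis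
  have z: "r s n = \<zero>\<^bsub>A\<^esub>" if "s \<notin> supp A\<omega> f" for s n using r[of s] that by (simp add: supp_def)
  have "lifts (\<lambda>n s. r s n) f"
    unfolding lifts_def using r z E.fs_finite[OF f] by (intro conjI exI[of _ "supp A\<omega> f"]) auto
  moreover have "supp A (\<lambda>s. r s n) \<subseteq> supp A\<omega> f" for n using z by (auto simp: supp_def)
  ultimately show ?thesis by blast
qed

lemma emb_X0: "y \<in> finsupp A \<Longrightarrow> \<iota> y \<in> carrier X0"
  using DC.emb_closed[of y] by (simp add: D.C_simps crossed_def)
lemma nrm_emb_X0: "y \<in> finsupp A \<Longrightarrow> nrm X0 (\<iota> y) = reduced_norm A \<alpha> y"
  using DC.nrm_emb[of y] by (simp add: D.C_simps crossed_def)

lemma lifts_seq: assumes g: "lifts g f" shows "(\<lambda>n. \<iota> (g n)) \<in> carrier (linf X0)"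
proof -
  obtain T where T: "finite T" "\<And>n s. s \<notin> T \<Longrightarrow> g n s = \<zero>\<^bsub>A\<^esub>" using g unfolding lifts_def by blast
  have "\<forall>s. \<exists>K. \<forall>n. nrm A (g n s) \<le> K" using U.S_bounded[OF lifts_linf[OF g]] by blast
  then obtain K where K: "\<And>s n. nrm A (g n s) \<le> K s" by metis
  show ?thesis
  proof (rule V.linfI)
    show "\<iota> (g n) \<in> carrier X0" for n by (rule emb_X0[OF lifts_fs[OF g]])
    show "nrm X0 (\<iota> (g n)) \<le> sum K T" for n
    proof -
      have "nrm X0 (\<iota> (g n)) \<le> (\<Sum>s\<in>supp A (g n). nrm A (g n s))"
        by (simp add: nrm_emb_X0[OF lifts_fs[OF g]] D.reduced_norm_le_sum[OF lifts_fs[OF g]])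
      also have "\<dots> \<le> (\<Sum>s\<in>T. nrm A (g n s))"
        using T by (intro sum_mono2) (auto simp: supp_def intro!: A.nrm_ge0 lifts_closed[OF g])
      also have "\<dots> \<le> sum K T" by (intro sum_mono K)
      finally show ?thesis .
    qed
  qed
qed

text \<open>The norm of a difference of two lifts is at most a sum of finitely many coefficient norms, each of
  which tends to 0.\<close>
lemma lifts_unique: assumes g: "lifts g f" and g': "lifts g' f"
  shows "V.cl (\<lambda>n. \<iota> (g n)) = V.cl (\<lambda>n. \<iota> (g' n))"
proof (rule V.cl_eqI[OF lifts_seq[OF g] lifts_seq[OF g']])
  obtain T where T: "finite T" "\<And>n s. s \<notin> T \<Longrightarrow> g n s = \<zero>\<^bsub>A\<^esub>" using g unfolding lifts_def by blast
  obtain T' where T': "finite T'" "\<And>n s. s \<notin> T' \<Longrightarrow> g' n s = \<zero>\<^bsub>A\<^esub>" using g' unfolding lifts_def by blast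
  show "V.eqv (\<lambda>n. \<iota> (g n)) (\<lambda>n. \<iota> (g' n))"
  proof (rule V.eqv_squeeze)
    have "((\<lambda>n. \<Sum>s\<in>T \<union> T'. nrm A (g n s \<ominus>\<^bsub>A\<^esub> g' n s)) \<longlongrightarrow> (\<Sum>s\<in>T \<union> T'. 0)) \<omega>"
    proof (rule tendsto_sum)
      fix s
      have "U.cl (\<lambda>n. g n s) = U.cl (\<lambda>n. g' n s)" using lifts_cl[OF g, of s] lifts_cl[OF g', of s] by simp
      then have "U.eqv (\<lambda>n. g n s) (\<lambda>n. g' n s)" by (rule U.cl_eqD[OF lifts_linf[OF g] lifts_linf[OF g']])
      then show "((\<lambda>n. nrm A (g n s \<ominus>\<^bsub>A\<^esub> g' n s)) \<longlongrightarrow> 0) \<omega>" by (simp add: U.eqv_def)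
    qed
    then show "((\<lambda>n. \<Sum>s\<in>T \<union> T'. nrm A (g n s \<ominus>\<^bsub>A\<^esub> g' n s)) \<longlongrightarrow> 0) \<omega>" by simp
    fix n
    let ?d = "\<lambda>s. g n s \<ominus>\<^bsub>A\<^esub> g' n s"
    have d: "?d \<in> finsupp A" by (rule D.fs_diff[OF lifts_fs[OF g] lifts_fs[OF g']])
    have "\<iota> (g n) \<ominus>\<^bsub>X0\<^esub> \<iota> (g' n) = \<iota> ?d"
      using DC.emb_diff[of "g n" "g' n"] lifts_fs[OF g, of n] lifts_fs[OF g', of n]
      by (simp add: D.C_simps crossed_def D.C_diff)
    then have "nrm X0 (\<iota> (g n) \<ominus>\<^bsub>X0\<^esub> \<iota> (g' n)) \<le> (\<Sum>s\<in>supp A ?d. nrm A (?d s))"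
      by (simp add: nrm_emb_X0[OF d] D.reduced_norm_le_sum[OF d])
    also have "\<dots> \<le> (\<Sum>s\<in>T \<union> T'. nrm A (?d s))"
    proof (rule sum_mono2)
      show "supp A ?d \<subseteq> T \<union> T'"
      proof
        fix s assume s: "s \<in> supp A ?d"
        show "s \<in> T \<union> T'"
        proof (rule ccontr)
          assume "s \<notin> T \<union> T'"
          then have "?d s = \<zero>\<^bsub>A\<^esub>" using T(2)[of s n] T'(2)[of s n] by (simp add: a_minus_def A.M.r_neg)
          then show False using s by (simp add: supp_def)
        qed
      qed
    qed (use T T' in \<open>auto intro!: A.nrm_ge0 lifts_closed[OF g] lifts_closed[OF g']\<close>)
    finally show "nrm X0 (\<iota> (g n) \<ominus>\<^bsub>X0\<^esub> \<iota> (g' n)) \<le> (\<Sum>s\<in>T \<union> T'. nrm A (?d s))" .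
  qed (auto intro: emb_X0 lifts_fs[OF g] lifts_fs[OF g'])
qed

definition \<Phi> :: "('g \<Rightarrow> (nat \<Rightarrow> 'a) set) \<Rightarrow> (nat \<Rightarrow> (nat \<Rightarrow> 'g \<Rightarrow> 'a) set) set" where
  "\<Phi> f = V.cl (\<lambda>n. \<iota> ((SOME g. lifts g f) n))"

lemma \<Phi>_eq: assumes "lifts g f" shows "\<Phi> f = V.cl (\<lambda>n. \<iota> (g n))"
  unfolding \<Phi>_def by (rule lifts_unique[OF someI[of "\<lambda>g. lifts g f", OF assms] assms])

lemma \<Phi>_closed: assumes "f \<in> finsupp A\<omega>" shows "\<Phi> f \<in> carrier Y"
proof -
  obtain g where g: "lifts g f" using lift_exists[OF assms] by blast
  show ?thesis unfolding \<Phi>_eq[OF g] using V.cl_closed[OF lifts_seq[OF g]] by (simp add: VQ)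
qed

lemma lifts_add: assumes g: "lifts g f" and g': "lifts g' f'"
  shows "lifts (\<lambda>n. g n \<oplus>\<^bsub>Cc A \<alpha>\<^esub> g' n) (f \<oplus>\<^bsub>Cc A\<omega> \<alpha>\<omega>\<^esub> f')"
proof -
  obtain T where T: "finite T" "\<And>n s. s \<notin> T \<Longrightarrow> g n s = \<zero>\<^bsub>A\<^esub>" using g unfolding lifts_def by blast
  obtain T' where T': "finite T'" "\<And>n s. s \<notin> T' \<Longrightarrow> g' n s = \<zero>\<^bsub>A\<^esub>" using g' unfolding lifts_def by blast
  show ?thesis unfolding lifts_def
  proof (intro conjI allI exI[of _ "T \<union> T'"] impI)
    fix s
    show "(\<lambda>n. (g n \<oplus>\<^bsub>Cc A \<alpha>\<^esub> g' n) s) \<in> carrier (linf A)"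
      unfolding D.C_simps by (rule U.S_add[OF lifts_linf[OF g] lifts_linf[OF g']])
    show "(f \<oplus>\<^bsub>Cc A\<omega> \<alpha>\<omega>\<^esub> f') s = U.cl (\<lambda>n. (g n \<oplus>\<^bsub>Cc A \<alpha>\<^esub> g' n) s)"
      unfolding D.C_simps E.C_simps lifts_cl[OF g] lifts_cl[OF g']
      by (rule U.cl_add[OF lifts_linf[OF g] lifts_linf[OF g'], unfolded UQ])
  qed (use T T' in \<open>auto simp: D.C_simps\<close>)
qed

lemma lifts_smult: assumes g: "lifts g f"
  shows "lifts (\<lambda>n. c \<odot>\<^bsub>Cc A \<alpha>\<^esub> g n) (c \<odot>\<^bsub>Cc A\<omega> \<alpha>\<omega>\<^esub> f)"
proof -
  obtain T where T: "finite T" "\<And>n s. s \<notin> T \<Longrightarrow> g n s = \<zero>\<^bsub>A\<^esub>" using g unfolding lifts_def by blast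
  show ?thesis unfolding lifts_def
  proof (intro conjI allI exI[of _ T] impI)
    fix s
    show "(\<lambda>n. (c \<odot>\<^bsub>Cc A \<alpha>\<^esub> g n) s) \<in> carrier (linf A)"
      unfolding D.C_simps by (rule U.S_smult[OF lifts_linf[OF g]])
    show "(c \<odot>\<^bsub>Cc A\<omega> \<alpha>\<omega>\<^esub> f) s = U.cl (\<lambda>n. (c \<odot>\<^bsub>Cc A \<alpha>\<^esub> g n) s)"
      unfolding D.C_simps E.C_simps lifts_cl[OF g] by (rule U.cl_smult[OF lifts_linf[OF g], unfolded UQ])
  qed (use T in \<open>auto simp: D.C_simps A.sm_zero\<close>)
qed

lemma lifts_star: assumes g: "lifts g f"
  shows "lifts (\<lambda>n. star (Cc A \<alpha>) (g n)) (star (Cc A\<omega> \<alpha>\<omega>) f)"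
proof -
  obtain T where T: "finite T" "\<And>n s. s \<notin> T \<Longrightarrow> g n s = \<zero>\<^bsub>A\<^esub>" using g unfolding lifts_def by blast
  show ?thesis unfolding lifts_def
  proof (intro conjI allI exI[of _ "uminus ` T"] impI)
    fix n s assume "s \<notin> uminus ` T"
    then have "- s \<notin> T" using image_eqI[of s uminus "- s" T] by auto
    then show "star (Cc A \<alpha>) (g n) s = \<zero>\<^bsub>A\<^esub>" using T(2) by (simp add: D.C_simps A.star_zero D.a_zero)
  next
    fix s
    have l: "(\<lambda>n. star A (g n (- s))) \<in> carrier (linf A)" by (rule U.S_star[OF lifts_linf[OF g]])
    show "(\<lambda>n. star (Cc A \<alpha>) (g n) s) \<in> carrier (linf A)" unfolding D.C_simps by (rule alpha_linf[OF l])
    show "star (Cc A\<omega> \<alpha>\<omega>) f s = U.cl (\<lambda>n. star (Cc A \<alpha>) (g n) s)"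
      unfolding D.C_simps E.C_simps lifts_cl[OF g] U.cl_star[OF lifts_linf[OF g], unfolded UQ] by (rule ultra_action_cl[OF l])
  qed (simp add: T)
qed

lemma lifts_mult: assumes g: "lifts g f" and g': "lifts g' f'"
  shows "lifts (\<lambda>n. g n \<otimes>\<^bsub>Cc A \<alpha>\<^esub> g' n) (f \<otimes>\<^bsub>Cc A\<omega> \<alpha>\<omega>\<^esub> f')"
proof -
  obtain T where T: "finite T" "\<And>n s. s \<notin> T \<Longrightarrow> g n s = \<zero>\<^bsub>A\<^esub>" using g unfolding lifts_def by blast
  obtain T' where T': "finite T'" "\<And>n s. s \<notin> T' \<Longrightarrow> g' n s = \<zero>\<^bsub>A\<^esub>" using g' unfolding lifts_def by blast
  have sT: "supp A (g n) \<subseteq> T" "supp A (g' n) \<subseteq> T'" for n using T T' by (auto simp: supp_def)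
  have sf: "supp A\<omega> f \<subseteq> T"
    using T(2) by (auto simp: supp_def lifts_cl[OF g] U.cl_zero[unfolded UQ])
  have tm: "(\<lambda>n. g n s \<otimes>\<^bsub>A\<^esub> \<alpha> s (g' n (t - s))) \<in> carrier (linf A)" for s t
    by (rule U.S_mult[OF lifts_linf[OF g] alpha_linf[OF lifts_linf[OF g']]])
  have eq: "(\<lambda>n. (g n \<otimes>\<^bsub>Cc A \<alpha>\<^esub> g' n) t) = (\<lambda>n. finsum A (\<lambda>s. g n s \<otimes>\<^bsub>A\<^esub> \<alpha> s (g' n (t - s))) T)" for t
    by (rule ext) (rule D.mul_eq[OF lifts_fs[OF g] lifts_fs[OF g'] T(1) sT(1)])
  show ?thesis unfolding lifts_def
  proof (intro conjI allI exI[of _ "(\<lambda>(s, u). s + u) ` (T \<times> T')"] impI)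
    fix n s assume s: "s \<notin> (\<lambda>(s, u). s + u) ` (T \<times> T')"
    have "supp A (g n \<otimes>\<^bsub>Cc A \<alpha>\<^esub> g' n) \<subseteq> (\<lambda>(s, u). s + u) ` (T \<times> T')"
      using D.supp_mul[OF lifts_fs[OF g] lifts_fs[OF g'], of n n] sT[of n] by fast
    then show "(g n \<otimes>\<^bsub>Cc A \<alpha>\<^esub> g' n) s = \<zero>\<^bsub>A\<^esub>" by (intro A.not_supp[of s]) (use s in blast)
  next
    fix t
    show "(\<lambda>n. (g n \<otimes>\<^bsub>Cc A \<alpha>\<^esub> g' n) t) \<in> carrier (linf A)"
      unfolding eq by (rule U.finsum_S[OF T(1) tm])
    have "(f \<otimes>\<^bsub>Cc A\<omega> \<alpha>\<omega>\<^esub> f') t = finsum A\<omega> (\<lambda>s. f s \<otimes>\<^bsub>A\<omega>\<^esub> \<alpha>\<omega> s (f' (t - s))) T"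
      by (rule E.mul_eq[OF lifts_fs'[OF g] lifts_fs'[OF g'] T(1) sf])
    also have "\<dots> = finsum A\<omega> (\<lambda>s. U.cl (\<lambda>n. g n s \<otimes>\<^bsub>A\<^esub> \<alpha> s (g' n (t - s)))) T"
      unfolding lifts_cl[OF g] lifts_cl[OF g'] ultra_action_cl[OF lifts_linf[OF g']]
        U.cl_mult[OF lifts_linf[OF g] alpha_linf[OF lifts_linf[OF g']], unfolded UQ] ..
    also have "\<dots> = U.cl (\<lambda>n. (g n \<otimes>\<^bsub>Cc A \<alpha>\<^esub> g' n) t)"
      unfolding eq by (rule U.cl_finsum[OF T(1) tm, unfolded UQ])
    finally show "(f \<otimes>\<^bsub>Cc A\<omega> \<alpha>\<omega>\<^esub> f') t = U.cl (\<lambda>n. (g n \<otimes>\<^bsub>Cc A \<alpha>\<^esub> g' n) t)" .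
  qed (simp add: T T')
qed

lemma \<Phi>_star_hom: "\<Phi> \<in> star_hom (Cc A\<omega> \<alpha>\<omega>) Y"
proof -
  note h = DC.emb_hom[folded crossed_def, unfolded D.C_simps(1)]
  note v = V.cl_add[unfolded VQ] V.cl_mult[unfolded VQ] V.cl_smult[unfolded VQ] V.cl_star[unfolded VQ]
  have 1: "\<Phi> (f \<oplus>\<^bsub>Cc A\<omega> \<alpha>\<omega>\<^esub> f') = \<Phi> f \<oplus>\<^bsub>Y\<^esub> \<Phi> f' \<and> \<Phi> (f \<otimes>\<^bsub>Cc A\<omega> \<alpha>\<omega>\<^esub> f') = \<Phi> f \<otimes>\<^bsub>Y\<^esub> \<Phi> f'"
    if f: "f \<in> finsupp A\<omega>" and f': "f' \<in> finsupp A\<omega>" for f f'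
  proof -
    obtain g where g: "lifts g f" using lift_exists[OF f] by blast
    obtain g' where g': "lifts g' f'" using lift_exists[OF f'] by blast
    show ?thesis
      by (simp add: \<Phi>_eq[OF g] \<Phi>_eq[OF g'] \<Phi>_eq[OF lifts_add[OF g g']] \<Phi>_eq[OF lifts_mult[OF g g']]
        h lifts_fs[OF g] lifts_fs[OF g'] v lifts_seq[OF g] lifts_seq[OF g'])
  qed
  have 2: "\<Phi> (c \<odot>\<^bsub>Cc A\<omega> \<alpha>\<omega>\<^esub> f) = c \<odot>\<^bsub>Y\<^esub> \<Phi> f \<and> \<Phi> (star (Cc A\<omega> \<alpha>\<omega>) f) = star Y (\<Phi> f)"
    if f: "f \<in> finsupp A\<omega>" for c f
  proof -
    obtain g where g: "lifts g f" using lift_exists[OF f] by blast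
    show ?thesis
      by (simp add: \<Phi>_eq[OF g] \<Phi>_eq[OF lifts_smult[OF g]] \<Phi>_eq[OF lifts_star[OF g]]
        h lifts_fs[OF g] v lifts_seq[OF g])
  qed
  show ?thesis using 1 2 \<Phi>_closed by (auto simp: star_hom_def E.C_simps(1))
qed

lemmas \<Phi>_hom = star_homD[OF \<Phi>_star_hom, unfolded E.C_simps(1)]

lemma nrm_\<Phi>_lim: assumes g: "lifts g f" shows "((\<lambda>n. reduced_norm A \<alpha> (g n)) \<longlongrightarrow> nrm Y (\<Phi> f)) \<omega>"
  using V.nrm_cl[OF lifts_seq[OF g]] by (simp add: \<Phi>_eq[OF g] VQ nrm_emb_X0 lifts_fs[OF g])

text \<open>Both sides satisfy the C*-identity, are at least the norm of each coefficient and at most the sum of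
  these norms; for \<open>\<Phi>\<close> this is inherited from the reduced norm over \<open>A\<close> in the limit. So
  \<open>cstar_norm_le\<close> applies in both directions.\<close>
theorem \<Phi>_isometric: assumes f: "f \<in> finsupp A\<omega>" shows "nrm Y (\<Phi> f) = reduced_norm A\<omega> \<alpha>\<omega> f"
proof (rule antisym)
  have cs: "nrm Y (\<Phi> (star (Cc A\<omega> \<alpha>\<omega>) f \<otimes>\<^bsub>Cc A\<omega> \<alpha>\<omega>\<^esub> f)) = (nrm Y (\<Phi> f))\<^sup>2" if "f \<in> finsupp A\<omega>" for f
    using that by (simp add: \<Phi>_hom E.fs_star Y.cstar_identity \<Phi>_closed)
  have ge0: "0 \<le> nrm Y (\<Phi> f)" if "f \<in> finsupp A\<omega>" for f using that by (intro Y.nrm_ge0 \<Phi>_closed)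
  have up: "nrm Y (\<Phi> f) \<le> (\<Sum>s\<in>supp A\<omega> f. nrm A\<omega> (f s))" if f: "f \<in> finsupp A\<omega>" for f
  proof -
    obtain g where g: "lifts g f" "\<And>n. supp A (g n) \<subseteq> supp A\<omega> f" using lift_exists[OF f] by blast
    have lim: "((\<lambda>n. \<Sum>s\<in>supp A\<omega> f. nrm A (g n s)) \<longlongrightarrow> (\<Sum>s\<in>supp A\<omega> f. nrm A\<omega> (f s))) \<omega>"
      unfolding lifts_cl[OF g(1)] by (rule tendsto_sum) (rule U.nrm_cl[OF lifts_linf[OF g(1)], unfolded UQ])
    show ?thesis
    proof (rule tendsto_le[OF nontriv lim nrm_\<Phi>_lim[OF g(1)]], rule always_eventually, rule allI)
      fix n
      have "reduced_norm A \<alpha> (g n) \<le> (\<Sum>s\<in>supp A (g n). nrm A (g n s))" by (rule D.reduced_norm_le_sum[OF lifts_fs[OF g(1)]])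
      also have "\<dots> \<le> (\<Sum>s\<in>supp A\<omega> f. nrm A (g n s))"
        by (rule sum_mono2[OF E.fs_finite[OF f] g(2)]) (auto intro: A.nrm_ge0 lifts_closed[OF g(1)])
      finally show "reduced_norm A \<alpha> (g n) \<le> (\<Sum>s\<in>supp A\<omega> f. nrm A (g n s))" .
    qed
  qed
  have low: "nrm A\<omega> (f s) \<le> nrm Y (\<Phi> f)" if f: "f \<in> finsupp A\<omega>" for f s
  proof -
    obtain g where g: "lifts g f" using lift_exists[OF f] by blast
    show ?thesis unfolding lifts_cl[OF g, of s]
      by (rule tendsto_le[OF nontriv nrm_\<Phi>_lim[OF g] U.nrm_cl[OF lifts_linf[OF g], unfolded UQ]])
        (intro always_eventually allI D.coeff_le_reduced_norm lifts_fs[OF g])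
  qed
  show "nrm Y (\<Phi> f) \<le> reduced_norm A\<omega> \<alpha>\<omega> f"
    by (rule E.cstar_norm_le[OF cs ge0 up E.reduced_norm_cstar E.reduced_norm_ge0 E.coeff_le_reduced_norm f])
  show "reduced_norm A\<omega> \<alpha>\<omega> f \<le> nrm Y (\<Phi> f)"
    by (rule E.cstar_norm_le[OF E.reduced_norm_cstar E.reduced_norm_ge0 E.reduced_norm_le_sum cs ge0 low f])
qed

end

section \<open>Continuity of the dual action\<close>

lemma star_hom_diff:
  assumes "pre_cstar B" "pre_cstar C" "\<psi> \<in> star_hom B C" "x \<in> carrier B" "y \<in> carrier B"
  shows "\<psi> (x \<ominus>\<^bsub>B\<^esub> y) = \<psi> x \<ominus>\<^bsub>C\<^esub> \<psi> y"
proof -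
  interpret B: pre_cstar B by fact
  interpret C: pre_cstar C by fact
  note psi = star_homD[OF assms(3)]
  have "\<psi> (\<ominus>\<^bsub>B\<^esub> y) = \<ominus>\<^bsub>C\<^esub> \<psi> y"
    using psi(4)[OF assms(5), of "-1"] assms psi by (simp add: B.sm_minus1 C.sm_minus1)
  then show ?thesis using assms psi by (simp add: a_minus_def)
qed

context pre_cstar
begin

lemma nrm_tendsto:
  assumes u: "\<And>n. u n \<in> carrier A" and l: "l \<in> carrier A" and lim: "(\<lambda>n. nrm A (u n \<ominus> l)) \<longlonglongrightarrow> 0"
  shows "(\<lambda>n. nrm A (u n)) \<longlonglongrightarrow> nrm A l"
proof -
  have "(\<lambda>n. nrm A (u n) - nrm A l) \<longlonglongrightarrow> 0"
    by (rule tendsto_0_le[OF lim, where K = 1])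
      (use nrm_diff_ge[OF u l] nrm_ge0 u l in \<open>auto intro!: always_eventually\<close>)
  then show ?thesis by (simp add: LIM_zero_iff)
qed

lemma tendsto_smult:
  assumes u: "\<And>n. u n \<in> carrier A" and l: "l \<in> carrier A" and lim: "(\<lambda>n. nrm A (u n \<ominus> l)) \<longlonglongrightarrow> 0"
  shows "(\<lambda>n. nrm A (c \<odot> u n \<ominus> c \<odot> l)) \<longlonglongrightarrow> 0"
proof -
  have "c \<odot> u n \<ominus> c \<odot> l = c \<odot> (u n \<ominus> l)" for n using u l by (simp add: a_minus_def sm_radd sm_minus)
  then have "nrm A (c \<odot> u n \<ominus> c \<odot> l) = cmod c * nrm A (u n \<ominus> l)" for n using u l by (simp add: nrm_smult)
  then show ?thesis using tendsto_mult_right_zero[OF lim, of "cmod c"] by simp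
qed

lemma tendsto_star:
  assumes u: "\<And>n. u n \<in> carrier A" and l: "l \<in> carrier A" and lim: "(\<lambda>n. nrm A (u n \<ominus> l)) \<longlonglongrightarrow> 0"
  shows "(\<lambda>n. nrm A (star A (u n) \<ominus> star A l)) \<longlonglongrightarrow> 0"
proof -
  have "nrm A (star A (u n) \<ominus> star A l) = nrm A (u n \<ominus> l)" for n
    using u[of n] l nrm_star[of "u n \<ominus> l"] by (simp add: a_minus_def star_add star_minus)
  then show ?thesis using lim by simp
qed

lemma tendsto_add_mult:
  assumes u: "\<And>n. u n \<in> carrier A" "l \<in> carrier A" "(\<lambda>n. nrm A (u n \<ominus> l)) \<longlonglongrightarrow> 0"
    and v: "\<And>n. v n \<in> carrier A" "m \<in> carrier A" "(\<lambda>n. nrm A (v n \<ominus> m)) \<longlonglongrightarrow> 0"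
  shows "(\<lambda>n. nrm A ((u n \<oplus> v n) \<ominus> (l \<oplus> m))) \<longlonglongrightarrow> 0"
    and "(\<lambda>n. nrm A ((u n \<otimes> v n) \<ominus> (l \<otimes> m))) \<longlonglongrightarrow> 0"
proof -
  interpret C: seq_quot A sequentially "{x. cauchy_in A x}" by (rule seq_quot_completion)
  have mem: "u \<in> {x. cauchy_in A x}" "v \<in> {x. cauchy_in A x}" "(\<lambda>n. l) \<in> {x. cauchy_in A x}" "(\<lambda>n. m) \<in> {x. cauchy_in A x}"
    using convergent_cauchy[OF u] convergent_cauchy[OF v] const_cauchy u v by auto
  have e: "C.eqv u (\<lambda>n. l)" "C.eqv v (\<lambda>n. m)" using u v by (auto simp: C.eqv_def)
  show "(\<lambda>n. nrm A ((u n \<oplus> v n) \<ominus> (l \<oplus> m))) \<longlonglongrightarrow> 0"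
    using C.eqv_add[OF mem e] by (simp add: C.eqv_def)
  show "(\<lambda>n. nrm A ((u n \<otimes> v n) \<ominus> (l \<otimes> m))) \<longlonglongrightarrow> 0"
    using C.eqv_mult[OF mem e] by (simp add: C.eqv_def)
qed

text \<open>The inverse in \<open>linf A\<close> is determined by its group structure, and is therefore pointwise.\<close>
lemma linf_diff:
  assumes x: "x \<in> carrier (linf A)" and y: "y \<in> carrier (linf A)"
  shows "x \<ominus>\<^bsub>linf A\<^esub> y = (\<lambda>n. x n \<ominus> y n)"
    and "(\<lambda>n. x n \<ominus> y n) \<in> carrier (linf A)"
proof -
  have bdI: "x \<in> carrier (linf A)" if "\<And>n. x n \<in> carrier A" "\<And>n. nrm A (x n) \<le> K" for x K
    using that by (auto simp: linf_def bdd_above_def)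
  have bdE: "(\<forall>n. x n \<in> carrier A) \<and> (\<exists>K. \<forall>n. nrm A (x n) \<le> K)" if "x \<in> carrier (linf A)" for x
    using that by (auto simp: linf_def bdd_above_def)
  have add: "u \<oplus>\<^bsub>linf A\<^esub> v = (\<lambda>n. u n \<oplus> v n)" "\<zero>\<^bsub>linf A\<^esub> = (\<lambda>n. \<zero>)" for u v by (auto simp: linf_def)
  have neg: "(\<lambda>n. \<ominus> u n) \<in> carrier (linf A)" if u: "u \<in> carrier (linf A)" for u
  proof -
    obtain K where "\<And>n. u n \<in> carrier A" "\<And>n. nrm A (u n) \<le> K" using bdE[OF u] by blast
    then show ?thesis by (intro bdI[of _ K]) (auto simp: nrm_minus)
  qed
  have sum: "(\<lambda>n. u n \<oplus> v n) \<in> carrier (linf A)" if u: "u \<in> carrier (linf A)" and v: "v \<in> carrier (linf A)" for u v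
  proof -
    obtain K where K: "\<And>n. u n \<in> carrier A" "\<And>n. nrm A (u n) \<le> K" using bdE[OF u] by blast
    obtain L where L: "\<And>n. v n \<in> carrier A" "\<And>n. nrm A (v n) \<le> L" using bdE[OF v] by blast
    show ?thesis by (rule bdI[of _ "K + L"]) (use K L in simp, rule order_trans[OF nrm_triangle add_mono], use K L in auto)
  qed
  have ag: "abelian_group (linf A)"
  proof (rule abelian_groupI)
    fix u assume u: "u \<in> carrier (linf A)"
    then have "(\<lambda>n. \<ominus> u n) \<oplus>\<^bsub>linf A\<^esub> u = \<zero>\<^bsub>linf A\<^esub>" using bdE[OF u] by (simp add: add M.l_neg)
    then show "\<exists>y\<in>carrier (linf A). y \<oplus>\<^bsub>linf A\<^esub> u = \<zero>\<^bsub>linf A\<^esub>" using neg[OF u] by blast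
  qed (auto simp: add sum dest!: bdE intro!: bdI[of _ 0] M.a_assoc M.a_comm simp: nrm_zero)
  interpret L: abelian_group "linf A" by (rule ag)
  have "(\<lambda>n. \<ominus> y n) \<oplus>\<^bsub>linf A\<^esub> y = \<zero>\<^bsub>linf A\<^esub>" using bdE[OF y] by (simp add: add M.l_neg)
  then have "\<ominus>\<^bsub>linf A\<^esub> y = (\<lambda>n. \<ominus> y n)" by (rule L.minus_equality) (use y neg in auto)
  then show "x \<ominus>\<^bsub>linf A\<^esub> y = (\<lambda>n. x n \<ominus> y n)" by (simp add: a_minus_def add)
  show "(\<lambda>n. x n \<ominus> y n) \<in> carrier (linf A)" unfolding a_minus_def by (intro sum neg x y)
qed

end

lemma dual_open_nbhd:
  fixes V :: "('g \<Rightarrow> complex) set"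
  assumes "open V" "\<gamma>\<^sub>0 \<in> V"
  shows "\<exists>S \<eta>. finite S \<and> \<eta> > 0 \<and> (\<forall>\<gamma>. (\<forall>s\<in>S. cmod (\<gamma> s - \<gamma>\<^sub>0 s) < \<eta>) \<longrightarrow> \<gamma> \<in> V)"
proof -
  obtain W where W: "\<gamma>\<^sub>0 \<in> PiE UNIV W" "\<And>i. open (W i)" "finite {i. W i \<noteq> UNIV}" "PiE UNIV W \<subseteq> V"
    using product_topology_open_contains_basis[of "\<lambda>_. euclidean" UNIV V \<gamma>\<^sub>0] assms
    by (auto simp: open_fun_def topspace_euclidean)
  define S where "S = {i. W i \<noteq> UNIV}"
  have "\<exists>\<eta>>0. \<forall>y. dist y (\<gamma>\<^sub>0 s) < \<eta> \<longrightarrow> y \<in> W s" for s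
    using W(1) W(2)[of s] unfolding open_dist by (auto simp: PiE_def Pi_def)
  then obtain r where r: "\<And>s. r s > 0" "\<And>s y. dist y (\<gamma>\<^sub>0 s) < r s \<Longrightarrow> y \<in> W s" by metis
  define \<eta> where "\<eta> = Min (insert 1 (r ` S))"
  have fin: "finite S" using W(3) by (simp add: S_def)
  have \<eta>: "\<eta> > 0" "\<And>s. s \<in> S \<Longrightarrow> \<eta> \<le> r s" using fin r by (auto simp: \<eta>_def)
  have "\<gamma> \<in> V" if g: "\<forall>s\<in>S. cmod (\<gamma> s - \<gamma>\<^sub>0 s) < \<eta>" for \<gamma>
  proof -
    have "\<gamma> s \<in> W s" for s
    proof (cases "s \<in> S")
      case True
      then have "dist (\<gamma> s) (\<gamma>\<^sub>0 s) < r s" using g \<eta>(2)[OF True] by (auto simp: dist_norm)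
      then show ?thesis by (rule r(2))
    qed (simp add: S_def)
    then show ?thesis using W(4) by auto
  qed
  then show ?thesis using fin \<eta> by blast
qed

context crossed_ultra
begin

interpretation DQ: seq_quot "Cc A \<alpha>" sequentially "{x. cauchy_in (Cc A \<alpha>) x}"
  by (rule DC.seq_quot_completion)

lemma DQ_Q: "seq_quot.Q (Cc A \<alpha>) sequentially {x. cauchy_in (Cc A \<alpha>) x} = X0"
  by (simp add: DC.completion_Q crossed_def)

abbreviation da where "da \<equiv> dual_action A \<alpha>"

lemma dual_cauchy: assumes g: "\<gamma> \<in> dual_group" and x: "cauchy_in (Cc A \<alpha>) x"
  shows "cauchy_in (Cc A \<alpha>) (\<lambda>n. D.dual \<gamma> (x n))"
    and "cauchy_in (Cc A \<alpha>) y \<Longrightarrow> nrm (Cc A \<alpha>) (D.dual \<gamma> (x n) \<ominus>\<^bsub>Cc A \<alpha>\<^esub> D.dual \<gamma> (y n)) \<le> nrm (Cc A \<alpha>) (x n \<ominus>\<^bsub>Cc A \<alpha>\<^esub> y n)"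
proof -
  have le: "nrm (Cc A \<alpha>) (D.dual \<gamma> f \<ominus>\<^bsub>Cc A \<alpha>\<^esub> D.dual \<gamma> h) \<le> nrm (Cc A \<alpha>) (f \<ominus>\<^bsub>Cc A \<alpha>\<^esub> h)"
    if f: "f \<in> finsupp A" and h: "h \<in> finsupp A" for f h
  proof -
    have "D.dual \<gamma> f \<ominus>\<^bsub>Cc A \<alpha>\<^esub> D.dual \<gamma> h = D.dual \<gamma> (\<lambda>s. f s \<ominus>\<^bsub>A\<^esub> h s)"
      unfolding D.C_diff[OF D.fs_dual[OF f] D.fs_dual[OF h]] using A.fs_closed[OF f] A.fs_closed[OF h]
      by (auto simp: D.dual_def a_minus_def A.sm_radd A.sm_minus)
    then show ?thesis
      using D.reduced_norm_dual_le[OF g D.fs_diff[OF f h]] by (simp add: D.C_diff[OF f h] D.C_simps)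
  qed
  have c: "x n \<in> finsupp A" for n using x by (simp add: cauchy_in_def D.C_simps)
  show "cauchy_in (Cc A \<alpha>) (\<lambda>n. D.dual \<gamma> (x n))"
    by (rule DC.cauchyI[OF _ x, of _ 1 0]) (simp_all add: le c D.C_simps(1) D.fs_dual)
  show "nrm (Cc A \<alpha>) (D.dual \<gamma> (x n) \<ominus>\<^bsub>Cc A \<alpha>\<^esub> D.dual \<gamma> (y n)) \<le> nrm (Cc A \<alpha>) (x n \<ominus>\<^bsub>Cc A \<alpha>\<^esub> y n)"
    if "cauchy_in (Cc A \<alpha>) y" using that by (intro le c) (simp add: cauchy_in_def D.C_simps)
qed

lemma da_cl: assumes g: "\<gamma> \<in> dual_group" and x: "cauchy_in (Cc A \<alpha>) x"
  shows "da \<gamma> (DQ.cl x) = DQ.cl (\<lambda>n. D.dual \<gamma> (x n))"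
proof -
  have "coset_map DQ.R DQ.J (\<lambda>x n s. cnj (\<gamma> s) \<odot>\<^bsub>A\<^esub> x n s) (DQ.cl x) = DQ.cl (\<lambda>n s. cnj (\<gamma> s) \<odot>\<^bsub>A\<^esub> x n s)"
  proof (rule DQ.coset_map_cl[where T = "\<lambda>x n s. cnj (\<gamma> s) \<odot>\<^bsub>A\<^esub> x n s"])
    fix y assume y: "y \<in> {x. cauchy_in (Cc A \<alpha>) x}"
    then show "(\<lambda>n s. cnj (\<gamma> s) \<odot>\<^bsub>A\<^esub> y n s) \<in> {x. cauchy_in (Cc A \<alpha>) x}"
      using dual_cauchy(1)[OF g] by (simp add: D.dual_def)
    assume e: "DQ.eqv y x"
    have "DQ.eqv (\<lambda>n. D.dual \<gamma> (y n)) (\<lambda>n. D.dual \<gamma> (x n))"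
    proof (rule DQ.eqv_squeeze)
      show "(\<lambda>n. nrm (Cc A \<alpha>) (y n \<ominus>\<^bsub>Cc A \<alpha>\<^esub> x n)) \<longlonglongrightarrow> 0" using e by (simp add: DQ.eqv_def)
    qed (use y x dual_cauchy[OF g] in \<open>auto simp: cauchy_in_def\<close>)
    then show "DQ.eqv (\<lambda>n s. cnj (\<gamma> s) \<odot>\<^bsub>A\<^esub> y n s) (\<lambda>n s. cnj (\<gamma> s) \<odot>\<^bsub>A\<^esub> x n s)" by (simp add: D.dual_def)
  qed (use x in simp)
  then show ?thesis by (simp add: dual_action_def DQ.R_def DQ.J_def cauchy_alg_def D.dual_def)
qed

lemma cases_X0: "Z \<in> carrier X0 \<Longrightarrow> (\<And>x. cauchy_in (Cc A \<alpha>) x \<Longrightarrow> Z = DQ.cl x \<Longrightarrow> P) \<Longrightarrow> P"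
  using DQ.cl_cases[unfolded DQ_Q] by blast

lemma da_closed: assumes "\<gamma> \<in> dual_group" "Z \<in> carrier X0" shows "da \<gamma> Z \<in> carrier X0"
proof -
  obtain x where "cauchy_in (Cc A \<alpha>) x" "Z = DQ.cl x" using assms(2) by (rule cases_X0)
  then show ?thesis using assms(1) DQ.cl_closed[unfolded DQ_Q] by (simp add: da_cl dual_cauchy)
qed

lemma da_diff: assumes g: "\<gamma> \<in> dual_group" and Z: "Z \<in> carrier X0" "Z' \<in> carrier X0"
  shows "nrm X0 (da \<gamma> Z \<ominus>\<^bsub>X0\<^esub> da \<gamma> Z') \<le> nrm X0 (Z \<ominus>\<^bsub>X0\<^esub> Z')"
proof -
  obtain x where x: "cauchy_in (Cc A \<alpha>) x" "Z = DQ.cl x" using Z(1) by (rule cases_X0)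
  obtain x' where x': "cauchy_in (Cc A \<alpha>) x'" "Z' = DQ.cl x'" using Z(2) by (rule cases_X0)
  note m = x(1) x'(1) dual_cauchy(1)[OF g x(1)] dual_cauchy(1)[OF g x'(1)]
  have 1: "da \<gamma> Z \<ominus>\<^bsub>X0\<^esub> da \<gamma> Z' = DQ.cl (\<lambda>n. D.dual \<gamma> (x n) \<ominus>\<^bsub>Cc A \<alpha>\<^esub> D.dual \<gamma> (x' n))"
    using DQ.cl_diff[unfolded DQ_Q, of "\<lambda>n. D.dual \<gamma> (x n)" "\<lambda>n. D.dual \<gamma> (x' n)"] m by (simp add: x(2) x'(2) da_cl[OF g])
  have 2: "Z \<ominus>\<^bsub>X0\<^esub> Z' = DQ.cl (\<lambda>n. x n \<ominus>\<^bsub>Cc A \<alpha>\<^esub> x' n)"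
    using DQ.cl_diff[unfolded DQ_Q, of x x'] m by (simp add: x(2) x'(2))
  have l1: "(\<lambda>n. nrm (Cc A \<alpha>) (D.dual \<gamma> (x n) \<ominus>\<^bsub>Cc A \<alpha>\<^esub> D.dual \<gamma> (x' n))) \<longlonglongrightarrow> nrm X0 (da \<gamma> Z \<ominus>\<^bsub>X0\<^esub> da \<gamma> Z')"
    unfolding 1 by (rule DQ.nrm_cl[unfolded DQ_Q]) (rule DQ.S_diff, use m in auto)
  have l2: "(\<lambda>n. nrm (Cc A \<alpha>) (x n \<ominus>\<^bsub>Cc A \<alpha>\<^esub> x' n)) \<longlonglongrightarrow> nrm X0 (Z \<ominus>\<^bsub>X0\<^esub> Z')"
    unfolding 2 by (rule DQ.nrm_cl[unfolded DQ_Q]) (rule DQ.S_diff, use m in auto)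
  show ?thesis
    by (rule tendsto_le[OF _ l2 l1]) (auto intro!: always_eventually dual_cauchy(2)[OF g m(1,2)])
qed

lemma da_emb: assumes g: "\<gamma> \<in> dual_group" and y: "y \<in> finsupp A" shows "da \<gamma> (\<iota> y) = \<iota> (D.dual \<gamma> y)"
  using da_cl[OF g DC.const_cauchy, of y] y by (simp add: D.C_simps(1) DC.emb_cl)

lemma da_bound: assumes g: "\<gamma> \<in> dual_group" and Z: "Z \<in> carrier X0" shows "nrm X0 (da \<gamma> Z) \<le> nrm X0 Z"
proof -
  have z: "(\<lambda>s. \<zero>\<^bsub>A\<^esub>) \<in> finsupp A" by (rule A.fs_zero)
  have n0: "nrm X0 (\<iota> (\<lambda>s. \<zero>\<^bsub>A\<^esub>)) = 0"
    using nrm_emb_X0[OF z] D.reduced_norm_le_sum[OF z] D.reduced_norm_ge0[OF z] by (simp add: supp_def)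
  have "\<iota> (\<lambda>s. \<zero>\<^bsub>A\<^esub>) = \<zero>\<^bsub>X0\<^esub>" using X0.nrm_eq_0[OF emb_X0[OF z]] n0 by simp
  moreover have "da \<gamma> (\<iota> (\<lambda>s. \<zero>\<^bsub>A\<^esub>)) = \<iota> (\<lambda>s. \<zero>\<^bsub>A\<^esub>)"
    unfolding da_emb[OF g z] by (simp add: D.dual_def A.sm_zero)
  ultimately have d0: "da \<gamma> \<zero>\<^bsub>X0\<^esub> = \<zero>\<^bsub>X0\<^esub>" by simp
  have mz: "W \<ominus>\<^bsub>X0\<^esub> \<zero>\<^bsub>X0\<^esub> = W" if "W \<in> carrier X0" for W by (rule V.diff_zero[OF that])
  show ?thesis using da_diff[OF g Z X0.M.zero_closed] mz[OF Z] mz[OF da_closed[OF g Z]] by (simp add: d0)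
qed

definition osc where "osc \<gamma> \<gamma>\<^sub>0 Z = nrm X0 (da \<gamma> Z \<ominus>\<^bsub>X0\<^esub> da \<gamma>\<^sub>0 Z)"

text \<open>The dual action is contractive, so replacing \<open>Z\<close> by \<open>Z'\<close> costs at most the distance, once for each
  character.\<close>
lemma osc_perturb:
  assumes g: "\<gamma> \<in> dual_group" "\<gamma>\<^sub>0 \<in> dual_group" and Z: "Z \<in> carrier X0" "Z' \<in> carrier X0"
  shows "osc \<gamma> \<gamma>\<^sub>0 Z \<le> osc \<gamma> \<gamma>\<^sub>0 Z' + 2 * nrm X0 (Z \<ominus>\<^bsub>X0\<^esub> Z')"
proof -
  note c = da_closed[OF g(1) Z(1)] da_closed[OF g(1) Z(2)] da_closed[OF g(2) Z(1)] da_closed[OF g(2) Z(2)]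
  have "osc \<gamma> \<gamma>\<^sub>0 Z \<le> nrm X0 (da \<gamma> Z \<ominus>\<^bsub>X0\<^esub> da \<gamma> Z') + nrm X0 (da \<gamma> Z' \<ominus>\<^bsub>X0\<^esub> da \<gamma>\<^sub>0 Z)"
    unfolding osc_def by (intro X0.nrm_diff_triangle c)
  also have "nrm X0 (da \<gamma> Z' \<ominus>\<^bsub>X0\<^esub> da \<gamma>\<^sub>0 Z) \<le> osc \<gamma> \<gamma>\<^sub>0 Z' + nrm X0 (da \<gamma>\<^sub>0 Z' \<ominus>\<^bsub>X0\<^esub> da \<gamma>\<^sub>0 Z)"
    unfolding osc_def by (intro X0.nrm_diff_triangle c)
  also have "nrm X0 (da \<gamma> Z \<ominus>\<^bsub>X0\<^esub> da \<gamma> Z') \<le> nrm X0 (Z \<ominus>\<^bsub>X0\<^esub> Z')" by (rule da_diff[OF g(1) Z])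
  also have "nrm X0 (da \<gamma>\<^sub>0 Z' \<ominus>\<^bsub>X0\<^esub> da \<gamma>\<^sub>0 Z) \<le> nrm X0 (Z \<ominus>\<^bsub>X0\<^esub> Z')"
    using da_diff[OF g(2) Z(2,1)] X0.nrm_diff_commute[OF Z] by simp
  finally show ?thesis by simp
qed

lemma osc_emb: assumes g: "\<gamma> \<in> dual_group" "\<gamma>\<^sub>0 \<in> dual_group" and y: "y \<in> finsupp A"
  shows "osc \<gamma> \<gamma>\<^sub>0 (\<iota> y) = reduced_norm A \<alpha> (\<lambda>s. D.dual \<gamma> y s \<ominus>\<^bsub>A\<^esub> D.dual \<gamma>\<^sub>0 y s)"
proof -
  note d = D.fs_dual[OF y, of \<gamma>] D.fs_dual[OF y, of \<gamma>\<^sub>0]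
  have "\<iota> (D.dual \<gamma> y) \<ominus>\<^bsub>X0\<^esub> \<iota> (D.dual \<gamma>\<^sub>0 y) = \<iota> (\<lambda>s. D.dual \<gamma> y s \<ominus>\<^bsub>A\<^esub> D.dual \<gamma>\<^sub>0 y s)"
    using DC.emb_diff[of "D.dual \<gamma> y" "D.dual \<gamma>\<^sub>0 y"] d by (simp add: D.C_simps(1) D.C_diff crossed_def)
  then show ?thesis by (simp add: osc_def da_emb[OF g(1) y] da_emb[OF g(2) y] nrm_emb_X0 D.fs_diff[OF d])
qed

text \<open>Continuity in the supremum norm is continuity of the dual action at every \<open>x n\<close>, uniformly in \<open>n\<close>.\<close>
lemma continuous_seqs_iff:
  "x \<in> continuous_seqs A \<alpha> \<longleftrightarrow> x \<in> carrier (linf X0) \<and>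
    (\<forall>\<gamma>\<^sub>0\<in>dual_group. \<forall>e>0. eventually (\<lambda>\<gamma>. \<forall>n. osc \<gamma> \<gamma>\<^sub>0 (x n) \<le> e) (at \<gamma>\<^sub>0 within dual_group))"
proof -
  have in_dual: "eventually (\<lambda>\<gamma>. \<gamma> \<in> dual_group) (at \<gamma>\<^sub>0 within dual_group)" for \<gamma>\<^sub>0 :: "'g \<Rightarrow> complex"
    by (simp add: eventually_at_filter)
  have "(((\<lambda>\<gamma>. nrm (linf X0) ((\<lambda>n. da \<gamma> (x n)) \<ominus>\<^bsub>linf X0\<^esub> (\<lambda>n. da \<gamma>\<^sub>0 (x n)))) \<longlongrightarrow> 0) (at \<gamma>\<^sub>0 within dual_group))
    \<longleftrightarrow> (\<forall>e>0. eventually (\<lambda>\<gamma>. \<forall>n. osc \<gamma> \<gamma>\<^sub>0 (x n) \<le> e) (at \<gamma>\<^sub>0 within dual_group))"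
    if x: "x \<in> carrier (linf X0)" and g0: "\<gamma>\<^sub>0 \<in> dual_group" for \<gamma>\<^sub>0
  proof -
    have xc: "x n \<in> carrier X0" for n using V.S_closed[OF x] .
    have mem: "(\<lambda>n. da \<gamma> (x n)) \<in> carrier (linf X0)" if g: "\<gamma> \<in> dual_group" for \<gamma>
    proof -
      obtain K where "\<And>n. nrm X0 (x n) \<le> K" using V.S_bounded[OF x] by blast
      then show ?thesis using da_bound[OF g xc] by (intro V.linfI[of _ K] da_closed[OF g] xc) (meson order_trans)
    qed
    define N where "N \<gamma> = nrm (linf X0) ((\<lambda>n. da \<gamma> (x n)) \<ominus>\<^bsub>linf X0\<^esub> (\<lambda>n. da \<gamma>\<^sub>0 (x n)))" for \<gamma>
    have N: "N \<gamma> = (SUP n. osc \<gamma> \<gamma>\<^sub>0 (x n))" "bdd_above (range (\<lambda>n. osc \<gamma> \<gamma>\<^sub>0 (x n)))" if g: "\<gamma> \<in> dual_group" for \<gamma>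
      using X0.linf_diff[OF mem[OF g] mem[OF g0]] by (auto simp: N_def osc_def linf_def)
    have osc0: "osc \<gamma> \<gamma>\<^sub>0 (x n) \<ge> 0" if g: "\<gamma> \<in> dual_group" for \<gamma> n
      unfolding osc_def by (intro X0.nrm_ge0 X0.M.minus_closed da_closed g g0 xc)
    have N0: "N \<gamma> \<ge> 0" if g: "\<gamma> \<in> dual_group" for \<gamma>
      using cSUP_upper[OF UNIV_I N(2)[OF g], of 0] osc0[OF g, of 0] by (simp add: N(1)[OF g])
    show ?thesis
      unfolding N_def[symmetric]
    proof
      assume lim: "(N \<longlongrightarrow> 0) (at \<gamma>\<^sub>0 within dual_group)"
      show "\<forall>e>0. eventually (\<lambda>\<gamma>. \<forall>n. osc \<gamma> \<gamma>\<^sub>0 (x n) \<le> e) (at \<gamma>\<^sub>0 within dual_group)"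
      proof (intro allI impI)
        fix e :: real assume "e > 0"
        then have "eventually (\<lambda>\<gamma>. N \<gamma> < e) (at \<gamma>\<^sub>0 within dual_group)" using lim by (intro order_tendstoD(2)) auto
        then show "eventually (\<lambda>\<gamma>. \<forall>n. osc \<gamma> \<gamma>\<^sub>0 (x n) \<le> e) (at \<gamma>\<^sub>0 within dual_group)"
          using in_dual
        proof eventually_elim
          case (elim \<gamma>)
          show ?case
          proof
            fix n
            show "osc \<gamma> \<gamma>\<^sub>0 (x n) \<le> e"
              using cSUP_upper[OF UNIV_I N(2)[OF elim(2)], of n] elim N(1)[OF elim(2)] by simp
          qed
        qed
      qed
    next
      assume ev: "\<forall>e>0. eventually (\<lambda>\<gamma>. \<forall>n. osc \<gamma> \<gamma>\<^sub>0 (x n) \<le> e) (at \<gamma>\<^sub>0 within dual_group)"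
      show "(N \<longlongrightarrow> 0) (at \<gamma>\<^sub>0 within dual_group)"
      proof (rule tendstoI)
        fix e :: real assume e: "e > 0"
        then have "eventually (\<lambda>\<gamma>. \<forall>n. osc \<gamma> \<gamma>\<^sub>0 (x n) \<le> e / 2) (at \<gamma>\<^sub>0 within dual_group)" using ev[rule_format, of "e / 2"] by simp
        then show "eventually (\<lambda>\<gamma>. dist (N \<gamma>) 0 < e) (at \<gamma>\<^sub>0 within dual_group)"
          using in_dual
        proof eventually_elim
          case (elim \<gamma>)
          have "N \<gamma> \<le> e / 2" unfolding N(1)[OF elim(2)] by (rule cSUP_least) (use elim in auto)
          then show ?case using N0[OF elim(2)] e by (simp add: dist_real_def)
        qed
      qed
    qed
  qed
  then show ?thesis unfolding continuous_seqs_def by blast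
qed

text \<open>The oscillation is at most \<open>\<Sum> \<bar>\<gamma> s - \<gamma>\<^sub>0 s\<bar> K s\<close> over the common finite support, where \<open>K s\<close> bounds the
  coefficients at \<open>s\<close>.\<close>
lemma lifts_continuous: assumes g: "lifts g f" shows "(\<lambda>n. \<iota> (g n)) \<in> continuous_seqs A \<alpha>"
  unfolding continuous_seqs_iff
proof (intro conjI ballI allI impI)
  show "(\<lambda>n. \<iota> (g n)) \<in> carrier (linf X0)" by (rule lifts_seq[OF g])
  fix \<gamma>\<^sub>0 :: "'g \<Rightarrow> complex" and e :: real assume g0: "\<gamma>\<^sub>0 \<in> dual_group" and e: "e > 0"
  obtain T where T: "finite T" "\<And>n s. s \<notin> T \<Longrightarrow> g n s = \<zero>\<^bsub>A\<^esub>" using g unfolding lifts_def by blast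
  have "\<forall>s. \<exists>K. \<forall>n. nrm A (g n s) \<le> K" using U.S_bounded[OF lifts_linf[OF g]] by blast
  then obtain K where K: "\<And>s n. nrm A (g n s) \<le> K s" by metis
  have coord: "((\<lambda>\<gamma>. \<gamma> s) \<longlongrightarrow> \<gamma>\<^sub>0 s) (at \<gamma>\<^sub>0 within dual_group)" for s
  proof -
    have "continuous_on UNIV (\<lambda>\<gamma> :: 'g \<Rightarrow> complex. \<gamma> s)" by (rule continuous_on_product_coordinates)
    then show ?thesis by (meson UNIV_I continuous_on_def subset_UNIV tendsto_within_subset)
  qed
  have "((\<lambda>\<gamma>. \<Sum>s\<in>T. cmod (\<gamma> s - \<gamma>\<^sub>0 s) * K s) \<longlongrightarrow> (\<Sum>s\<in>T. cmod (\<gamma>\<^sub>0 s - \<gamma>\<^sub>0 s) * K s)) (at \<gamma>\<^sub>0 within dual_group)"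
    by (intro tendsto_intros coord)
  then have "eventually (\<lambda>\<gamma>. (\<Sum>s\<in>T. cmod (\<gamma> s - \<gamma>\<^sub>0 s) * K s) < e) (at \<gamma>\<^sub>0 within dual_group)"
    using e by (intro order_tendstoD(2)) auto
  moreover have "eventually (\<lambda>\<gamma>. \<gamma> \<in> dual_group) (at \<gamma>\<^sub>0 within dual_group)" by (simp add: eventually_at_filter)
  ultimately show "eventually (\<lambda>\<gamma>. \<forall>n. osc \<gamma> \<gamma>\<^sub>0 (\<iota> (g n)) \<le> e) (at \<gamma>\<^sub>0 within dual_group)"
  proof eventually_elim
    case (elim \<gamma>)
    show ?case
    proof
      fix n
      let ?d = "\<lambda>s. D.dual \<gamma> (g n) s \<ominus>\<^bsub>A\<^esub> D.dual \<gamma>\<^sub>0 (g n) s"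
      note gc = lifts_closed[OF g, of n]
      have d: "?d s = (cnj (\<gamma> s - \<gamma>\<^sub>0 s)) \<odot>\<^bsub>A\<^esub> g n s" for s by (simp add: D.dual_def A.sm_diff[OF gc])
      have df: "?d \<in> finsupp A" by (intro D.fs_diff D.fs_dual lifts_fs[OF g])
      have "osc \<gamma> \<gamma>\<^sub>0 (\<iota> (g n)) \<le> (\<Sum>s\<in>supp A ?d. nrm A (?d s))"
        unfolding osc_emb[OF elim(2) g0 lifts_fs[OF g]] by (rule D.reduced_norm_le_sum[OF df])
      also have "\<dots> \<le> (\<Sum>s\<in>T. nrm A (?d s))"
      proof (rule sum_mono2[OF T(1)])
        have "?d s = \<zero>\<^bsub>A\<^esub>" if "s \<notin> T" for s using T(2)[OF that, of n] by (simp add: d A.sm_zero)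
        then show "supp A ?d \<subseteq> T" by (auto simp: supp_def)
      qed (intro A.nrm_ge0 A.fs_closed[OF df])
      also have "\<dots> \<le> (\<Sum>s\<in>T. cmod (\<gamma> s - \<gamma>\<^sub>0 s) * K s)"
        unfolding d by (intro sum_mono) (simp add: A.nrm_smult[OF gc] mult_left_mono[OF K] del: complex_cnj_diff)
      finally show "osc \<gamma> \<gamma>\<^sub>0 (\<iota> (g n)) \<le> e" using elim(1) by simp
    qed
  qed
qed

end

context crossed_ultra
begin

section \<open>Extension to the completion\<close>

lemma \<iota>'_closed: "f \<in> finsupp A\<omega> \<Longrightarrow> \<iota>' f \<in> carrier X"
  using EC.emb_closed[of f] by (simp add: E.C_simps(1) crossed_def)
lemmas \<iota>'_hom = EC.emb_hom[folded crossed_def, unfolded E.C_simps(1)]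
lemma \<iota>'_nrm: "f \<in> finsupp A\<omega> \<Longrightarrow> nrm X (\<iota>' f) = reduced_norm A\<omega> \<alpha>\<omega> f"
  using EC.nrm_emb[of f] by (simp add: E.C_simps crossed_def)
lemma \<iota>'_dense: "Z \<in> carrier X \<Longrightarrow> e > 0 \<Longrightarrow> \<exists>f\<in>finsupp A\<omega>. nrm X (Z \<ominus>\<^bsub>X\<^esub> \<iota>' f) < e"
  using EC.emb_dense[of Z e] by (simp add: E.C_simps(1) crossed_def)

lemma \<Phi>_diff: "f \<in> finsupp A\<omega> \<Longrightarrow> f' \<in> finsupp A\<omega> \<Longrightarrow> \<Phi> (f \<ominus>\<^bsub>Cc A\<omega> \<alpha>\<omega>\<^esub> f') = \<Phi> f \<ominus>\<^bsub>Y\<^esub> \<Phi> f'"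
  using star_hom_diff[OF EC.pre_cstar_axioms Y.pre_cstar_axioms \<Phi>_star_hom, of f f'] by (simp add: E.C_simps(1))
lemma \<iota>'_diff: "f \<in> finsupp A\<omega> \<Longrightarrow> f' \<in> finsupp A\<omega> \<Longrightarrow> \<iota>' (f \<ominus>\<^bsub>Cc A\<omega> \<alpha>\<omega>\<^esub> f') = \<iota>' f \<ominus>\<^bsub>X\<^esub> \<iota>' f'"
  using EC.emb_diff[of f f'] by (simp add: E.C_simps(1) crossed_def)
lemma \<Phi>_dist: assumes f: "f \<in> finsupp A\<omega>" "f' \<in> finsupp A\<omega>"
  shows "nrm Y (\<Phi> f \<ominus>\<^bsub>Y\<^esub> \<Phi> f') = nrm X (\<iota>' f \<ominus>\<^bsub>X\<^esub> \<iota>' f')"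
proof -
  have "f \<ominus>\<^bsub>Cc A\<omega> \<alpha>\<omega>\<^esub> f' \<in> finsupp A\<omega>" using E.fs_diff[OF f] by (simp add: E.C_diff[OF f])
  then show ?thesis by (simp add: \<Phi>_diff[OF f, symmetric] \<iota>'_diff[OF f, symmetric] \<Phi>_isometric \<iota>'_nrm)
qed

text \<open>The graph of the continuous extension of \<open>\<Phi>\<close> to \<open>X\<close>. As a relation it can be handled before limits
  are known to exist in \<open>Y\<close>.\<close>
definition extension :: "(nat \<Rightarrow> 'g \<Rightarrow> (nat \<Rightarrow> 'a) set) set \<Rightarrow> (nat \<Rightarrow> (nat \<Rightarrow> 'g \<Rightarrow> 'a) set) set \<Rightarrow> bool" where
  "extension Z y \<longleftrightarrow> Z \<in> carrier X \<and> y \<in> carrier Y \<and> (\<exists>f. (\<forall>m. f m \<in> finsupp A\<omega>) \<and>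
     (\<lambda>m. nrm X (\<iota>' (f m) \<ominus>\<^bsub>X\<^esub> Z)) \<longlonglongrightarrow> 0 \<and> (\<lambda>m. nrm Y (\<Phi> (f m) \<ominus>\<^bsub>Y\<^esub> y)) \<longlonglongrightarrow> 0)"

lemma extensionE: assumes "extension Z y"
  obtains f where "Z \<in> carrier X" "y \<in> carrier Y" "\<forall>m. f m \<in> finsupp A\<omega>" "\<forall>m. \<iota>' (f m) \<in> carrier X" "\<forall>m. \<Phi> (f m) \<in> carrier Y"
    "(\<lambda>m. nrm X (\<iota>' (f m) \<ominus>\<^bsub>X\<^esub> Z)) \<longlonglongrightarrow> 0" "(\<lambda>m. nrm Y (\<Phi> (f m) \<ominus>\<^bsub>Y\<^esub> y)) \<longlonglongrightarrow> 0"
  using assms \<iota>'_closed \<Phi>_closed unfolding extension_def by blast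

lemma extension_emb: assumes f: "f \<in> finsupp A\<omega>" shows "extension (\<iota>' f) (\<Phi> f)"
  unfolding extension_def
proof (intro conjI exI[of _ "\<lambda>_. f"] allI \<iota>'_closed \<Phi>_closed f)
  show "(\<lambda>m. nrm X (\<iota>' f \<ominus>\<^bsub>X\<^esub> \<iota>' f)) \<longlonglongrightarrow> 0" using \<iota>'_closed[OF f] by (simp add: a_minus_def X.M.r_neg X.nrm_zero)
  show "(\<lambda>m. nrm Y (\<Phi> f \<ominus>\<^bsub>Y\<^esub> \<Phi> f)) \<longlonglongrightarrow> 0" using \<Phi>_closed[OF f] by (simp add: a_minus_def Y.M.r_neg Y.nrm_zero)
qed

lemma extension_add_mult: assumes 1: "extension Z y" and 2: "extension Z' y'"
  shows "extension (Z \<oplus>\<^bsub>X\<^esub> Z') (y \<oplus>\<^bsub>Y\<^esub> y')" "extension (Z \<otimes>\<^bsub>X\<^esub> Z') (y \<otimes>\<^bsub>Y\<^esub> y')"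
proof -
  obtain f where f: "Z \<in> carrier X" "y \<in> carrier Y" "\<forall>m. f m \<in> finsupp A\<omega>" "\<forall>m. \<iota>' (f m) \<in> carrier X" "\<forall>m. \<Phi> (f m) \<in> carrier Y"
    "(\<lambda>m. nrm X (\<iota>' (f m) \<ominus>\<^bsub>X\<^esub> Z)) \<longlonglongrightarrow> 0" "(\<lambda>m. nrm Y (\<Phi> (f m) \<ominus>\<^bsub>Y\<^esub> y)) \<longlonglongrightarrow> 0" using 1 by (rule extensionE)
  obtain h where h: "Z' \<in> carrier X" "y' \<in> carrier Y" "\<forall>m. h m \<in> finsupp A\<omega>" "\<forall>m. \<iota>' (h m) \<in> carrier X" "\<forall>m. \<Phi> (h m) \<in> carrier Y"
    "(\<lambda>m. nrm X (\<iota>' (h m) \<ominus>\<^bsub>X\<^esub> Z')) \<longlonglongrightarrow> 0" "(\<lambda>m. nrm Y (\<Phi> (h m) \<ominus>\<^bsub>Y\<^esub> y')) \<longlonglongrightarrow> 0" using 2 by (rule extensionE)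
  note tX = X.tendsto_add_mult[of "\<lambda>m. \<iota>' (f m)" Z "\<lambda>m. \<iota>' (h m)" Z', OF f(4)[rule_format] f(1) f(6) h(4)[rule_format] h(1) h(6)]
  note tY = Y.tendsto_add_mult[of "\<lambda>m. \<Phi> (f m)" y "\<lambda>m. \<Phi> (h m)" y', OF f(5)[rule_format] f(2) f(7) h(5)[rule_format] h(2) h(7)]
  have m1: "f m \<oplus>\<^bsub>Cc A\<omega> \<alpha>\<omega>\<^esub> h m \<in> finsupp A\<omega>" for m unfolding E.C_simps by (rule E.fs_add) (use f h in auto)
  have m2: "f m \<otimes>\<^bsub>Cc A\<omega> \<alpha>\<omega>\<^esub> h m \<in> finsupp A\<omega>" for m by (rule E.fs_mul) (use f h in auto)
  show "extension (Z \<oplus>\<^bsub>X\<^esub> Z') (y \<oplus>\<^bsub>Y\<^esub> y')"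
    unfolding extension_def
    by (intro conjI exI[of _ "\<lambda>m. f m \<oplus>\<^bsub>Cc A\<omega> \<alpha>\<omega>\<^esub> h m"] allI m1)
      (use f h tX(1) tY(1) in \<open>simp_all add: \<iota>'_hom \<Phi>_hom\<close>)
  show "extension (Z \<otimes>\<^bsub>X\<^esub> Z') (y \<otimes>\<^bsub>Y\<^esub> y')"
    unfolding extension_def
    by (intro conjI exI[of _ "\<lambda>m. f m \<otimes>\<^bsub>Cc A\<omega> \<alpha>\<omega>\<^esub> h m"] allI m2)
      (use f h tX(2) tY(2) in \<open>simp_all add: \<iota>'_hom \<Phi>_hom X.mult_closed Y.mult_closed\<close>)
qed

lemma extension_smult_star: assumes 1: "extension Z y"
  shows "extension (c \<odot>\<^bsub>X\<^esub> Z) (c \<odot>\<^bsub>Y\<^esub> y)" "extension (star X Z) (star Y y)"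
proof -
  obtain f where f: "Z \<in> carrier X" "y \<in> carrier Y" "\<forall>m. f m \<in> finsupp A\<omega>" "\<forall>m. \<iota>' (f m) \<in> carrier X" "\<forall>m. \<Phi> (f m) \<in> carrier Y"
    "(\<lambda>m. nrm X (\<iota>' (f m) \<ominus>\<^bsub>X\<^esub> Z)) \<longlonglongrightarrow> 0" "(\<lambda>m. nrm Y (\<Phi> (f m) \<ominus>\<^bsub>Y\<^esub> y)) \<longlonglongrightarrow> 0" using 1 by (rule extensionE)
  note tX = X.tendsto_smult[of "\<lambda>m. \<iota>' (f m)", OF f(4)[rule_format] f(1) f(6)] X.tendsto_star[of "\<lambda>m. \<iota>' (f m)", OF f(4)[rule_format] f(1) f(6)]
  note tY = Y.tendsto_smult[of "\<lambda>m. \<Phi> (f m)", OF f(5)[rule_format] f(2) f(7)] Y.tendsto_star[of "\<lambda>m. \<Phi> (f m)", OF f(5)[rule_format] f(2) f(7)]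
  have m1: "c \<odot>\<^bsub>Cc A\<omega> \<alpha>\<omega>\<^esub> f m \<in> finsupp A\<omega>" for m unfolding E.C_simps by (rule E.fs_smult) (use f in auto)
  have m2: "star (Cc A\<omega> \<alpha>\<omega>) (f m) \<in> finsupp A\<omega>" for m by (rule E.fs_star) (use f in auto)
  show "extension (c \<odot>\<^bsub>X\<^esub> Z) (c \<odot>\<^bsub>Y\<^esub> y)"
    unfolding extension_def
    by (intro conjI exI[of _ "\<lambda>m. c \<odot>\<^bsub>Cc A\<omega> \<alpha>\<omega>\<^esub> f m"] allI m1)
      (use f tX(1) tY(1) in \<open>simp_all add: \<iota>'_hom \<Phi>_hom X.sm_closed Y.sm_closed\<close>)
  show "extension (star X Z) (star Y y)"
    unfolding extension_def
    by (intro conjI exI[of _ "\<lambda>m. star (Cc A\<omega> \<alpha>\<omega>) (f m)"] allI m2)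
      (use f tX(2) tY(2) in \<open>simp_all add: \<iota>'_hom \<Phi>_hom X.star_closed Y.star_closed\<close>)
qed

lemma extension_nrm: assumes "extension Z y" shows "nrm Y y = nrm X Z"
proof -
  obtain f where f: "Z \<in> carrier X" "y \<in> carrier Y" "\<forall>m. f m \<in> finsupp A\<omega>" "\<forall>m. \<iota>' (f m) \<in> carrier X" "\<forall>m. \<Phi> (f m) \<in> carrier Y"
    "(\<lambda>m. nrm X (\<iota>' (f m) \<ominus>\<^bsub>X\<^esub> Z)) \<longlonglongrightarrow> 0" "(\<lambda>m. nrm Y (\<Phi> (f m) \<ominus>\<^bsub>Y\<^esub> y)) \<longlonglongrightarrow> 0" using assms by (rule extensionE)
  have "(\<lambda>m. nrm Y (\<Phi> (f m))) \<longlonglongrightarrow> nrm Y y" by (rule Y.nrm_tendsto[OF f(5)[rule_format] f(2) f(7)])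
  moreover have "(\<lambda>m. nrm X (\<iota>' (f m))) \<longlonglongrightarrow> nrm X Z" by (rule X.nrm_tendsto[OF f(4)[rule_format] f(1) f(6)])
  moreover have "nrm Y (\<Phi> (f m)) = nrm X (\<iota>' (f m))" for m using f(3) by (simp add: \<Phi>_isometric \<iota>'_nrm)
  ultimately show ?thesis by (simp add: LIMSEQ_unique)
qed

lemma extension_diff: assumes 1: "extension Z y" and 2: "extension Z' y'" shows "extension (Z \<ominus>\<^bsub>X\<^esub> Z') (y \<ominus>\<^bsub>Y\<^esub> y')"
proof -
  have "Z' \<in> carrier X" "y' \<in> carrier Y" using 2 by (auto simp: extension_def)
  then show ?thesis using extension_add_mult(1)[OF 1 extension_smult_star(1)[OF 2, of "-1"]]
    by (simp add: a_minus_def X.sm_minus1 Y.sm_minus1)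
qed

lemma extension_dist: assumes 1: "extension Z y" and 2: "extension Z' y'" shows "nrm Y (y \<ominus>\<^bsub>Y\<^esub> y') = nrm X (Z \<ominus>\<^bsub>X\<^esub> Z')"
  by (rule extension_nrm[OF extension_diff[OF 1 2]])

lemma extension_unique: assumes 1: "extension Z y" and 2: "extension Z y'" shows "y = y'"
proof (rule Y.eq_if_nrm_le_0)
  show "y \<in> carrier Y" "y' \<in> carrier Y" using 1 2 by (auto simp: extension_def)
  have "Z \<in> carrier X" using 1 by (auto simp: extension_def)
  then show "nrm Y (y \<ominus>\<^bsub>Y\<^esub> y') \<le> 0" unfolding extension_dist[OF 1 2] by (simp add: a_minus_def X.M.r_neg X.nrm_zero)
qed

lemma half_power_tendsto: "(\<lambda>m. (1/2 :: real) ^ m) \<longlonglongrightarrow> 0" by (rule LIMSEQ_power_zero) simp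

text \<open>The lifts \<open>w j\<close> of a fast sequence \<open>f j\<close> with limit \<open>Z\<close> are combined to a diagonal sequence \<open>v\<close>. For
  fixed \<open>K\<close>, each \<open>v n\<close> either is one of \<open>w 0 n, \<dots>, w K n\<close> or lies within \<open>(1/2) ^ K\<close> of \<open>w K n\<close>, so the
  dual action is as continuous on \<open>v\<close> as on the finitely many sequences \<open>w 0, \<dots>, w K\<close>, up to a small
  error.\<close>
lemma extension_exists_continuous: assumes Z: "Z \<in> carrier X" shows "\<exists>v\<in>continuous_seqs A \<alpha>. extension Z (V.cl v)"
proof -
  have "\<exists>f\<in>finsupp A\<omega>. nrm X (Z \<ominus>\<^bsub>X\<^esub> \<iota>' f) < (1/2) ^ (j + 2)" for j by (rule \<iota>'_dense[OF Z]) simp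
  then obtain f where f: "\<And>j. f j \<in> finsupp A\<omega>" "\<And>j. nrm X (Z \<ominus>\<^bsub>X\<^esub> \<iota>' (f j)) < (1/2) ^ (j + 2)" by metis
  have "\<exists>g. lifts g (f j)" for j using lift_exists[OF f(1)] by blast
  then obtain g where g: "\<And>j. lifts (g j) (f j)" by metis
  define w where "w j = (\<lambda>n. \<iota> (g j n))" for j
  have w: "w j \<in> carrier (linf X0)" for j unfolding w_def by (rule lifts_seq[OF g])
  have wcl: "V.cl (w j) = \<Phi> (f j)" for j by (simp add: w_def \<Phi>_eq[OF g])
  note ic = \<iota>'_closed[OF f(1)]
  have dZ: "nrm X (\<iota>' (f j) \<ominus>\<^bsub>X\<^esub> Z) < (1/2) ^ (j + 2)" for j using f(2) X.nrm_diff_commute[OF Z ic] by simp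
  have cauchy: "nrm Y (V.cl (w i) \<ominus>\<^bsub>Y\<^esub> V.cl (w j)) < (1/2) ^ i" if ij: "i \<le> j" for i j
  proof -
    have "nrm Y (V.cl (w i) \<ominus>\<^bsub>Y\<^esub> V.cl (w j)) \<le> nrm X (\<iota>' (f i) \<ominus>\<^bsub>X\<^esub> Z) + nrm X (Z \<ominus>\<^bsub>X\<^esub> \<iota>' (f j))"
      unfolding wcl \<Phi>_dist[OF f(1) f(1)] by (intro X.nrm_diff_triangle ic Z)
    also have "\<dots> < (1/2) ^ (i + 2) + (1/2) ^ (j + 2)" by (intro add_strict_mono dZ f)
    also have "\<dots> \<le> (1/2) ^ (i + 2) + (1/2) ^ (i + 2)" using ij by (intro add_left_mono power_decreasing) auto
    also have "\<dots> \<le> (1/2) ^ i" by simp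
    finally show ?thesis .
  qed
  have free: "eventually (\<lambda>n. n \<noteq> k) \<omega>" for k using om by (simp add: free_ultrafilter_def)
  have "\<exists>v\<in>carrier (linf X0). (\<forall>i. nrm Y (V.cl (w i) \<ominus>\<^bsub>Y\<^esub> V.cl v) \<le> (1/2) ^ i) \<and>
    (\<forall>n. \<exists>k. v n = w k n \<and> (\<forall>i\<le>k. nrm X0 (w i n \<ominus>\<^bsub>X0\<^esub> v n) \<le> (1/2) ^ i))"
    by (rule V.diagonal_sequence[unfolded VQ, OF free w _ refl]) (rule cauchy)
  then obtain v where v: "v \<in> carrier (linf X0)"
    and near': "\<forall>i. nrm Y (V.cl (w i) \<ominus>\<^bsub>Y\<^esub> V.cl v) \<le> (1/2) ^ i"
    and diag: "\<forall>n. \<exists>k. v n = w k n \<and> (\<forall>i\<le>k. nrm X0 (w i n \<ominus>\<^bsub>X0\<^esub> v n) \<le> (1/2) ^ i)"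
    by (elim bexE conjE)
  note near = near'[rule_format]
  have vc: "V.cl v \<in> carrier Y" using V.cl_closed[OF v] by (simp add: VQ)
  have "extension Z (V.cl v)"
    unfolding extension_def
  proof (intro conjI exI[of _ f] allI Z vc f(1))
    have "nrm X (\<iota>' (f m) \<ominus>\<^bsub>X\<^esub> Z) \<le> (1/2) ^ m" for m
    proof -
      have "(1/2 :: real) ^ (m + 2) \<le> (1/2) ^ m" by (intro power_decreasing) auto
      then show ?thesis using dZ[of m] by linarith
    qed
    then show "(\<lambda>m. nrm X (\<iota>' (f m) \<ominus>\<^bsub>X\<^esub> Z)) \<longlonglongrightarrow> 0"
      by (intro tendsto_sandwich[of "\<lambda>_. 0", OF _ _ tendsto_const half_power_tendsto])
        (auto intro!: always_eventually X.nrm_ge0 X.M.minus_closed ic Z)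
    show "(\<lambda>m. nrm Y (\<Phi> (f m) \<ominus>\<^bsub>Y\<^esub> V.cl v)) \<longlonglongrightarrow> 0"
      using near unfolding wcl by (intro tendsto_sandwich[of "\<lambda>_. 0", OF _ _ tendsto_const half_power_tendsto])
        (auto intro!: always_eventually Y.nrm_ge0 Y.M.minus_closed \<Phi>_closed f vc)
  qed
  moreover have "v \<in> continuous_seqs A \<alpha>"
    unfolding continuous_seqs_iff
  proof (intro conjI v ballI allI impI)
    fix \<gamma>\<^sub>0 :: "'g \<Rightarrow> complex" and e :: real assume g0: "\<gamma>\<^sub>0 \<in> dual_group" and e: "e > 0"
    have "eventually (\<lambda>i. (1/2 :: real) ^ i < e / 4) sequentially" using half_power_tendsto e by (intro order_tendstoD(2)) auto
    then obtain K where K: "(1/2 :: real) ^ K < e / 4" by (auto simp: eventually_sequentially)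
    have "eventually (\<lambda>\<gamma>. \<forall>n. osc \<gamma> \<gamma>\<^sub>0 (w j n) \<le> e / 2) (at \<gamma>\<^sub>0 within dual_group)" for j
      using lifts_continuous[OF g[of j]] g0 e unfolding continuous_seqs_iff w_def by (meson half_gt_zero)
    then have "eventually (\<lambda>\<gamma>. \<forall>j\<in>{..K}. \<forall>n. osc \<gamma> \<gamma>\<^sub>0 (w j n) \<le> e / 2) (at \<gamma>\<^sub>0 within dual_group)"
      by (intro eventually_ball_finite) auto
    moreover have "eventually (\<lambda>\<gamma>. \<gamma> \<in> dual_group) (at \<gamma>\<^sub>0 within dual_group)" by (simp add: eventually_at_filter)
    ultimately show "eventually (\<lambda>\<gamma>. \<forall>n. osc \<gamma> \<gamma>\<^sub>0 (v n) \<le> e) (at \<gamma>\<^sub>0 within dual_group)"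
    proof eventually_elim
      case (elim \<gamma>)
      show ?case
      proof
        fix n
        obtain k where k: "v n = w k n" "\<forall>i\<le>k. nrm X0 (w i n \<ominus>\<^bsub>X0\<^esub> v n) \<le> (1/2) ^ i" using diag by blast
        show "osc \<gamma> \<gamma>\<^sub>0 (v n) \<le> e"
        proof (cases "k \<le> K")
          case True
          then have "osc \<gamma> \<gamma>\<^sub>0 (v n) \<le> e / 2" using elim k by auto
          then show ?thesis using e by simp
        next
          case False
          have wc: "w K n \<in> carrier X0" "v n \<in> carrier X0" using V.S_closed[OF w] V.S_closed[OF v] by auto
          have "osc \<gamma> \<gamma>\<^sub>0 (v n) \<le> osc \<gamma> \<gamma>\<^sub>0 (w K n) + 2 * nrm X0 (v n \<ominus>\<^bsub>X0\<^esub> w K n)"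
            by (rule osc_perturb[OF elim(2) g0 wc(2,1)])
          also have "nrm X0 (v n \<ominus>\<^bsub>X0\<^esub> w K n) = nrm X0 (w K n \<ominus>\<^bsub>X0\<^esub> v n)" by (rule X0.nrm_diff_commute[OF wc(2,1)])
          also have "\<dots> \<le> (1/2) ^ K" using k(2) False by auto
          also have "osc \<gamma> \<gamma>\<^sub>0 (w K n) \<le> e / 2" using elim by auto
          finally show ?thesis using K by simp
        qed
      qed
    qed
  qed
  ultimately show ?thesis by blast
qed

section \<open>Approximation of continuous sequences\<close>

text \<open>Approximate \<open>x n\<close> by finitely supported \<open>y n\<close>, uniformly in \<open>n\<close>. Near the trivial character the dual
  action still moves all \<open>y n\<close> little, and \<open>fejer_approximation\<close> replaces them by \<open>z n\<close> with supports in
  one finite set. Such a sequence is a lift.\<close>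
lemma continuous_approx:
  assumes x: "x \<in> continuous_seqs A \<alpha>" and e: "e > 0"
  shows "\<exists>f\<in>finsupp A\<omega>. nrm Y (V.cl x \<ominus>\<^bsub>Y\<^esub> \<Phi> f) \<le> 5 * e"
proof -
  have xl: "x \<in> carrier (linf X0)"
    and xosc: "\<And>\<gamma>\<^sub>0 e. \<gamma>\<^sub>0 \<in> dual_group \<Longrightarrow> e > 0 \<Longrightarrow> eventually (\<lambda>\<gamma>. \<forall>n. osc \<gamma> \<gamma>\<^sub>0 (x n) \<le> e) (at \<gamma>\<^sub>0 within dual_group)"
    using x unfolding continuous_seqs_iff by auto
  have xc: "x n \<in> carrier X0" for n using V.S_closed[OF xl] .
  define \<epsilon> :: "'g \<Rightarrow> complex" where "\<epsilon> = (\<lambda>_. 1)"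
  have eps: "\<epsilon> \<in> dual_group" by (simp add: \<epsilon>_def dual_group_def)
  obtain O1 where O1: "open O1" "\<epsilon> \<in> O1"
    "\<And>\<gamma>. \<gamma> \<in> O1 \<Longrightarrow> \<gamma> \<noteq> \<epsilon> \<Longrightarrow> \<gamma> \<in> dual_group \<Longrightarrow> \<forall>n. osc \<gamma> \<epsilon> (x n) \<le> e"
    using xosc[OF eps e] unfolding eventually_at_topological by blast
  obtain S \<eta> where S: "finite S" "\<eta> > 0" "\<And>\<gamma>. (\<forall>s\<in>S. cmod (\<gamma> s - \<epsilon> s) < \<eta>) \<Longrightarrow> \<gamma> \<in> O1"
    using dual_open_nbhd[OF O1(1,2)] by blast
  have small: "osc \<gamma> \<epsilon> (x n) \<le> e" if "\<gamma> \<in> dual_group" "\<forall>s\<in>S. cmod (\<gamma> s - 1) < \<eta>" for \<gamma> n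
  proof (cases "\<gamma> = \<epsilon>")
    case True
    then show ?thesis using e da_closed[OF eps xc[of n]] by (simp add: osc_def a_minus_def X0.M.r_neg X0.nrm_zero)
  next
    case False
    have "\<gamma> \<in> O1" using that by (intro S(3)) (simp add: \<epsilon>_def)
    then show ?thesis using O1(3) False that by blast
  qed
  obtain L where L: "L > 0" "\<And>n. nrm X0 (x n) \<le> L" using V.S_bounded[OF xl] by blast
  define M where "M = L + e"
  have M: "M > 0" using L e by (simp add: M_def)
  have "\<exists>y\<in>finsupp A. nrm X0 (x n \<ominus>\<^bsub>X0\<^esub> \<iota> y) < e" for n
    using DC.emb_dense[of "x n" e] xc e by (simp add: D.C_simps(1) crossed_def)
  then obtain y where y: "\<And>n. y n \<in> finsupp A" "\<And>n. nrm X0 (x n \<ominus>\<^bsub>X0\<^esub> \<iota> (y n)) < e" by metis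
  note yc = emb_X0[OF y(1)]
  have yM: "reduced_norm A \<alpha> (y n) \<le> M" for n
    using X0.nrm_diff_ge[OF xc[of n] yc[of n]] y(2)[of n] L(2)[of n] by (simp add: nrm_emb_X0[OF y(1)] M_def)
  have yosc: "reduced_norm A \<alpha> (\<lambda>s. D.dual \<gamma> (y n) s \<ominus>\<^bsub>A\<^esub> y n s) \<le> 3 * e"
    if g: "\<gamma> \<in> dual_group" "\<forall>s\<in>S. cmod (\<gamma> s - 1) < \<eta>" for \<gamma> n
  proof -
    have "D.dual \<epsilon> (y n) = y n" using A.fs_closed[OF y(1)] by (simp add: D.dual_def \<epsilon>_def A.sm_one)
    then have "reduced_norm A \<alpha> (\<lambda>s. D.dual \<gamma> (y n) s \<ominus>\<^bsub>A\<^esub> y n s) = osc \<gamma> \<epsilon> (\<iota> (y n))"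
      by (simp add: osc_emb[OF g(1) eps y(1)])
    also have "\<dots> \<le> osc \<gamma> \<epsilon> (x n) + 2 * nrm X0 (\<iota> (y n) \<ominus>\<^bsub>X0\<^esub> x n)"
      by (rule osc_perturb[OF g(1) eps yc xc])
    also have "\<dots> \<le> e + 2 * e"
      using small[OF g] y(2)[of n] X0.nrm_diff_commute[OF yc xc, of n n] by (intro add_mono) auto
    finally show ?thesis by simp
  qed
  \<comment> \<open>The mass far from 1 then contributes \<open>2 M d = e\<close>.\<close>
  define d where "d = e / (2 * M)"
  have d: "d > 0" using e M by (simp add: d_def)
  obtain K where K: "finite K" and appr0: "\<forall>y M d'. y \<in> finsupp A \<longrightarrow> reduced_norm A \<alpha> y \<le> M \<longrightarrow> 0 \<le> d' \<longrightarrow>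
    (\<forall>\<gamma>\<in>dual_group. (\<forall>s\<in>S. cmod (\<gamma> s - 1) < \<eta>) \<longrightarrow> reduced_norm A \<alpha> (\<lambda>s. D.dual \<gamma> y s \<ominus>\<^bsub>A\<^esub> y s) \<le> d') \<longrightarrow>
    (\<exists>z\<in>finsupp A. supp A z \<subseteq> K \<and> reduced_norm A \<alpha> (\<lambda>s. z s \<ominus>\<^bsub>A\<^esub> y s) \<le> d' + 2 * M * d)"
    using D.fejer_approximation[OF S(1,2) d] by (elim exE conjE)
  have "0 \<le> 3 * e" using e by simp
  note appr = appr0[rule_format, OF _ _ this]
  have "\<exists>z\<in>finsupp A. supp A z \<subseteq> K \<and> reduced_norm A \<alpha> (\<lambda>s. z s \<ominus>\<^bsub>A\<^esub> y n s) \<le> 3 * e + 2 * M * d" for n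
    by (rule appr[OF y(1) yM]) (rule yosc, assumption, blast)
  moreover have "3 * e + 2 * M * d = 4 * e" using M by (simp add: d_def)
  ultimately obtain z where z: "\<And>n. z n \<in> finsupp A" "\<And>n. supp A (z n) \<subseteq> K"
    "\<And>n. reduced_norm A \<alpha> (\<lambda>s. z n s \<ominus>\<^bsub>A\<^esub> y n s) \<le> 4 * e" by metis
  have zx: "nrm X0 (x n \<ominus>\<^bsub>X0\<^esub> \<iota> (z n)) \<le> 5 * e" for n
  proof -
    have "\<iota> (z n) \<ominus>\<^bsub>X0\<^esub> \<iota> (y n) = \<iota> (\<lambda>s. z n s \<ominus>\<^bsub>A\<^esub> y n s)"
      using DC.emb_diff[of "z n" "y n"] z(1)[of n] y(1)[of n] by (simp add: D.C_simps(1) D.C_diff crossed_def)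
    then have "nrm X0 (\<iota> (z n) \<ominus>\<^bsub>X0\<^esub> \<iota> (y n)) \<le> 4 * e"
      using z(3)[of n] by (simp add: nrm_emb_X0[OF D.fs_diff[OF z(1) y(1)]])
    then have "nrm X0 (\<iota> (y n) \<ominus>\<^bsub>X0\<^esub> \<iota> (z n)) \<le> 4 * e"
      using X0.nrm_diff_commute[OF yc emb_X0[OF z(1)], of n n] by simp
    then show ?thesis
      using X0.nrm_diff_triangle[OF xc yc emb_X0[OF z(1)], of n n n] y(2)[of n] by simp
  qed
  have zb: "reduced_norm A \<alpha> (z n) \<le> L + 5 * e" for n
    using X0.nrm_diff_ge[OF xc emb_X0[OF z(1)], of n n] zx[of n] L(2)[of n] by (simp add: nrm_emb_X0[OF z(1)])
  have zl: "(\<lambda>n. z n s) \<in> carrier (linf A)" for s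
    by (rule U.linfI[of _ "L + 5 * e"])
      (use A.fs_closed[OF z(1)] D.coeff_le_reduced_norm[OF z(1)] zb order_trans in blast)+
  define f where "f s = U.cl (\<lambda>n. z n s)" for s
  have "z n s = \<zero>\<^bsub>A\<^esub>" if "s \<notin> K" for n s by (rule A.not_supp[of s "z n"]) (use z(2) that in blast)
  then have lf: "lifts z f"
    unfolding lifts_def f_def using K zl by (intro conjI exI[of _ K]) auto
  have "nrm Y (V.cl x \<ominus>\<^bsub>Y\<^esub> \<Phi> f) \<le> 5 * e"
    unfolding \<Phi>_eq[OF lf] V.cl_diff[OF xl lifts_seq[OF lf], unfolded VQ]
    by (rule V.nrm_cl_le[OF V.S_diff[OF xl lifts_seq[OF lf]], unfolded VQ]) (simp add: zx)
  then show ?thesis using lifts_fs'[OF lf] by blast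
qed

text \<open>An isometry has closed range on a complete space: approximations of \<open>V.cl x\<close> in the range form a
  Cauchy sequence, hence so do their preimages.\<close>
lemma continuous_in_range: assumes x: "x \<in> continuous_seqs A \<alpha>" shows "\<exists>Z. extension Z (V.cl x)"
proof -
  have xl: "x \<in> carrier (linf X0)" using x unfolding continuous_seqs_iff by blast
  have xY: "V.cl x \<in> carrier Y" using V.cl_closed[OF xl] by (simp add: VQ)
  have "\<exists>f\<in>finsupp A\<omega>. nrm Y (V.cl x \<ominus>\<^bsub>Y\<^esub> \<Phi> f) \<le> 5 * (1/2) ^ m" for m
    by (rule continuous_approx[OF x]) simp
  then obtain f where f: "\<And>m. f m \<in> finsupp A\<omega>" "\<And>m. nrm Y (V.cl x \<ominus>\<^bsub>Y\<^esub> \<Phi> (f m)) \<le> 5 * (1/2) ^ m" by metis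
  note fY = \<Phi>_closed[OF f(1)]
  have lim: "(\<lambda>m. nrm Y (\<Phi> (f m) \<ominus>\<^bsub>Y\<^esub> V.cl x)) \<longlonglongrightarrow> 0"
  proof (rule tendsto_sandwich[of "\<lambda>_. 0", OF _ _ tendsto_const])
    show "(\<lambda>m. 5 * (1/2 :: real) ^ m) \<longlonglongrightarrow> 0" using tendsto_mult_right_zero[OF half_power_tendsto, of 5] .
    show "\<forall>\<^sub>F m in sequentially. nrm Y (\<Phi> (f m) \<ominus>\<^bsub>Y\<^esub> V.cl x) \<le> 5 * (1/2) ^ m"
      using f(2) Y.nrm_diff_commute[OF fY xY] by (intro always_eventually) simp
    show "\<forall>\<^sub>F m in sequentially. 0 \<le> nrm Y (\<Phi> (f m) \<ominus>\<^bsub>Y\<^esub> V.cl x)"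
      by (intro always_eventually allI Y.nrm_ge0 Y.M.minus_closed fY xY)
  qed
  have "cauchy_in Y (\<lambda>m. \<Phi> (f m))" by (rule Y.convergent_cauchy[OF fY xY lim])
  then have "cauchy_in X (\<lambda>m. \<iota>' (f m))" using \<iota>'_closed[OF f(1)] by (simp add: cauchy_in_def \<Phi>_dist[OF f(1) f(1)])
  then obtain Z where "Z \<in> carrier X" "(\<lambda>m. nrm X (\<iota>' (f m) \<ominus>\<^bsub>X\<^esub> Z)) \<longlonglongrightarrow> 0"
    using EC.completion_complete[folded crossed_def] by blast
  then have "extension Z (V.cl x)" unfolding extension_def using f(1) lim xY by blast
  then show ?thesis by blast
qed

section \<open>The canonical homomorphism\<close>

lemma lifts_delta: assumes a: "a \<in> carrier (linf A)"
  shows "lifts (\<lambda>n t. if t = s then a n else \<zero>\<^bsub>A\<^esub>) (\<lambda>t. if t = s then U.cl a else \<zero>\<^bsub>A\<omega>\<^esub>)"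
  unfolding lifts_def
proof (intro conjI exI[of _ "{s}"] allI impI)
  fix t
  show "(\<lambda>n. if t = s then a n else \<zero>\<^bsub>A\<^esub>) \<in> carrier (linf A)" using a U.zero_S by (cases "t = s") auto
  show "(if t = s then U.cl a else \<zero>\<^bsub>A\<omega>\<^esub>) = U.cl (\<lambda>n. if t = s then a n else \<zero>\<^bsub>A\<^esub>)"
    using U.cl_zero[unfolded UQ] by (cases "t = s") auto
qed auto

lemma crossed_elem_extension: assumes a: "a \<in> carrier (linf A)"
  shows "extension (crossed_elem A\<omega> \<alpha>\<omega> (ultra_class \<omega> A a) s) (ultra_class \<omega> X0 (\<lambda>n. crossed_elem A \<alpha> (a n) s))"
  unfolding crossed_elem_def Ucl Vcl
  using extension_emb[OF lifts_fs'[OF lifts_delta[OF a, of s]]] by (simp add: \<Phi>_eq[OF lifts_delta[OF a]])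

text \<open>By induction on the support, since \<open>\<iota>' f\<close> is a finite sum of elements \<open>(f s) \<lambda>\<^sub>s\<close>.\<close>
lemma agree_on_sums:
  assumes p: "\<psi> \<in> star_hom X Y"
    and elem: "\<And>a s. a \<in> carrier (linf A) \<Longrightarrow>
      extension (crossed_elem A\<omega> \<alpha>\<omega> (ultra_class \<omega> A a) s) (\<psi> (crossed_elem A\<omega> \<alpha>\<omega> (ultra_class \<omega> A a) s))"
    and f: "f \<in> finsupp A\<omega>"
  shows "extension (\<iota>' f) (\<psi> (\<iota>' f))"
proof -
  note psi = star_homD[OF p]
  have "\<forall>f\<in>finsupp A\<omega>. supp A\<omega> f \<subseteq> T \<longrightarrow> extension (\<iota>' f) (\<psi> (\<iota>' f))" if "finite T" for T
    using that
  proof (induction T rule: finite_induct)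
    case empty
    show ?case
    proof (intro ballI impI)
      fix f :: "'g \<Rightarrow> (nat \<Rightarrow> 'a) set" assume f: "f \<in> finsupp A\<omega>" "supp A\<omega> f \<subseteq> {}"
      have "nrm X (\<iota>' f) = 0"
        using \<iota>'_nrm[OF f(1)] E.reduced_norm_le_sum[OF f(1)] E.reduced_norm_ge0[OF f(1)] f(2) by simp
      then have "\<iota>' f = \<zero>\<^bsub>X\<^esub>" using X.nrm_eq_0[OF \<iota>'_closed[OF f(1)]] by simp
      moreover have "\<psi> \<zero>\<^bsub>X\<^esub> = 0 \<odot>\<^bsub>Y\<^esub> \<psi> \<zero>\<^bsub>X\<^esub>" using psi(4)[OF X.M.zero_closed, of 0] by (simp add: X.sm_zero)
      moreover have "extension (0 \<odot>\<^bsub>X\<^esub> \<iota>' f) (0 \<odot>\<^bsub>Y\<^esub> \<Phi> f)" by (rule extension_smult_star(1)[OF extension_emb[OF f(1)]])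
      ultimately show "extension (\<iota>' f) (\<psi> (\<iota>' f))"
        using \<Phi>_closed[OF f(1)] psi(1)[OF X.M.zero_closed] by (simp add: X.sm_zero Y.sm_0)
    qed
  next
    case (insert s T)
    show ?case
    proof (intro ballI impI)
      fix f :: "'g \<Rightarrow> (nat \<Rightarrow> 'a) set" assume f: "f \<in> finsupp A\<omega>" "supp A\<omega> f \<subseteq> insert s T"
      define f1 where "f1 t = (if t = s then \<zero>\<^bsub>A\<omega>\<^esub> else f t)" for t
      define f2 where "f2 t = (if t = s then f s else \<zero>\<^bsub>A\<omega>\<^esub>)" for t
      have f1: "f1 \<in> finsupp A\<omega>" "supp A\<omega> f1 \<subseteq> T"
      proof -
        show "f1 \<in> finsupp A\<omega>"
          by (rule E.fsI[of _ "supp A\<omega> f"]) (auto simp: f1_def E.fs_closed[OF f(1)] E.fs_finite[OF f(1)] E.not_supp)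
        show "supp A\<omega> f1 \<subseteq> T" using f(2) by (auto simp: f1_def supp_def split: if_splits)
      qed
      have f2: "f2 \<in> finsupp A\<omega>" unfolding f2_def[abs_def] by (rule E.fs_delta[OF E.fs_closed[OF f(1)]])
      have "f = f1 \<oplus>\<^bsub>Cc A\<omega> \<alpha>\<omega>\<^esub> f2"
      proof
        fix t
        show "f t = (f1 \<oplus>\<^bsub>Cc A\<omega> \<alpha>\<omega>\<^esub> f2) t"
          using E.fs_closed[OF f(1)] by (cases "t = s") (auto simp: E.C_simps f1_def f2_def)
      qed
      then have if': "\<iota>' f = \<iota>' f1 \<oplus>\<^bsub>X\<^esub> \<iota>' f2" by (simp add: \<iota>'_hom(2) f1 f2)
      obtain a where a: "a \<in> carrier (linf A)" "f s = U.cl a" using E.fs_closed[OF f(1), of s] by (rule cases_A\<omega>)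
      have "\<iota>' f2 = crossed_elem A\<omega> \<alpha>\<omega> (ultra_class \<omega> A a) s"
        unfolding crossed_elem_def Ucl f2_def[abs_def] a(2) ..
      then have e2: "extension (\<iota>' f2) (\<psi> (\<iota>' f2))" using elem[OF a(1)] by simp
      have e1: "extension (\<iota>' f1) (\<psi> (\<iota>' f1))" using insert.IH f1 by blast
      show "extension (\<iota>' f) (\<psi> (\<iota>' f))"
        unfolding if' psi(2)[OF \<iota>'_closed[OF f1(1)] \<iota>'_closed[OF f2]] by (rule extension_add_mult(1)[OF e1 e2])
    qed
  qed
  from this[OF E.fs_finite[OF f]] f show ?thesis by blast
qed

text \<open>Automatic contractivity carries agreement from the finitely supported functions to their closure.\<close>
lemma canonical_hom_extension:
  assumes "canonical_hom \<omega> A \<alpha> \<psi>" and Z: "Z \<in> carrier X"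
  shows "extension Z (\<psi> Z)"
proof -
  have p: "\<psi> \<in> star_hom X Y"
    and el: "\<And>a s. a \<in> carrier (linf A) \<Longrightarrow> \<psi> (crossed_elem A\<omega> \<alpha>\<omega> (ultra_class \<omega> A a) s) = ultra_class \<omega> X0 (\<lambda>n. crossed_elem A \<alpha> (a n) s)"
    using assms(1) by (auto simp: canonical_hom_def)
  note psi = star_homD[OF p]
  have contr: "nrm Y (\<psi> W) \<le> nrm X W" if "W \<in> carrier X" for W
    by (rule star_hom_contractive[OF X.pre_cstar_axioms Y.pre_cstar_axioms _ p that])
      (rule EC.completion_complete[folded crossed_def])
  have "\<exists>f\<in>finsupp A\<omega>. nrm X (Z \<ominus>\<^bsub>X\<^esub> \<iota>' f) < (1/2) ^ j" for j by (rule \<iota>'_dense[OF Z]) simp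
  then obtain f where f: "\<And>j. f j \<in> finsupp A\<omega>" "\<And>j. nrm X (Z \<ominus>\<^bsub>X\<^esub> \<iota>' (f j)) < (1/2) ^ j" by metis
  note ic = \<iota>'_closed[OF f(1)]
  have lX: "nrm X (\<iota>' (f m) \<ominus>\<^bsub>X\<^esub> Z) \<le> (1/2) ^ m" for m
    using f(2)[of m] X.nrm_diff_commute[OF Z ic, of m] by simp
  have eq: "\<psi> (\<iota>' (f m)) = \<Phi> (f m)" for m
    by (rule extension_unique[OF agree_on_sums[OF p _ f(1)] extension_emb[OF f(1)]]) (simp add: el crossed_elem_extension)
  have lY: "nrm Y (\<Phi> (f m) \<ominus>\<^bsub>Y\<^esub> \<psi> Z) \<le> (1/2) ^ m" for m
  proof -
    have "\<Phi> (f m) \<ominus>\<^bsub>Y\<^esub> \<psi> Z = \<psi> (\<iota>' (f m) \<ominus>\<^bsub>X\<^esub> Z)"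
      unfolding eq[symmetric] by (rule star_hom_diff[OF X.pre_cstar_axioms Y.pre_cstar_axioms p ic Z, symmetric])
    then show ?thesis using contr[of "\<iota>' (f m) \<ominus>\<^bsub>X\<^esub> Z"] lX[of m] ic Z by simp
  qed
  show ?thesis
    unfolding extension_def
  proof (intro conjI exI[of _ f] allI Z psi(1) f(1))
    show "(\<lambda>m. nrm X (\<iota>' (f m) \<ominus>\<^bsub>X\<^esub> Z)) \<longlonglongrightarrow> 0"
      by (intro tendsto_sandwich[of "\<lambda>_. 0", OF _ _ tendsto_const half_power_tendsto])
        (auto intro!: always_eventually X.nrm_ge0 X.M.minus_closed ic Z lX)
    show "(\<lambda>m. nrm Y (\<Phi> (f m) \<ominus>\<^bsub>Y\<^esub> \<psi> Z)) \<longlonglongrightarrow> 0"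
      by (intro tendsto_sandwich[of "\<lambda>_. 0", OF _ _ tendsto_const half_power_tendsto])
        (auto intro!: always_eventually Y.nrm_ge0 Y.M.minus_closed \<Phi>_closed f(1) psi(1) Z lY)
  qed
qed

theorem canonical_isomorphism:
  "\<exists>\<phi>. canonical_hom \<omega> A \<alpha> \<phi> \<and>
    (\<forall>\<psi>. canonical_hom \<omega> A \<alpha> \<psi> \<longrightarrow> (\<forall>x\<in>carrier X. \<psi> x = \<phi> x)) \<and>
    inj_on \<phi> (carrier X) \<and> \<phi> ` carrier X = continuous_part \<omega> A \<alpha>"
proof -
  define \<phi> where "\<phi> Z = (SOME y. extension Z y)" for Z
  have \<phi>: "extension Z (\<phi> Z)" if "Z \<in> carrier X" for Z
    unfolding \<phi>_def by (rule someI_ex) (use extension_exists_continuous[OF that] in blast)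
  have \<phi>_eq: "\<phi> Z = y" if "extension Z y" for Z y
    using \<phi>[of Z] extension_unique[OF _ that] that by (auto simp: extension_def)
  have 1: "canonical_hom \<omega> A \<alpha> \<phi>"
    unfolding canonical_hom_def
  proof (intro conjI ballI allI)
    show "\<phi> \<in> star_hom X Y"
      unfolding star_hom_def
      by (auto simp: extension_def[of _ "\<phi> _"] dest!: \<phi> intro!: \<phi>_eq extension_add_mult extension_smult_star)
    show "\<phi> (crossed_elem A\<omega> \<alpha>\<omega> (ultra_class \<omega> A a) s) = ultra_class \<omega> X0 (\<lambda>n. crossed_elem A \<alpha> (a n) s)"
      if "a \<in> carrier (linf A)" for a s by (rule \<phi>_eq[OF crossed_elem_extension[OF that]])
  qed
  have 2: "\<psi> x = \<phi> x" if "canonical_hom \<omega> A \<alpha> \<psi>" "x \<in> carrier X" for \<psi> x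
    by (rule \<phi>_eq[OF canonical_hom_extension[OF that], symmetric])
  have 3: "inj_on \<phi> (carrier X)"
  proof (rule inj_onI)
    fix Z Z' assume Z: "Z \<in> carrier X" "Z' \<in> carrier X" and eq: "\<phi> Z = \<phi> Z'"
    have "\<phi> Z' \<in> carrier Y" using \<phi>[OF Z(2)] by (auto simp: extension_def)
    then have "nrm X (Z \<ominus>\<^bsub>X\<^esub> Z') \<le> 0"
      unfolding extension_dist[OF \<phi>[OF Z(1)] \<phi>[OF Z(2)], symmetric] eq by (simp add: a_minus_def Y.M.r_neg Y.nrm_zero)
    then show "Z = Z'" by (rule X.eq_if_nrm_le_0[OF Z])
  qed
  have 4: "\<phi> ` carrier X = continuous_part \<omega> A \<alpha>"
  proof (intro subset_antisym subsetI)
    fix y assume "y \<in> \<phi> ` carrier X"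
    then obtain Z where Z: "Z \<in> carrier X" "y = \<phi> Z" by blast
    obtain v where "v \<in> continuous_seqs A \<alpha>" "extension Z (V.cl v)" using extension_exists_continuous[OF Z(1)] by blast
    then show "y \<in> continuous_part \<omega> A \<alpha>" using \<phi>_eq Z(2) by (auto simp: continuous_part_def Vcl)
  next
    fix y assume "y \<in> continuous_part \<omega> A \<alpha>"
    then obtain v where v: "v \<in> continuous_seqs A \<alpha>" "y = V.cl v" by (auto simp: continuous_part_def Vcl)
    obtain Z where Z: "extension Z (V.cl v)" using continuous_in_range[OF v(1)] by blast
    then have "Z \<in> carrier X" by (simp add: extension_def)
    then show "y \<in> \<phi> ` carrier X" using \<phi>_eq[OF Z] v(2) by blast
  qed
  show ?thesis using 1 2 3 4 by blast
qed

end

theorem theorem4p6: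
  fixes \<omega> :: "nat filter"
    and A :: "'a cstar"
    and \<alpha> :: "'g::ab_group_add \<Rightarrow> 'a \<Rightarrow> 'a"
  assumes "free_ultrafilter \<omega>"
    and "cstar_algebra A"
    and "cstar_action A \<alpha>"
  shows "\<exists>\<phi>. canonical_hom \<omega> A \<alpha> \<phi> \<and>
    (\<forall>\<psi>. canonical_hom \<omega> A \<alpha> \<psi> \<longrightarrow>
      (\<forall>x\<in>carrier (crossed (ultrapower \<omega> A) (ultra_action \<omega> A \<alpha>)). \<psi> x = \<phi> x)) \<and>
    inj_on \<phi> (carrier (crossed (ultrapower \<omega> A) (ultra_action \<omega> A \<alpha>))) \<and>
    \<phi> ` carrier (crossed (ultrapower \<omega> A) (ultra_action \<omega> A \<alpha>)) = continuous_part \<omega> A \<alpha>"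
proof -
  interpret crossed_ultra \<omega> A \<alpha> by (rule crossed_ultra.intro[OF assms])
  show ?thesis by (rule canonical_isomorphism)
qed

end
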